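(* Let $f$ be a simple parabolic germ at $\infty$, let $\omega\in 2\pi\mathrm{i}\mathbb{Z}\setminus\{0\}$, let $\Gamma$ be a path in $\mathbb{C}\setminus 2\pi\mathrm{i}\mathbb{Z}$ going from $1$ to $\omega+1$, and let $\alpha=-\rho\omega$, $N$, $\beta=\alpha+N$ and the operators $E_\beta$, $B_\alpha$ be as defined in the context. Let $b_\alpha := z^{-\alpha}(1-z^{-1})^{-\alpha}\, b_N$, where $b_N := b_* - C_{\mathrm{id}-1}[\tilde\varphi]_N + C_{\mathrm{id}+b}[\tilde\varphi]_N$. (1) The formal series $\tilde\Phi_k(z) := (E_\beta B_\alpha)^k E_\beta b_\alpha \in z^{-\beta-1}\mathbb{C}[[z^{-1}]]$, $k\ge 0$, are $(\omega,\Gamma)$-simple, and so is $z^{-\alpha}\{\tilde\varphi\}_N$. (2) For any $\varepsilon,L>0$ there exist $C_0,\Lambda>0$ with $\Lambda<1$ such that, for each $\gamma\in\mathscr{R}_{\varepsilon,L}$ and each $k\ge0$, $$|\operatorname{cont}_\gamma \mathcal{B}\tilde\Phi_k| \le C_0\Lambda^k .$$ Moreover $\hat\Phi := \sum_{k\ge0}\mathcal{B}\tilde\Phi_k$ coincides with the formal Borel transform of $z^{-\alpha}\{\tilde\varphi\}_N$. (3) There exist complex numbers $S^\Gamma_{\omega,k}$, $k\ge0$, which are $O(\Lambda^k)$ for some $\Lambda<1$ and satisfy $$\mathcal{A}^\Gamma_\omega\tilde\Phi_k = \sum_{k_1+k_2=k} S^\Gamma_{\omega,k_1}\tilde\Psi_{k_2}\quad\text{for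 each } k\ge0,$$ $$\mathcal{A}^\Gamma_\omega\big(z^{-\alpha}\{\tilde\varphi\}_N\big) = S^\Gamma_\omega\, e^{-\omega\tilde\varphi},\qquad\text{where } S^\Gamma_\omega=\sum_{k\ge0}S^\Gamma_{\omega,k}.$$
   Context: **Resurgence.** $\mathbb{C}_{\log}$ is the Riemann surface of the logarithm (universal cover of $\mathbb{C}^*$ with base-point at $1$). For $\beta\in\mathbb{C}$ with $\operatorname{Re}\beta>-1$, the formal Borel transform is $$\mathcal{B}:\ \sum_{n\ge0}c_n z^{-n-\beta-1}\in z^{-\beta-1}\mathbb{C}[[z^{-1}]]\ \mapsto\ \sum_{n\ge0}c_n\frac{\zeta^{n+\beta}}{\Gamma(n+\beta+1)}\in\zeta^\beta\mathbb{C}[[\zeta]]$$ (in this formula $\Gamma(\cdot)$ is Euler's Gamma function). If $\hat\phi\in\zeta^\beta\mathbb{C}\{\zeta\}$ converges for all $\zeta\in\mathbb{C}_{\log}$ with $|\zeta|<2\pi$ and extends analytically along any path of $\mathbb{C}\setminus2\pi\mathrm{i}\mathbb{Z}$ issuing from $1$, then $\hat\phi$ and $\tilde\phi=\mathcal{B}^{-1}\hat\phi$ are called $2\pi\mathrm{i}\mathbb{Z}$-resurgent. $\operatorname{cont}_\gamma\hat\phi$ denotes the analytic continuation of $\hat\phi$ along $\gamma$, a holomorphic germ at the endpoint of $\gamma$; in a bound on $|\operatorname{cont}_\gamma\hat\phi|$ its value at the endpoint is meant. Given $\omega\in2\pi\mathrm{i}\mathbb{Z}$ and a path $\Gamma$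 in $\mathbb{C}\setminus2\pi\mathrm{i}\mathbb{Z}$ from $1$ to $\omega+1$, a $2\pi\mathrm{i}\mathbb{Z}$-resurgent $\hat\phi$ (and $\tilde\phi=\mathcal{B}^{-1}\hat\phi$) is $(\omega,\Gamma)$-simple if $$\operatorname{cont}_\Gamma\hat\phi(\omega+\zeta)=\frac{c}{2\pi\mathrm{i}\zeta}+\hat\chi(\zeta)\frac{\log\zeta}{2\pi\mathrm{i}}+\hat R(\zeta)\quad\text{for }\zeta>0\text{ (small)},$$ with $c\in\mathbb{C}$, $\hat\chi,\hat R\in\mathbb{C}\{\zeta\}$ (the germ at $\omega+1$ being continued along the segment towards $\omega$). The alien operator is then $\mathcal{A}^\Gamma_\omega\tilde\phi:=c+\mathcal{B}^{-1}\hat\chi\in\mathbb{C}[[z^{-1}]]$. $\mathscr{R}_{\varepsilon,L}$ is the set of all paths of length $<L$ issuing from $1$ and staying at distance $>\varepsilon$ from $2\pi\mathrm{i}\mathbb{Z}$. **The germ.** $C_g$ denotes the composition operator $C_g\psi=\psi\circ g$. $f=(\mathrm{id}+b)\circ(\mathrm{id}+1)$ is a simple parabolic germ at $\infty$, i.e. holomorphic near $\infty$ with $f(z)=z+1-\rho z^{-1}+O(z^{-2})$, $\rho\in\mathbb{C}$, $b\in z^{-1}\mathbb{C}\{z^{-1}\}$. Put $b_*(z):=b(z)+\rho\log\frac{1+z^{-1}b(z)}{1-z^{-1}}\in z^{-2}\mathbb{C}\{z^{-1}\}$. The equation $C_{\mathrm{id}-1}\varphi=C_{\mathrm{id}+b}\varphi+b_*$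 has a unique solution $\tilde\varphi\in z^{-1}\mathbb{C}[[z^{-1}]]$; it is known to be $2\pi\mathrm{i}\mathbb{Z}$-resurgent. **Parameters and operators.** $\alpha:=-\rho\omega$; $N\ge\max\{0,-2\operatorname{Re}\alpha\}$ is an integer; $\beta:=\alpha+N$ (so $\operatorname{Re}\beta\ge0$). Write $\tilde\varphi=[\tilde\varphi]_N+\{\tilde\varphi\}_N$ with $[\tilde\varphi]_N\in\operatorname{Span}(z^{-1},\dots,z^{-N})$ and $\{\tilde\varphi\}_N\in z^{-N-1}\mathbb{C}[[z^{-1}]]$. (One has $b_\alpha\in z^{-\beta-2}\mathbb{C}\{z^{-1}\}$.) - $E:z^{-2}\mathbb{C}[[z^{-1}]]\to z^{-1}\mathbb{C}[[z^{-1}]]$ and $E_\beta:z^{-\beta-2}\mathbb{C}[[z^{-1}]]\to z^{-\beta-1}\mathbb{C}[[z^{-1}]]$ are the inverses of $C_{\mathrm{id}-1}-\mathrm{Id}$ (a bijection $z^{-1}\mathbb{C}[[z^{-1}]]\to z^{-2}\mathbb{C}[[z^{-1}]]$, resp. $z^{-\beta-1}\mathbb{C}[[z^{-1}]]\to z^{-\beta-2}\mathbb{C}[[z^{-1}]]$). - $B_\alpha:\tilde\phi\in z^{-\beta-1}\mathbb{C}[[z^{-1}]]\mapsto c_\alpha C_{\mathrm{id}+b}\tilde\phi-\tilde\phi\in z^{-\beta-2}\mathbb{C}[[z^{-1}]]$, with $c_\alpha:=\big(\frac{1+z^{-1}b}{1-z^{-1}}\big)^\alpha\in1+z^{-1}\mathbb{C}\{z^{-1}\}$.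 - $B^\omega:\tilde\psi\mapsto e^{-\omega b_*}C_{\mathrm{id}+b}\tilde\psi-\tilde\psi$ on $\mathbb{C}[[z^{-1}]]$. - $\tilde\Psi_k:=(EB^\omega)^k1\in z^{-k}\mathbb{C}[[z^{-1}]]$, $k\ge0$. *)

theory Defs
  imports
    "HOL-Complex_Analysis.Complex_Analysis"
    "HOL-Library.Landau_Symbols"
begin

section \<open>Formal series in the inverse variable\<close>

text \<open>
  A series in \<open>\<complex>[[z\<^sup>-\<^sup>1]]\<close> is a \<^typ>\<open>complex fps\<close> with \<^term>\<open>fps_X\<close> standing for \<open>z\<^sup>-\<^sup>1\<close>.
  An element \<open>z\<^sup>-\<^sup>s P(z\<^sup>-\<^sup>1)\<close> of \<open>z\<^sup>-\<^sup>s \<complex>[[z\<^sup>-\<^sup>1]]\<close> (\<open>s\<close> complex) is represented by \<open>P\<close>, the exponent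
  \<open>s\<close> being passed separately; its subspace \<open>z\<^sup>-\<^sup>s\<^sup>-\<^sup>1 \<complex>[[z\<^sup>-\<^sup>1]]\<close> consists of the \<open>P\<close> with \<open>P $ 0 = 0\<close>.
\<close>

text \<open>\<open>log G\<close> and \<open>G\<^sup>a\<close>, for \<open>G\<close> with constant term 1.\<close>

definition fps_log1 :: "complex fps \<Rightarrow> complex fps" where
  "fps_log1 G = fps_ln 1 oo (G - 1)"

definition fps_cpow :: "complex fps \<Rightarrow> complex \<Rightarrow> complex fps" where
  "fps_cpow G a = fps_binomial a oo (G - 1)"

text \<open>Composition with \<open>id + h\<close>: it sends \<open>z\<^sup>-\<^sup>1\<close> to \<open>(z + h)\<^sup>-\<^sup>1 = z\<^sup>-\<^sup>1 / (1 + z\<^sup>-\<^sup>1 h)\<close>.\<close>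

definition comp_id_plus :: "complex fps \<Rightarrow> complex fps \<Rightarrow> complex fps" where
  "comp_id_plus h P = P oo (fps_X / (1 + fps_X * h))"

text \<open>The same on \<open>z\<^sup>-\<^sup>s \<complex>[[z\<^sup>-\<^sup>1]]\<close>, where \<open>(z + h)\<^sup>-\<^sup>s = z\<^sup>-\<^sup>s (1 + z\<^sup>-\<^sup>1 h)\<^sup>-\<^sup>s\<close>.\<close>

definition comp_id_plus_tw :: "complex \<Rightarrow> complex fps \<Rightarrow> complex fps \<Rightarrow> complex fps" where
  "comp_id_plus_tw s h P = fps_cpow (1 + fps_X * h) (- s) * comp_id_plus h P"


section \<open>Resurgence\<close>

definition sing_set :: "complex set" where
  "sing_set = range (\<lambda>n::int. 2 * of_real pi * \<i> * of_int n)"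

text \<open>
  The Borel transform of \<open>z\<^sup>-\<^sup>\<beta>\<^sup>-\<^sup>1 P(z\<^sup>-\<^sup>1)\<close> is \<open>\<zeta>\<^sup>\<beta>\<close> times \<open>borel_fps \<beta> P\<close>. As a function on the
  Riemann surface of the logarithm it is written in the global coordinate \<open>w = log \<zeta>\<close>.
\<close>

definition borel_fps :: "complex \<Rightarrow> complex fps \<Rightarrow> complex fps" where
  "borel_fps \<beta> P = Abs_fps (\<lambda>n. P $ n / Gamma (of_nat n + \<beta> + 1))"

definition borel_fun :: "complex \<Rightarrow> complex fps \<Rightarrow> complex \<Rightarrow> complex" where
  "borel_fun \<beta> P w = exp (\<beta> * w) * eval_fps (borel_fps \<beta> P) (exp w)"

text \<open>Representative, near the base-point 1 of the universal cover.\<close>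

definition borel_germ :: "complex \<Rightarrow> complex fps \<Rightarrow> complex \<Rightarrow> complex" where
  "borel_germ \<beta> P \<zeta> = borel_fun \<beta> P (Ln \<zeta>)"

text \<open>\<open>g\<close> represents the germ at the endpoint of \<open>\<gamma>\<close> obtained by continuing the germ of \<open>f\<close> at
  the initial point of \<open>\<gamma>\<close> along \<open>\<gamma>\<close>.\<close>

definition continues_along ::
    "(real \<Rightarrow> complex) \<Rightarrow> (complex \<Rightarrow> complex) \<Rightarrow> (complex \<Rightarrow> complex) \<Rightarrow> bool" where
  "continues_along \<gamma> f g \<longleftrightarrow>
     (\<exists>F. (\<forall>t\<in>{0..1}. F t analytic_on {\<gamma> t} \<and>
              (\<exists>\<delta>>0. \<forall>u\<in>{0..1}. \<bar>u - t\<bar> < \<delta> \<longrightarrow> (\<forall>\<^sub>F z in nhds (\<gamma> u). F u z = F t z))) \<and>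
          (\<forall>\<^sub>F z in nhds (pathstart \<gamma>). F 0 z = f z) \<and>
          (\<forall>\<^sub>F z in nhds (pathfinish \<gamma>). F 1 z = g z))"

definition cont :: "(real \<Rightarrow> complex) \<Rightarrow> (complex \<Rightarrow> complex) \<Rightarrow> (complex \<Rightarrow> complex)" where
  "cont \<gamma> f = (SOME g. continues_along \<gamma> f g)"

definition paths_from_1 :: "(real \<Rightarrow> complex) set" where
  "paths_from_1 = {\<gamma>. path \<gamma> \<and> pathstart \<gamma> = 1 \<and> path_image \<gamma> \<inter> sing_set = {}}"

definition resurgent :: "complex \<Rightarrow> complex fps \<Rightarrow> bool" where
  "resurgent \<beta> P \<longleftrightarrow>
     fps_conv_radius (borel_fps \<beta> P) \<ge> ereal (2 * pi) \<and>
     (\<forall>\<gamma>\<in>paths_from_1. \<exists>g. continues_along \<gamma> (borel_germ \<beta> P) g)"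

definition simple_expansion ::
    "complex \<Rightarrow> (real \<Rightarrow> complex) \<Rightarrow> complex \<Rightarrow> complex fps \<Rightarrow>
     complex \<Rightarrow> complex fps \<Rightarrow> complex fps \<Rightarrow> bool" where
  "simple_expansion \<omega> \<Gamma> \<beta> P c chi R \<longleftrightarrow>
     fps_conv_radius chi > 0 \<and> fps_conv_radius R > 0 \<and>
     (\<forall>\<^sub>F t in at_right (0::real).
        cont (\<Gamma> +++ linepath (\<omega> + 1) (\<omega> + of_real t)) (borel_germ \<beta> P) (\<omega> + of_real t) =
          c / (2 * of_real pi * \<i> * of_real t)
          + eval_fps chi (of_real t) * (of_real (ln t) / (2 * of_real pi * \<i>))
          + eval_fps R (of_real t))"

definition simple_at :: "complex \<Rightarrow> (real \<Rightarrow> complex) \<Rightarrow> complex \<Rightarrow> complex fps \<Rightarrow> bool" where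
  "simple_at \<omega> \<Gamma> \<beta> P \<longleftrightarrow> resurgent \<beta> P \<and> (\<exists>c chi R. simple_expansion \<omega> \<Gamma> \<beta> P c chi R)"

text \<open>Inverse Borel transform from \<open>\<complex>[[\<zeta>]]\<close> to \<open>z\<^sup>-\<^sup>1 \<complex>[[z\<^sup>-\<^sup>1]]\<close> (the result is an untwisted series).\<close>

definition inv_borel :: "complex fps \<Rightarrow> complex fps" where
  "inv_borel chi = fps_X * Abs_fps (\<lambda>n. fact n * chi $ n)"

definition alien :: "complex \<Rightarrow> (real \<Rightarrow> complex) \<Rightarrow> complex \<Rightarrow> complex fps \<Rightarrow> complex fps" where
  "alien \<omega> \<Gamma> \<beta> P =
     (THE A. \<exists>c chi R. simple_expansion \<omega> \<Gamma> \<beta> P c chi R \<and> A = fps_const c + inv_borel chi)"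

definition path_len :: "(real \<Rightarrow> complex) \<Rightarrow> ereal" where
  "path_len \<gamma> =
     (SUP ts \<in> {ts. sorted ts \<and> set ts \<subseteq> {0..1}}.
        ereal (\<Sum>i<length ts - 1. dist (\<gamma> (ts ! i)) (\<gamma> (ts ! Suc i))))"

definition short_paths :: "real \<Rightarrow> real \<Rightarrow> (real \<Rightarrow> complex) set" where
  "short_paths \<epsilon> L =
     {\<gamma>. path \<gamma> \<and> pathstart \<gamma> = 1 \<and> path_len \<gamma> < ereal L \<and>
          (\<forall>\<zeta>\<in>path_image \<gamma>. infdist \<zeta> sing_set > \<epsilon>)}"


section \<open>The germ and the associated series\<close>

definition simple_parabolic :: "(complex \<Rightarrow> complex) \<Rightarrow> complex \<Rightarrow> bool" where
  "simple_parabolic f \<rho> \<longleftrightarrow>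
     (\<exists>r>0. f holomorphic_on {z. norm z > r}) \<and>
     (\<lambda>z. f z - (z + 1 - \<rho> / z)) \<in> O[at_infinity](\<lambda>z. 1 / z ^ 2)"

text \<open>From \<open>f = (id + b) \<circ> (id + 1)\<close> we get \<open>b(z) = f(z - 1) - z\<close>, which vanishes at infinity;
  it is expanded in \<open>w = z\<^sup>-\<^sup>1\<close>.\<close>

definition germ_b :: "(complex \<Rightarrow> complex) \<Rightarrow> complex fps" where
  "germ_b f = fps_expansion (\<lambda>w. if w = 0 then 0 else f (1 / w - 1) - 1 / w) 0"

definition quot_b :: "(complex \<Rightarrow> complex) \<Rightarrow> complex fps" where
  "quot_b f = (1 + fps_X * germ_b f) / (1 - fps_X)"

definition b_star :: "(complex \<Rightarrow> complex) \<Rightarrow> complex \<Rightarrow> complex fps" where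
  "b_star f \<rho> = germ_b f + fps_const \<rho> * fps_log1 (quot_b f)"

definition phi_ser :: "(complex \<Rightarrow> complex) \<Rightarrow> complex \<Rightarrow> complex fps" where
  "phi_ser f \<rho> =
     (THE P. P $ 0 = 0 \<and> comp_id_plus (-1) P = comp_id_plus (germ_b f) P + b_star f \<rho>)"

definition b_trunc :: "(complex \<Rightarrow> complex) \<Rightarrow> complex \<Rightarrow> nat \<Rightarrow> complex fps" where
  "b_trunc f \<rho> N =
     (let T = fps_cutoff (N + 1) (phi_ser f \<rho>)
      in b_star f \<rho> - comp_id_plus (-1) T + comp_id_plus (germ_b f) T)"

text \<open>
  In the rest of this section \<open>\<beta> = \<alpha> + N\<close>, and all series in \<open>z\<^sup>-\<^sup>\<beta>\<^sup>-\<^sup>1 \<complex>[[z\<^sup>-\<^sup>1]]\<close> are represented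
  relative to the prefactor \<open>z\<^sup>-\<^sup>\<beta>\<^sup>-\<^sup>1\<close>. Since \<open>z\<^sup>-\<^sup>\<alpha> = z\<^sup>-\<^sup>\<beta>\<^sup>-\<^sup>1 z\<^sup>N\<^sup>+\<^sup>1\<close>, the product of \<open>z\<^sup>-\<^sup>\<alpha>\<close> with a series in
  \<open>z\<^sup>-\<^sup>N\<^sup>-\<^sup>1 \<complex>[[z\<^sup>-\<^sup>1]]\<close> is represented by shifting the latter by \<open>N + 1\<close>. The remainder \<open>phi_rem\<close>
  stands for \<open>z\<^sup>-\<^sup>\<alpha> {\<phi>}\<^sub>N\<close>.
\<close>

definition phi_rem :: "(complex \<Rightarrow> complex) \<Rightarrow> complex \<Rightarrow> nat \<Rightarrow> complex fps" where
  "phi_rem f \<rho> N = fps_shift (N + 1) (phi_ser f \<rho> - fps_cutoff (N + 1) (phi_ser f \<rho>))"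

definition b_alpha :: "(complex \<Rightarrow> complex) \<Rightarrow> complex \<Rightarrow> complex \<Rightarrow> nat \<Rightarrow> complex fps" where
  "b_alpha f \<rho> \<alpha> N = fps_cpow (1 - fps_X) (- \<alpha>) * fps_shift (N + 1) (b_trunc f \<rho> N)"

text \<open>Inverse of the difference operator, to be applied to \<open>z\<^sup>-\<^sup>\<beta>\<^sup>-\<^sup>2 \<complex>[[z\<^sup>-\<^sup>1]]\<close>, that is, to series with
  zero constant term.\<close>

definition E_tw :: "complex \<Rightarrow> complex fps \<Rightarrow> complex fps" where
  "E_tw \<beta> = inv (\<lambda>P. comp_id_plus_tw (\<beta> + 1) (-1) P - P)"

definition B_tw :: "(complex \<Rightarrow> complex) \<Rightarrow> complex \<Rightarrow> complex \<Rightarrow> complex fps \<Rightarrow> complex fps" where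
  "B_tw f \<alpha> \<beta> P = fps_cpow (quot_b f) \<alpha> * comp_id_plus_tw (\<beta> + 1) (germ_b f) P - P"

definition Phi :: "(complex \<Rightarrow> complex) \<Rightarrow> complex \<Rightarrow> complex \<Rightarrow> nat \<Rightarrow> nat \<Rightarrow> complex fps" where
  "Phi f \<rho> \<alpha> N k =
     (let \<beta> = \<alpha> + of_nat N
      in ((\<lambda>P. E_tw \<beta> (B_tw f \<alpha> \<beta> P)) ^^ k) (E_tw \<beta> (b_alpha f \<rho> \<alpha> N)))"

text \<open>The untwisted operators, acting on \<open>\<complex>[[z\<^sup>-\<^sup>1]]\<close> with no prefactor.\<close>

definition E_op :: "complex fps \<Rightarrow> complex fps" where
  "E_op = inv_into {P. P $ 0 = 0} (\<lambda>P. comp_id_plus (-1) P - P)"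

definition B_omega :: "(complex \<Rightarrow> complex) \<Rightarrow> complex \<Rightarrow> complex \<Rightarrow> complex fps \<Rightarrow> complex fps" where
  "B_omega f \<rho> \<omega> P = (fps_exp (- \<omega>) oo b_star f \<rho>) * comp_id_plus (germ_b f) P - P"

definition Psi :: "(complex \<Rightarrow> complex) \<Rightarrow> complex \<Rightarrow> complex \<Rightarrow> nat \<Rightarrow> complex fps" where
  "Psi f \<rho> \<omega> k = ((\<lambda>P. E_op (B_omega f \<rho> \<omega> P)) ^^ k) 1"

end

theory Submission
  imports Defs
begin

text \<open>
  On the Borel side \<open>E\<^sub>\<beta>\<close> is division by \<open>e\<^sup>\<zeta> - 1\<close> and \<open>B\<^sub>\<alpha>\<close> is a Volterra operator with an entire
  kernel, so the Borel transforms \<open>\<phi>\<^sub>k\<close> of the \<open>\<Phi>\<^sub>k\<close> satisfy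
  \<open>(e\<^sup>\<zeta> - 1) \<phi>\<^sub>k\<^sub>+\<^sub>1(\<zeta>) = \<integral>\<^sub>0\<^sup>\<zeta> K(\<xi>, \<zeta> - \<xi>) \<phi>\<^sub>k(\<xi>) d\<xi>\<close>, which continues them along any path avoiding
  \<open>2\<pi>\<i>\<int>\<close>. Near the origin the Taylor coefficients of \<open>\<phi>\<^sub>k\<close> evolve under a lower triangular matrix
  whose \<open>n\<close>-th column carries a factor \<open>1/(n+1)\<close> and whose diagonal is bounded by \<open>\<bar>\<alpha>\<bar>/\<bar>\<beta>+1\<bar>\<close>, a
  number below 1 because \<open>N \<ge> -2 Re \<alpha>\<close>; hence the decay \<open>\<Lambda>\<^sup>k\<close> there. Away from the origin
  the Volterra operator is a contraction for the weight \<open>exp(\<mu> \<cdot> length)\<close> with \<open>\<mu>\<close> large, so the decay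
  persists along paths of bounded length.

  Near \<open>\<omega>\<close> the translated kernel is the one of \<open>B\<^sup>\<omega>\<close>, and it vanishes at the origin. By induction
  \<open>\<phi>\<^sub>k(\<omega> + \<zeta>) = c\<^sub>k/(2\<pi>\<i>\<zeta>) + \<chi>\<^sub>k(\<zeta>) log \<zeta>/(2\<pi>\<i>) + R\<^sub>k(\<zeta>)\<close> with
  \<open>(e\<^sup>\<zeta> - 1) \<chi>\<^sub>k\<^sub>+\<^sub>1(\<zeta>) = c\<^sub>k K\<^sub>\<omega>(0, \<zeta>) + \<integral>\<^sub>0\<^sup>\<zeta> K\<^sub>\<omega>(\<xi>, \<zeta> - \<xi>) \<chi>\<^sub>k(\<xi>) d\<xi>\<close>. This says that the alien
  values obey \<open>a\<^sub>k\<^sub>+\<^sub>1 = c\<^sub>k\<^sub>+\<^sub>1 + E B\<^sup>\<omega> a\<^sub>k\<close>, whence their expansion in the \<open>\<Psi>\<^sub>k\<close> with \<open>S\<^sub>k = c\<^sub>k\<close>.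
  The bounds on \<open>c\<^sub>k\<close> and \<open>\<chi>\<^sub>k\<close> come from the variation of \<open>\<phi>\<^sub>k\<close> around \<open>\<omega>\<close>, which equals \<open>\<chi>\<^sub>k\<close>.
\<close>

unbundle no vec_syntax

subsection \<open>Complex powers of formal power series\<close>

text \<open>The branch point at 0 and multivaluedness elsewhere shape the argument. The integral
  from 0 is split at 1. The part from 0 to 1 is entire in the endpoint, because the kernel is, and
  inherits the factor \<Lambda>^k from the Taylor coefficients. The rest is continued on a sequence
  of convex sets free of singularities, where functions are single valued. One such sequence serves
  all k at once, so bounds are uniform in k and sums can be formed on it.

  At \<omega>, translation multiplies c_\<alpha> by e^(-\<omega> b), and \<alpha> = -\<rho>\<omega>
  turns the product into e^(-\<omega> b_star). As b_star = O(z^-2), its z^-1 coefficient is 0. This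
  is the vanishing of the translated kernel at the origin; otherwise a term log \<zeta>/\<zeta>
  could appear and the shape of the singularity would be lost. The chain goes on past the end of
  \<Gamma> around \<omega>, through half-discs covering two turns, so both branches that define the
  variation are values of one continued function with one bound.

  The hypothesis on N enters through |\<beta>+1|^2 - |\<alpha>|^2 = (N+1)(N+1+2 Re \<alpha>) >
  0.\<close>

lemma fps_linear_ode_unique:
  fixes F G :: "complex fps"
  assumes "fps_deriv F = D * F" "fps_deriv G = D * G" "F $ 0 = G $ 0" "G $ 0 \<noteq> 0"
  shows "F = G"
proof -
  let ?Q = "F * inverse G"
  have GI: "G * inverse G = 1" using assms(4) by (rule inverse_mult_eq_1')
  have "fps_deriv ?Q = D * F * inverse G - F * (D * G) * (inverse G)\<^sup>2"
    by (simp add: fps_inverse_deriv[OF assms(4)] assms(1,2) algebra_simps)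
  also have "\<dots> = D * F * inverse G - F * D * inverse G * (G * inverse G)"
    by (simp only: power2_eq_square mult.assoc mult.left_commute)
  also have "\<dots> = 0" by (simp add: GI mult.commute mult.left_commute)
  finally have "?Q = fps_const (?Q $ 0)" by (metis fps_deriv_eq_0_iff)
  moreover have "?Q $ 0 = 1" using assms(3,4) by simp
  ultimately have "?Q = 1" by (metis fps_const_1_eq_1)
  hence "F * inverse G * G = G" by simp
  thus ?thesis using GI by (metis mult.assoc mult.commute mult.right_neutral)
qed

lemma fps_cpow_nth_0 [simp]: "fps_cpow G a $ 0 = 1"
  by (simp add: fps_cpow_def)

lemma fps_cpow_deriv:
  assumes "G $ 0 = 1"
  shows "fps_deriv (fps_cpow G a) = (fps_const a * fps_deriv G * inverse G) * fps_cpow G a"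
proof -
  have G0: "(G - 1) $ 0 = 0" using assms by simp
  have "fps_deriv (fps_cpow G a) = ((fps_const a * fps_binomial a * inverse (1 + fps_X)) oo (G - 1)) * fps_deriv G"
    unfolding fps_cpow_def by (subst fps_compose_deriv[OF G0]) (simp add: fps_binomial_deriv fps_divide_unit)
  also have "(fps_const a * fps_binomial a * inverse (1 + fps_X)) oo (G - 1)
     = fps_const a * fps_cpow G a * inverse ((1 + fps_X) oo (G - 1))"
    by (simp add: fps_compose_mult_distrib[OF G0] fps_cpow_def fps_inverse_compose[OF G0])
  also have "(1 + fps_X) oo (G - 1) = G"
    using G0 by (simp add: fps_compose_add_distrib)
  finally show ?thesis by (simp add: mult_ac)
qed

text \<open>Identities between powers are all reduced to this: \<open>G^a\<close> is the solution
  with value 1 of the linear equation F' = a (G'/G) F, so that no convolution of binomial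
  coefficients is needed.\<close>

lemma fps_cpow_unique:
  assumes "G $ 0 = 1" "F $ 0 = 1" "fps_deriv F = (fps_const a * fps_deriv G * inverse G) * F"
  shows "F = fps_cpow G a"
  using fps_linear_ode_unique[OF assms(3) fps_cpow_deriv[OF assms(1)]] assms by simp

lemma fps_cpow_add: "G $ 0 = 1 \<Longrightarrow> fps_cpow G (a + b) = fps_cpow G a * fps_cpow G b"
  by (rule sym, rule fps_cpow_unique)
     (simp_all add: fps_cpow_deriv algebra_simps fps_const_add[symmetric] del: fps_const_add)

lemma fps_cpow_mult:
  assumes "G $ 0 = 1" "H $ 0 = 1"
  shows "fps_cpow (G * H) a = fps_cpow G a * fps_cpow H a"
proof (rule sym, rule fps_cpow_unique)
  have 1: "G * inverse G = 1" "H * inverse H = 1" using assms by (simp_all add: inverse_mult_eq_1')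
  have "fps_deriv (G * H) * inverse (G * H) = fps_deriv G * inverse G * (H * inverse H) + fps_deriv H * inverse H * (G * inverse G)"
    by (simp add: fps_inverse_mult algebra_simps)
  hence 2: "fps_deriv (G * H) * inverse (G * H) = fps_deriv G * inverse G + fps_deriv H * inverse H" 
    by (simp add: 1)
  have "fps_const a * fps_deriv (G * H) * inverse (G * H) = fps_const a * (fps_deriv G * inverse G + fps_deriv H * inverse H)"
    by (simp only: mult.assoc 2)
  thus "fps_deriv (fps_cpow G a * fps_cpow H a) =
    fps_const a * fps_deriv (G * H) * inverse (G * H) * (fps_cpow G a * fps_cpow H a)"
    by (simp add: fps_cpow_deriv assms algebra_simps)
qed (use assms in auto)

lemma fps_cpow_0 [simp]: "fps_cpow G 0 = 1"
  by (simp add: fps_cpow_def)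

lemma fps_cpow_of_nat: "G $ 0 = 1 \<Longrightarrow> fps_cpow G (of_nat n) = G ^ n"
proof (induction n)
  case (Suc n)
  have 1: "fps_cpow G 1 = G"
    using Suc.prems unfolding fps_cpow_def fps_binomial_1 by (simp add: fps_compose_add_distrib)
  have "fps_cpow G (of_nat (Suc n)) = fps_cpow G (of_nat n + 1)" by (simp add: add.commute)
  also have "\<dots> = G ^ n * G" by (simp add: fps_cpow_add[OF Suc.prems] 1 Suc)
  finally show ?case by (simp add: mult.commute)
qed auto

lemma fps_cpow_minus: 
  assumes "G $ 0 = 1" shows "fps_cpow G (- a) = inverse (fps_cpow G a)"
proof -
  have "fps_cpow G a * fps_cpow G (- a) = 1" using fps_cpow_add[OF assms, of a "-a"] by simp
  thus ?thesis by (metis fps_inverse_unique)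
qed

lemma fps_cpow_inverse:
  assumes "G $ 0 = 1" shows "fps_cpow (inverse G) a = fps_cpow G (- a)"
proof -
  have "fps_cpow G a * fps_cpow (inverse G) a = 1" 
    using assms fps_cpow_mult[of G "inverse G" a] by (simp add: inverse_mult_eq_1') (simp add: fps_cpow_def)
  thus ?thesis by (metis fps_inverse_unique fps_cpow_minus assms)
qed

lemma fps_exp_compose_deriv:
  fixes L :: "complex fps"
  assumes "L $ 0 = 0"
  shows "fps_deriv (fps_exp a oo L) = (fps_const a * fps_deriv L) * (fps_exp a oo L)"
  by (simp add: fps_compose_deriv[OF assms] fps_compose_mult_distrib[OF assms] mult_ac)

lemma fps_exp_compose_add:
  fixes L M :: "complex fps"
  assumes "L $ 0 = 0" "M $ 0 = 0"
  shows "fps_exp a oo (L + M) = (fps_exp a oo L) * (fps_exp a oo M)"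
  by (rule fps_linear_ode_unique[where D="fps_const a * fps_deriv (L + M)"])
     (simp_all add: fps_exp_compose_deriv assms algebra_simps)

lemma fps_exp_compose_add_exponent:
  fixes L :: "complex fps"
  assumes "L $ 0 = 0"
  shows "fps_exp (a + b) oo L = (fps_exp a oo L) * (fps_exp b oo L)"
  by (simp add: fps_exp_add_mult fps_compose_mult_distrib[OF assms])

lemma fps_log1_deriv:
  assumes "G $ 0 = 1"
  shows "fps_deriv (fps_log1 G) = fps_deriv G * inverse G"
proof -
  have G0: "(G - 1) $ 0 = 0" using assms by simp
  have "fps_deriv (fps_log1 G) = (inverse (1 + fps_X) oo (G - 1)) * fps_deriv G"
    unfolding fps_log1_def by (subst fps_compose_deriv[OF G0]) (simp add: fps_ln_deriv)
  also have "inverse (1 + fps_X) oo (G - 1) = inverse ((1 + fps_X) oo (G - 1))"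
    by (rule fps_inverse_compose[OF G0]) simp
  also have "(1 + fps_X) oo (G - 1) = G"
    using G0 by (simp add: fps_compose_add_distrib)
  finally show ?thesis by (simp add: mult_ac)
qed

lemma fps_log1_nth_0 [simp]: "fps_log1 G $ 0 = 0" by (simp add: fps_log1_def)

text \<open>Turns the logarithmic part of \<open>b_star\<close> into a power: this is how
  e^(-\<omega> b_star) comes to contain the factor
  \<open>fps_cpow (quot_b f) (- \<rho> * \<omega>)\<close>.\<close>

lemma fps_exp_log1_eq_cpow:
  assumes "G $ 0 = 1"
  shows "fps_exp c oo (fps_const r * fps_log1 G) = fps_cpow G (c * r)"
  by (rule fps_cpow_unique[OF assms])
     (simp_all add: fps_exp_compose_deriv fps_log1_deriv assms mult_ac fps_const_mult[symmetric] del: fps_const_mult)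

lemma fps_mult_compose_nth:
  fixes F P c :: "complex fps"
  assumes "c $ 0 = 0"
  shows "(F * (P oo c)) $ N = (\<Sum>i\<le>N. P $ i * (F * c ^ i) $ N)"
proof -
  have "(F * (P oo c)) $ N = (\<Sum>j\<le>N. F $ j * (\<Sum>i\<le>N. P $ i * (c ^ i) $ (N - j)))"
  proof -
    have "(P oo c) $ (N - j) = (\<Sum>i\<le>N. P $ i * (c ^ i) $ (N - j))" if "j \<le> N" for j
      unfolding fps_compose_nth atLeast0AtMost
      by (rule sum.mono_neutral_left)
         (use startsby_zero_power_prefix[OF assms] in \<open>auto simp: not_le\<close>)
    thus ?thesis by (simp add: fps_mult_nth atLeast0AtMost)
  qed
  also have "\<dots> = (\<Sum>i\<le>N. \<Sum>j\<le>N. F $ j * (P $ i * (c ^ i) $ (N - j)))"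
    by (simp add: sum_distrib_left) (rule sum.swap)
  also have "\<dots> = (\<Sum>i\<le>N. P $ i * (F * c ^ i) $ N)"
    by (simp add: fps_mult_nth atLeast0AtMost sum_distrib_left mult_ac)
  finally show ?thesis .
qed

lemma fps_mult_compose_X_mult_nth:
  fixes F P b :: "complex fps"
  shows "(F * (P oo (fps_X * b))) $ N = (\<Sum>l\<le>N. P $ l * (F * b ^ l) $ (N - l))"
proof -
  have eq: "F * (fps_X * b) ^ l = fps_X ^ l * (F * b ^ l)" for l
    unfolding power_mult_distrib by (rule mult.left_commute)
  show ?thesis
    by (subst fps_mult_compose_nth, simp, rule sum.cong, simp) (simp only: eq fps_X_power_mult_nth, simp)
qed

text \<open>Each (z+b)^(-s-n) equals z^(-s-n) (1 + b/z)^(-s-n). The binomial series supplies the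
  index \<open>l\<close>, and its factor z^-l together with z^-n lowers the index of
  \<open>h * b ^ l\<close> to \<open>N - n - l\<close>.\<close>

lemma comp_id_plus_tw_nth:
  "(h * comp_id_plus_tw s b P) $ N =
     (\<Sum>n\<le>N. P $ n * (\<Sum>l\<le>N - n. ((- (s + of_nat n)) gchoose l) * (h * b ^ l) $ (N - n - l)))"
proof -
  let ?G = "1 + fps_X * b" and ?d = "fps_X / (1 + fps_X * b)"
  have G: "?G $ 0 = 1" by simp
  have d: "?d = fps_X * inverse ?G" by (simp add: fps_divide_unit)
  have pw: "h * fps_cpow ?G (- s) * ?d ^ n = fps_X ^ n * (h * fps_cpow ?G (- (s + of_nat n)))" for n
  proof -
    have "inverse ?G ^ n = fps_cpow ?G (- of_nat n)"
      by (simp add: fps_cpow_minus[OF G] fps_cpow_of_nat[OF G] fps_inverse_power)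
    moreover have "fps_cpow ?G (- (s + of_nat n)) = fps_cpow ?G (- s) * fps_cpow ?G (- of_nat n)"
      using fps_cpow_add[OF G, of "-s" "- of_nat n"] by simp
    ultimately show ?thesis by (simp add: d power_mult_distrib mult_ac)
  qed
  have "(h * comp_id_plus_tw s b P) $ N = (\<Sum>n\<le>N. P $ n * (h * fps_cpow ?G (- s) * ?d ^ n) $ N)"
    unfolding comp_id_plus_tw_def comp_id_plus_def mult.assoc[symmetric]
    by (rule fps_mult_compose_nth) (simp add: d)
  also have "\<dots> = (\<Sum>n\<le>N. P $ n * (h * fps_cpow ?G (- (s + of_nat n))) $ (N - n))"
    by (rule sum.cong) (auto simp: pw fps_X_power_mult_nth)
  also have "\<dots> = (\<Sum>n\<le>N. P $ n * (\<Sum>l\<le>N - n. ((- (s + of_nat n)) gchoose l) * (h * b ^ l) $ (N - n - l)))"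
    by (rule sum.cong, simp) (simp add: fps_cpow_def fps_mult_compose_X_mult_nth)
  finally show ?thesis .
qed

subsection \<open>The twisted operators in Borel coordinates\<close>

text \<open>Each application of \<open>T\<close> settles one more entry, so entry n of the (n+1)-st
  iterate no longer depends on the starting sequence. The fixed point is the diagonal of the
  iterates, and the seed \<open>undefined\<close> never matters.\<close>

lemma triangular_fixpoint:
  fixes T :: "(nat \<Rightarrow> 'a) \<Rightarrow> (nat \<Rightarrow> 'a)"
  assumes "\<And>p q n. (\<And>m. m < n \<Longrightarrow> p m = q m) \<Longrightarrow> T p n = T q n"
  shows "\<exists>!p. T p = p"
proof -
  define p where "p n = (T ^^ Suc n) (\<lambda>_. undefined) n" for n
  have *: "(T ^^ k) (\<lambda>_. undefined) n = p n" if "k > n" for k n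
    using that
  proof (induction n arbitrary: k rule: less_induct)
    case (less n)
    obtain k' where k: "k = Suc k'" using less.prems by (cases k) auto
    have "T ((T ^^ k') (\<lambda>_. undefined)) n = T ((T ^^ n) (\<lambda>_. undefined)) n"
      by (rule assms) (use less k in auto)
    thus ?case by (simp add: k p_def)
  qed
  have "T p n = p n" for n
  proof -
    have "T p n = T ((T ^^ n) (\<lambda>_. undefined)) n" by (rule assms) (simp add: *)
    thus ?thesis by (simp add: p_def)
  qed
  hence "T p = p" by auto
  moreover have "q = p" if "T q = q" for q
  proof
    fix n show "q n = p n"
    proof (induction n rule: less_induct)
      case (less n)
      have "T q n = T p n" by (rule assms) (use less in auto)
      thus ?case using that \<open>T p = p\<close> by simp
    qed
  qed
  ultimately show ?thesis by blast
qed

lemma Gamma_shift_nonzero: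
  assumes "Re \<beta> \<ge> 0" 
  shows "of_nat n + \<beta> + 1 \<notin> \<int>\<^sub>\<le>\<^sub>0" "Gamma (of_nat n + \<beta> + 1) \<noteq> 0" "of_nat n + \<beta> + 1 \<noteq> 0"
proof -
  have "Re (of_nat n + \<beta> + 1) > 0" using assms by simp
  moreover have "Re z \<le> 0" if "z \<in> \<int>\<^sub>\<le>\<^sub>0" for z :: complex using that by (auto elim!: nonpos_Ints_cases)
  ultimately show "of_nat n + \<beta> + 1 \<notin> \<int>\<^sub>\<le>\<^sub>0" by fastforce
  thus "Gamma (of_nat n + \<beta> + 1) \<noteq> 0" by (simp add: Gamma_eq_zero_iff)
  show "of_nat n + \<beta> + 1 \<noteq> 0" using \<open>Re (of_nat n + \<beta> + 1) > 0\<close> by (metis less_irrefl zero_complex.simps(1))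
qed

definition unborel_fps :: "complex \<Rightarrow> complex fps \<Rightarrow> complex fps" where
  "unborel_fps \<beta> p = Abs_fps (\<lambda>n. p $ n * Gamma (of_nat n + \<beta> + 1))"

lemma borel_unborel [simp]: "Re \<beta> \<ge> 0 \<Longrightarrow> borel_fps \<beta> (unborel_fps \<beta> p) = p"
  by (rule fps_ext) (simp add: borel_fps_def unborel_fps_def Gamma_shift_nonzero)

lemma borel_fps_inj: "Re \<beta> \<ge> 0 \<Longrightarrow> borel_fps \<beta> P = borel_fps \<beta> Q \<longleftrightarrow> P = Q"
  by (auto simp: fps_eq_iff borel_fps_def Gamma_shift_nonzero)

lemma borel_fps_add [simp]: "borel_fps \<beta> (P + Q) = borel_fps \<beta> P + borel_fps \<beta> Q"
  and borel_fps_diff [simp]: "borel_fps \<beta> (P - Q) = borel_fps \<beta> P - borel_fps \<beta> Q"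
  and borel_fps_const_mult [simp]: "borel_fps \<beta> (fps_const c * P) = fps_const c * borel_fps \<beta> P"
  and borel_fps_0 [simp]: "borel_fps \<beta> 0 = 0"
  by (simp_all add: fps_eq_iff borel_fps_def add_divide_distrib diff_divide_distrib)

lemma borel_fps_nth_0_eq_0 [simp]: "P $ 0 = 0 \<Longrightarrow> borel_fps \<beta> P $ 0 = 0"
  by (simp add: borel_fps_def)

text \<open>Common form of both operators: \<open>B_tw\<close>, with
  \<open>h = fps_cpow (quot_b f) \<alpha>\<close>, and \<open>B_omega\<close> on series without
  constant term, with \<open>h = h\<^sub>\<omega> \<omega>\<close>, \<beta> = 0 and z^-1 as the
  prefactor.\<close>

definition tw_op :: "complex fps \<Rightarrow> complex fps \<Rightarrow> complex \<Rightarrow> complex fps \<Rightarrow> complex fps" where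
  "tw_op h b \<beta> P = h * comp_id_plus_tw (\<beta> + 1) b P - P"

text \<open>The matrix of \<open>tw_op\<close> between Borel transforms, for n < N. The binomial
  coefficient and the quotient of Gamma values are merged into a sign, 1/l! and one Pochhammer
  symbol. The index \<open>l = N - n\<close> is absent: for n < N its factor
  \<open>(h * b ^ l) $ 0\<close> is 0, and on the diagonal it is removed by the subtraction of the
  identity.\<close>

definition Bmat :: "complex fps \<Rightarrow> complex fps \<Rightarrow> complex \<Rightarrow> nat \<Rightarrow> nat \<Rightarrow> complex" where
  "Bmat h b \<beta> N n = (\<Sum>l<N - n. (-1) ^ l / fact l * (h * b ^ l) $ (N - n - l) /
      pochhammer (of_nat (n + l) + \<beta> + 1) (N - n - l))"

lemma borel_coeff_ratio:
  assumes "Re \<beta> \<ge> 0" "n + l \<le> N"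
  shows "P $ n * ((- (\<beta> + 1 + of_nat n)) gchoose l) / Gamma (of_nat N + \<beta> + 1)
       = borel_fps \<beta> P $ n * ((-1) ^ l / fact l / pochhammer (of_nat (n + l) + \<beta> + 1) (N - n - l))"
proof -
  let ?s = "of_nat n + \<beta> + 1"
  have 1: "pochhammer ?s l = Gamma (of_nat (n + l) + \<beta> + 1) / Gamma ?s"
    using pochhammer_Gamma[OF Gamma_shift_nonzero(1)[OF assms(1), of n], of l] by (simp add: algebra_simps)
  have 2: "pochhammer (of_nat (n + l) + \<beta> + 1) (N - n - l) = Gamma (of_nat N + \<beta> + 1) / Gamma (of_nat (n + l) + \<beta> + 1)"
    using pochhammer_Gamma[OF Gamma_shift_nonzero(1)[OF assms(1), of "n + l"], of "N - n - l"] assms(2)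
    by (simp add: algebra_simps of_nat_diff)
  have 3: "(- (\<beta> + 1 + of_nat n)) gchoose l = (-1) ^ l * pochhammer ?s l / fact l"
    by (simp add: gbinomial_pochhammer algebra_simps)
  show ?thesis unfolding 3 1 2 borel_fps_def
    using Gamma_shift_nonzero(2)[OF assms(1)] by (simp add: divide_simps)
qed

lemma borel_fps_tw_comp:
  assumes "Re \<beta> \<ge> 0"
  shows "borel_fps \<beta> (h * comp_id_plus_tw (\<beta> + 1) b P) $ N =
    (\<Sum>n\<le>N. borel_fps \<beta> P $ n * (\<Sum>l\<le>N - n. (-1) ^ l / fact l * (h * b ^ l) $ (N - n - l) /
      pochhammer (of_nat (n + l) + \<beta> + 1) (N - n - l)))"
proof -
  have "borel_fps \<beta> (h * comp_id_plus_tw (\<beta> + 1) b P) $ N = 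
     (\<Sum>n\<le>N. \<Sum>l\<le>N - n. P $ n * ((- (\<beta> + 1 + of_nat n)) gchoose l) / Gamma (of_nat N + \<beta> + 1) * (h * b ^ l) $ (N - n - l))"
    by (simp add: borel_fps_def comp_id_plus_tw_nth sum_divide_distrib sum_distrib_left mult_ac)
  also have "\<dots> = (\<Sum>n\<le>N. \<Sum>l\<le>N - n. borel_fps \<beta> P $ n * ((-1) ^ l / fact l / pochhammer (of_nat (n + l) + \<beta> + 1) (N - n - l)) * (h * b ^ l) $ (N - n - l))"
    by (intro sum.cong refl, subst borel_coeff_ratio[OF assms]) auto
  finally show ?thesis by (simp add: sum_distrib_left mult_ac)
qed

lemma borel_fps_tw_op:
  assumes "Re \<beta> \<ge> 0" "h $ 0 = 1" "b $ 0 = 0"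
  shows "borel_fps \<beta> (tw_op h b \<beta> P) $ N = (\<Sum>n<N. borel_fps \<beta> P $ n * Bmat h b \<beta> N n)"
proof -
  let ?t = "\<lambda>n l. (-1) ^ l / fact l * (h * b ^ l) $ (N - n - l) / pochhammer (of_nat (n + l) + \<beta> + 1) (N - n - l)"
  have last: "(\<Sum>l\<le>N - n. ?t n l) = Bmat h b \<beta> N n" if "n < N" for n
  proof -
    have "(h * b ^ (N - n)) $ 0 = 0" using that assms by (simp add: fps_power_zeroth)
    hence "?t n (N - n) = 0" by simp
    moreover have "{..N - n} = insert (N - n) {..<N - n}" by auto
    ultimately show ?thesis by (simp add: Bmat_def)
  qed
  have "borel_fps \<beta> (h * comp_id_plus_tw (\<beta> + 1) b P) $ N = 
     borel_fps \<beta> P $ N + (\<Sum>n<N. borel_fps \<beta> P $ n * Bmat h b \<beta> N n)"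
    unfolding borel_fps_tw_comp[OF assms(1)] lessThan_Suc_atMost[symmetric] sum.lessThan_Suc[of _ N]
    using last assms(2) by (simp add: lessThan_Suc_atMost)
  thus ?thesis by (simp add: tw_op_def)
qed

lemma fps_power_uminus_one_nth: "((- 1) ^ l :: complex fps) $ m = (if m = 0 then (-1) ^ l else 0)"
  by (induction l) auto

text \<open>The powers of the constant series -1 have only a constant term, so
  \<open>l = N - n\<close> alone survives and the inner sum is 1/(N-n)!, a coefficient of the
  exponential.\<close>

lemma borel_fps_comp_minus_one:
  assumes "Re \<beta> \<ge> 0"
  shows "borel_fps \<beta> (comp_id_plus_tw (\<beta> + 1) (-1) P) = fps_exp 1 * borel_fps \<beta> P"
proof (rule fps_ext)
  fix N
  have "(\<Sum>l\<le>N - n. (-1) ^ l / fact l * (1 * (-1) ^ l :: complex fps) $ (N - n - l) /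
      pochhammer (of_nat (n + l) + \<beta> + 1) (N - n - l)) = 1 / fact (N - n)" for n
  proof -
    have "(\<Sum>l\<le>N - n. (-1) ^ l / fact l * (1 * (-1) ^ l :: complex fps) $ (N - n - l) /
      pochhammer (of_nat (n + l) + \<beta> + 1) (N - n - l)) = (\<Sum>l\<le>N - n. if l = N - n then 1 / fact (N - n) else 0)"
      by (rule sum.cong) (auto simp: fps_power_uminus_one_nth power_mult_distrib[symmetric])
    thus ?thesis by simp
  qed
  hence "borel_fps \<beta> (comp_id_plus_tw (\<beta> + 1) (-1) P) $ N = (\<Sum>n\<le>N. borel_fps \<beta> P $ n * (1 / fact (N - n)))"
    using borel_fps_tw_comp[OF assms, of 1 "-1" P N] by simp
  thus "borel_fps \<beta> (comp_id_plus_tw (\<beta> + 1) (-1) P) $ N = (fps_exp 1 * borel_fps \<beta> P) $ N"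
    by (subst mult.commute) (simp add: fps_mult_nth atLeast0AtMost)
qed

section \<open>Division by exp \<zeta> - 1 and the inverses of the difference operators\<close>

definition expm1_quot :: "complex fps" where "expm1_quot = fps_shift 1 (fps_exp 1 - 1)"

text \<open>\<zeta>/(exp \<zeta> - 1), the generating function of the Bernoulli numbers; its poles
  nearest to 0 are at 2\<pi>\<i> and -2\<pi>\<i>.\<close>

definition bern :: "complex fps" where "bern = inverse expm1_quot"

lemma expm1_quot_nth_0 [simp]: "expm1_quot $ 0 = 1" by (simp add: expm1_quot_def)

lemma bern_nth_0 [simp]: "bern $ 0 = 1" by (simp add: bern_def)

lemma exp_minus_one_eq: "fps_exp 1 - 1 = fps_X * expm1_quot"
  unfolding expm1_quot_def by (rule fps_ext) (simp add: fps_X_mult_nth)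

lemma fps_eq_X_times_shift: "q $ 0 = 0 \<Longrightarrow> q = fps_X * fps_shift 1 (q :: complex fps)"
  by (rule fps_ext) (simp add: fps_X_mult_nth)

lemma exp_minus_one_mult_eq_iff:
  fixes p q :: "complex fps"
  shows "(fps_exp 1 - 1) * p = q \<longleftrightarrow> q $ 0 = 0 \<and> p = bern * fps_shift 1 q"
proof -
  let ?e = expm1_quot
  have e: "?e * bern = 1" unfolding bern_def by (rule inverse_mult_eq_1') simp
  show ?thesis
  proof safe
    assume "q = (fps_exp 1 - 1) * p"
    show "((fps_exp 1 - 1) * p) $ 0 = 0" by simp
    have "(fps_exp 1 - 1) * p = fps_X * (?e * p)" unfolding exp_minus_one_eq by (rule mult.assoc)
    hence "fps_shift 1 ((fps_exp 1 - 1) * p) = ?e * p" by (simp add: fps_eq_iff)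
    moreover have "bern * (?e * p) = p" proof -
      have "bern * (?e * p) = (?e * bern) * p" by (simp only: mult.assoc mult.left_commute)
      thus ?thesis by (simp only: e mult_1)
    qed
    ultimately show "p = bern * fps_shift 1 ((fps_exp 1 - 1) * p)" by simp
  next
    assume q: "q $ 0 = 0" 
    have "(fps_exp 1 - 1) * (bern * fps_shift 1 q) = fps_X * ((?e * bern) * fps_shift 1 q)"
      unfolding exp_minus_one_eq by (simp only: mult.assoc)
    thus "(fps_exp 1 - 1) * (bern * fps_shift 1 q) = q" using q fps_eq_X_times_shift[OF q] by (simp only: e mult_1)
  qed
qed

lemma diff_op_eq_iff:
  assumes "Re \<beta> \<ge> 0"
  shows "comp_id_plus_tw (\<beta> + 1) (-1) Q - Q = P \<longleftrightarrow> (fps_exp 1 - 1) * borel_fps \<beta> Q = borel_fps \<beta> P"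
  by (subst borel_fps_inj[OF assms, symmetric], unfold borel_fps_diff borel_fps_comp_minus_one[OF assms])
     (simp add: algebra_simps)

text \<open>\<open>E_tw\<close> is an \<open>inv\<close>, meaningful only once the operator is
  injective. Injectivity holds because exp \<zeta> - 1 is not a zero divisor on the Borel
  side.\<close>

lemma E_tw_eqI:
  assumes "Re \<beta> \<ge> 0" "(fps_exp 1 - 1) * borel_fps \<beta> Q = borel_fps \<beta> P"
  shows "E_tw \<beta> P = Q"
proof -
  have "inj (\<lambda>P. comp_id_plus_tw (\<beta> + 1) (-1) P - P)"
  proof (rule injI)
    fix P Q assume "comp_id_plus_tw (\<beta> + 1) (-1) P - P = comp_id_plus_tw (\<beta> + 1) (-1) Q - Q"
    hence "borel_fps \<beta> P = borel_fps \<beta> Q"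
      unfolding diff_op_eq_iff[OF assms(1)] 
      using diff_op_eq_iff[OF assms(1), of Q] exp_minus_one_mult_eq_iff by metis
    thus "P = Q" using borel_fps_inj[OF assms(1)] by blast
  qed
  moreover have "comp_id_plus_tw (\<beta> + 1) (-1) Q - Q = P" using diff_op_eq_iff assms by blast
  ultimately show ?thesis unfolding E_tw_def by (rule inv_f_eq)
qed

lemma E_tw_borel:
  assumes "Re \<beta> \<ge> 0" "P $ 0 = 0"
  shows "(fps_exp 1 - 1) * borel_fps \<beta> (E_tw \<beta> P) = borel_fps \<beta> P"
    and "borel_fps \<beta> (E_tw \<beta> P) = bern * fps_shift 1 (borel_fps \<beta> P)"
proof -
  define Q where "Q = unborel_fps \<beta> (bern * fps_shift 1 (borel_fps \<beta> P))"
  have "(fps_exp 1 - 1) * borel_fps \<beta> Q = borel_fps \<beta> P"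
    unfolding exp_minus_one_mult_eq_iff using assms by (simp add: Q_def)
  moreover from E_tw_eqI[OF assms(1) this] have "E_tw \<beta> P = Q" .
  ultimately show "(fps_exp 1 - 1) * borel_fps \<beta> (E_tw \<beta> P) = borel_fps \<beta> P"
    "borel_fps \<beta> (E_tw \<beta> P) = bern * fps_shift 1 (borel_fps \<beta> P)" 
    using exp_minus_one_mult_eq_iff by auto
qed

lemma comp_id_plus_X_mult: "comp_id_plus b (fps_X * Q) = fps_X * comp_id_plus_tw 1 b Q"
proof -
  let ?G = "1 + fps_X * b"
  have G: "?G $ 0 = 1" by simp
  have d: "fps_X / ?G = fps_X * inverse ?G" by (simp add: fps_divide_unit)
  have "fps_cpow ?G 1 = ?G" using fps_cpow_of_nat[OF G, of 1] by simp
  hence "fps_cpow ?G (- 1) = inverse ?G" by (simp add: fps_cpow_minus[OF G])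
  thus ?thesis unfolding comp_id_plus_def comp_id_plus_tw_def d
    by (subst fps_compose_mult_distrib) (simp_all add: mult.assoc)
qed

text \<open>Removing the factor z^-1 reduces the untwisted difference operator to the twisted one
  with \<beta> = 0. The restriction to zero constant term in \<open>E_op\<close> gives injectivity,
  since the operator kills constants.\<close>

lemma E_op_eqI:
  assumes "Q $ 0 = 0" "comp_id_plus (-1) Q - Q = P"
  shows "E_op P = Q"
proof -
  have "inj_on (\<lambda>P. comp_id_plus (-1) P - P) {P. P $ 0 = 0}"
  proof (rule inj_onI)
    fix P Q :: "complex fps"
    assume PQ: "P \<in> {P. P $ 0 = 0}" "Q \<in> {P. P $ 0 = 0}" and eq: "comp_id_plus (-1) P - P = comp_id_plus (-1) Q - Q"
    have *: "comp_id_plus (-1) R - R = fps_X * (comp_id_plus_tw (0 + 1) (-1) (fps_shift 1 R) - fps_shift 1 R)" if "R $ 0 = 0" for R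
      using comp_id_plus_X_mult[of "-1" "fps_shift 1 R"] fps_eq_X_times_shift[OF that] by (simp add: algebra_simps)
    have "comp_id_plus_tw (0 + 1) (-1) (fps_shift 1 P) - fps_shift 1 P = comp_id_plus_tw (0 + 1) (-1) (fps_shift 1 Q) - fps_shift 1 Q"
      using eq PQ *[of P] *[of Q] by simp
    hence "fps_shift 1 P = fps_shift 1 Q" using E_tw_eqI[of 0] diff_op_eq_iff[of 0] by (metis order_refl zero_complex.simps(1))
    thus "P = Q" using fps_eq_X_times_shift PQ by (metis mem_Collect_eq)
  qed
  thus ?thesis unfolding E_op_def by (rule inv_into_f_eq) (use assms in auto)
qed

lemma E_op_X_mult:
  assumes "W $ 0 = 0"
  shows "E_op (fps_X * W) = fps_X * E_tw 0 W"
proof (rule E_op_eqI)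
  have "comp_id_plus_tw (0 + 1) (-1) (E_tw 0 W) - E_tw 0 W = W"
    using diff_op_eq_iff[of 0] E_tw_borel(1)[of 0 W] assms by simp
  thus "comp_id_plus (- 1) (fps_X * E_tw 0 W) - fps_X * E_tw 0 W = fps_X * W"
    by (simp add: comp_id_plus_X_mult algebra_simps)
qed simp

text \<open>The matrix of \<open>E_tw\<close> after \<open>tw_op\<close>. Dividing by exp \<zeta> -
  1 lowers the degree by one, hence the row \<open>N + 1 - i\<close>; the strictly triangular
  \<open>Bmat\<close> becomes triangular with a diagonal that need not vanish.\<close>

definition EBmat :: "complex fps \<Rightarrow> complex fps \<Rightarrow> complex \<Rightarrow> nat \<Rightarrow> nat \<Rightarrow> complex" where
  "EBmat h b \<beta> N n = (\<Sum>i\<le>N - n. bern $ i * Bmat h b \<beta> (N + 1 - i) n)"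

lemma bern_shift_Bmat:
  assumes "\<And>N. y $ N = (\<Sum>n<N. p n * Bmat h b \<beta> N n)"
  shows "(bern * fps_shift 1 y) $ N = (\<Sum>n\<le>N. EBmat h b \<beta> N n * p n)"
proof -
  have "(bern * fps_shift 1 y) $ N = (\<Sum>i\<le>N. bern $ i * (\<Sum>n<N + 1 - i. p n * Bmat h b \<beta> (N + 1 - i) n))"
    by (auto simp: fps_mult_nth atLeast0AtMost assms Suc_diff_le intro!: sum.cong)
  also have "\<dots> = (\<Sum>i\<le>N. \<Sum>n\<le>N - i. bern $ i * (p n * Bmat h b \<beta> (N + 1 - i) n))"
    by (intro sum.cong refl) (simp add: sum_distrib_left Suc_diff_le lessThan_Suc_atMost)
  also have "\<dots> = (\<Sum>n\<le>N. \<Sum>i\<le>N - n. bern $ i * (p n * Bmat h b \<beta> (N + 1 - i) n))"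
    unfolding sum.Sigma[OF finite_atMost ballI[OF finite_atMost]]
    by (rule sum.reindex_bij_witness[of _ "\<lambda>(n,i). (i,n)" "\<lambda>(i,n). (n,i)"]) auto
  finally show ?thesis by (simp add: EBmat_def sum_distrib_right sum_distrib_left mult_ac)
qed

text \<open>Only i = 0 and l = 0 remain, from the first subdiagonal of \<open>Bmat\<close>. With h =
  c_\<alpha> the entry is \<alpha>/(N+\<beta>+1), the only part that weights cannot make small; with
  h = 1 or h = e^(-\<omega> b_star) it is 0.\<close>

lemma EBmat_diag:
  assumes "h $ 0 = 1" "b $ 0 = 0"
  shows "EBmat h b \<beta> N N = h $ 1 / (of_nat N + \<beta> + 1)"
  by (simp add: EBmat_def Bmat_def)

lemma EBmat_apply:
  assumes "Re \<beta> \<ge> 0" "h $ 0 = 1" "b $ 0 = 0"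
  shows "borel_fps \<beta> (E_tw \<beta> (tw_op h b \<beta> P)) $ N = (\<Sum>n\<le>N. EBmat h b \<beta> N n * borel_fps \<beta> P $ n)"
proof -
  have "borel_fps \<beta> (tw_op h b \<beta> P) $ 0 = 0" by (simp only: borel_fps_tw_op[OF assms]) simp
  hence "tw_op h b \<beta> P $ 0 = 0" using Gamma_shift_nonzero(2)[OF assms(1), of 0] by (simp add: borel_fps_def)
  from E_tw_borel(2)[OF assms(1) this] show ?thesis 
    using bern_shift_Bmat[OF borel_fps_tw_op[OF assms, of P]] by simp
qed

subsection \<open>The formal solution\<close>

locale parabolic_germ =
  fixes f :: "complex \<Rightarrow> complex" and \<rho> :: complex
  assumes simple_parabolic: "simple_parabolic f \<rho>"
begin

abbreviation "b \<equiv> germ_b f"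
abbreviation "bs \<equiv> b_star f \<rho>"
abbreviation "h\<^sub>\<omega> \<omega> \<equiv> fps_exp (- \<omega>) oo bs"

text \<open>In the chart w = 1/z the germ of b is B(w) = f(1/w - 1) - 1/w. The asymptotics of f give
  the derivative of B at 0, hence continuity there, and the removable singularity theorem makes B
  holomorphic.\<close>

lemma b_facts: "fps_conv_radius b > 0" "b $ 0 = 0" "b $ 1 = - \<rho>"
proof -
  define B where "B = (\<lambda>w. if w = 0 then 0 else f (1 / w - 1) - 1 / w)"
  obtain r where r: "r > 0" "f holomorphic_on {z. norm z > r}" 
    and O: "(\<lambda>z. f z - (z + 1 - \<rho> / z)) \<in> O[at_infinity](\<lambda>z. 1 / z ^ 2)"
    using simple_parabolic unfolding simple_parabolic_def by blast
  from O obtain c where c: "c > 0" "\<forall>\<^sub>F z in at_infinity. norm (f z - (z + 1 - \<rho> / z)) \<le> c * norm (1 / z ^ 2)"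
    by (elim landau_o.bigE)
  have i1: "((\<lambda>z::complex. 1 / z) \<longlongrightarrow> 0) at_infinity" 
    using tendsto_inverse_0[where 'a=complex] by (simp add: divide_inverse)
  \<comment> \<open>The factor is z + 1 and not z because z = 1/w - 1 will be substituted: the limit
    sought is that of B(w)/w.\<close>
  have "((\<lambda>z. (z + 1) * (f z - (z + 1 - \<rho> / z))) \<longlongrightarrow> 0) at_infinity"
  proof (rule Lim_null_comparison)
    show "\<forall>\<^sub>F z in at_infinity. norm ((z + 1) * (f z - (z + 1 - \<rho> / z))) \<le> c * norm (1 / z + (1 / z) * (1 / z))"
      using c(2) eventually_not_equal_at_infinity[of 0]
    proof eventually_elim
      case (elim z)
      have "norm ((z + 1) * (f z - (z + 1 - \<rho> / z))) \<le> norm (z + 1) * (c * norm (1 / z ^ 2))"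
        unfolding norm_mult using elim by (intro mult_left_mono) auto
      also have "\<dots> = c * norm ((z + 1) * (1 / z ^ 2))" by (simp add: norm_mult norm_divide)
      also have "(z + 1) * (1 / z ^ 2) = 1 / z + (1 / z) * (1 / z)" using elim by (simp add: field_simps power2_eq_square)
      finally show ?case .
    qed
    show "((\<lambda>z. c * norm (1 / z + (1 / z) * (1 / z) :: complex)) \<longlongrightarrow> 0) at_infinity"
      by (rule tendsto_eq_intros i1 refl | simp)+
  qed
  moreover have "((\<lambda>z. - \<rho> * (1 + 1 / z)) \<longlongrightarrow> - \<rho>) at_infinity"
    by (rule tendsto_eq_intros i1 refl | simp)+
  ultimately have "((\<lambda>z. (z + 1) * (f z - (z + 1 - \<rho> / z)) + (- \<rho> * (1 + 1 / z))) \<longlongrightarrow> - \<rho>) at_infinity"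
    using tendsto_add by fastforce
  hence lim: "((\<lambda>z. (z + 1) * (f z - z - 1)) \<longlongrightarrow> - \<rho>) at_infinity"
  proof (rule Lim_transform_eventually)
    show "\<forall>\<^sub>F z in at_infinity. (z + 1) * (f z - (z + 1 - \<rho> / z)) + (- \<rho> * (1 + 1 / z)) = (z + 1) * (f z - z - 1)"
      using eventually_not_equal_at_infinity[of 0] by eventually_elim (simp add: field_simps)
  qed
  have fl: "filterlim (\<lambda>w::complex. 1 / w - 1) at_infinity (at 0)"
  proof -
    have "filterlim (\<lambda>w::complex. inverse w + (- 1)) at_infinity (at 0)"
      by (rule tendsto_add_filterlim_at_infinity'[OF filterlim_inverse_at_infinity tendsto_const])
    thus ?thesis by (simp add: divide_inverse)
  qed
  have "((\<lambda>w. (1 / w - 1 + 1) * (f (1 / w - 1) - (1 / w - 1) - 1)) \<longlongrightarrow> - \<rho>) (at 0)"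
    using filterlim_compose[OF lim fl] .
  hence "((\<lambda>w. (B w - B 0) / (w - 0)) \<longlongrightarrow> - \<rho>) (at 0)"
    by (rule Lim_transform_eventually)
       (auto simp: eventually_at_filter B_def)
  hence der: "(B has_field_derivative - \<rho>) (at 0)" by (simp add: has_field_derivative_iff)
  define S where "S = ball (0::complex) (1 / (r + 1))"
  have hol0: "B holomorphic_on S - {0}"
  proof -
    have "norm (1 / w - 1) > r" if "w \<in> S - {0}" for w
    proof -
      have "norm w * (r + 1) < 1" "norm w > 0" using that r by (auto simp: S_def field_simps)
      hence "r + 1 < norm (1 / w)" by (simp add: norm_divide field_simps)
      also have "norm (1 / w) \<le> norm (1 / w - 1) + 1" using norm_triangle_sub[of "1 / w" 1] by simp
      finally show ?thesis by simp
    qed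
    hence "(\<lambda>w. f (1 / w - 1) - 1 / w) holomorphic_on S - {0}"
      by (intro holomorphic_intros holomorphic_on_compose_gen[OF _ r(2), unfolded o_def]) auto
    thus ?thesis by (rule holomorphic_transform) (auto simp: B_def)
  qed
  have "B holomorphic_on S"
  proof (rule no_isolated_singularity)
    have "isCont B w" if "w \<in> S" for w
    proof (cases "w = 0")
      case True thus ?thesis using der DERIV_isCont by blast
    next
      case False
      have "open (S - {0})" by (auto simp: S_def)
      thus ?thesis using hol0 that False by (metis Diff_iff at_within_open continuous_on_eq_continuous_within holomorphic_on_imp_continuous_on singletonD)
    qed
    thus "continuous_on S B" by (simp add: continuous_at_imp_continuous_on)
  qed (use hol0 in \<open>auto simp: S_def\<close>)
  hence "B has_fps_expansion fps_expansion B 0"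
    using r by (intro has_fps_expansion_fps_expansion) (auto simp: S_def)
  moreover have bB: "b = fps_expansion B 0" by (simp add: germ_b_def B_def)
  ultimately show "fps_conv_radius b > 0" by (simp add: has_fps_expansion_def)
  show "b $ 0 = 0" "b $ 1 = - \<rho>"
    using DERIV_imp_deriv[OF der] by (simp_all add: bB fps_expansion_def) (simp add: B_def)
qed

lemma quot_facts: "quot_b f $ 0 = 1" "quot_b f $ 1 = 1"
  "quot_b f = (1 + fps_X * b) * inverse (1 - fps_X)" 
proof -
  show *: "quot_b f = (1 + fps_X * b) * inverse (1 - fps_X)" by (simp add: quot_b_def fps_divide_unit)
  show "quot_b f $ 0 = 1" by (simp add: *)
  have "inverse (1 - fps_X) * (1 - fps_X) = (1 :: complex fps)" by (rule inverse_mult_eq_1) simp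
  hence "(inverse (1 - fps_X) * (1 - fps_X :: complex fps)) $ 1 = 0" by simp
  hence "inverse (1 - fps_X :: complex fps) $ 1 = 1" by (simp add: fps_mult_nth)
  thus "quot_b f $ 1 = 1" by (simp add: * b_facts fps_mult_nth)
qed

lemma fps_compose_nth_1: "(F oo G) $ Suc 0 = F $ 1 * G $ 1" if "G $ 0 = 0" for F G :: "complex fps"
  by (simp add: fps_compose_nth)

text \<open>At order z^-1, b contributes -\<rho> and the logarithm contributes \<rho>. This
  cancellation is the purpose of the correction in \<open>b_star\<close>;
  \<open>h\<^sub>\<omega>_facts\<close> passes it on to e^(-\<omega> b_star).\<close>

lemma bs_facts: "bs $ 0 = 0" "bs $ 1 = 0"
proof -
  show "bs $ 0 = 0" by (simp add: b_star_def b_facts)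
  show "bs $ 1 = 0" using b_facts(3) quot_facts 
    by (simp add: b_star_def fps_log1_def fps_compose_nth_1 fps_ln_nth)
qed

lemma h\<^sub>\<omega>_facts: "h\<^sub>\<omega> \<omega> $ 0 = 1" "h\<^sub>\<omega> \<omega> $ 1 = 0"
  using bs_facts by (simp_all add: fps_compose_nth_1)

lemma h\<^sub>\<omega>_eq: "h\<^sub>\<omega> \<omega> = fps_cpow (quot_b f) (- \<rho> * \<omega>) * (fps_exp (- \<omega>) oo b)"
  unfolding b_star_def
  by (subst fps_exp_compose_add)
     (simp_all add: b_facts fps_exp_log1_eq_cpow quot_facts mult_ac)

lemma cpow_quot_facts: "fps_cpow (quot_b f) a $ 0 = 1" "fps_cpow (quot_b f) a $ 1 = a"
  using quot_facts by (simp_all add: fps_cpow_def fps_compose_nth_1)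

text \<open>With the factor z^-1 removed and the Borel transform applied, the equation becomes a
  triangular fixed-point equation. For h = 1 the diagonal of \<open>EBmat\<close> is zero, so each
  entry depends on earlier ones only.\<close>

lemma phi_ser_unique_existence: 
  "\<exists>!P. P $ 0 = 0 \<and> comp_id_plus (-1) P = comp_id_plus b P + bs"
proof -
  let ?W = "fps_shift 1 bs"
  let ?D = "\<lambda>P. P $ 0 = 0 \<and> comp_id_plus (-1) P = comp_id_plus b P + bs"
  have W0: "?W $ 0 = 0" using bs_facts by simp
  have bs: "bs = fps_X * ?W" using fps_eq_X_times_shift bs_facts by blast
  define T where "T = (\<lambda>(q::nat \<Rightarrow> complex) N. (\<Sum>n\<le>N. EBmat 1 b 0 N n * q n) + (bern * fps_shift 1 (borel_fps 0 ?W)) $ N)"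
  have "T p n = T q n" if "\<And>m. m < n \<Longrightarrow> p m = q m" for p q n
  proof -
    have "EBmat 1 b 0 n n = 0" by (simp add: EBmat_diag b_facts)
    hence "(\<Sum>m\<le>n. EBmat 1 b 0 n m * p m) = (\<Sum>m\<le>n. EBmat 1 b 0 n m * q m)"
      using that by (intro sum.cong) (auto simp: le_less)
    thus ?thesis by (simp add: T_def)
  qed
  hence ex1: "\<exists>!q. T q = q" by (rule triangular_fixpoint)
  have key: "?D (fps_X * Q) \<longleftrightarrow> T (($) (borel_fps 0 Q)) = ($) (borel_fps 0 Q)" for Q
  proof -
    have "?D (fps_X * Q) \<longleftrightarrow> fps_X * comp_id_plus_tw (0 + 1) (-1) Q = fps_X * (comp_id_plus_tw 1 b Q + ?W)"
      by (subst bs) (simp add: comp_id_plus_X_mult distrib_left)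
    also have "\<dots> \<longleftrightarrow> comp_id_plus_tw (0 + 1) (-1) Q = comp_id_plus_tw 1 b Q + ?W" 
      by (subst mult_cancel_left) simp
    also have "\<dots> \<longleftrightarrow> comp_id_plus_tw (0 + 1) (-1) Q - Q = tw_op 1 b 0 Q + ?W" 
      by (auto simp: tw_op_def algebra_simps)
    also have "\<dots> \<longleftrightarrow> (fps_exp 1 - 1) * borel_fps 0 Q = borel_fps 0 (tw_op 1 b 0 Q + ?W)"
      by (rule diff_op_eq_iff) simp
    also have "\<dots> \<longleftrightarrow> borel_fps 0 Q = bern * fps_shift 1 (borel_fps 0 (tw_op 1 b 0 Q + ?W))"
    proof -
      have "borel_fps 0 (tw_op 1 b 0 Q) $ 0 = 0" by (subst borel_fps_tw_op) (auto simp: b_facts)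
      thus ?thesis by (subst exp_minus_one_mult_eq_iff) (use W0 in simp)
    qed
    also have "bern * fps_shift 1 (borel_fps 0 (tw_op 1 b 0 Q + ?W)) = 
       Abs_fps (T (($) (borel_fps 0 Q)))"
    proof (rule fps_ext)
      fix N
      have "(bern * fps_shift 1 (borel_fps 0 (tw_op 1 b 0 Q))) $ N = (\<Sum>n\<le>N. EBmat 1 b 0 N n * borel_fps 0 Q $ n)"
        by (rule bern_shift_Bmat) (rule borel_fps_tw_op, auto simp: b_facts)
      thus "(bern * fps_shift 1 (borel_fps 0 (tw_op 1 b 0 Q + ?W))) $ N = Abs_fps (T (($) (borel_fps 0 Q))) $ N"
        by (simp add: T_def distrib_left fps_shift_add)
    qed
    finally show ?thesis by (simp only: fps_eq_iff fun_eq_iff fps_nth_Abs_fps) (intro iff_allI eq_commute)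
  qed
  from ex1 obtain q where q: "T q = q" "\<And>q'. T q' = q' \<Longrightarrow> q' = q" by blast
  define Q where "Q = unborel_fps 0 (Abs_fps q)"
  have bQ: "borel_fps 0 Q = Abs_fps q" by (simp add: Q_def)
  have nq: "($) (Abs_fps q) = q" by (rule ext, rule fps_nth_Abs_fps)
  have DQ: "?D (fps_X * Q)" unfolding key bQ nq by (rule q(1))
  have "P = fps_X * Q" if P: "?D P" for P
  proof -
    have PX: "P = fps_X * fps_shift 1 P" using P fps_eq_X_times_shift by blast
    have "?D (fps_X * fps_shift 1 P)" using P PX by metis
    hence "($) (borel_fps 0 (fps_shift 1 P)) = q" unfolding key by (rule q(2))
    hence "borel_fps 0 (fps_shift 1 P) = borel_fps 0 Q" unfolding bQ by (metis fps_nth_inverse)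
    hence "fps_shift 1 P = Q" using borel_fps_inj[of 0 "fps_shift 1 P" Q] by simp
    thus ?thesis using PX by metis
  qed
  thus ?thesis using DQ by blast
qed

lemma phi_ser: "phi_ser f \<rho> $ 0 = 0" 
  "comp_id_plus (-1) (phi_ser f \<rho>) = comp_id_plus b (phi_ser f \<rho>) + bs"
  using theI'[OF phi_ser_unique_existence] unfolding phi_ser_def by auto

lemma comp_id_plus_add: "comp_id_plus c (P + Q) = comp_id_plus c P + comp_id_plus c Q"
  and comp_id_plus_diff: "comp_id_plus c (P - Q) = comp_id_plus c P - comp_id_plus c Q"
  by (simp_all add: comp_id_plus_def fps_compose_add_distrib fps_compose_sub_distrib)

lemma comp_id_plus_const_mult: "comp_id_plus c (fps_const k * P) = fps_const k * comp_id_plus c P"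
proof -
  have "(fps_X / (1 + fps_X * c)) $ 0 = 0" by (simp add: fps_divide_unit)
  thus ?thesis unfolding comp_id_plus_def by (simp add: fps_compose_mult_distrib)
qed

lemma comp_id_plus_X_power_mult: 
  "comp_id_plus c (fps_X ^ n * Q) = fps_X ^ n * (fps_cpow (1 + fps_X * c) (- of_nat n) * comp_id_plus c Q)"
proof -
  let ?G = "1 + fps_X * c"
  have G: "?G $ 0 = 1" by simp
  have d: "fps_X / ?G = fps_X * inverse ?G" by (simp add: fps_divide_unit)
  have 1: "fps_cpow ?G (- of_nat n) = inverse ?G ^ n" 
    by (simp add: fps_cpow_minus[OF G] fps_cpow_of_nat[OF G] fps_inverse_power)
  show ?thesis unfolding 1 comp_id_plus_def d
    by (subst fps_compose_mult_distrib, simp, subst fps_compose_power[symmetric], simp)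
       (simp add: power_mult_distrib mult.assoc)
qed

text \<open>The equation of the remainder multiplied by z^(-\<alpha>) (1 - z^-1)^(-\<alpha>). On the
  left this factor is the translate of z^(-\<alpha>). On the right it is compared with the factor
  (z+b)^(-\<alpha>) produced by the twisted composition, and the quotient of the two is
  c_\<alpha>.\<close>

lemma phi_rem_eq:
  assumes "\<beta> = \<alpha> + of_nat N"
  shows "comp_id_plus_tw (\<beta> + 1) (-1) (phi_rem f \<rho> N) - phi_rem f \<rho> N = 
      tw_op (fps_cpow (quot_b f) \<alpha>) b \<beta> (phi_rem f \<rho> N) + b_alpha f \<rho> \<alpha> N"
    and "b_alpha f \<rho> \<alpha> N $ 0 = 0"
proof -
  let ?R = "phi_rem f \<rho> N" and ?phi = "phi_ser f \<rho>"
  define T where "T = fps_cutoff (N + 1) ?phi"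
  have D: "?phi - T = fps_X ^ (N + 1) * ?R"
    by (rule fps_ext) (simp add: phi_rem_def T_def fps_X_power_mult_nth del: power_Suc)
  let ?c = "\<lambda>c. fps_cpow (1 + fps_X * c) (- of_nat (N + 1)) * comp_id_plus c ?R"
  have "comp_id_plus (-1) (?phi - T) = comp_id_plus b (?phi - T) + b_trunc f \<rho> N"
    unfolding b_trunc_def Let_def T_def[symmetric] comp_id_plus_diff phi_ser(2) by simp
  hence "b_trunc f \<rho> N = fps_X ^ (N + 1) * (?c (-1) - ?c b)"
    unfolding D comp_id_plus_X_power_mult by (simp add: algebra_simps)
  hence bt: "fps_shift (N + 1) (b_trunc f \<rho> N) = ?c (-1) - ?c b" 
    by (simp add: mult.commute[of "fps_X ^ _"] del: power_Suc)
  have ba: "b_alpha f \<rho> \<alpha> N = fps_cpow (1 - fps_X) (- \<alpha>) * (?c (-1) - ?c b)" 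
    unfolding b_alpha_def bt ..
  have exps: "- (\<beta> + 1) = - \<alpha> + - of_nat (N + 1)" by (simp add: assms)
  have 1: "comp_id_plus_tw (\<beta> + 1) (-1) ?R = fps_cpow (1 - fps_X) (- \<alpha>) * ?c (-1)"
    unfolding comp_id_plus_tw_def exps by (subst fps_cpow_add) (simp_all add: mult.assoc)
  have q: "fps_cpow (quot_b f) \<alpha> = fps_cpow (1 + fps_X * b) \<alpha> * fps_cpow (1 - fps_X) (- \<alpha>)"
    unfolding quot_facts(3) by (subst fps_cpow_mult) (simp_all add: fps_cpow_inverse)
  have e2: "fps_cpow (1 + fps_X * b) \<alpha> * fps_cpow (1 + fps_X * b) (- (\<beta> + 1)) = fps_cpow (1 + fps_X * b) (- of_nat (N + 1))"
    by (subst fps_cpow_add[symmetric]) (simp_all add: assms algebra_simps)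
  have 2: "fps_cpow (quot_b f) \<alpha> * comp_id_plus_tw (\<beta> + 1) b ?R = fps_cpow (1 - fps_X) (- \<alpha>) * ?c b"
    unfolding comp_id_plus_tw_def q e2[symmetric] by (simp only: mult_ac)
  show "comp_id_plus_tw (\<beta> + 1) (-1) ?R - ?R = tw_op (fps_cpow (quot_b f) \<alpha>) b \<beta> ?R + b_alpha f \<rho> \<alpha> N"
    unfolding tw_op_def 1 2 ba by (simp add: right_diff_distrib)
  show "b_alpha f \<rho> \<alpha> N $ 0 = 0" unfolding ba by (simp add: comp_id_plus_def)
qed

text \<open>Mirrors the splitting of an alien value into the residue c and the transform of \<chi>:
  on constants B^\<omega> is multiplication by e^(-\<omega> b_star) - 1, on the rest it is
  \<open>tw_op\<close> with \<beta> = 0.\<close>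

lemma B_omega_const_plus:
  "B_omega f \<rho> \<omega> (fps_const c + fps_X * P) = 
     fps_X * (fps_const c * fps_shift 1 (h\<^sub>\<omega> \<omega> - 1) + tw_op (h\<^sub>\<omega> \<omega>) b 0 P)"
proof -
  have "h\<^sub>\<omega> \<omega> - 1 = fps_X * fps_shift 1 (h\<^sub>\<omega> \<omega> - 1)" by (rule fps_eq_X_times_shift) simp
  moreover have "comp_id_plus b (fps_const c) = fps_const c" by (simp add: comp_id_plus_def)
  ultimately have "B_omega f \<rho> \<omega> (fps_const c) = fps_X * (fps_const c * fps_shift 1 (h\<^sub>\<omega> \<omega> - 1))"
    unfolding B_omega_def by (metis (no_types, opaque_lifting) left_diff_distrib mult.commute mult.left_commute mult_1)
  moreover have "B_omega f \<rho> \<omega> (fps_const c + fps_X * P) = B_omega f \<rho> \<omega> (fps_const c) + B_omega f \<rho> \<omega> (fps_X * P)"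
    unfolding B_omega_def comp_id_plus_add by (simp add: algebra_simps)
  moreover have "B_omega f \<rho> \<omega> (fps_X * P) = fps_X * tw_op (h\<^sub>\<omega> \<omega>) b 0 P"
    unfolding B_omega_def comp_id_plus_X_mult tw_op_def by (simp add: algebra_simps)
  ultimately show ?thesis by (simp add: distrib_left)
qed

lemma B_omega_add: "B_omega f \<rho> \<omega> (P + Q) = B_omega f \<rho> \<omega> P + B_omega f \<rho> \<omega> Q"
  and B_omega_const_mult: "B_omega f \<rho> \<omega> (fps_const k * P) = fps_const k * B_omega f \<rho> \<omega> P"
  unfolding B_omega_def comp_id_plus_add comp_id_plus_const_mult by (simp_all add: algebra_simps)

lemma tw_op_nth_0: "h $ 0 = 1 \<Longrightarrow> tw_op h c \<beta> P $ 0 = 0"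
  by (simp add: tw_op_def comp_id_plus_tw_def comp_id_plus_def)

definition EB :: "complex \<Rightarrow> complex fps \<Rightarrow> complex fps" where
  "EB \<omega> P = E_op (B_omega f \<rho> \<omega> P)"

lemma EB_spec: "EB \<omega> P $ 0 = 0" "comp_id_plus (-1) (EB \<omega> P) - EB \<omega> P = B_omega f \<rho> \<omega> P"
proof -
  define W where "W = fps_const (P $ 0) * fps_shift 1 (h\<^sub>\<omega> \<omega> - 1) + tw_op (h\<^sub>\<omega> \<omega>) b 0 (fps_shift 1 P)"
  have W0: "W $ 0 = 0" using h\<^sub>\<omega>_facts[of \<omega>] by (simp add: W_def tw_op_nth_0)
  have P: "P = fps_const (P $ 0) + fps_X * fps_shift 1 P"
    using fps_eq_X_times_shift[of "P - fps_const (P $ 0)"] by (simp add: fps_eq_iff fps_X_mult_nth)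
  have BW: "B_omega f \<rho> \<omega> P = fps_X * W"
    by (subst P, subst B_omega_const_plus) (simp add: W_def)
  have E: "EB \<omega> P = fps_X * E_tw 0 W" unfolding EB_def BW by (rule E_op_X_mult[OF W0])
  have "comp_id_plus_tw (0 + 1) (-1) (E_tw 0 W) - E_tw 0 W = W"
    using diff_op_eq_iff[of 0] E_tw_borel(1)[of 0 W] W0 by simp
  thus "comp_id_plus (-1) (EB \<omega> P) - EB \<omega> P = B_omega f \<rho> \<omega> P"
    unfolding E BW comp_id_plus_X_mult by (simp add: algebra_simps)
  show "EB \<omega> P $ 0 = 0" by (simp add: E)
qed

lemma EB_eqI: "Q $ 0 = 0 \<Longrightarrow> comp_id_plus (-1) Q - Q = B_omega f \<rho> \<omega> P \<Longrightarrow> EB \<omega> P = Q"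
  unfolding EB_def by (rule E_op_eqI)

lemma EB_add: "EB \<omega> (P + Q) = EB \<omega> P + EB \<omega> Q"
  by (rule EB_eqI) (use EB_spec[of \<omega>] in \<open>simp_all add: comp_id_plus_add B_omega_add algebra_simps\<close>)

lemma EB_const_mult: "EB \<omega> (fps_const k * P) = fps_const k * EB \<omega> P"
  by (rule EB_eqI) (use EB_spec[of \<omega>] in \<open>simp_all add: comp_id_plus_const_mult B_omega_const_mult right_diff_distrib[symmetric]\<close>)

lemma EB_0: "EB \<omega> 0 = 0"
  using EB_const_mult[of \<omega> 0 0] by simp

lemma EB_sum: "EB \<omega> (\<Sum>i\<in>I. P i) = (\<Sum>i\<in>I. EB \<omega> (P i))"
  by (induction I rule: infinite_finite_induct) (auto simp: EB_add EB_0)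

lemma Psi_0: "Psi f \<rho> \<omega> 0 = 1" and Psi_Suc: "Psi f \<rho> \<omega> (Suc k) = EB \<omega> (Psi f \<rho> \<omega> k)"
  by (simp_all add: Psi_def EB_def)

text \<open>B^\<omega> raises the order by two and E lowers it by one. The gain of two needs both
  vanishing coefficients: that of z^-1 in e^(-\<omega> b_star) and the constant term of b.\<close>

lemma EB_low_order:
  assumes "\<And>n. n < j \<Longrightarrow> P $ n = 0" "n < Suc j"
  shows "EB \<omega> P $ n = 0"
proof -
  have c0: "comp_id_plus b P = comp_id_plus_tw 0 b P" by (simp add: comp_id_plus_tw_def)
  have B: "B_omega f \<rho> \<omega> P $ N = 0" if N: "N < Suc (Suc j)" for N
  proof -
    have inner: "(\<Sum>l\<le>N - n. (- (0 + of_nat n :: complex) gchoose l) * (h\<^sub>\<omega> \<omega> * b ^ l) $ (N - n - l)) = (if n = N then 1 else 0)"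
      if n: "n \<le> N" "n \<ge> j" for n
    proof -
      consider "n = N" | "N = Suc n" using n N by linarith
      thus ?thesis
      proof cases
        case 2
        have "{..Suc 0} = {0, 1}" by auto
        thus ?thesis using 2 h\<^sub>\<omega>_facts[of \<omega>] b_facts by (simp add: fps_mult_nth)
      qed (use h\<^sub>\<omega>_facts in simp)
    qed
    have "(h\<^sub>\<omega> \<omega> * comp_id_plus_tw 0 b P) $ N = (\<Sum>n\<le>N. if n = N then P $ n else 0)"
      unfolding comp_id_plus_tw_nth
    proof (rule sum.cong[OF refl])
      fix n assume "n \<in> {..N}"
      thus "P $ n * (\<Sum>l\<le>N - n. (- (0 + of_nat n) gchoose l) * (h\<^sub>\<omega> \<omega> * b ^ l) $ (N - n - l)) = (if n = N then P $ n else 0)"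
        using assms(1)[of n] by (cases "j \<le> n") (simp_all only: inner atMost_iff, auto)
    qed
    thus ?thesis unfolding B_omega_def c0 by simp
  qed
  define W where "W = fps_shift 1 (B_omega f \<rho> \<omega> P)"
  have W: "W $ n = 0" if "n < Suc j" for n using B that by (simp add: W_def)
  have XW: "B_omega f \<rho> \<omega> P = fps_X * W" unfolding W_def by (rule fps_eq_X_times_shift) (simp add: B)
  have E: "EB \<omega> P = fps_X * E_tw 0 W" unfolding EB_def XW by (rule E_op_X_mult) (simp add: W)
  have "borel_fps 0 (E_tw 0 W) $ m = 0" if "m < j" for m
    using that W by (subst E_tw_borel) (auto simp: fps_mult_nth borel_fps_def intro!: sum.neutral)
  hence "E_tw 0 W $ m = 0" if "m < j" for m
    using that Gamma_shift_nonzero(2)[of 0 m] by (auto simp: borel_fps_def)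
  thus ?thesis unfolding E using assms(2) by (cases n) (auto simp: fps_X_mult_nth)
qed

text \<open>Exponentiating the equation of \<phi> gives C_(id-1) U = e^(-\<omega> b_star) C_(id+b) U
  for U = e^(-\<omega>\<phi>), that is, (C_(id-1) - Id)(U - 1) = B^\<omega> U.\<close>

lemma exp_phi_fixpoint:
  "fps_exp (- \<omega>) oo phi_ser f \<rho> = 1 + EB \<omega> (fps_exp (- \<omega>) oo phi_ser f \<rho>)"
proof -
  let ?U = "fps_exp (- \<omega>) oo phi_ser f \<rho>"
  have d: "(fps_X / (1 + fps_X * c)) $ 0 = 0" for c :: "complex fps" by (simp add: fps_divide_unit)
  have c: "comp_id_plus c ?U = fps_exp (- \<omega>) oo comp_id_plus c (phi_ser f \<rho>)" for c
    unfolding comp_id_plus_def by (rule fps_compose_assoc[symmetric]) (use d phi_ser in auto)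
  have c0: "comp_id_plus c (phi_ser f \<rho>) $ 0 = 0" for c using phi_ser by (simp add: comp_id_plus_def)
  have "comp_id_plus (-1) ?U = (h\<^sub>\<omega> \<omega>) * comp_id_plus b ?U"
    unfolding c phi_ser(2) by (subst fps_exp_compose_add) (use c0 bs_facts in \<open>auto simp: mult.commute\<close>)
  moreover have "comp_id_plus (-1) 1 = 1" by (simp add: comp_id_plus_def)
  ultimately have "EB \<omega> ?U = ?U - 1"
    by (intro EB_eqI) (simp_all add: comp_id_plus_diff B_omega_def)
  thus ?thesis by simp
qed

lemma Psi_low_order: "n < k \<Longrightarrow> Psi f \<rho> \<omega> k $ n = 0"
proof (induction k arbitrary: n)
  case (Suc k)
  show ?case unfolding Psi_Suc by (rule EB_low_order[where j=k]) (use Suc in auto)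
qed simp

text \<open>The fixed-point equation makes e^(-\<omega>\<phi>) the geometric series of
  \<open>EB\<close> applied to 1. It converges formally because each application raises the
  order.\<close>

lemma exp_phi_eq_sum_Psi:
  "n < m \<Longrightarrow> (fps_exp (- \<omega>) oo phi_ser f \<rho>) $ n = (\<Sum>k<m. Psi f \<rho> \<omega> k $ n)"
proof (induction m arbitrary: n)
  case (Suc m)
  let ?U = "fps_exp (- \<omega>) oo phi_ser f \<rho>"
  have "EB \<omega> (?U - (\<Sum>k<m. Psi f \<rho> \<omega> k)) $ n = 0"
    by (rule EB_low_order[where j=m]) (use Suc in \<open>auto simp: fps_sum_nth\<close>)
  moreover have "EB \<omega> (?U - (\<Sum>k<m. Psi f \<rho> \<omega> k)) = (?U - 1) - (\<Sum>k<m. Psi f \<rho> \<omega> (Suc k))"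
  proof -
    have "EB \<omega> ?U = EB \<omega> (?U - (\<Sum>k<m. Psi f \<rho> \<omega> k)) + EB \<omega> (\<Sum>k<m. Psi f \<rho> \<omega> k)"
      by (simp add: EB_add[symmetric])
    thus ?thesis using exp_phi_fixpoint[of \<omega>] by (simp add: EB_sum Psi_Suc algebra_simps)
  qed
  moreover have "(\<Sum>k<Suc m. Psi f \<rho> \<omega> k) = 1 + (\<Sum>k<m. Psi f \<rho> \<omega> (Suc k))"
    by (subst sum.lessThan_Suc_shift) (simp add: Psi_0)
  ultimately have "(?U - (\<Sum>k<Suc m. Psi f \<rho> \<omega> k)) $ n = 0" by (simp add: algebra_simps)
  thus ?case by (simp add: fps_sum_nth)
qed simp

end

subsection \<open>Geometric decay of the Taylor coefficients\<close>

lemma eball_cball_subset: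
  assumes "ereal s < r" shows "cball (0::complex) s \<subseteq> eball 0 r"
  using assms by (auto simp: dist_norm) (meson ereal_less_eq(3) le_less_trans)

lemma fps_coeff_bound:
  fixes P :: "complex fps"
  assumes "s > 0" "ereal s < fps_conv_radius P" "\<And>w. norm w = s \<Longrightarrow> norm (eval_fps P w) \<le> C"
  shows "norm (P $ n) \<le> C / s ^ n"
proof -
  have sub: "cball (0::complex) s \<subseteq> eball 0 (fps_conv_radius P)"
    using assms(2) by (rule eball_cball_subset)
  have "norm ((deriv ^^ n) (eval_fps P) 0) \<le> fact n * C / s ^ n"
  proof (rule Cauchy_inequality)
    show "eval_fps P holomorphic_on ball 0 s"
      using order_trans[OF ball_subset_cball sub] by (rule holomorphic_on_eval_fps)
    show "continuous_on (cball 0 s) (eval_fps P)" using sub by (rule continuous_on_subset[OF continuous_on_eval_fps])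
  qed (use assms in \<open>auto simp: norm_minus_commute\<close>)
  moreover have "P $ n = (deriv ^^ n) (eval_fps P) 0 / fact n"
    using assms by (intro fps_nth_conv_deriv) (metis ereal_less(2) order.strict_trans)
  moreover have "norm ((deriv ^^ n) (eval_fps P) 0 / fact n) = norm ((deriv ^^ n) (eval_fps P) 0) / fact n"
    by (simp add: norm_divide)
  ultimately have "norm (P $ n) \<le> fact n * C / s ^ n / fact n" 
    using divide_right_mono[of _ _ "fact n :: real"] by (metis fact_ge_zero)
  thus ?thesis by simp
qed

lemma fps_coeff_bound_ex:
  fixes P :: "complex fps"
  assumes "s > 0" "ereal s < fps_conv_radius P"
  obtains C where "C > 0" "\<And>n. norm (P $ n) \<le> C / s ^ n"
proof -
  have sub: "cball (0::complex) s \<subseteq> eball 0 (fps_conv_radius P)"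
    using assms(2) by (rule eball_cball_subset)
  have "compact (eval_fps P ` cball 0 s)"
    using sub by (intro compact_continuous_image continuous_on_subset[OF continuous_on_eval_fps]) auto
  then obtain C where C: "C > 0" "\<forall>y\<in>eval_fps P ` cball 0 s. norm y \<le> C"
    using compact_imp_bounded bounded_pos by metis
  show ?thesis by (rule that[OF C(1)], rule fps_coeff_bound[OF assms]) (use C in auto)
qed

lemma fps_conv_radius_geI:
  fixes P :: "complex fps"
  assumes "\<And>s. 0 < s \<Longrightarrow> ereal s < R \<Longrightarrow> \<exists>C. \<forall>n. norm (P $ n) \<le> C / s ^ n"
  shows "fps_conv_radius P \<ge> R"
  unfolding fps_conv_radius_def
proof (rule conv_radius_geI_ex')
  fix r :: real assume r: "0 < r" "ereal r < R"
  then obtain s where s: "r < s" "ereal s < R" using ereal_dense2 less_ereal.simps(1) by blast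
  obtain C where C: "\<And>n. norm (P $ n) \<le> C / s ^ n" using assms[of s] r s by auto
  show "summable (\<lambda>n. P $ n * of_real r ^ n)"
  proof (rule summable_comparison_test')
    show "summable (\<lambda>n. C * (r / s) ^ n)" using r s by (intro summable_mult summable_geometric) auto
    show "norm (P $ n * of_real r ^ n) \<le> C * (r / s) ^ n" if "n \<ge> 0" for n
      using mult_right_mono[OF C[of n], of "r ^ n"] r by (simp add: norm_mult norm_power power_divide)
  qed
qed

text \<open>Everything is dominated by C \<Lambda>^k (|z|/s)^n, so Tannery's theorem exchanges the
  sum over k with the sum over powers. This serves for the Taylor series at 0 and again for those at
  \<omega>.\<close>

lemma fps_suminf_of_geometric:
  fixes P :: "nat \<Rightarrow> complex fps"
  assumes bnd: "\<And>k n. norm (P k $ n) \<le> C * \<Lambda> ^ k / s ^ n" and "0 < \<Lambda>" "\<Lambda> < 1" "0 < s"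
  defines "S \<equiv> Abs_fps (\<lambda>n. \<Sum>k. P k $ n)"
  shows "fps_conv_radius S \<ge> s" "norm z < s \<Longrightarrow> (\<lambda>k. eval_fps (P k) z) sums eval_fps S z"
    "(\<lambda>k. P k $ n) sums (S $ n)"
proof -
  have sm: "summable (\<lambda>k. C * \<Lambda> ^ k / s ^ n)" for n
    using assms by (intro summable_mult summable_divide summable_geometric) auto
  have sn: "summable (\<lambda>k. norm (P k $ n))" for n
    by (rule summable_comparison_test'[OF sm[of n]]) (use bnd in auto)
  have Ss: "(\<lambda>k. P k $ n) sums (S $ n)" for n 
    using summable_norm_cancel[OF sn] by (simp add: S_def summable_sums)
  thus "(\<lambda>k. P k $ n) sums (S $ n)" .
  have C0: "C \<ge> 0" using order_trans[OF norm_ge_zero bnd[of 0 0]] by simp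
  have Sb: "norm (S $ n) \<le> (C / (1 - \<Lambda>)) / s ^ n" for n
  proof -
    have "norm (S $ n) \<le> (\<Sum>k. norm (P k $ n))" unfolding S_def using sn by (simp add: summable_norm)
    also have "\<dots> \<le> (\<Sum>k. C * \<Lambda> ^ k / s ^ n)" by (rule suminf_le[OF bnd sn sm])
    also have "\<dots> = (C / (1 - \<Lambda>)) / s ^ n" 
      using assms by (subst suminf_divide) (auto simp: suminf_mult suminf_geometric intro!: summable_mult summable_geometric)
    finally show ?thesis .
  qed
  show rad: "fps_conv_radius S \<ge> s"
  proof (rule fps_conv_radius_geI)
    fix t :: real assume t: "0 < t" "ereal t < ereal s"
    have "C / (1 - \<Lambda>) / s ^ n \<le> C / (1 - \<Lambda>) / t ^ n" for n
      using t C0 assms by (intro divide_left_mono power_mono mult_pos_pos) auto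
    thus "\<exists>C. \<forall>n. norm (S $ n) \<le> C / t ^ n" using Sb order_trans by blast
  qed
  assume z: "norm z < s"
  define q where "q = norm z / s"
  have q: "0 \<le> q" "q < 1" using z assms by (auto simp: q_def)
  have Pz: "norm (P k $ n * z ^ n) \<le> C * \<Lambda> ^ k * q ^ n" for k n
    using mult_right_mono[OF bnd[of k n], of "norm z ^ n"] by (simp add: norm_mult norm_power q_def power_divide)
  have "((\<lambda>K. \<Sum>n. (\<Sum>k<K. P k $ n) * z ^ n) \<longlonglongrightarrow> (\<Sum>n. S $ n * z ^ n))"
  proof (rule conjunct2[OF conjunct2[OF tannerys_theorem]])
    show "(\<lambda>K. (\<Sum>k<K. P k $ n) * z ^ n) \<longlonglongrightarrow> S $ n * z ^ n" for n
      using Ss[of n] unfolding sums_def by (intro tendsto_mult_right)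
    have "norm ((\<Sum>k<K. P k $ n) * z ^ n) \<le> C / (1 - \<Lambda>) * q ^ n" for n K
    proof -
      have "norm ((\<Sum>k<K. P k $ n) * z ^ n) \<le> (\<Sum>k<K. C * \<Lambda> ^ k * q ^ n)"
        unfolding sum_distrib_right by (rule order_trans[OF norm_sum]) (intro sum_mono Pz)
      also have "\<dots> = C * q ^ n * (\<Sum>k<K. \<Lambda> ^ k)" by (simp add: sum_distrib_left mult_ac)
      also have "\<dots> \<le> C * q ^ n * (\<Sum>k. \<Lambda> ^ k)" using assms q C0
        by (intro mult_left_mono sum_le_suminf summable_geometric) auto
      finally show ?thesis using assms by (simp add: suminf_geometric mult_ac)
    qed
    thus "eventually (\<lambda>(n, K). norm ((\<Sum>k<K. P k $ n) * z ^ n) \<le> C / (1 - \<Lambda>) * q ^ n) (at_top \<times>\<^sub>F sequentially)"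
      by (intro always_eventually) auto
    show "summable (\<lambda>n. C / (1 - \<Lambda>) * q ^ n)" using q by (intro summable_mult summable_geometric) auto
  qed auto
  moreover have "(\<Sum>n. (\<Sum>k<K. P k $ n) * z ^ n) = (\<Sum>k<K. eval_fps (P k) z)" for K
  proof -
    have "summable (\<lambda>n. P k $ n * z ^ n)" for k
      by (rule summable_comparison_test'[OF _ Pz[of k]]) (use q in \<open>auto intro!: summable_mult summable_geometric\<close>)
    thus ?thesis unfolding eval_fps_def sum_distrib_right by (subst suminf_sum) auto
  qed
  ultimately show "(\<lambda>k. eval_fps (P k) z) sums eval_fps S z" by (simp add: sums_def eval_fps_def)
qed

text \<open>One pair \<open>R\<close>, \<open>C\<close> serves all powers \<open>l\<close>: since b
  vanishes at 0, the disc is shrunk until |b| < 1 on it, and then h b^l is bounded there by a bound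
  of h.\<close>

lemma mult_power_coeff_bound:
  fixes h b :: "complex fps"
  assumes "fps_conv_radius h > 0" "fps_conv_radius b > 0" "b $ 0 = 0"
  obtains R C where "R \<ge> 1" "C > 0" "\<And>l m. norm ((h * b ^ l) $ m) \<le> C * R ^ m"
proof -
  have "0 < min (fps_conv_radius h) (fps_conv_radius b)" using assms by simp
  then obtain s0 where s0: "0 < s0" "ereal s0 < min (fps_conv_radius h) (fps_conv_radius b)"
    using ereal_dense2 ereal_less(2) by (metis zero_ereal_def less_ereal.simps(1))
  have "isCont (eval_fps b) 0" using assms by (intro continuous_eval_fps) (auto simp: zero_ereal_def)
  hence "(eval_fps b \<longlongrightarrow> 0) (nhds 0)"
    using tendsto_at_iff_tendsto_nhds[of "eval_fps b" 0] assms(3) by (simp add: isCont_def eval_fps_at_0)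
  hence "\<forall>\<^sub>F w in nhds 0. norm (eval_fps b w) < 1"
    by (intro order_tendstoD(2)[OF tendsto_norm]) auto
  then obtain d where d: "d > 0" "\<And>w. norm w < d \<Longrightarrow> norm (eval_fps b w) < 1"
    unfolding eventually_nhds_metric by (auto simp: dist_norm)
  \<comment> \<open>\<open>d / 2\<close> keeps the closed disc where |b| < 1, and the cap 1 makes R
    = 1/s at least 1.\<close>
  define s where "s = min (min s0 (d / 2)) 1"
  have s: "0 < s" "s \<le> 1" "s < d" "ereal s < fps_conv_radius h" "ereal s < fps_conv_radius b"
    using s0 d(1) by (auto simp: s_def min_less_iff_disj elim!: order.strict_trans1[rotated])
  have "compact (eval_fps h ` cball 0 s)"
    by (intro compact_continuous_image continuous_on_subset[OF continuous_on_eval_fps] eball_cball_subset s) auto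
  then obtain C where C: "C > 0" "\<forall>y\<in>eval_fps h ` cball 0 s. norm y \<le> C"
    using compact_imp_bounded bounded_pos by metis
  show ?thesis
  proof (rule that)
    show "1 / s \<ge> 1" using s by simp
    fix l m
    have rad: "ereal s < fps_conv_radius (b ^ l)" using s fps_conv_radius_power[of b l] by (meson less_le_trans)
    hence rad2: "ereal s < fps_conv_radius (h * b ^ l)" 
      using s fps_conv_radius_mult[of h "b ^ l"] by (meson less_le_trans min_less_iff_conj)
    have "norm ((h * b ^ l) $ m) \<le> C / s ^ m"
    proof (rule fps_coeff_bound[OF s(1) rad2])
      fix w :: complex assume w: "norm w = s"
      have "norm (eval_fps (h * b ^ l) w) = norm (eval_fps h w) * norm (eval_fps b w) ^ l"
        using w s rad by (subst eval_fps_mult) (auto simp: eval_fps_power norm_mult norm_power)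
      also have "\<dots> \<le> C * 1" using w s C d(2)[of w]
        by (intro mult_mono power_le_one) auto
      finally show "norm (eval_fps (h * b ^ l) w) \<le> C" by simp
    qed
    thus "norm ((h * b ^ l) $ m) \<le> C * (1 / s) ^ m" by (simp add: power_divide)
  qed (use C in auto)
qed

text \<open>The first factor has real part at least n + 1, and the i-th one after it at least i. The
  extra n + 1 is the origin of the 1/(n+1) in the columns of the matrix.\<close>

lemma norm_pochhammer_ge:
  assumes "Re \<beta> \<ge> 0"
  shows "norm (pochhammer (of_nat n + \<beta> + 1) (Suc m)) \<ge> (real n + 1) * fact m"
proof (induction m)
  case 0
  have "real n + 1 \<le> Re (of_nat n + \<beta> + 1)" using assms by simp
  also have "\<dots> \<le> norm (of_nat n + \<beta> + 1)" by (rule complex_Re_le_cmod)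
  finally show ?case by simp
next
  case (Suc m)
  have "real (Suc m) \<le> Re (of_nat n + \<beta> + 1 + of_nat (Suc m))" using assms by simp
  also have "\<dots> \<le> norm (of_nat n + \<beta> + 1 + of_nat (Suc m))" by (rule complex_Re_le_cmod)
  finally have "(real n + 1) * fact m * real (Suc m) \<le> norm (pochhammer (of_nat n + \<beta> + 1) (Suc m)) * norm (of_nat n + \<beta> + 1 + of_nat (Suc m))"
    using Suc by (intro mult_mono) auto
  thus ?case unfolding pochhammer_Suc[of _ "Suc m"] norm_mult by (simp add: mult_ac)
qed

lemma power_div_fact_le_exp: "(x::real) \<ge> 0 \<Longrightarrow> x ^ k / fact k \<le> exp x"
proof -
  assume x: "x \<ge> 0"
  have "(\<Sum>j\<in>{k}. x ^ j / fact j) \<le> (\<Sum>j. x ^ j / fact j)"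
    using summable_exp[of x] x by (intro sum_le_suminf) (auto simp: field_simps)
  thus ?thesis by (simp add: exp_def field_simps)
qed

lemma sum_power_div_fact_le_exp: "(x::real) \<ge> 0 \<Longrightarrow> finite I \<Longrightarrow> (\<Sum>l\<in>I. x ^ l / fact l) \<le> exp x"
proof -
  assume x: "x \<ge> 0" "finite I"
  have "(\<Sum>j\<in>I. x ^ j / fact j) \<le> (\<Sum>j. x ^ j / fact j)"
    using summable_exp[of x] x by (intro sum_le_suminf) (auto simp: field_simps)
  thus ?thesis by (simp add: exp_def field_simps)
qed

text \<open>The entries decay faster than any geometric sequence, since by the binomial theorem the
  inner sum is at most a constant times (1+R)^k/k!. Hence \<open>t\<close> is free and can be taken
  beyond the rate available for \<open>bern\<close>.\<close>

lemma Bmat_bound: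
  assumes "Re \<beta> \<ge> 0" "fps_conv_radius h > 0" "fps_conv_radius b > 0" "b $ 0 = 0" "t > 0"
  obtains D where "D > 0" "\<And>N n. n < N \<Longrightarrow> norm (Bmat h b \<beta> N n) \<le> D / t ^ (N - n) / (real n + 1)"
proof -
  obtain R C where RC: "R \<ge> 1" "C > 0" "\<And>l m. norm ((h * b ^ l) $ m) \<le> C * R ^ m"
    using mult_power_coeff_bound[OF assms(2-4)] by blast
  define D where "D = C * R * t * exp ((1 + R) * t)"
  show ?thesis
  proof (rule that)
    show "D > 0" using RC assms by (auto simp: D_def)
    fix N n :: nat assume n: "n < N"
    then obtain k where k: "N - n = Suc k" by (metis Suc_diff_Suc)
    have "norm (Bmat h b \<beta> N n) \<le> (\<Sum>l\<le>k. C * R / (real n + 1) * (1 / fact l * (R ^ (k - l) / fact (k - l))))"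
      unfolding Bmat_def k lessThan_Suc_atMost
    proof (rule order_trans[OF norm_sum], rule sum_mono)
      fix l assume "l \<in> {..k}"
      hence l: "Suc k - l = Suc (k - l)" by auto
      have "(real n + 1) * fact (k - l) \<le> (real (n + l) + 1) * fact (k - l)" by simp
      also have "\<dots> \<le> norm (pochhammer (of_nat (n + l) + \<beta> + 1) (Suc (k - l)))"
        by (rule norm_pochhammer_ge[OF assms(1)])
      finally have p: "(real n + 1) * fact (k - l) \<le> norm (pochhammer (of_nat (n + l) + \<beta> + 1) (Suc (k - l)))" .
      have "norm ((- 1) ^ l / fact l * (h * b ^ l) $ (Suc k - l) / pochhammer (of_nat (n + l) + \<beta> + 1) (Suc k - l))
         = 1 / fact l * norm ((h * b ^ l) $ Suc (k - l)) / norm (pochhammer (of_nat (n + l) + \<beta> + 1) (Suc (k - l)))"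
        by (simp add: l norm_mult norm_divide norm_power)
      also have "\<dots> \<le> 1 / fact l * (C * R ^ Suc (k - l)) / ((real n + 1) * fact (k - l))"
        using RC(1,2) RC(3)[of l "Suc (k - l)"] p by (intro frac_le mult_left_mono) auto
      also have "\<dots> = C * R / (real n + 1) * (1 / fact l * (R ^ (k - l) / fact (k - l)))" by (simp add: mult_ac)
      finally show "norm ((- 1) ^ l / fact l * (h * b ^ l) $ (Suc k - l) / pochhammer (of_nat (n + l) + \<beta> + 1) (Suc k - l)) 
         \<le> C * R / (real n + 1) * (1 / fact l * (R ^ (k - l) / fact (k - l)))" .
    qed
    also have "\<dots> = C * R / (real n + 1) * ((1 + R) ^ k / fact k)"
      using exp_series_add_commuting[of "1::real" R k] by (simp add: sum_distrib_left divide_inverse mult_ac)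
    also have "(1 + R) ^ k / fact k \<le> exp ((1 + R) * t) / t ^ k"
    proof -
      have "((1 + R) * t) ^ k / fact k \<le> exp ((1 + R) * t)" by (rule power_div_fact_le_exp) (use RC assms in auto)
      hence "(1 + R) ^ k / fact k * t ^ k \<le> exp ((1 + R) * t)" unfolding power_mult_distrib by simp
      thus ?thesis using assms(5) by (subst pos_le_divide_eq) auto
    qed
    hence "C * R / (real n + 1) * ((1 + R) ^ k / fact k) \<le> C * R / (real n + 1) * (exp ((1 + R) * t) / t ^ k)"
      using RC by (intro mult_left_mono) auto
    also have "\<dots> = D / t ^ (N - n) / (real n + 1)" unfolding k D_def using assms(5) by (simp add: field_simps)
    finally show "norm (Bmat h b \<beta> N n) \<le> D / t ^ (N - n) / (real n + 1)" .
  qed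
qed

lemma eval_expm1_quot: "w \<noteq> 0 \<Longrightarrow> eval_fps expm1_quot w = (exp w - 1) / w"
  "fps_conv_radius expm1_quot = \<infinity>"
proof -
  have "fps_conv_radius (fps_exp 1 - 1 :: complex fps) \<ge> min \<infinity> \<infinity>"
    by (rule order_trans[OF _ fps_conv_radius_diff]) simp
  hence r: "fps_conv_radius (fps_exp 1 - 1 :: complex fps) = \<infinity>" by simp
  thus "fps_conv_radius expm1_quot = \<infinity>" by (simp add: expm1_quot_def)
  assume "w \<noteq> 0"
  have "eval_fps (fps_exp 1 - 1) w = w * eval_fps expm1_quot w"
    unfolding exp_minus_one_eq
    by (subst eval_fps_mult) (simp_all add: \<open>fps_conv_radius expm1_quot = \<infinity>\<close>)
  moreover have "eval_fps (fps_exp 1 - 1) w = exp w - 1" by (subst eval_fps_diff) auto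
  ultimately show "eval_fps expm1_quot w = (exp w - 1) / w" using \<open>w \<noteq> 0\<close> by (simp add: field_simps)
qed

lemma exp_eq_1_near_0: "norm w < 2 * pi \<Longrightarrow> exp w = 1 \<Longrightarrow> w = (0::complex)"
proof -
  assume w: "norm w < 2 * pi" "exp w = 1"
  then obtain n where n: "Re w = 0" "Im w = of_int (2 * n) * pi" unfolding exp_eq_1 by blast
  have "\<bar>Im w\<bar> < 2 * pi" using abs_Im_le_cmod[of w] w by simp
  hence "\<bar>of_int n * (2 * pi)\<bar> < 1 * (2 * pi)" using n by (simp add: mult_ac)
  hence "\<bar>real_of_int n\<bar> < 1" unfolding abs_mult by simp
  hence "n = 0" by linarith
  thus "w = 0" using n by (simp add: complex_eq_iff)
qed

lemma bern_conv_radius: "fps_conv_radius bern \<ge> ereal (2 * pi)"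
proof (rule holomorphic_on_imp_fps_conv_radius_ge)
  show "(\<lambda>w. inverse (eval_fps expm1_quot w)) has_fps_expansion bern"
    unfolding bern_def by (rule has_fps_expansion_inverse) (auto simp: eval_fps_has_fps_expansion eval_expm1_quot)
  have "eval_fps expm1_quot w \<noteq> 0" if "norm w < 2 * pi" for w
    using that exp_eq_1_near_0[OF that] by (cases "w = 0") (auto simp: eval_expm1_quot eval_fps_at_0)
  thus "(\<lambda>w. inverse (eval_fps expm1_quot w)) holomorphic_on eball 0 (ereal (2 * pi))"
    by (intro holomorphic_intros) (auto simp: eval_expm1_quot)
qed

lemma bern_bound:
  assumes "0 < s" "s < 2 * pi"
  obtains C where "C > 0" "\<And>n. norm (bern $ n) \<le> C / s ^ n"
proof -
  have "ereal s < fps_conv_radius bern" using bern_conv_radius assms(2) by (meson ereal_less(2) less_ereal.simps(1) less_le_trans)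
  thus ?thesis using fps_coeff_bound_ex[OF assms(1)] that by blast
qed

lemma EBmat_bound:
  assumes "Re \<beta> \<ge> 0" "fps_conv_radius h > 0" "fps_conv_radius b > 0" "b $ 0 = 0" "0 < s" "s < 2 * pi"
  obtains D where "D > 0" "\<And>N n. n \<le> N \<Longrightarrow> norm (EBmat h b \<beta> N n) \<le> D / s ^ (N - n) / (real n + 1)"
proof -
  obtain C where C: "C > 0" "\<And>n. norm (bern $ n) \<le> C / s ^ n" using bern_bound[OF assms(5,6)] by blast
  \<comment> \<open>The rate 2s for \<open>Bmat\<close> against s for \<open>bern\<close> turns the
    convolution into a geometric sum of ratio 1/2.\<close>
  have "2 * s > 0" using assms by simp
  then obtain D where D: "D > 0" "\<And>N n. n < N \<Longrightarrow> norm (Bmat h b \<beta> N n) \<le> D / (2 * s) ^ (N - n) / (real n + 1)"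
    using Bmat_bound[OF assms(1-4), of "2 * s"] by metis
  show ?thesis
  proof (rule that)
    show "C * D / s > 0" using C D assms by simp
    fix N n :: nat assume n: "n \<le> N"
    define j where "j = N - n"
    have "norm (EBmat h b \<beta> N n) \<le> (\<Sum>i\<le>j. C * D / (real n + 1) / s ^ Suc j * (1/2) ^ (Suc j - i))"
      unfolding EBmat_def j_def[symmetric]
    proof (rule order_trans[OF norm_sum], rule sum_mono)
      fix i assume "i \<in> {..j}"
      hence i: "i \<le> j" "n < N + 1 - i" "N + 1 - i - n = Suc j - i" using n by (auto simp: j_def)
      have "norm (bern $ i * Bmat h b \<beta> (N + 1 - i) n) \<le> (C / s ^ i) * (D / (2 * s) ^ (Suc j - i) / (real n + 1))"
        unfolding norm_mult using C(2)[of i] D(2)[OF i(2)] C(1) assms(5) i by (intro mult_mono) auto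
      also have "\<dots> = C * D / (real n + 1) / (s ^ i * s ^ (Suc j - i)) * (1/2) ^ (Suc j - i)" 
        by (simp add: power_mult_distrib power_divide field_simps)
      also have "s ^ i * s ^ (Suc j - i) = s ^ Suc j" using i by (simp add: power_add[symmetric])
      finally show "norm (bern $ i * Bmat h b \<beta> (N + 1 - i) n) \<le> C * D / (real n + 1) / s ^ Suc j * (1/2) ^ (Suc j - i)" .
    qed
    also have "\<dots> = C * D / (real n + 1) / s ^ Suc j * (\<Sum>i\<le>j. (1/2) ^ (Suc j - i))" by (simp add: sum_distrib_left)
    also have "(\<Sum>i\<le>j. (1/2) ^ (Suc j - i)) = (\<Sum>i\<le>j. (1/2::real) ^ Suc i)"
      by (rule sum.reindex_bij_witness[of _ "\<lambda>i. j - i" "\<lambda>i. j - i"]) (auto simp: Suc_diff_le)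
    also have "\<dots> \<le> 1"
    proof -
      have "(\<Sum>i\<le>j. (1/2::real) ^ Suc i) \<le> (\<Sum>i. (1/2::real) ^ Suc i)"
        by (intro sum_le_suminf) (auto simp: summable_Suc_iff intro!: summable_mult summable_geometric)
      thus ?thesis using power_half_series by (simp add: sums_iff)
    qed
    hence "C * D / (real n + 1) / s ^ Suc j * (\<Sum>i\<le>j. (1/2) ^ Suc i) \<le> C * D / (real n + 1) / s ^ Suc j * 1"
      using C D assms by (intro mult_left_mono) auto
    also have "\<dots> = C * D / s / s ^ (N - n) / (real n + 1)" by (simp add: j_def)
    finally show "norm (EBmat h b \<beta> N n) \<le> C * D / s / s ^ (N - n) / (real n + 1)" .
  qed
qed

text \<open>The diagonal is at most \<kappa> < 1, and the rest is made small by the weight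
  \<open>w n = Q ^ min n n0\<close>. For n < n0 an entry below the diagonal gains a factor 1/Q from
  the weights; for n \<ge> n0 the column factor 1/(n+1) is already at most 1/Q. The weight is
  bounded, so it disappears into the final constant.\<close>

lemma triangular_iterates_geometric:
  fixes M :: "nat \<Rightarrow> nat \<Rightarrow> complex" and p :: "nat \<Rightarrow> nat \<Rightarrow> complex"
  assumes M: "\<And>N n. n \<le> N \<Longrightarrow> norm (M N n) \<le> D / s' ^ (N - n) / (real n + 1)"
    and diag: "\<And>N. norm (M N N) \<le> \<kappa>" "\<kappa> < 1"
    and s: "0 < s" "s < s'" "D > 0"
    and p0: "\<And>n. norm (p 0 n) \<le> C0 / s ^ n"
    and rec: "\<And>k N. p (Suc k) N = (\<Sum>n\<le>N. M N n * p k n)"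
  obtains C \<Lambda> where "C > 0" "0 < \<Lambda>" "\<Lambda> < 1" "\<And>k n. norm (p k n) \<le> C * \<Lambda> ^ k / s ^ n"
proof -
  define q where "q = s / s'"
  have q: "0 < q" "q < 1" using s by (auto simp: q_def)
  \<comment> \<open>Half of the gap to 1: the weighted rows will sum to at most \<kappa> + \<delta>
    = (1+\<kappa>)/2, which is the \<Lambda> obtained.\<close>
  define \<delta> where "\<delta> = (1 - \<kappa>) / 2"
  have \<kappa>0: "\<kappa> \<ge> 0" using order_trans[OF norm_ge_zero diag(1)] .
  have \<delta>: "\<delta> > 0" "\<kappa> + \<delta> < 1" using diag(2) by (auto simp: \<delta>_def field_simps)
  \<comment> \<open>Chosen so that D/Q \<le> \<delta> (1 - q), where 1 - q compensates the geometric
    sum over a row.\<close>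
  define Q where "Q = max 1 (D / (\<delta> * (1 - q)))"
  obtain n0 :: nat where n0: "real n0 \<ge> Q" using real_arch_simple by blast
  have Q: "Q \<ge> 1" "D \<le> \<delta> * (1 - q) * Q" using \<delta> q by (auto simp: Q_def field_simps max_def)
  define w where "w n = Q ^ min n n0" for n
  have w1: "w n \<ge> 1" for n using Q by (simp add: w_def)
  define a where "a k n = norm (p k n) * s ^ n" for k n
  define m where "m N n = norm (M N n) * s ^ (N - n)" for N n
  have mb: "m N n \<le> D * q ^ (N - n) / (real n + 1)" if "n \<le> N" for N n
    using mult_right_mono[OF M[OF that], of "s ^ (N - n)"] s by (simp add: m_def q_def power_divide mult_ac)
  have mw: "m N n * w n \<le> \<delta> * (1 - q) * q ^ (N - n) * w N" if "n < N" for N n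
  proof (cases "n < n0")
    case True
    have "Q * w n \<le> w N" unfolding w_def power_Suc[symmetric] using Q that True by (intro power_increasing) auto
    hence *: "D * w n \<le> \<delta> * (1 - q) * w N" 
    proof -
      have "D * w n \<le> \<delta> * (1 - q) * Q * w n" using Q(2) w1[of n] by (intro mult_right_mono) auto
      also have "\<dots> = \<delta> * (1 - q) * (Q * w n)" by simp
      also have "\<dots> \<le> \<delta> * (1 - q) * w N" using \<open>Q * w n \<le> w N\<close> \<delta> q by (intro mult_left_mono) auto
      finally show ?thesis .
    qed
    have "m N n \<le> D * q ^ (N - n) / 1"  
    proof (rule order_trans[OF mb])
      show "D * q ^ (N - n) / (real n + 1) \<le> D * q ^ (N - n) / 1" using s q by (intro divide_left_mono) auto
    qed (use that in simp)
    hence "m N n * w n \<le> q ^ (N - n) * (D * w n)" using w1[of n] mult_right_mono[of "m N n" "D * q ^ (N - n)" "w n"] by (simp add: mult_ac)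
    also have "\<dots> \<le> q ^ (N - n) * (\<delta> * (1 - q) * w N)" using * q by (intro mult_left_mono) auto
    finally show ?thesis by (simp add: mult_ac)
  next
    case False
    have "Q \<le> real n + 1" using False n0 by linarith
    hence "\<delta> * (1 - q) * Q \<le> \<delta> * (1 - q) * (real n + 1)" using \<delta> q by (intro mult_left_mono) auto
    hence "D \<le> \<delta> * (1 - q) * (real n + 1)" using Q by linarith
    hence "D / (real n + 1) \<le> \<delta> * (1 - q)" by (simp add: field_simps)
    hence "D / (real n + 1) * q ^ (N - n) \<le> \<delta> * (1 - q) * q ^ (N - n)" using q by (intro mult_right_mono) auto
    hence "m N n \<le> \<delta> * (1 - q) * q ^ (N - n)" using mb[of n N] that by simp
    moreover have "w n \<le> w N" unfolding w_def using Q that by (intro power_increasing) auto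
    ultimately show ?thesis using \<delta> q w1[of n] by (intro mult_mono) (auto simp: m_def)
  qed
  have row: "(\<Sum>n\<le>N. m N n * w n) \<le> (\<kappa> + \<delta>) * w N" for N
  proof -
    have "(\<Sum>n<N. m N n * w n) \<le> (\<Sum>n<N. \<delta> * (1 - q) * q ^ (N - n) * w N)" by (intro sum_mono mw) auto
    also have "\<dots> = \<delta> * w N * ((1 - q) * (\<Sum>n<N. q ^ (N - n)))" by (simp add: sum_distrib_left mult_ac)
    also have "(\<Sum>n<N. q ^ (N - n)) = (\<Sum>i<N. q ^ Suc i)"
      by (rule sum.reindex_bij_witness[of _ "\<lambda>i. N - Suc i" "\<lambda>n. N - Suc n"]) (auto simp: Suc_diff_Suc simp flip: power_Suc)
    also have "(1 - q) * (\<Sum>i<N. q ^ Suc i) = q * (1 - q ^ N)"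
      using q sum_gp_strict[of q N] by (simp add: sum_distrib_left[symmetric])
    also have "\<delta> * w N * (q * (1 - q ^ N)) \<le> \<delta> * w N * 1"
    proof (intro mult_left_mono)
      have "q * (1 - q ^ N) \<le> 1 * 1" using q by (intro mult_mono) (auto simp: power_le_one)
      thus "q * (1 - q ^ N) \<le> 1" by simp
    qed (use \<delta> w1[of N] in auto)
    finally have "(\<Sum>n<N. m N n * w n) \<le> \<delta> * w N" by simp
    moreover have "m N N * w N \<le> \<kappa> * w N" using diag(1)[of N] w1[of N] by (intro mult_right_mono) (auto simp: m_def)
    ultimately show ?thesis by (simp add: lessThan_Suc_atMost[symmetric] distrib_right)
  qed
  have C0: "C0 \<ge> 0" using order_trans[OF norm_ge_zero p0[of 0]] by simp
  have ab: "a k n \<le> C0 * (\<kappa> + \<delta>) ^ k * w n" for k n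
  proof (induction k arbitrary: n)
    case 0
    have "a 0 n \<le> C0" using p0[of n] s by (simp add: a_def field_simps)
    thus ?case using w1[of n] C0 by (simp add: mult_le_cancel_left1 order_trans)
  next
    case (Suc k)
    have "a (Suc k) n \<le> (\<Sum>i\<le>n. norm (M n i * p k i)) * s ^ n"
      unfolding a_def rec using s by (intro mult_right_mono norm_sum) auto
    also have "\<dots> = (\<Sum>i\<le>n. m n i * a k i)"
      unfolding sum_distrib_right
      by (intro sum.cong refl) (auto simp: m_def a_def norm_mult mult_ac power_add[symmetric])
    also have "\<dots> \<le> (\<Sum>i\<le>n. m n i * (C0 * (\<kappa> + \<delta>) ^ k * w i))"
      using s by (intro sum_mono mult_left_mono Suc.IH) (auto simp: m_def)
    also have "\<dots> = C0 * (\<kappa> + \<delta>) ^ k * (\<Sum>i\<le>n. m n i * w i)" by (simp add: sum_distrib_left mult_ac)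
    also have "\<dots> \<le> C0 * (\<kappa> + \<delta>) ^ k * ((\<kappa> + \<delta>) * w n)" using C0 \<kappa>0 \<delta> by (intro mult_left_mono row) auto
    finally show ?case by (simp add: mult_ac)
  qed
  define C where "C = C0 * Q ^ n0 + 1"
  show ?thesis
  proof (rule that)
    show "C > 0" using C0 Q by (auto simp: C_def intro!: add_nonneg_pos)
    show "0 < \<kappa> + \<delta>" "\<kappa> + \<delta> < 1" using \<delta> \<kappa>0 by auto
    fix k n
    have "w n \<le> Q ^ n0" unfolding w_def using Q by (intro power_increasing) auto
    hence "C0 * (\<kappa> + \<delta>) ^ k * w n \<le> C0 * (\<kappa> + \<delta>) ^ k * Q ^ n0" using C0 \<kappa>0 \<delta> by (intro mult_left_mono) auto
    also have "\<dots> \<le> C * (\<kappa> + \<delta>) ^ k" using \<kappa>0 \<delta> by (simp add: C_def algebra_simps)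
    finally show "norm (p k n) \<le> C * (\<kappa> + \<delta>) ^ k / s ^ n" using ab[of k n] s by (simp add: a_def field_simps)
  qed
qed

subsection \<open>The integral kernel\<close>

text \<open>C_(id+b) is the sum of b^l/l! times the l-th derivative, and d/dz is multiplication by
  -\<xi> on the Borel side. So h e^(-\<xi> b) is the symbol of the twisted composition, expanded
  here in z^-1; for m \<ge> 1, z^-m becomes a convolution with \<eta>^(m-1)/(m-1)!.\<close>

definition kap :: "complex fps \<Rightarrow> complex fps \<Rightarrow> nat \<Rightarrow> complex \<Rightarrow> complex" where
  "kap h b m \<xi> = (h * (fps_exp (- \<xi>) oo b)) $ m"

text \<open>If \<open>\<phi>\<close> is the Borel transform of a twisted series \<open>P\<close>, that of \<open>tw_op h b \<beta> P\<close> is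
  \<open>\<integral>\<^sub>0\<^sup>\<zeta> kerK h b \<xi> (\<zeta> - \<xi>) \<phi>(\<xi>) d\<xi>\<close>.\<close>

definition kerK :: "complex fps \<Rightarrow> complex fps \<Rightarrow> complex \<Rightarrow> complex \<Rightarrow> complex" where
  "kerK h b \<xi> \<eta> = (\<Sum>m. kap h b (Suc m) \<xi> * \<eta> ^ m / fact m)"

definition pow_fps :: "complex \<Rightarrow> complex fps \<Rightarrow> complex \<Rightarrow> complex" where
  "pow_fps \<beta> p z = exp (\<beta> * Ln z) * eval_fps p z"

lemma borel_germ_eq: "z \<noteq> 0 \<Longrightarrow> borel_germ \<beta> P z = pow_fps \<beta> (borel_fps \<beta> P) z"
  by (simp add: borel_germ_def borel_fun_def pow_fps_def)

text \<open>Moving \<xi> by \<omega> multiplies the symbol by e^(-\<omega> b), so the translated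
  kernel belongs to another operator of the same form.\<close>

lemma kerK_shift:
  assumes "b $ 0 = 0"
  shows "kerK h b (\<omega> + \<xi>) \<eta> = kerK (h * (fps_exp (- \<omega>) oo b)) b \<xi> \<eta>"
proof -
  have "fps_exp (- \<omega> + - \<xi>) oo b = (fps_exp (- \<omega>) oo b) * (fps_exp (- \<xi>) oo b)"
    by (rule fps_exp_compose_add_exponent[OF assms])
  thus ?thesis by (simp add: kerK_def kap_def mult.assoc)
qed

lemma kap_eq_sum:
  assumes "b $ 0 = 0"
  shows "kap h b m \<xi> = (\<Sum>l\<le>m. (- \<xi>) ^ l / fact l * (h * b ^ l) $ m)"
  unfolding kap_def by (subst fps_mult_compose_nth[OF assms]) simp

lemma kerK_00: "b $ 0 = 0 \<Longrightarrow> kerK h b 0 0 = h $ 1"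
proof -
  assume b: "b $ 0 = 0"
  have "kerK h b 0 0 = (\<Sum>m\<in>{0}. kap h b (Suc m) 0 * 0 ^ m / fact m)"
    unfolding kerK_def by (rule suminf_finite) auto
  thus ?thesis by (simp add: kap_def)
qed

locale kernel_data =
  fixes h b :: "complex fps" and R C :: real
  assumes h0: "h $ 0 = 1" and b0: "b $ 0 = 0" and R1: "R \<ge> 1" and C0: "C > 0"
    and hb_bound: "\<And>l m. norm ((h * b ^ l) $ m) \<le> C * R ^ m"
begin

lemma kap_bound: "norm (kap h b m \<xi>) \<le> C * R ^ m * exp (norm \<xi>)"
proof -
  have "norm (kap h b m \<xi>) \<le> (\<Sum>l\<le>m. norm \<xi> ^ l / fact l * (C * R ^ m))"
    unfolding kap_eq_sum[OF b0]
    by (rule order_trans[OF norm_sum], rule sum_mono) 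
       (auto simp: norm_mult norm_divide norm_power intro!: mult_left_mono divide_right_mono hb_bound)
  also have "\<dots> = C * R ^ m * (\<Sum>l\<le>m. norm \<xi> ^ l / fact l)" by (simp add: sum_distrib_left mult_ac)
  also have "\<dots> \<le> C * R ^ m * exp (norm \<xi>)" using C0 R1
    by (intro mult_left_mono sum_power_div_fact_le_exp) auto
  finally show ?thesis .
qed

lemma kerK_term_bound:
  assumes "norm \<xi> \<le> r" "norm \<eta> \<le> r"
  shows "norm (kap h b (Suc m) \<xi> * \<eta> ^ m / fact m) \<le> C * R * exp r * ((R * r) ^ m / fact m)"
proof -
  have r: "r \<ge> 0" using assms norm_ge_zero order_trans by blast
  have "norm (kap h b (Suc m) \<xi> * \<eta> ^ m / fact m) = norm (kap h b (Suc m) \<xi>) * (norm \<eta> ^ m / fact m)"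
    by (simp add: norm_mult norm_divide norm_power)
  also have "\<dots> \<le> (C * R ^ Suc m * exp r) * (r ^ m / fact m)"
  proof (rule mult_mono)
    show "norm (kap h b (Suc m) \<xi>) \<le> C * R ^ Suc m * exp r"
      using C0 R1 assms by (intro order_trans[OF kap_bound] mult_left_mono) auto
    show "norm \<eta> ^ m / fact m \<le> r ^ m / fact m" using assms by (intro divide_right_mono power_mono) auto
  qed (use C0 R1 in auto)
  also have "\<dots> = C * R * exp r * ((R * r) ^ m / fact m)" by (simp add: power_mult_distrib)
  finally show ?thesis .
qed

lemma kerK_bound_summable: "summable (\<lambda>m. C * R * exp r * ((R * r) ^ m / fact m))"
  using summable_exp[of "R * r"] by (intro summable_mult) (simp add: divide_inverse mult.commute)

lemma kerK_sums: "(\<lambda>m. kap h b (Suc m) \<xi> * \<eta> ^ m / fact m) sums kerK h b \<xi> \<eta>"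
  unfolding kerK_def
  by (rule summable_sums, rule summable_comparison_test'[OF kerK_bound_summable[of "max (norm \<xi>) (norm \<eta>)"]])
     (rule kerK_term_bound, auto)

text \<open>\<open>kap h b m\<close> is a polynomial in \<xi> of degree at most m. As a power series
  it can be multiplied with the Taylor series of a Borel transform.\<close>

definition kfps :: "nat \<Rightarrow> complex fps" where
  "kfps m = Abs_fps (\<lambda>l. (-1) ^ l / fact l * (h * b ^ l) $ m)"

lemma kfps_high: "l > m \<Longrightarrow> kfps m $ l = 0"
proof -
  assume l: "l > m"
  have "(h * b ^ l) $ m = (\<Sum>i=0..m. h $ i * (b ^ l) $ (m - i))" by (simp add: fps_mult_nth)
  also have "\<dots> = 0" using l startsby_zero_power_prefix[OF b0] by (intro sum.neutral) auto
  finally show ?thesis by (simp add: kfps_def)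
qed

lemma eval_kfps: "eval_fps (kfps m) \<xi> = kap h b m \<xi>"
proof -
  have "eval_fps (kfps m) \<xi> = (\<Sum>l\<le>m. kfps m $ l * \<xi> ^ l)"
    unfolding eval_fps_def by (rule suminf_finite) (auto simp: kfps_high)
  thus ?thesis unfolding kap_eq_sum[OF b0] by (simp add: kfps_def power_minus[of \<xi>] mult_ac)
qed

lemma kfps_radius: "fps_conv_radius (kfps m) = \<infinity>"
proof -
  have "fps_conv_radius (kfps m) \<ge> \<infinity>"
    unfolding fps_conv_radius_def
    by (rule conv_radius_geI_ex', rule summable_finite[of "{..m}"]) (auto simp: kfps_high)
  thus ?thesis by simp
qed

end

text \<open>\<open>Jpr \<beta> p j\<close> is the \<open>j\<close>-fold primitive of \<open>\<zeta>\<^sup>\<beta> p(\<zeta>)\<close> vanishing at the origin.\<close>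

definition iter_prim :: "complex \<Rightarrow> complex fps \<Rightarrow> nat \<Rightarrow> complex fps" where
  "iter_prim \<beta> p j = Abs_fps (\<lambda>n. p $ n / pochhammer (of_nat n + \<beta> + 1) j)"

definition Jpr :: "complex \<Rightarrow> complex fps \<Rightarrow> nat \<Rightarrow> complex \<Rightarrow> complex" where
  "Jpr \<beta> p j z = pow_fps (\<beta> + of_nat j) (iter_prim \<beta> p j) z"

lemma iter_prim_radius:
  assumes "Re \<beta> \<ge> 0"
  shows "fps_conv_radius (iter_prim \<beta> p j) \<ge> fps_conv_radius p"
proof (cases j)
  case 0 thus ?thesis by (simp add: iter_prim_def fps_nth_inverse)
next
  case (Suc i)
  have n1: "norm (iter_prim \<beta> p j $ n) \<le> norm (p $ n)" for n
  proof -
    have "1 * 1 \<le> (real n + 1) * fact i" by (intro mult_mono) auto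
    hence "1 \<le> norm (pochhammer (of_nat n + \<beta> + 1) j)" 
      using norm_pochhammer_ge[OF assms, of n i] by (simp add: Suc)
    hence "norm (p $ n) / norm (pochhammer (of_nat n + \<beta> + 1) j) \<le> norm (p $ n) / 1" 
      by (intro divide_left_mono) auto
    thus ?thesis by (simp add: iter_prim_def norm_divide)
  qed
  show ?thesis
  proof (rule fps_conv_radius_geI)
    fix s :: real assume s: "0 < s" "ereal s < fps_conv_radius p"
    then obtain C where "\<And>n. norm (p $ n) \<le> C / s ^ n" using fps_coeff_bound_ex by metis
    thus "\<exists>C. \<forall>n. norm (iter_prim \<beta> p j $ n) \<le> C / s ^ n" using n1 order_trans by blast
  qed
qed

lemma Jpr_deriv:
  assumes "Re \<beta> \<ge> 0" "Re z > 0" "ereal (norm z) < fps_conv_radius p"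
  shows "(Jpr \<beta> p (Suc j) has_field_derivative Jpr \<beta> p j z) (at z)"
proof -
  let ?q = "iter_prim \<beta> p (Suc j)" and ?a = "\<beta> + of_nat (Suc j)"
  have r: "ereal (norm z) < fps_conv_radius ?q" using assms(3) iter_prim_radius[OF assms(1), of p "Suc j"] by (rule less_le_trans)
  have r': "ereal (norm z) < fps_conv_radius (fps_deriv ?q)" using r fps_conv_radius_deriv[of ?q] by (rule less_le_trans)
  have z: "z \<noteq> 0" "z \<notin> \<real>\<^sub>\<le>\<^sub>0" using assms(2) by (auto simp: complex_nonpos_Reals_iff)
  have "(Jpr \<beta> p (Suc j) has_field_derivative 
     exp (?a * Ln z) * (?a * inverse z) * eval_fps ?q z + exp (?a * Ln z) * eval_fps (fps_deriv ?q) z) (at z)"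
    unfolding Jpr_def pow_fps_def using z r
    by (auto intro!: derivative_eq_intros has_field_derivative_eval_fps simp: divide_inverse)
  moreover have "exp (?a * Ln z) * (?a * inverse z) * eval_fps ?q z + exp (?a * Ln z) * eval_fps (fps_deriv ?q) z = Jpr \<beta> p j z"
  proof -
    have "iter_prim \<beta> p j = fps_const ?a * ?q + fps_X * fps_deriv ?q"
    proof (rule fps_ext)
      fix n
      have nz: "of_nat n + \<beta> + 1 + of_nat j \<noteq> 0" using Gamma_shift_nonzero(3)[OF assms(1), of "n + j"] by (simp add: algebra_simps)
      have "(fps_const ?a * ?q + fps_X * fps_deriv ?q) $ n = (of_nat n + \<beta> + 1 + of_nat j) * ?q $ n"
        by (cases n) (simp_all add: fps_X_mult_nth algebra_simps)
      also have "\<dots> = iter_prim \<beta> p j $ n" unfolding iter_prim_def fps_nth_Abs_fps pochhammer_Suc using nz by simp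
      finally show "iter_prim \<beta> p j $ n = (fps_const ?a * ?q + fps_X * fps_deriv ?q) $ n" ..
    qed
    moreover have "ereal (norm z) < fps_conv_radius (fps_const ?a * ?q)"
      using r by (rule less_le_trans) (use fps_conv_radius_mult[of "fps_const ?a" ?q] in simp)
    moreover have "ereal (norm z) < fps_conv_radius (fps_X * fps_deriv ?q)"
      using r' by (rule less_le_trans) (use fps_conv_radius_mult[of "fps_X" "fps_deriv ?q"] in simp)
    ultimately have "eval_fps (iter_prim \<beta> p j) z = ?a * eval_fps ?q z + z * eval_fps (fps_deriv ?q) z"
      using r r' by (simp add: eval_fps_add eval_fps_mult)
    moreover have "exp (?a * Ln z) = exp ((\<beta> + of_nat j) * Ln z) * z"
      using z by (simp add: algebra_simps exp_add)
    ultimately show ?thesis using z by (simp add: Jpr_def pow_fps_def field_simps)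
  qed
  ultimately show ?thesis by simp
qed

lemma norm_pow_Ln_le:
  assumes "Re \<beta> \<ge> 0" "0 < t" "t \<le> x"
  shows "norm (exp (\<beta> * Ln (of_real t))) \<le> exp (Re \<beta> * \<bar>ln x\<bar>)"
proof -
  have "ln t \<le> \<bar>ln x\<bar>" using assms by (smt (verit) ln_le_cancel_iff)
  thus ?thesis using assms by (simp add: norm_exp_eq_Re Ln_of_real mult_left_mono)
qed

lemma eval_fps_bounded:
  fixes p :: "complex fps"
  assumes "ereal x < fps_conv_radius p"
  obtains B where "B > 0" "\<And>z. norm z \<le> x \<Longrightarrow> norm (eval_fps p z) \<le> B"
proof -
  have "compact (eval_fps p ` cball 0 x)"
    using eball_cball_subset[OF assms] by (intro compact_continuous_image continuous_on_subset[OF continuous_on_eval_fps]) auto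
  then obtain B where "B > 0" "\<forall>y\<in>eval_fps p ` cball 0 x. norm y \<le> B"
    using compact_imp_bounded bounded_pos by metis
  thus ?thesis using that by auto
qed

text \<open>Cauchy's formula for repeated integration. \<open>H M\<close> collects \<open>M\<close>
  boundary terms of the integrations by parts; its derivative telescopes to a single term, which for
  M = m + 1 is the integrand.\<close>

lemma Jpr_integral:
  assumes \<beta>: "Re \<beta> \<ge> 0" and x: "x > 0" "ereal x < fps_conv_radius p"
  shows "((\<lambda>t. of_real (x - t) ^ m / fact m * Jpr \<beta> p 0 (of_real t)) has_integral Jpr \<beta> p (Suc m) (of_real x)) {0..x}"
proof -
  define H where "H M z = (\<Sum>i<M. (of_real x - z) ^ i / fact i * Jpr \<beta> p (Suc m - i) z)" for M z
  have "(H M has_field_derivative (if M = 0 then 0 else (of_real x - z) ^ (M - 1) / fact (M - 1) * Jpr \<beta> p (Suc m - M) z)) (at z)" 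
    if z: "Re z > 0" "ereal (norm z) < fps_conv_radius p" "M \<le> Suc m" for z M
    using z(3)
  proof (induction M)
    case 0 thus ?case by (simp add: H_def)
  next
    case (Suc M)
    have HS: "H (Suc M) = (\<lambda>z. H M z + (of_real x - z) ^ M / fact M * Jpr \<beta> p (Suc m - M) z)" 
      by (auto simp: H_def)
    have "Suc m - M = Suc (m - M)" using Suc by simp
    hence J: "(Jpr \<beta> p (Suc m - M) has_field_derivative Jpr \<beta> p (m - M) z) (at z)" 
      using Jpr_deriv[OF \<beta> z(1,2)] by simp
    have D: "((\<lambda>z. (of_real x - z) ^ M / fact M) has_field_derivative 
        (if M = 0 then 0 else - ((of_real x - z) ^ (M - 1) / fact (M - 1)))) (at z)"
    proof (cases M)
      case (Suc k)
      have "((\<lambda>z. (of_real x - z) ^ Suc k) has_field_derivative (of_nat (Suc k) * ((of_real x - z) ^ k * (-1)))) (at z)"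
        by (rule derivative_eq_intros refl | simp)+
      from DERIV_cdivide[OF this, of "fact (Suc k)"] show ?thesis
        by (simp add: Suc fact_Suc del: of_nat_Suc)
    qed simp
    show ?case unfolding HS
    proof (rule DERIV_cong[OF DERIV_add[OF Suc.IH DERIV_mult[OF D J]]])
      show "M \<le> Suc m" using Suc.prems by simp
      show "(if M = 0 then 0 else (of_real x - z) ^ (M - 1) / fact (M - 1) * Jpr \<beta> p (Suc m - M) z) +
        ((if M = 0 then 0 else - ((of_real x - z) ^ (M - 1) / fact (M - 1))) * Jpr \<beta> p (Suc m - M) z +
         Jpr \<beta> p (m - M) z * ((of_real x - z) ^ M / fact M)) =
        (if Suc M = 0 then 0 else (of_real x - z) ^ (Suc M - 1) / fact (Suc M - 1) * Jpr \<beta> p (Suc m - Suc M) z)"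
        by (simp add: field_simps)
    qed
  qed
  note HD = this
  \<comment> \<open>The limit at 0 is put in by hand: the primitives are written through
    \<open>Ln\<close>, so their value at 0 need not be their limit there.\<close>
  define f where "f t = (if t = 0 then 0 else H (Suc m) (of_real t))" for t
  have "((\<lambda>t. of_real (x - t) ^ m / fact m * Jpr \<beta> p 0 (of_real t)) has_integral (f x - f 0)) {0..x}"
  proof (rule fundamental_theorem_of_calculus_interior)
    have der: "(f has_vector_derivative of_real (x - t) ^ m / fact m * Jpr \<beta> p 0 (of_real t)) (at t)" 
      if "t > 0" "t \<le> x" for t
    proof -
      have "ereal (norm (of_real t :: complex)) < fps_conv_radius p" using that x(2) by (auto elim!: le_less_trans[rotated])
      hence "(H (Suc m) has_field_derivative (of_real x - of_real t) ^ m / fact m * Jpr \<beta> p 0 (of_real t)) (at (of_real t))"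
        using HD[of "of_real t" "Suc m"] that by simp
      hence "((\<lambda>t. H (Suc m) (of_real t)) has_vector_derivative of_real (x - t) ^ m / fact m * Jpr \<beta> p 0 (of_real t)) (at t)"
        using has_vector_derivative_real_field[of "H (Suc m)"] by simp
      thus ?thesis
      proof (rule has_vector_derivative_transform_within_open[of _ _ _ "{0<..}"])
        show "open {0::real<..}" by simp
      qed (use that in \<open>auto simp: f_def\<close>)
    qed
    thus "\<And>t. t \<in> {0<..<x} \<Longrightarrow> (f has_vector_derivative of_real (x - t) ^ m / fact m * Jpr \<beta> p 0 (of_real t)) (at t)" by simp
    have lim0: "(f \<longlongrightarrow> 0) (at 0 within {0..x})"
    proof -
      have J0: "((\<lambda>t. Jpr \<beta> p (Suc j) (of_real t)) \<longlongrightarrow> 0) (at 0 within {0..x})" for j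
      proof -
        have "ereal x < fps_conv_radius (iter_prim \<beta> p (Suc j))" 
          using x(2) iter_prim_radius[OF \<beta>, of p "Suc j"] by (rule less_le_trans)
        then obtain B where B: "B > 0" "\<And>z. norm z \<le> x \<Longrightarrow> norm (eval_fps (iter_prim \<beta> p (Suc j)) z) \<le> B"
          using eval_fps_bounded by blast
        have bd: "norm (Jpr \<beta> p (Suc j) (of_real t)) \<le> t * (exp (Re (\<beta> + of_nat j) * \<bar>ln x\<bar>) * B)" if "0 < t" "t \<le> x" for t
        proof -
          have "exp ((\<beta> + of_nat (Suc j)) * Ln (of_real t)) = exp ((\<beta> + of_nat j) * Ln (of_real t)) * of_real t"
            using that by (simp add: algebra_simps exp_add)
          hence "norm (Jpr \<beta> p (Suc j) (of_real t)) = norm (exp ((\<beta> + of_nat j) * Ln (of_real t))) * t * norm (eval_fps (iter_prim \<beta> p (Suc j)) (of_real t))"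
            using that unfolding Jpr_def pow_fps_def by (simp add: norm_mult)
          also have "\<dots> \<le> exp (Re (\<beta> + of_nat j) * \<bar>ln x\<bar>) * t * B"
            using that \<beta> B by (intro mult_mono norm_pow_Ln_le) auto
          finally show ?thesis by (simp add: mult_ac)
        qed
        show ?thesis
        proof (rule Lim_null_comparison)
          show "\<forall>\<^sub>F t in at 0 within {0..x}. norm (Jpr \<beta> p (Suc j) (of_real t)) \<le> t * (exp (Re (\<beta> + of_nat j) * \<bar>ln x\<bar>) * B)"
            using bd by (auto simp: eventually_at_filter)
          show "((\<lambda>t. t * (exp (Re (\<beta> + of_nat j) * \<bar>ln x\<bar>) * B)) \<longlongrightarrow> 0) (at 0 within {0..x})"
            by (rule tendsto_eq_intros refl | simp)+
        qed
      qed
      have "((\<lambda>t. H (Suc m) (of_real t)) \<longlongrightarrow> (\<Sum>i<Suc m. (of_real x - of_real 0) ^ i / fact i * 0)) (at 0 within {0..x})"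
        unfolding H_def
      proof (intro tendsto_intros)
        fix i assume "i \<in> {..<Suc m}"
        hence "Suc m - i = Suc (m - i)" by auto
        thus "((\<lambda>t. Jpr \<beta> p (Suc m - i) (of_real t)) \<longlongrightarrow> 0) (at 0 within {0..x})" using J0 by simp
      qed auto
      hence "((\<lambda>t. H (Suc m) (of_real t)) \<longlongrightarrow> 0) (at 0 within {0..x})" by simp
      thus ?thesis
        by (rule Lim_transform_eventually) (auto simp: eventually_at_filter f_def)
    qed
    show "continuous_on {0..x} f"
      unfolding continuous_on_def
    proof
      fix t assume t: "t \<in> {0..x}"
      show "(f \<longlongrightarrow> f t) (at t within {0..x})"
      proof (cases "t = 0")
        case True thus ?thesis using lim0 by (simp add: f_def)
      next
        case False
        hence "isCont f t" using der[of t] t has_vector_derivative_continuous by fastforce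
        thus ?thesis by (meson isCont_def tendsto_within_subset subset_UNIV)
      qed
    qed
  qed (use x in auto)
  moreover have "f x - f 0 = Jpr \<beta> p (Suc m) (of_real x)"
  proof -
    have "H (Suc m) (of_real x) = (\<Sum>i<Suc m. if i = 0 then Jpr \<beta> p (Suc m) (of_real x) else 0)"
      unfolding H_def by (intro sum.cong) auto
    thus ?thesis using x by (simp add: f_def)
  qed
  ultimately show ?thesis by simp
qed


section \<open>Integral representation of the twisted operator on a real segment\<close>

context kernel_data
begin

text \<open>The contribution of the m-th term of the kernel to the coefficient of
  \<zeta>^(\<beta>+N): it comes from the (m+1)-fold primitive of \<open>kap h b (Suc m)\<close>
  times the Borel transform.\<close>

definition tt :: "complex \<Rightarrow> complex fps \<Rightarrow> nat \<Rightarrow> nat \<Rightarrow> complex" where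
  "tt \<beta> p m N = (if m < N then iter_prim \<beta> (kfps (Suc m) * p) (Suc m) $ (N - Suc m) else 0)"

lemma borel_tw_op_eq_sum_tt:
  assumes "Re \<beta> \<ge> 0"
  shows "borel_fps \<beta> (tw_op h b \<beta> P) $ N = (\<Sum>m<N. tt \<beta> (borel_fps \<beta> P) m N)"
proof -
  let ?p = "borel_fps \<beta> P"
  define G where "G n l = ?p $ n * ((-1) ^ l / fact l * (h * b ^ l) $ (N - n - l) / pochhammer (of_nat (n + l) + \<beta> + 1) (N - n - l))" for n l
  have "borel_fps \<beta> (tw_op h b \<beta> P) $ N = (\<Sum>n<N. \<Sum>l<N - n. G n l)"
    by (simp add: borel_fps_tw_op[OF assms h0 b0] Bmat_def G_def sum_distrib_left)
  also have "\<dots> = (\<Sum>(n,l)\<in>Sigma {..<N} (\<lambda>n. {..<N - n}). G n l)" by (rule sum.Sigma) auto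
  \<comment> \<open>The pairs (n, l) are sorted by m = N - 1 - n - l, the index of the term of the
    kernel.\<close>
  also have "\<dots> = (\<Sum>(m,l)\<in>Sigma {..<N} (\<lambda>m. {..N - Suc m}). G (N - Suc m - l) l)"
    by (rule sum.reindex_bij_witness[of _ "\<lambda>(m,l). (N - Suc m - l, l)" "\<lambda>(n,l). (N - Suc (n + l), l)"]) auto
  also have "\<dots> = (\<Sum>m<N. \<Sum>l\<le>N - Suc m. G (N - Suc m - l) l)" by (rule sum.Sigma[symmetric]) auto
  also have "\<dots> = (\<Sum>m<N. tt \<beta> ?p m N)"
  proof (rule sum.cong[OF refl])
    fix m assume "m \<in> {..<N}"
    hence m: "m < N" by simp
    have "(\<Sum>l\<le>N - Suc m. G (N - Suc m - l) l) = (\<Sum>l\<le>N - Suc m. kfps (Suc m) $ l * ?p $ (N - Suc m - l) / pochhammer (of_nat (N - Suc m) + \<beta> + 1) (Suc m))"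
    proof (rule sum.cong[OF refl])
      fix l assume "l \<in> {..N - Suc m}"
      hence "N - (N - Suc m - l) - l = Suc m" "N - Suc m - l + l = N - Suc m" using m by auto
      thus "G (N - Suc m - l) l = kfps (Suc m) $ l * ?p $ (N - Suc m - l) / pochhammer (of_nat (N - Suc m) + \<beta> + 1) (Suc m)"
        unfolding G_def kfps_def by (simp del: pochhammer_Suc)
    qed
    thus "(\<Sum>l\<le>N - Suc m. G (N - Suc m - l) l) = tt \<beta> ?p m N"
      using m by (simp add: tt_def iter_prim_def fps_mult_nth atLeast0AtMost sum_divide_distrib)
  qed
  finally show ?thesis .
qed

text \<open>The bound is a product of a function of m and one of N - 1 - m, so that summation over m
  gives a Cauchy product of summable sequences.\<close>

lemma tt_bound:
  assumes "Re \<beta> \<ge> 0" "0 < x" "ereal x < fps_conv_radius p"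
  obtains u v where "\<And>m N. m < N \<Longrightarrow> norm (tt \<beta> p m N) * x ^ N \<le> u m * v (N - Suc m)"
    "\<And>m. u m \<ge> 0" "\<And>m. v m \<ge> 0" "summable u" "summable v"
proof -
  obtain s where s: "x < s" "ereal s < fps_conv_radius p" using assms(3) ereal_dense2 less_ereal.simps(1) by blast
  hence s0: "0 < s" using assms(2) by simp
  obtain D where D: "D > 0" "\<And>n. norm (p $ n) \<le> D / s ^ n" using fps_coeff_bound_ex[OF s0 s(2)] by blast
  define u where "u m = C * D * exp s * (R * x) * ((R * x) ^ m / fact m)" for m
  define v where "v j = (x / s) ^ j" for j
  show ?thesis
  proof (rule that)
    fix m N :: nat assume m: "m < N"
    define j where "j = N - Suc m"
    have N: "N = Suc m + j" using m by (simp add: j_def)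
    have "norm ((kfps (Suc m) * p) $ j) \<le> (\<Sum>l\<le>j. C * R ^ Suc m * D / s ^ j * (s ^ l / fact l))"
      unfolding fps_mult_nth atLeast0AtMost
    proof (rule order_trans[OF norm_sum], rule sum_mono)
      fix l assume "l \<in> {..j}"
      hence l: "s ^ j = s ^ (j - l) * s ^ l" by (simp add: power_add[symmetric])
      have "norm (kfps (Suc m) $ l * p $ (j - l)) \<le> (1 / fact l * (C * R ^ Suc m)) * (D / s ^ (j - l))"
        unfolding norm_mult kfps_def fps_nth_Abs_fps
        using hb_bound[of l "Suc m"] C0 R1 D(2)[of "j - l"]
        by (intro mult_mono) (auto simp: norm_mult norm_divide norm_power intro!: divide_right_mono)
      also have "\<dots> = C * R ^ Suc m * D / s ^ j * (s ^ l / fact l)" using s0 unfolding l by (simp add: field_simps)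
      finally show "norm (kfps (Suc m) $ l * p $ (j - l)) \<le> C * R ^ Suc m * D / s ^ j * (s ^ l / fact l)" .
    qed
    also have "\<dots> = C * R ^ Suc m * D / s ^ j * (\<Sum>l\<le>j. s ^ l / fact l)" by (simp add: sum_distrib_left)
    also have "\<dots> \<le> C * R ^ Suc m * D / s ^ j * exp s" using s0 C0 R1 D
      by (intro mult_left_mono sum_power_div_fact_le_exp) auto
    finally have 1: "norm ((kfps (Suc m) * p) $ j) \<le> C * R ^ Suc m * D / s ^ j * exp s" .
    have "1 * fact m \<le> (real j + 1) * fact m" by (intro mult_right_mono) auto
    hence 2: "fact m \<le> norm (pochhammer (of_nat j + \<beta> + 1) (Suc m))" using norm_pochhammer_ge[OF assms(1), of j m] by linarith
    have "norm (tt \<beta> p m N) = norm ((kfps (Suc m) * p) $ j) / norm (pochhammer (of_nat j + \<beta> + 1) (Suc m))"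
      using m by (simp add: tt_def iter_prim_def j_def norm_divide del: pochhammer_Suc)
    also have "\<dots> \<le> (C * R ^ Suc m * D / s ^ j * exp s) / fact m"
      using 1 2 order_trans[OF norm_ge_zero 1] by (intro frac_le) auto
    finally have "norm (tt \<beta> p m N) * x ^ N \<le> (C * R ^ Suc m * D / s ^ j * exp s) / fact m * x ^ N"
      using assms by (intro mult_right_mono) auto
    also have "\<dots> = u m * v j" unfolding u_def v_def N by (simp add: power_add power_mult_distrib power_divide field_simps)
    finally show "norm (tt \<beta> p m N) * x ^ N \<le> u m * v (N - Suc m)" unfolding j_def .
  next
    show "summable u" unfolding u_def using summable_exp[of "R * x"] 
      by (intro summable_mult) (simp add: divide_inverse mult.commute)
    show "summable v" unfolding v_def using s s0 assms by (intro summable_geometric) auto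
    show "u m \<ge> 0" "v m \<ge> 0" for m using C0 D R1 assms s0 by (auto simp: u_def v_def)
  qed
qed

lemma tt_majorant:
  assumes "Re \<beta> \<ge> 0" "0 < x" "ereal x < fps_conv_radius p"
  obtains \<tau> where "summable \<tau>" "\<And>N. (\<Sum>m<N. norm (tt \<beta> p m N) * x ^ N) \<le> \<tau> N"
proof -
  obtain u v where uv: "\<And>m N. m < N \<Longrightarrow> norm (tt \<beta> p m N) * x ^ N \<le> u m * v (N - Suc m)"
    "\<And>m. u m \<ge> 0" "\<And>m. v m \<ge> 0" "summable u" "summable v" using tt_bound[OF assms] by metis
  define \<tau> where "\<tau> N = (\<Sum>m<N. u m * v (N - Suc m))" for N :: nat
  show ?thesis
  proof (rule that)
    have "summable (\<lambda>k. \<Sum>i\<le>k. u i * v (k - i))" using uv by (intro summable_Cauchy_product) auto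
    hence "summable (\<lambda>k. \<tau> (Suc k))" by (simp add: \<tau>_def lessThan_Suc_atMost)
    thus "summable \<tau>" by (subst (asm) summable_Suc_iff)
    show "(\<Sum>m<N. norm (tt \<beta> p m N) * x ^ N) \<le> \<tau> N" for N
      unfolding \<tau>_def by (intro sum_mono uv) auto
  qed
qed

lemma tw_op_radius:
  assumes "Re \<beta> \<ge> 0"
  shows "fps_conv_radius (borel_fps \<beta> (tw_op h b \<beta> P)) \<ge> fps_conv_radius (borel_fps \<beta> P)"
  unfolding fps_conv_radius_def
proof (rule conv_radius_geI_ex', fold fps_conv_radius_def)
  fix x :: real assume x: "0 < x" "ereal x < fps_conv_radius (borel_fps \<beta> P)"
  obtain \<tau> where \<tau>: "summable \<tau>" "\<And>N. (\<Sum>m<N. norm (tt \<beta> (borel_fps \<beta> P) m N) * x ^ N) \<le> \<tau> N"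
    using tt_majorant[OF assms x] by blast
  show "summable (\<lambda>n. borel_fps \<beta> (tw_op h b \<beta> P) $ n * of_real x ^ n)"
  proof (rule summable_comparison_test'[OF \<tau>(1)])
    fix N :: nat
    have "norm (borel_fps \<beta> (tw_op h b \<beta> P) $ N * of_real x ^ N) \<le> (\<Sum>m<N. norm (tt \<beta> (borel_fps \<beta> P) m N)) * x ^ N"
      unfolding borel_tw_op_eq_sum_tt[OF assms] norm_mult
      using x by (intro mult_mono norm_sum) (auto simp: norm_power sum_nonneg)
    also have "\<dots> \<le> \<tau> N" using \<tau>(2)[of N] by (simp add: sum_distrib_right)
    finally show "norm (borel_fps \<beta> (tw_op h b \<beta> P) $ N * of_real x ^ N) \<le> \<tau> N" .
  qed
qed

text \<open>The m-th term of the kernel integrates to an (m+1)-fold primitive by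
  \<open>Jpr_integral\<close>. The partial sums converge under the integral by dominated
  convergence, and as power series by Tannery's theorem; the two limits must agree.\<close>

lemma tw_op_integral:
  assumes \<beta>: "Re \<beta> \<ge> 0" and x: "0 < x" "ereal x < fps_conv_radius (borel_fps \<beta> P)"
  shows "((\<lambda>t. kerK h b (of_real t) (of_real (x - t)) * pow_fps \<beta> (borel_fps \<beta> P) (of_real t)) has_integral
     pow_fps \<beta> (borel_fps \<beta> (tw_op h b \<beta> P)) (of_real x)) {0..x}"
proof -
  let ?p = "borel_fps \<beta> P"
  let ?\<phi> = "\<lambda>t::real. pow_fps \<beta> ?p (of_real t)"
  define F where "F M t = (\<Sum>m<M. kap h b (Suc m) (of_real t) * of_real (x - t) ^ m / fact m) * ?\<phi> t" for M :: nat and t :: real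
  define I where "I M = (\<Sum>m<M. Jpr \<beta> (kfps (Suc m) * ?p) (Suc m) (of_real x))" for M
  have rad: "fps_conv_radius (kfps m * ?p) \<ge> fps_conv_radius ?p" for m
    using fps_conv_radius_mult[of "kfps m" ?p] by (simp add: kfps_radius)
  have xr: "ereal x < fps_conv_radius (kfps m * ?p)" for m using x(2) rad by (rule less_le_trans)
  have FI: "(F M has_integral I M) {0..x}" for M
  proof -
    have *: "((\<lambda>t. kap h b (Suc m) (of_real t) * of_real (x - t) ^ m / fact m * ?\<phi> t) has_integral Jpr \<beta> (kfps (Suc m) * ?p) (Suc m) (of_real x)) {0..x}" for m
    proof (rule has_integral_eq[OF _ Jpr_integral[OF \<beta> x(1) xr]])
      fix t assume "t \<in> {0..x}"
      hence "ereal (norm (of_real t :: complex)) < fps_conv_radius ?p" using x(2) by (auto elim!: le_less_trans[rotated])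
      hence "eval_fps (kfps (Suc m) * ?p) (of_real t) = kap h b (Suc m) (of_real t) * eval_fps ?p (of_real t)"
        by (subst eval_fps_mult) (auto simp: kfps_radius eval_kfps)
      thus "of_real (x - t) ^ m / fact m * Jpr \<beta> (kfps (Suc m) * ?p) 0 (of_real t) = kap h b (Suc m) (of_real t) * of_real (x - t) ^ m / fact m * ?\<phi> t"
        by (simp add: Jpr_def pow_fps_def iter_prim_def fps_nth_inverse)
    qed
    show ?thesis unfolding F_def I_def sum_distrib_right by (intro has_integral_sum *) auto
  qed
  obtain B where B: "B > 0" "\<And>z. norm z \<le> x \<Longrightarrow> norm (eval_fps ?p z) \<le> B" using eval_fps_bounded[OF x(2)] by blast
  define S where "S = (\<Sum>m. C * R * exp x * ((R * x) ^ m / fact m))"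
  define B' where "B' = max (exp (Re \<beta> * \<bar>ln x\<bar>)) (norm (exp (\<beta> * Ln 0)))"
  have Fb: "norm (F M t) \<le> S * (B' * B)" if t: "t \<in> {0..x}" for M t
  proof -
    have "norm (\<Sum>m<M. kap h b (Suc m) (of_real t) * of_real (x - t) ^ m / fact m) \<le> (\<Sum>m<M. C * R * exp x * ((R * x) ^ m / fact m))"
      by (rule order_trans[OF norm_sum], intro sum_mono kerK_term_bound) (use t in \<open>auto simp del: of_real_diff\<close>)
    also have "\<dots> \<le> S" unfolding S_def using C0 R1 x by (intro sum_le_suminf kerK_bound_summable) auto
    finally have 1: "norm (\<Sum>m<M. kap h b (Suc m) (of_real t) * of_real (x - t) ^ m / fact m) \<le> S" .
    have 2: "norm (exp (\<beta> * Ln (of_real t))) \<le> B'"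
      using norm_pow_Ln_le[OF \<beta>, of t x] t by (cases "t = 0") (auto simp: B'_def simp del: norm_exp_eq_Re)
    have 3: "norm (eval_fps ?p (of_real t)) \<le> B" using B t by auto
    show ?thesis unfolding F_def pow_fps_def norm_mult using 1 2 3
      order_trans[OF norm_ge_zero 1] order_trans[OF norm_ge_zero 2] by (intro mult_mono) auto
  qed
  have conv: "(\<lambda>M. F M t) \<longlonglongrightarrow> kerK h b (of_real t) (of_real (x - t)) * ?\<phi> t" for t
    unfolding F_def using kerK_sums[of "of_real t" "of_real (x - t)"] unfolding sums_def by (intro tendsto_mult_right)
  let ?g = "\<lambda>t. kerK h b (of_real t) (of_real (x - t)) * ?\<phi> t"
  have dc: "?g integrable_on {0..x}" "(\<lambda>M. integral {0..x} (F M)) \<longlonglongrightarrow> integral {0..x} ?g"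
    by (rule dominated_convergence[where f=F and h="\<lambda>_. S * (B' * B)"], use FI Fb conv in auto)+
  have "integral {0..x} (F M) = I M" for M using FI by (rule integral_unique)
  hence lim1: "I \<longlonglongrightarrow> integral {0..x} ?g" using dc(2) by simp
  have "I \<longlonglongrightarrow> pow_fps \<beta> (borel_fps \<beta> (tw_op h b \<beta> P)) (of_real x)"
  proof -
    let ?X = "complex_of_real x"
    obtain \<tau> where \<tau>: "summable \<tau>" "\<And>N. (\<Sum>m<N. norm (tt \<beta> ?p m N) * x ^ N) \<le> \<tau> N"
      using tt_majorant[OF \<beta> x] by blast
    have ttb: "norm (\<Sum>m<M. tt \<beta> ?p m N * ?X ^ N) \<le> \<tau> N" for M N
    proof -
      have "norm (\<Sum>m<M. tt \<beta> ?p m N * ?X ^ N) \<le> (\<Sum>m<M. norm (tt \<beta> ?p m N) * x ^ N)"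
        by (rule order_trans[OF norm_sum]) (use x in \<open>auto simp: norm_mult norm_power\<close>)
      also have "\<dots> \<le> (\<Sum>m<max M N. norm (tt \<beta> ?p m N) * x ^ N)" using x by (intro sum_mono2) auto
      also have "\<dots> = (\<Sum>m<N. norm (tt \<beta> ?p m N) * x ^ N)"
        by (rule sum.mono_neutral_right) (auto simp: tt_def)
      finally show ?thesis using \<tau>(2) order_trans by blast
    qed
    have Jm: "(\<lambda>N. exp (\<beta> * Ln ?X) * (tt \<beta> ?p m N * ?X ^ N)) sums Jpr \<beta> (kfps (Suc m) * ?p) (Suc m) ?X" for m
    proof -
      let ?q = "iter_prim \<beta> (kfps (Suc m) * ?p) (Suc m)"
      have "ereal (norm ?X) < fps_conv_radius ?q" using xr[of "Suc m"] x(1) iter_prim_radius[OF \<beta>, of "kfps (Suc m) * ?p" "Suc m"] by (auto elim: less_le_trans)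
      hence "(\<lambda>n. ?q $ n * ?X ^ n) sums eval_fps ?q ?X" by (rule sums_eval_fps)
      hence "(\<lambda>n. ?X ^ Suc m * (?q $ n * ?X ^ n)) sums (?X ^ Suc m * eval_fps ?q ?X)" by (rule sums_mult)
      moreover have "(\<lambda>n. ?X ^ Suc m * (?q $ n * ?X ^ n)) = (\<lambda>n. tt \<beta> ?p m (n + Suc m) * ?X ^ (n + Suc m))"
        by (auto simp: tt_def power_add mult_ac)
      ultimately have "(\<lambda>n. tt \<beta> ?p m (n + Suc m) * ?X ^ (n + Suc m)) sums (?X ^ Suc m * eval_fps ?q ?X)" by simp
      hence "(\<lambda>N. tt \<beta> ?p m N * ?X ^ N) sums (?X ^ Suc m * eval_fps ?q ?X)"
        by (subst (asm) sums_zero_iff_shift) (auto simp: tt_def)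
      hence "(\<lambda>N. exp (\<beta> * Ln ?X) * (tt \<beta> ?p m N * ?X ^ N)) sums (exp (\<beta> * Ln ?X) * (?X ^ Suc m * eval_fps ?q ?X))" by (rule sums_mult)
      moreover have "exp ((\<beta> + of_nat (Suc m)) * Ln ?X) = exp (\<beta> * Ln ?X) * ?X ^ Suc m"
        using x by (simp only: distrib_right exp_add exp_of_nat_mult exp_Ln of_real_eq_0_iff)
      ultimately show ?thesis by (simp add: Jpr_def pow_fps_def mult.assoc)
    qed
    have IM: "I M = exp (\<beta> * Ln ?X) * (\<Sum>N. \<Sum>m<M. tt \<beta> ?p m N * ?X ^ N)" for M
    proof -
      have "(\<lambda>N. \<Sum>m<M. exp (\<beta> * Ln ?X) * (tt \<beta> ?p m N * ?X ^ N)) sums I M" unfolding I_def by (intro sums_sum Jm)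
      hence "(\<lambda>N. exp (\<beta> * Ln ?X) * (\<Sum>m<M. tt \<beta> ?p m N * ?X ^ N)) sums I M" by (simp add: sum_distrib_left)
      moreover have "(\<lambda>N. exp (\<beta> * Ln ?X) * (\<Sum>m<M. tt \<beta> ?p m N * ?X ^ N)) sums (exp (\<beta> * Ln ?X) * (\<Sum>N. \<Sum>m<M. tt \<beta> ?p m N * ?X ^ N))"
        by (intro sums_mult summable_sums summable_comparison_test'[OF \<tau>(1)] ttb)
      ultimately show ?thesis by (rule sums_unique2)
    qed
    have "(\<lambda>M. \<Sum>N. \<Sum>m<M. tt \<beta> ?p m N * ?X ^ N) \<longlonglongrightarrow> (\<Sum>N. borel_fps \<beta> (tw_op h b \<beta> P) $ N * ?X ^ N)"
    proof (rule conjunct2[OF conjunct2[OF tannerys_theorem]])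
      show "(\<lambda>M. \<Sum>m<M. tt \<beta> ?p m N * ?X ^ N) \<longlonglongrightarrow> borel_fps \<beta> (tw_op h b \<beta> P) $ N * ?X ^ N" for N
      proof (rule tendsto_eventually, rule eventually_sequentiallyI)
        fix M assume "M \<ge> N"
        hence "(\<Sum>m<M. tt \<beta> ?p m N * ?X ^ N) = (\<Sum>m<N. tt \<beta> ?p m N * ?X ^ N)"
          by (intro sum.mono_neutral_right) (auto simp: tt_def)
        thus "(\<Sum>m<M. tt \<beta> ?p m N * ?X ^ N) = borel_fps \<beta> (tw_op h b \<beta> P) $ N * ?X ^ N"
          by (simp add: borel_tw_op_eq_sum_tt[OF \<beta>] sum_distrib_right)
      qed
      show "eventually (\<lambda>(N, M). norm (\<Sum>m<M. tt \<beta> ?p m N * ?X ^ N) \<le> \<tau> N) (at_top \<times>\<^sub>F sequentially)"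
        using ttb by (intro always_eventually) auto
    qed (use \<tau> in auto)
    thus ?thesis unfolding IM pow_fps_def eval_fps_def by (intro tendsto_mult_left)
  qed
  with lim1 have "integral {0..x} ?g = pow_fps \<beta> (borel_fps \<beta> (tw_op h b \<beta> P)) (of_real x)"
    by (rule LIMSEQ_unique)
  thus ?thesis using dc(1) by (simp add: has_integral_integrable_integral)
qed

end

section \<open>Holomorphic dependence of line integrals on parameters and endpoints\<close>

lemma contour_integral_linepath_eq_integral:
  "contour_integral (linepath a b) g = integral {0..1} (\<lambda>t. g (linepath a b t) * (b - a))"
  by (simp add: contour_integral_integral)

lemma linepath_in_convex: "convex S \<Longrightarrow> a \<in> S \<Longrightarrow> b \<in> S \<Longrightarrow> t \<in> {0..1} \<Longrightarrow> linepath a b t \<in> S"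
  unfolding linepath_def convex_alt by auto

text \<open>Morera's theorem: integration over a triangle is exchanged with the parameter integral,
  and Cauchy's theorem makes the inner integral vanish.\<close>

lemma holomorphic_param_integral:
  fixes F :: "complex \<Rightarrow> real \<Rightarrow> complex"
  assumes "open U" and cont: "continuous_on (U \<times> {0..1}) (\<lambda>(z,t). F z t)"
    and hol: "\<And>t. t \<in> {0..1} \<Longrightarrow> (\<lambda>z. F z t) holomorphic_on U"
  shows "(\<lambda>z. integral {0..1} (F z)) holomorphic_on U"
proof -
  let ?f = "\<lambda>z. integral {0..1} (F z)"
  have contf: "continuous_on U ?f" using integral_continuous_on_param[of U 0 1 F] cont by simp
  have "?f analytic_on U"
  proof (rule Morera_triangle[OF contf assms(1)], intro allI impI)
    fix a b c assume hull: "convex hull {a,b,c} \<subseteq> U"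
    have seg: "closed_segment x y \<subseteq> convex hull {a,b,c}" if "x \<in> {a,b,c}" "y \<in> {a,b,c}" for x y
      unfolding segment_convex_hull by (rule hull_mono) (use that in auto)
    have one: "contour_integral (linepath x y) ?f = integral {0..1} (\<lambda>t. contour_integral (linepath x y) (\<lambda>z. F z t))"
      "(\<lambda>t. contour_integral (linepath x y) (\<lambda>z. F z t)) integrable_on {0..1}"
      if xy: "x \<in> {a,b,c}" "y \<in> {a,b,c}" for x y
    proof -
      have im: "linepath x y s \<in> U" if "s \<in> {0..1}" for s 
        using seg[OF xy] hull linepath_in_path[OF that, of x y] by auto
      have ct: "continuous_on ({0..1} \<times> {0..1}) (\<lambda>p. F (linepath x y (fst p)) (snd p) * (y - x))"
      proof (intro continuous_intros)
        have lp: "continuous_on ({0..1} \<times> {0..1}) (\<lambda>p. (linepath x y (fst p), snd p))"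
          unfolding linepath_def by (intro continuous_intros)
        show "continuous_on ({0..1} \<times> {0..1}) (\<lambda>p. F (linepath x y (fst p)) (snd p))"
          using continuous_on_compose2[OF cont lp] im by (auto simp: image_subset_iff)
      qed
      have "continuous_on (cbox (0, 0) (1, 1)) (\<lambda>(s,t). F (linepath x y s) t * (y - x))"
        using ct by (simp add: cbox_Pair_eq case_prod_unfold)
      from integral_swap_continuous[OF this]
      have "integral {0..1} (\<lambda>s. integral {0..1} (\<lambda>t. F (linepath x y s) t * (y - x))) = 
            integral {0..1} (\<lambda>t. integral {0..1} (\<lambda>s. F (linepath x y s) t * (y - x)))" by simp
      thus "contour_integral (linepath x y) ?f = integral {0..1} (\<lambda>t. contour_integral (linepath x y) (\<lambda>z. F z t))"
        unfolding contour_integral_linepath_eq_integral by simp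
      have "continuous_on ({0..1} \<times> cbox 0 1) (\<lambda>(t,s). F (linepath x y s) t * (y - x))"
      proof -
        have "continuous_on ({0..1} \<times> {0..1}) ((\<lambda>p. F (linepath x y (fst p)) (snd p) * (y - x)) \<circ> prod.swap)"
          by (rule continuous_on_compose[OF continuous_on_swap]) (use ct in \<open>auto intro: continuous_on_subset\<close>)
        thus ?thesis by (simp add: o_def case_prod_unfold)
      qed
      from integral_continuous_on_param[OF this]
      show "(\<lambda>t. contour_integral (linepath x y) (\<lambda>z. F z t)) integrable_on {0..1}"
        unfolding contour_integral_linepath_eq_integral by (intro integrable_continuous_interval) simp
    qed
    have "contour_integral (linepath a b) ?f + contour_integral (linepath b c) ?f + contour_integral (linepath c a) ?f
      = integral {0..1} (\<lambda>t. contour_integral (linepath a b) (\<lambda>z. F z t) + contour_integral (linepath b c) (\<lambda>z. F z t) + contour_integral (linepath c a) (\<lambda>z. F z t))"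
      by (simp add: one integral_add integrable_add)
    also have "\<dots> = integral {0..1} (\<lambda>t::real. 0)"
    proof (rule integral_cong)
      fix t :: real assume "t \<in> {0..1}"
      hence "(\<lambda>z. F z t) holomorphic_on convex hull {a,b,c}" using hol hull holomorphic_on_subset by blast
      thus "contour_integral (linepath a b) (\<lambda>z. F z t) + contour_integral (linepath b c) (\<lambda>z. F z t) + contour_integral (linepath c a) (\<lambda>z. F z t) = 0"
        by (intro has_chain_integral_chain_integral3 Cauchy_theorem_triangle)
    qed
    finally show "contour_integral (linepath a b) ?f + contour_integral (linepath b c) ?f + contour_integral (linepath c a) ?f = 0" by simp
  qed
  thus ?thesis by (rule analytic_imp_holomorphic)
qed

text \<open>Joint holomorphy reduced to what is used: continuity, and holomorphy along every pair of
  holomorphic maps of one variable. In this form it is stable under products, composition and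
  parameter integrals, without any theory of several variables.\<close>

definition jholo :: "(complex \<Rightarrow> complex \<Rightarrow> complex) \<Rightarrow> complex set \<Rightarrow> complex set \<Rightarrow> bool" where
  "jholo L S T \<longleftrightarrow> continuous_on (S \<times> T) (\<lambda>p. L (fst p) (snd p)) \<and>
     (\<forall>U g1 g2. open U \<longrightarrow> g1 holomorphic_on U \<longrightarrow> g2 holomorphic_on U \<longrightarrow> g1 ` U \<subseteq> S \<longrightarrow> g2 ` U \<subseteq> T \<longrightarrow>
        (\<lambda>z. L (g1 z) (g2 z)) holomorphic_on U)"

lemma jholo_compose_holo:
  "jholo L S T \<Longrightarrow> open U \<Longrightarrow> g1 holomorphic_on U \<Longrightarrow> g2 holomorphic_on U \<Longrightarrow> 
    (\<And>z. z \<in> U \<Longrightarrow> g1 z \<in> S) \<Longrightarrow> (\<And>z. z \<in> U \<Longrightarrow> g2 z \<in> T) \<Longrightarrow> (\<lambda>z. L (g1 z) (g2 z)) holomorphic_on U"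
  unfolding jholo_def by (auto simp: image_subset_iff)

lemma jholo_compose_cont:
  assumes "jholo L S T" "continuous_on X g1" "continuous_on X g2" 
    "\<And>z. z \<in> X \<Longrightarrow> g1 z \<in> S" "\<And>z. z \<in> X \<Longrightarrow> g2 z \<in> T"
  shows "continuous_on X (\<lambda>z. L (g1 z) (g2 z))"
proof -
  have "continuous_on X ((\<lambda>p. L (fst p) (snd p)) \<circ> (\<lambda>z. (g1 z, g2 z)))"
    by (rule continuous_on_compose, intro continuous_intros assms)
       (rule continuous_on_subset[of "S \<times> T"], use assms in \<open>auto simp: jholo_def\<close>)
  thus ?thesis by (simp add: o_def)
qed

lemma jholo_subset: "jholo L S T \<Longrightarrow> S' \<subseteq> S \<Longrightarrow> T' \<subseteq> T \<Longrightarrow> jholo L S' T'"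
  unfolding jholo_def by (meson Sigma_mono continuous_on_subset order_trans)

lemma jholo_mult:
  assumes L: "jholo L S T" and M: "jholo M S T"
  shows "jholo (\<lambda>x y. L x y * M x y) S T"
  unfolding jholo_def
proof (intro conjI allI impI)
  show "continuous_on (S \<times> T) (\<lambda>p. L (fst p) (snd p) * M (fst p) (snd p))"
    using L M unfolding jholo_def by (intro continuous_on_mult) simp_all
  fix U g1 g2
  assume *: "open U" "g1 holomorphic_on U" "g2 holomorphic_on U" "g1 ` U \<subseteq> S" "g2 ` U \<subseteq> T"
  show "(\<lambda>z. L (g1 z) (g2 z) * M (g1 z) (g2 z)) holomorphic_on U"
    using *(4,5) by (intro holomorphic_on_mult jholo_compose_holo[OF L *(1-3)] jholo_compose_holo[OF M *(1-3)]) auto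
qed

lemma jholo_compose2:
  assumes "jholo L S' T'" "jholo G1 S T" "jholo G2 S T"
    "\<And>x y. x \<in> S \<Longrightarrow> y \<in> T \<Longrightarrow> G1 x y \<in> S'" "\<And>x y. x \<in> S \<Longrightarrow> y \<in> T \<Longrightarrow> G2 x y \<in> T'"
  shows "jholo (\<lambda>x y. L (G1 x y) (G2 x y)) S T"
  unfolding jholo_def
proof (intro conjI allI impI)
  show "continuous_on (S \<times> T) (\<lambda>p. L (G1 (fst p) (snd p)) (G2 (fst p) (snd p)))"
    by (rule jholo_compose_cont[OF assms(1)]) (use assms in \<open>auto simp: jholo_def\<close>)
  fix U g1 g2
  assume *: "open U" "g1 holomorphic_on U" "g2 holomorphic_on U" "g1 ` U \<subseteq> S" "g2 ` U \<subseteq> T"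
  show "(\<lambda>z. L (G1 (g1 z) (g2 z)) (G2 (g1 z) (g2 z))) holomorphic_on U"
    by (rule jholo_compose_holo[OF assms(1) *(1)])
       (use * assms in \<open>auto intro!: jholo_compose_holo[OF assms(2)] jholo_compose_holo[OF assms(3)] simp: image_subset_iff\<close>)
qed

lemma jholo_fst: "f holomorphic_on S \<Longrightarrow> jholo (\<lambda>x y. f x) S T"
  unfolding jholo_def
proof (intro conjI allI impI)
  assume f: "f holomorphic_on S"
  show "continuous_on (S \<times> T) (\<lambda>p. f (fst p))"
    by (rule continuous_on_compose2[OF holomorphic_on_imp_continuous_on[OF f]]) (auto intro: continuous_intros)
  fix U g1 g2
  assume "open U" "g1 holomorphic_on U" "g1 ` U \<subseteq> S"
  thus "(\<lambda>z. f (g1 z)) holomorphic_on U" using holomorphic_on_compose_gen[OF _ f] by (simp add: o_def)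
qed

lemma jholo_snd_minus_fst: "jholo (\<lambda>x y. y - x) S T"
  unfolding jholo_def by (auto intro!: continuous_intros holomorphic_intros)

lemma jholo_integral:
  assumes cont: "continuous_on ((S \<times> T) \<times> {0..1}) (\<lambda>q. M (snd q) (fst (fst q)) (snd (fst q)))"
    and M: "\<And>t. t \<in> {0..1} \<Longrightarrow> jholo (M t) S T"
  shows "jholo (\<lambda>x y. integral {0..1} (\<lambda>t::real. M t x y)) S T"
  unfolding jholo_def
proof (intro conjI allI impI)
  show "continuous_on (S \<times> T) (\<lambda>p. integral {0..1} (\<lambda>t. M t (fst p) (snd p)))"
    using integral_continuous_on_param[of "S \<times> T" 0 1 "\<lambda>p t. M t (fst p) (snd p)"] cont by (simp add: case_prod_unfold)
  fix U g1 g2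
  assume *: "open U" "g1 holomorphic_on U" "g2 holomorphic_on U" "g1 ` U \<subseteq> S" "g2 ` U \<subseteq> T"
  show "(\<lambda>z. integral {0..1} (\<lambda>t. M t (g1 z) (g2 z))) holomorphic_on U"
  proof (rule holomorphic_param_integral[OF *(1)])
    show "(\<lambda>z. M t (g1 z) (g2 z)) holomorphic_on U" if "t \<in> {0..1}" for t
      using M[OF that] * unfolding jholo_def by blast
    have g: "continuous_on (U \<times> {0..1}) (\<lambda>q. g1 (fst q))" "continuous_on (U \<times> {0..1}) (\<lambda>q. g2 (fst q))"
      using * holomorphic_on_imp_continuous_on by (auto intro!: continuous_on_compose2[of U _ _ fst] continuous_intros)
    have "continuous_on (U \<times> {0..1}) ((\<lambda>q. M (snd q) (fst (fst q)) (snd (fst q))) \<circ> (\<lambda>q. ((g1 (fst q), g2 (fst q)), snd q)))"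
      by (rule continuous_on_compose, intro continuous_intros g)
         (rule continuous_on_subset[OF cont], use * in auto)
    thus "continuous_on (U \<times> {0..1}) (\<lambda>(z, t). M t (g1 z) (g2 z))" by (simp add: o_def case_prod_unfold)
  qed
qed

text \<open>The line integral is \<open>x - p\<close> times this average. The average is treated on
  its own because, for p = 0, it is the integral divided by x, which the integration by parts at
  \<omega> needs.\<close>

lemma jholo_line_average:
  assumes L: "jholo L S T" and S: "convex S" "p \<in> S" and f: "f holomorphic_on S"
  shows "jholo (\<lambda>x y. integral {0..1} (\<lambda>t. L (linepath p x t) y * f (linepath p x t))) S T"
proof (rule jholo_integral)
  let ?X = "(S \<times> T) \<times> {0..1::real}"
  have lp: "continuous_on ?X (\<lambda>q. linepath p (fst (fst q)) (snd q))"
    unfolding linepath_def by (intro continuous_intros)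
  have "continuous_on ?X (\<lambda>q. L (linepath p (fst (fst q)) (snd q)) (snd (fst q)))"
    by (rule jholo_compose_cont[OF L lp]) (auto intro!: continuous_intros linepath_in_convex S)
  moreover have "continuous_on ?X (\<lambda>q. f (linepath p (fst (fst q)) (snd q)))"
    by (rule continuous_on_compose2[OF holomorphic_on_imp_continuous_on[OF f] lp]) (auto intro!: linepath_in_convex S)
  ultimately show "continuous_on ?X (\<lambda>q. L (linepath p (fst (fst q)) (snd q)) (snd (fst q)) * f (linepath p (fst (fst q)) (snd q)))"
    by (rule continuous_on_mult)
  fix t :: real assume t: "t \<in> {0..1}"
  have h: "(\<lambda>x. linepath p x t) holomorphic_on S"
    unfolding linepath_def scaleR_conv_of_real by (intro holomorphic_intros)
  show "jholo (\<lambda>x y. L (linepath p x t) y * f (linepath p x t)) S T"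
  proof (rule jholo_mult)
    have "jholo (\<lambda>x y. y) S T" unfolding jholo_def by (auto intro!: continuous_intros)
    thus "jholo (\<lambda>x. L (linepath p x t)) S T"
      by (rule jholo_compose2[OF L jholo_fst[OF h]]) (auto intro!: linepath_in_convex S t)
    have "f \<circ> (\<lambda>x. linepath p x t) holomorphic_on S"
      by (rule holomorphic_on_compose_gen[OF h f]) (auto intro!: linepath_in_convex S t)
    thus "jholo (\<lambda>x y. f (linepath p x t)) S T" by (intro jholo_fst) (simp add: o_def)
  qed
qed

lemma jholo_line:
  assumes L: "jholo L S T" and S: "convex S" "p \<in> S" and f: "f holomorphic_on S"
  shows "jholo (\<lambda>x y. contour_integral (linepath p x) (\<lambda>\<xi>. L \<xi> y * f \<xi>)) S T"
proof -
  have "jholo (\<lambda>x y. integral {0..1} (\<lambda>t. L (linepath p x t) y * f (linepath p x t)) * (x - p)) S T"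
    by (intro jholo_mult jholo_line_average assms jholo_fst holomorphic_intros)
  thus ?thesis unfolding contour_integral_linepath_eq_integral by (simp only: integral_mult_left)
qed

lemma holomorphic_line_diag:
  assumes L: "jholo L S UNIV" and S: "convex S" "open S" "p \<in> S" and f: "f holomorphic_on S"
  shows "(\<lambda>z. contour_integral (linepath p z) (\<lambda>\<xi>. L \<xi> z * f \<xi>)) holomorphic_on S"
  by (rule jholo_compose_holo[OF jholo_line[OF L S(1,3) f] S(2)]) auto

lemma contour_integral_triangle:
  assumes "convex S" "open S" "g holomorphic_on S" "a \<in> S" "b \<in> S" "c \<in> S"
  shows "contour_integral (linepath a c) g = contour_integral (linepath a b) g + contour_integral (linepath b c) g"
proof -
  obtain G where G: "\<And>x. x \<in> S \<Longrightarrow> (G has_field_derivative g x) (at x within S)"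
    using holomorphic_convex_primitive'[OF assms(1,2,3)] by blast
  have "contour_integral (linepath x y) g = G y - G x" if "x \<in> S" "y \<in> S" for x y
    using contour_integral_primitive[of S G g "linepath x y"] G that closed_segment_subset[OF that assms(1)]
    by (intro contour_integral_unique) simp
  thus ?thesis using assms by simp
qed

lemma contour_integrable_linepath_holomorphic:
  assumes "convex S" "g holomorphic_on S" "a \<in> S" "b \<in> S"
  shows "g contour_integrable_on linepath a b"
  using assms closed_segment_subset[OF assms(3,4,1)]
  by (intro contour_integrable_continuous_linepath holomorphic_on_imp_continuous_on) (rule holomorphic_on_subset)

lemma jholo_slice: "jholo L S T \<Longrightarrow> open S \<Longrightarrow> y \<in> T \<Longrightarrow> (\<lambda>x. L x y) holomorphic_on S"
  by (rule jholo_compose_holo[of L S T S "\<lambda>x. x" "\<lambda>_. y"]) auto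

lemma jholo_slice2: "jholo L S T \<Longrightarrow> open T \<Longrightarrow> x \<in> S \<Longrightarrow> (\<lambda>y. L x y) holomorphic_on T"
  by (rule jholo_compose_holo[of L S T T "\<lambda>_. x" "\<lambda>x. x"]) auto

text \<open>Dividing the difference quotient out jointly is done with Cauchy's formula on a large circle.\<close>

lemma jholo_diffquot:
  assumes L: "jholo L UNIV UNIV" and r: "r > 0"
  obtains q where "jholo q (ball 0 r) UNIV" "\<And>x y. x \<in> ball 0 r \<Longrightarrow> x * q x y = L x y - L 0 y"
proof -
  let ?u = "\<lambda>t. circlepath 0 r t"
  define q where "q x y = integral {0..1} (\<lambda>t. L (?u t) y * (1 / (?u t - x)))" for x y
  have nu: "norm (?u t) = r" for t using r by (simp add: circlepath norm_mult)
  have nz: "?u t - x \<noteq> 0" if "x \<in> ball 0 r" for x t using nu[of t] that by auto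
  have cu: "continuous_on A ?u" for A unfolding circlepath by (intro continuous_intros)
  have "jholo q (ball 0 r) UNIV"
    unfolding q_def
  proof (rule jholo_integral)
    let ?X = "(ball 0 r \<times> (UNIV::complex set)) \<times> {0..1::real}"
    have c1: "continuous_on ?X (\<lambda>q. ?u (snd q))" by (rule continuous_on_compose2[OF cu[of UNIV]]) (auto intro: continuous_intros)
    have "continuous_on ?X (\<lambda>q. L (?u (snd q)) (snd (fst q)))"
      by (rule jholo_compose_cont[OF L c1]) (auto intro!: continuous_intros)
    thus "continuous_on ?X (\<lambda>q. L (?u (snd q)) (snd (fst q)) * (1 / (?u (snd q) - fst (fst q))))"
      using nz by (intro continuous_intros c1) auto
    fix t :: real assume t: "t \<in> {0..1}"
    show "jholo (\<lambda>x y. L (?u t) y * (1 / (?u t - x))) (ball 0 r) UNIV"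
    proof (rule jholo_mult)
      have "jholo (\<lambda>x y. y) (ball 0 r) UNIV" unfolding jholo_def by (auto intro!: continuous_intros)
      thus "jholo (\<lambda>x. L (?u t)) (ball 0 r) UNIV"
        using jholo_compose2[OF L jholo_fst[of "\<lambda>_. ?u t" "ball 0 r" UNIV]] by auto
      show "jholo (\<lambda>x y. 1 / (?u t - x)) (ball 0 r) UNIV"
        using nz by (intro jholo_fst holomorphic_intros) auto
    qed
  qed
  moreover have "x * q x y = L x y - L 0 y" if x: "x \<in> ball 0 r" for x y
  proof -
    have hol: "(\<lambda>u. L u y) holomorphic_on UNIV" by (rule jholo_slice[OF L]) auto
    have vd: "vector_derivative (circlepath 0 r) (at t) = 2 * of_real pi * \<i> * ?u t" for t
      unfolding vector_derivative_circlepath by (simp add: circlepath)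
    have C: "((\<lambda>t. L (?u t) y * (?u t / (?u t - w))) has_integral L w y) {0..1}" if "norm w < r" for w
    proof -
      have "((\<lambda>u. L u y / (u - w)) has_contour_integral (2 * of_real pi * \<i> * L w y)) (circlepath 0 r)"
        using that hol by (intro Cauchy_integral_circlepath) (auto intro: holomorphic_on_imp_continuous_on holomorphic_on_subset continuous_on_subset)
      hence "((\<lambda>t. (L (?u t) y / (?u t - w)) * (2 * of_real pi * \<i> * ?u t)) has_integral (2 * of_real pi * \<i> * L w y)) {0..1}"
        unfolding has_contour_integral vd by simp
      from has_integral_mult_right[OF this, of "1 / (2 * of_real pi * \<i>)"]
      show ?thesis by (simp add: field_simps)
    qed
    have "((\<lambda>t. L (?u t) y * (?u t / (?u t - x)) - L (?u t) y * (?u t / (?u t - 0))) has_integral L x y - L 0 y) {0..1}"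
      by (intro has_integral_diff C) (use x r in auto)
    moreover have "L (?u t) y * (?u t / (?u t - x)) - L (?u t) y * (?u t / (?u t - 0)) = x * (L (?u t) y * (1 / (?u t - x)))" for t
      using nz[OF x, of t] nz[of 0 t] r by (simp add: field_simps)
    ultimately have "((\<lambda>t. x * (L (?u t) y * (1 / (?u t - x)))) has_integral L x y - L 0 y) {0..1}" by simp
    hence "integral {0..1} (\<lambda>t. x * (L (?u t) y * (1 / (?u t - x)))) = L x y - L 0 y" by (rule integral_unique)
    thus ?thesis by (simp only: q_def integral_mult_right)
  qed
  ultimately show ?thesis using that by blast
qed

section \<open>The entire kernel, and integrals based at 0 and at 1\<close>

context kernel_data
begin

lemma continuous_kap [continuous_intros]: "continuous_on A g \<Longrightarrow> continuous_on A (\<lambda>z. kap h b m (g z))"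
  unfolding kap_eq_sum[OF b0] by (intro continuous_intros) auto

lemma holomorphic_kap [holomorphic_intros]: "g holomorphic_on A \<Longrightarrow> (\<lambda>z. kap h b m (g z)) holomorphic_on A"
  unfolding kap_eq_sum[OF b0] by (intro holomorphic_intros) auto

lemma jholo_kerK: "jholo (kerK h b) UNIV UNIV"
  unfolding jholo_def
proof (intro conjI allI impI)
  have ball: "continuous_on (ball 0 r \<times> ball 0 r) (\<lambda>p. kerK h b (fst p) (snd p))" for r
    unfolding kerK_def
  proof (rule uniform_limit_theorem[OF always_eventually Weierstrass_m_test[OF _ kerK_bound_summable[of r]]], intro allI)
    show "continuous_on (ball 0 r \<times> ball 0 r) (\<lambda>p. \<Sum>i<n. kap h b (Suc i) (fst p) * snd p ^ i / fact i)" for n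
      by (intro continuous_intros) auto
  qed (rule kerK_term_bound, auto)
  have "isCont (\<lambda>p. kerK h b (fst p) (snd p)) p" for p
  proof -
    define r where "r = max (norm (fst p)) (norm (snd p)) + 1"
    have "p \<in> ball 0 r \<times> ball 0 r" by (cases p) (auto simp: r_def)
    thus ?thesis using ball[of r] by (metis continuous_on_eq_continuous_at open_Times open_ball)
  qed
  thus "continuous_on (UNIV \<times> UNIV) (\<lambda>p. kerK h b (fst p) (snd p))"
    by (simp add: continuous_at_imp_continuous_on)
  fix U g1 g2
  assume *: "open U" "g1 holomorphic_on U" "g2 holomorphic_on U"
  show "(\<lambda>z. kerK h b (g1 z) (g2 z)) holomorphic_on U"
  proof (rule holomorphic_uniform_sequence[OF *(1)])
    show "(\<lambda>z. \<Sum>m<n. kap h b (Suc m) (g1 z) * g2 z ^ m / fact m) holomorphic_on U" for n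
      using * by (intro holomorphic_intros) auto
    fix x assume "x \<in> U"
    then obtain d where d: "d > 0" "cball x d \<subseteq> U" using *(1) open_contains_cball by blast
    have "compact (g1 ` cball x d \<union> g2 ` cball x d)"
      using d * by (intro compact_Un compact_continuous_image) (auto intro: holomorphic_on_imp_continuous_on holomorphic_on_subset)
    then obtain r where r: "\<forall>y\<in>g1 ` cball x d \<union> g2 ` cball x d. norm y \<le> r"
      using compact_imp_bounded bounded_iff by metis
    have "uniform_limit (cball x d) (\<lambda>n z. \<Sum>m<n. kap h b (Suc m) (g1 z) * g2 z ^ m / fact m) (\<lambda>z. kerK h b (g1 z) (g2 z)) sequentially"
      unfolding kerK_def
      by (rule Weierstrass_m_test[OF _ kerK_bound_summable[of r]]) (rule kerK_term_bound, use r in auto)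
    thus "\<exists>d>0. cball x d \<subseteq> U \<and> uniform_limit (cball x d) (\<lambda>n z. \<Sum>m<n. kap h b (Suc m) (g1 z) * g2 z ^ m / fact m) (\<lambda>z. kerK h b (g1 z) (g2 z)) sequentially"
      using d by blast
  qed
qed

definition Lk :: "complex \<Rightarrow> complex \<Rightarrow> complex" where "Lk \<xi> z = kerK h b \<xi> (z - \<xi>)"

lemma jholo_Lk: "jholo Lk UNIV UNIV"
proof -
  have "jholo (\<lambda>x y. x) UNIV UNIV" unfolding jholo_def by (auto intro!: continuous_intros)
  thus ?thesis unfolding Lk_def by (rule jholo_compose2[OF jholo_kerK _ jholo_snd_minus_fst]) auto
qed

lemma pow_fps_holomorphic:
  assumes "\<And>z. z \<in> S \<Longrightarrow> Re z > 0 \<and> ereal (norm z) < fps_conv_radius p"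
  shows "pow_fps \<beta> p holomorphic_on S"
  unfolding pow_fps_def using assms
  by (intro holomorphic_intros) (fastforce simp: complex_nonpos_Reals_iff)+

text \<open>On the positive axis this is the integral representation just obtained; both sides are
  holomorphic in a disc, so the identity theorem extends it.\<close>

lemma tw_op_line_integral_0:
  assumes "ereal (norm z) < fps_conv_radius (borel_fps 0 P)"
  shows "eval_fps (borel_fps 0 (tw_op h b 0 P)) z = contour_integral (linepath 0 z) (\<lambda>\<xi>. Lk \<xi> z * eval_fps (borel_fps 0 P) \<xi>)"
proof -
  let ?p = "borel_fps 0 P" and ?T = "borel_fps 0 (tw_op h b 0 P)"
  obtain r where r: "norm z < r" "ereal r < fps_conv_radius ?p" using assms ereal_dense2 less_ereal.simps(1) by blast
  have r0: "r > 0" by (rule le_less_trans[OF norm_ge_zero r(1)])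
  let ?S = "ball (0::complex) r"
  have sub: "?S \<subseteq> eball 0 (fps_conv_radius ?p)" using eball_cball_subset[OF r(2)] ball_subset_cball by blast
  have hp: "eval_fps ?p holomorphic_on ?S" by (rule holomorphic_on_eval_fps[OF sub])
  have "?S \<subseteq> eball 0 (fps_conv_radius ?T)" using sub tw_op_radius[of 0 P] eball_mono by fastforce
  hence hT: "eval_fps ?T holomorphic_on ?S" by (rule holomorphic_on_eval_fps)
  define D where "D z = eval_fps ?T z - contour_integral (linepath 0 z) (\<lambda>\<xi>. Lk \<xi> z * eval_fps ?p \<xi>)" for z
  have "D z = 0"
  proof (rule analytic_continuation[of D ?S "of_real ` {0<..<r}" 0])
    show "D holomorphic_on ?S" unfolding D_def
      using r0 by (intro holomorphic_intros hT holomorphic_line_diag jholo_subset[OF jholo_Lk] hp) auto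
    show "(0::complex) islimpt of_real ` {0<..<r}"
      unfolding islimpt_approachable
    proof (intro allI impI)
      fix e :: real assume "e > 0"
      define x where "x = min (e / 2) (r / 2)"
      have "x > 0" "x < e" "x < r" using \<open>e > 0\<close> r0 by (auto simp: x_def min_def)
      thus "\<exists>x'\<in>complex_of_real ` {0<..<r}. x' \<noteq> 0 \<and> dist x' 0 < e" by (intro bexI[of _ "of_real x"]) auto
    qed
    fix w assume "w \<in> complex_of_real ` {0<..<r}"
    then obtain x where x: "w = of_real x" "0 < x" "x < r" by auto
    have xr: "ereal x < fps_conv_radius ?p" using x(3) r(2) by (meson ereal_less_eq(3) le_less_trans less_imp_le)
    have "((\<lambda>t. kerK h b (of_real t) (of_real (x - t)) * pow_fps 0 ?p (of_real t)) has_integral pow_fps 0 ?T (of_real x)) {0..x}"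
      using x xr by (intro tw_op_integral) auto
    hence "((\<lambda>t. Lk (of_real t) w * eval_fps ?p (of_real t)) has_integral eval_fps ?T w) {0..x}"
      by (simp add: pow_fps_def Lk_def x(1))
    hence "((\<lambda>\<xi>. Lk \<xi> w * eval_fps ?p \<xi>) has_contour_integral eval_fps ?T w) (linepath 0 w)"
      using x by (subst has_contour_integral_linepath_Reals_iff) auto
    thus "D w = 0" unfolding D_def by (simp add: contour_integral_unique)
  qed (use r r0 in auto)
  thus ?thesis by (simp add: D_def)
qed

text \<open>The path from 0 to z is bent through 1, and \<open>A\<close> is the part from 0 to 1,
  entire because the kernel is. The integrand is only bounded near 0, so \<open>A\<close> is built
  as the limit, uniform on discs, of integrals from \<open>s n\<close>. The last clause makes the
  bound of \<open>A\<close> linear in that of the integrand on the unit segment, which is how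
  \<Lambda>^k reaches it.\<close>

lemma tw_op_line_integral_1:
  assumes \<beta>: "Re \<beta> \<ge> 0" and rad: "fps_conv_radius (borel_fps \<beta> P) \<ge> ereal (2 * pi)"
  defines "p \<equiv> borel_fps \<beta> P" and "T \<equiv> borel_fps \<beta> (tw_op h b \<beta> P)"
  obtains A where "A holomorphic_on UNIV"
    "\<And>z. z \<in> ball 1 1 \<Longrightarrow> pow_fps \<beta> T z = A z + contour_integral (linepath 1 z) (\<lambda>\<xi>. Lk \<xi> z * pow_fps \<beta> p \<xi>)"
    "\<And>r M B z. (\<And>\<xi> z. norm \<xi> \<le> 1 \<Longrightarrow> norm z \<le> r \<Longrightarrow> norm (Lk \<xi> z) \<le> M) \<Longrightarrow>
        (\<And>t. 0 < t \<Longrightarrow> t \<le> 1 \<Longrightarrow> norm (pow_fps \<beta> p (of_real t)) \<le> B) \<Longrightarrow> norm z \<le> r \<Longrightarrow> norm (A z) \<le> M * B"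
proof -
  define s where "s n = 1 / (real n + 2)" for n
  have s: "0 < s n" "s n < 1" for n by (auto simp: s_def)
  have slim: "s \<longlonglongrightarrow> 0" unfolding s_def by real_asymp
  \<comment> \<open>A convex set on which \<zeta>^\<beta> is holomorphic and which contains both the
    segment (0, 1] and \<open>ball 1 1\<close>.\<close>
  define S where "S = {z::complex. Re z > 0} \<inter> ball 0 (2 * pi)"
  have S: "open S" "convex S" unfolding S_def by (auto intro!: convex_Int convex_halfspace_Re_gt open_Int open_halfspace_Re_gt)
  have pi2: "2 * pi > 6" using pi_gt3 by simp
  have inS: "of_real t \<in> S" if "0 < t" "t \<le> 1" for t using that pi2 by (auto simp: S_def)
  have ballS: "ball 1 1 \<subseteq> S"
  proof
    fix z :: complex assume z: "z \<in> ball 1 1"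
    have "\<bar>Re (1 - z)\<bar> < 1" using z abs_Re_le_cmod[of "1 - z"] by (simp add: dist_norm)
    moreover have "norm z \<le> norm (1::complex) + norm (1 - z)" using norm_triangle_sub[of z 1] by (simp add: norm_minus_commute)
    ultimately show "z \<in> S" using z pi2 by (auto simp: S_def dist_norm)
  qed
  have hphi: "pow_fps \<beta> p holomorphic_on S"
    by (rule pow_fps_holomorphic) (use rad in \<open>auto simp: S_def p_def elim!: less_le_trans[rotated]\<close>)
  have Tr: "fps_conv_radius T \<ge> ereal (2 * pi)" unfolding T_def using tw_op_radius[OF \<beta>, of P] rad by (rule order_trans[rotated])
  have hT: "pow_fps \<beta> T holomorphic_on S"
    by (rule pow_fps_holomorphic) (use Tr in \<open>auto simp: S_def elim!: less_le_trans[rotated]\<close>)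
  have LS: "jholo Lk S UNIV" by (rule jholo_subset[OF jholo_Lk]) auto
  have hint: "(\<lambda>\<xi>. Lk \<xi> z * pow_fps \<beta> p \<xi>) holomorphic_on S" for z
    using S by (intro holomorphic_intros hphi jholo_slice[OF LS]) auto
  note tri = contour_integral_triangle[OF S(2,1) hint]
  define a where "a n z = contour_integral (linepath (of_real (s n)) 1) (\<lambda>\<xi>. Lk \<xi> z * pow_fps \<beta> p \<xi>)" for n z
  have a_hol: "a n holomorphic_on UNIV" for n
    unfolding a_def
    by (rule jholo_compose_holo[OF jholo_line[OF LS S(2) _ hphi], of _ UNIV "\<lambda>_. 1" "\<lambda>z. z"])
       (use s[of n] inS[of "s n"] inS[of 1] in auto)
  have bnd: "norm (contour_integral (linepath (of_real u) (of_real v)) (\<lambda>\<xi>. Lk \<xi> z * pow_fps \<beta> p \<xi>)) \<le> M * B * \<bar>v - u\<bar>"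
    if M: "\<And>\<xi> z. norm \<xi> \<le> 1 \<Longrightarrow> norm z \<le> r \<Longrightarrow> norm (Lk \<xi> z) \<le> M"
      and B: "\<And>t. 0 < t \<Longrightarrow> t \<le> 1 \<Longrightarrow> norm (pow_fps \<beta> p (of_real t)) \<le> B" 
      and z: "norm z \<le> r" and uv: "0 < u" "u \<le> 1" "0 < v" "v \<le> 1" for r M B :: real and z :: complex and u v :: real
  proof -
    have MB: "M \<ge> 0" "B \<ge> 0" using order_trans[OF norm_ge_zero M[of 0 z]] order_trans[OF norm_ge_zero B[of 1]] z by auto
    have "norm (contour_integral (linepath (of_real u) (of_real v)) (\<lambda>\<xi>. Lk \<xi> z * pow_fps \<beta> p \<xi>)) \<le> M * B * norm (of_real v - of_real u :: complex)"
    proof (rule contour_integral_bound_linepath)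
      show "(\<lambda>\<xi>. Lk \<xi> z * pow_fps \<beta> p \<xi>) contour_integrable_on linepath (of_real u) (of_real v)"
        by (rule contour_integrable_linepath_holomorphic[OF S(2) hint inS[OF uv(1,2)] inS[OF uv(3,4)]])
      show "0 \<le> M * B" using MB by simp
      fix \<xi> assume "\<xi> \<in> closed_segment (complex_of_real u) (of_real v)"
      then obtain t where t: "\<xi> = of_real t" "t \<in> closed_segment u v" 
        using closed_segment_of_real[of u v] by auto
      hence "0 < t" "t \<le> 1" using uv by (auto simp: closed_segment_eq_real_ivl split: if_splits)
      thus "norm (Lk \<xi> z * pow_fps \<beta> p \<xi>) \<le> M * B"
        unfolding norm_mult t(1) using MB z by (intro mult_mono M B) auto
    qed
    thus ?thesis by (simp flip: of_real_diff)
  qed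
  have Bex: "\<exists>B. \<forall>t. 0 < t \<longrightarrow> t \<le> 1 \<longrightarrow> norm (pow_fps \<beta> p (of_real t)) \<le> B"
  proof -
    have "ereal 1 < fps_conv_radius p" using rad pi2 unfolding p_def by (auto elim!: less_le_trans[rotated])
    then obtain B where B: "B > 0" "\<And>z. norm z \<le> 1 \<Longrightarrow> norm (eval_fps p z) \<le> B" using eval_fps_bounded by blast
    have "norm (pow_fps \<beta> p (of_real t)) \<le> 1 * B" if "0 < t" "t \<le> 1" for t
      unfolding pow_fps_def norm_mult using norm_pow_Ln_le[OF \<beta> that(1), of 1] that B by (intro mult_mono) auto
    thus ?thesis by auto
  qed
  have Mex: "\<exists>M. \<forall>\<xi> z. norm \<xi> \<le> 1 \<longrightarrow> norm z \<le> r \<longrightarrow> norm (Lk \<xi> z) \<le> M" for r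
  proof -
    have "compact ((\<lambda>p. Lk (fst p) (snd p)) ` (cball 0 1 \<times> cball 0 r))"
      using jholo_Lk unfolding jholo_def by (intro compact_continuous_image compact_Times) (auto intro: continuous_on_subset)
    then obtain M where M: "\<forall>y\<in>(\<lambda>p. Lk (fst p) (snd p)) ` (cball 0 1 \<times> cball 0 r). norm y \<le> M"
      using compact_imp_bounded bounded_iff by metis
    have "norm (Lk \<xi> z) \<le> M" if "norm \<xi> \<le> 1" "norm z \<le> r" for \<xi> z
    proof -
      have "(\<xi>, z) \<in> cball 0 1 \<times> cball 0 r" using that by auto
      thus ?thesis using M by (metis (no_types, lifting) fst_conv image_eqI snd_conv)
    qed
    thus ?thesis by blast
  qed
  define A where "A z = lim (\<lambda>n. a n z)" for z
  have UL: "uniform_limit (cball 0 r) a A sequentially" for r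
  proof -
    obtain M where M: "\<And>\<xi> z. norm \<xi> \<le> 1 \<Longrightarrow> norm z \<le> r \<Longrightarrow> norm (Lk \<xi> z) \<le> M" using Mex[of r] by blast
    obtain B where B: "\<And>t. 0 < t \<Longrightarrow> t \<le> 1 \<Longrightarrow> norm (pow_fps \<beta> p (of_real t)) \<le> B" using Bex by blast
    have diff: "norm (a m z - a n z) \<le> M * B * \<bar>s n - s m\<bar>" if "norm z \<le> r" for m n z
    proof -
      have "a m z - a n z = contour_integral (linepath (of_real (s m)) (of_real (s n))) (\<lambda>\<xi>. Lk \<xi> z * pow_fps \<beta> p \<xi>)"
        unfolding a_def using tri[of "of_real (s m)" "of_real (s n)" 1 z] s[of m] s[of n] inS[of "s m"] inS[of "s n"] inS[of 1] by simp
      thus ?thesis using bnd[OF M B that, of "s m" "s n"] s[of m] s[of n] by (simp add: less_imp_le)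
    qed
    have "uniformly_Cauchy_on (cball 0 r) a"
    proof (rule uniformly_Cauchy_onI)
      fix e :: real assume e: "e > 0"
      have "Cauchy s" using slim by (simp add: LIMSEQ_imp_Cauchy)
      moreover have "e / (\<bar>M * B\<bar> + 1) > 0" using e by (simp add: add_nonneg_pos)
      ultimately obtain K where K: "\<And>m n. m \<ge> K \<Longrightarrow> n \<ge> K \<Longrightarrow> dist (s m) (s n) < e / (\<bar>M * B\<bar> + 1)"
        unfolding Cauchy_def by meson
      have "dist (a m z) (a n z) < e" if "z \<in> cball 0 r" "m \<ge> K" "n \<ge> K" for m n z
      proof -
        have "dist (a m z) (a n z) \<le> (\<bar>M * B\<bar> + 1) * \<bar>s n - s m\<bar>"
          using diff[of z m n] that(1) by (auto simp: dist_norm elim!: order_trans intro!: mult_right_mono)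
        also have "\<dots> < e" using K[OF that(2,3)] by (simp add: dist_real_def abs_minus_commute field_simps)
        finally show ?thesis .
      qed
      thus "\<exists>K. \<forall>z\<in>cball 0 r. \<forall>m\<ge>K. \<forall>n\<ge>K. dist (a m z) (a n z) < e" by blast
    qed
    thus ?thesis unfolding A_def using Cauchy_uniformly_convergent uniformly_convergent_uniform_limit_iff by blast
  qed
  have alim: "(\<lambda>n. a n z) \<longlonglongrightarrow> A z" for z
    using tendsto_uniform_limitI[OF UL[of "norm z"], of z] by simp
  have A_hol: "A holomorphic_on UNIV"
  proof (rule holomorphic_uniform_sequence[OF open_UNIV a_hol])
    fix x :: complex
    have "cball x 1 \<subseteq> cball 0 (norm x + 1)"
    proof
      fix y assume "y \<in> cball x 1"
      thus "y \<in> cball 0 (norm x + 1)" using norm_triangle_sub[of y x] by (simp add: dist_norm norm_minus_commute)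
    qed
    hence "uniform_limit (cball x 1) a A sequentially" by (rule uniform_limit_on_subset[OF UL])
    thus "\<exists>d>0. cball x d \<subseteq> UNIV \<and> uniform_limit (cball x d) a A sequentially" by (intro exI[of _ 1]) auto
  qed
  show ?thesis
  proof (rule that[OF A_hol])
    fix r M B :: real and z :: complex
    assume M: "\<And>\<xi> z. norm \<xi> \<le> 1 \<Longrightarrow> norm z \<le> r \<Longrightarrow> norm (Lk \<xi> z) \<le> M"
      and B: "\<And>t. 0 < t \<Longrightarrow> t \<le> 1 \<Longrightarrow> norm (pow_fps \<beta> p (of_real t)) \<le> B" and z: "norm z \<le> r"
    have MB: "M \<ge> 0" "B \<ge> 0" using order_trans[OF norm_ge_zero M[of 0 z]] order_trans[OF norm_ge_zero B[of 1]] z by auto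
    have "norm (a n z) \<le> M * B" for n
    proof -
      have "norm (a n z) \<le> M * B * \<bar>1 - s n\<bar>" 
        unfolding a_def using bnd[OF M B z, of "s n" 1] s[of n] by (simp add: less_imp_le)
      also have "\<dots> \<le> M * B * 1" using MB s[of n] by (intro mult_left_mono) auto
      finally show ?thesis by simp
    qed
    thus "norm (A z) \<le> M * B" using alim[of z] by (intro Lim_norm_ubound[OF _ alim[of z]]) auto
  next
    fix z :: complex assume z: "z \<in> ball 1 1"
    define D where "D z = pow_fps \<beta> T z - (A z + contour_integral (linepath 1 z) (\<lambda>\<xi>. Lk \<xi> z * pow_fps \<beta> p \<xi>))" for z
    have S1: "1 \<in> S" using inS[of 1] by simp
    have "D z = 0"
    proof (rule analytic_continuation[of D S "of_real ` {1/2<..<1}" "of_real (3/4)"])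
      show "D holomorphic_on S" unfolding D_def
        using S1 S by (intro holomorphic_intros hT holomorphic_line_diag LS hphi holomorphic_on_subset[OF A_hol]) auto
      show "connected S" using S(2) by (rule convex_connected)
      show "open S" by (rule S(1))
      show "complex_of_real (3/4) islimpt of_real ` {1/2<..<1}"
        unfolding islimpt_approachable
      proof (intro allI impI)
        fix e :: real assume "e > 0"
        define x where "x = 3/4 + min (e / 2) (1/8)"
        have "x > 3/4" "x < 1" "x - 3/4 < e" using \<open>e > 0\<close> by (auto simp: x_def min_def)
        thus "\<exists>x'\<in>complex_of_real ` {1/2<..<1}. x' \<noteq> of_real (3/4) \<and> dist x' (of_real (3/4)) < e" 
          unfolding dist_norm by (intro bexI[of _ "of_real x"]) (auto simp only: of_real_eq_iff of_real_diff[symmetric] norm_of_real, auto)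
      qed
      show "complex_of_real ` {1/2<..<1} \<subseteq> S" using inS by auto
      show "complex_of_real (3/4) \<in> S" by (rule inS) auto
      show "z \<in> S" using z ballS by blast
      fix w assume "w \<in> complex_of_real ` {1/2<..<1}"
      then obtain x where x: "w = of_real x" "1/2 < x" "x < 1" by auto
      let ?g = "\<lambda>t. Lk (of_real t) w * pow_fps \<beta> p (of_real t)"
      have xr: "ereal x < fps_conv_radius p" using x(3) rad pi2 unfolding p_def by (auto elim!: less_le_trans[rotated])
      have HI: "(?g has_integral pow_fps \<beta> T w) {0..x}"
        using tw_op_integral[OF \<beta>, of x P] xr x unfolding p_def T_def by (simp add: Lk_def)
      obtain M where M: "\<And>\<xi> z. norm \<xi> \<le> 1 \<Longrightarrow> norm z \<le> 1 \<Longrightarrow> norm (Lk \<xi> z) \<le> M" using Mex[of 1] by blast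
      obtain B where B: "\<And>t. 0 < t \<Longrightarrow> t \<le> 1 \<Longrightarrow> norm (pow_fps \<beta> p (of_real t)) \<le> B" using Bex by blast
      have MB: "M \<ge> 0" "B \<ge> 0" using order_trans[OF norm_ge_zero M[of 0 0]] order_trans[OF norm_ge_zero B[of 1]] by auto
      let ?c = "\<lambda>n. contour_integral (linepath (of_real (s n)) w) (\<lambda>\<xi>. Lk \<xi> w * pow_fps \<beta> p \<xi>)"
      \<comment> \<open>The difference is the integral over [0, s n]. The maximum with the value at
        0 is taken because \<open>B\<close> covers positive arguments only.\<close>
      have est: "\<forall>\<^sub>F n in sequentially. norm (pow_fps \<beta> T w - ?c n) \<le> max (M * B) (norm (?g 0)) * s n"
      proof -
        have "\<forall>\<^sub>F n in sequentially. s n < 1/2" using order_tendstoD(2)[OF slim, of "1/2"] by simp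
        thus ?thesis
        proof eventually_elim
          case (elim n)
          have sn: "0 < s n" "s n < x" using s[of n] elim x by auto
          have c: "((\<lambda>\<xi>. Lk \<xi> w * pow_fps \<beta> p \<xi>) has_contour_integral ?c n) (linepath (of_real (s n)) w)"
            using sn x inS[of "s n"] inS[of x] by (intro has_contour_integral_integral contour_integrable_linepath_holomorphic[OF S(2) hint]) auto
          hence "(?g has_integral ?c n) {s n..x}"
            using sn x by (subst (asm) has_contour_integral_linepath_Reals_iff) auto
          moreover have "?g integrable_on {0..s n}"
            using HI sn by (intro integrable_on_subinterval[OF has_integral_integrable]) auto
          ultimately have comb: "(?g has_integral (integral {0..s n} ?g + ?c n)) {0..x}"
            using sn by (intro has_integral_combine[of 0 "s n" x]) (auto simp: has_integral_integral)
          have "pow_fps \<beta> T w - ?c n = integral {0..s n} ?g" using has_integral_unique[OF HI comb] by simp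
          moreover have "norm (integral {0..s n} ?g) \<le> max (M * B) (norm (?g 0)) * measure lborel (cbox 0 (s n))"
          proof (rule has_integral_bound)
            show "(?g has_integral integral {0..s n} ?g) (cbox 0 (s n))"
              using HI sn by (simp add: has_integral_integral[symmetric]) (rule integrable_on_subinterval[OF has_integral_integrable], auto)
            fix t assume t: "t \<in> cbox 0 (s n)"
            show "norm (?g t) \<le> max (M * B) (norm (?g 0))"
            proof (cases "t = 0")
              case False
              have "norm (?g t) \<le> M * B"
                unfolding norm_mult using t False s[of n] MB x by (intro mult_mono M B) auto
              thus ?thesis by simp
            qed simp
          qed (use MB in \<open>auto simp: le_max_iff_disj\<close>)
          ultimately show ?case using sn by simp
        qed
      qed
      have "(\<lambda>n. pow_fps \<beta> T w - ?c n) \<longlonglongrightarrow> 0"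
        by (rule Lim_null_comparison[OF est]) (use tendsto_mult_right_zero[OF slim] in simp)
      moreover have "(\<lambda>n. pow_fps \<beta> T w - ?c n) \<longlonglongrightarrow> pow_fps \<beta> T w - (A w + contour_integral (linepath 1 w) (\<lambda>\<xi>. Lk \<xi> w * pow_fps \<beta> p \<xi>))"
      proof -
        have "?c n = a n w + contour_integral (linepath 1 w) (\<lambda>\<xi>. Lk \<xi> w * pow_fps \<beta> p \<xi>)" for n
          unfolding a_def using tri[of "of_real (s n)" 1 w w] s[of n] inS[of "s n"] inS[of x] S1 x by auto
        thus ?thesis using alim by (auto intro!: tendsto_intros)
      qed
      ultimately show "D w = 0" unfolding D_def using LIMSEQ_unique by blast
    qed
    thus "pow_fps \<beta> T z = A z + contour_integral (linepath 1 z) (\<lambda>\<xi>. Lk \<xi> z * pow_fps \<beta> p \<xi>)" by (simp add: D_def)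
  qed
qed

end

subsection \<open>Iterated integration along chains of convex sets\<close>

lemma sing_set_iff: "z \<in> sing_set \<longleftrightarrow> exp z = 1"
proof
  assume "z \<in> sing_set"
  then obtain n :: int where "z = 2 * of_real pi * \<i> * of_int n" by (auto simp: sing_set_def)
  thus "exp z = 1" unfolding exp_eq_1 by (auto intro!: exI[of _ n])
next
  assume "exp z = 1"
  then obtain n where "Re z = 0" "Im z = of_int (2 * n) * pi" unfolding exp_eq_1 by blast
  hence "z = 2 * of_real pi * \<i> * of_int n" by (simp add: complex_eq_iff)
  thus "z \<in> sing_set" by (auto simp: sing_set_def)
qed

lemma closed_sing_set: "closed sing_set"
proof -
  have "sing_set = exp -` {1} \<inter> UNIV" by (auto simp: sing_set_iff)
  moreover have "closed (UNIV \<inter> exp -` {1::complex})"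
    by (rule continuous_closed_preimage) (auto intro: continuous_intros)
  ultimately show ?thesis by (simp add: Int_commute)
qed

lemma zero_in_sing_set: "0 \<in> sing_set" by (simp add: sing_set_iff)

text \<open>A path is replaced by convex open sets \<open>U j\<close>, consecutive ones sharing the base point
  \<open>p (j + 1)\<close>; a function continued along it becomes a compatible family, and \<open>acc\<close> collects the
  integral over the polygon through the base points.\<close>

definition chain :: "(nat \<Rightarrow> complex) \<Rightarrow> (nat \<Rightarrow> complex set) \<Rightarrow> bool" where
  "chain p U \<longleftrightarrow> (\<forall>j. open (U j) \<and> convex (U j) \<and> U j \<inter> sing_set = {} \<and> p j \<in> U j \<and> p (Suc j) \<in> U j)"

definition compat :: "(nat \<Rightarrow> complex set) \<Rightarrow> (nat \<Rightarrow> complex \<Rightarrow> complex) \<Rightarrow> bool" where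
  "compat U f \<longleftrightarrow> (\<forall>j. f j holomorphic_on U j \<and> (\<forall>z\<in>U j \<inter> U (Suc j). f j z = f (Suc j) z))"

primrec acc :: "(nat \<Rightarrow> complex) \<Rightarrow> (complex \<Rightarrow> complex \<Rightarrow> complex) \<Rightarrow> (complex \<Rightarrow> complex) \<Rightarrow>
    (nat \<Rightarrow> complex \<Rightarrow> complex) \<Rightarrow> nat \<Rightarrow> complex \<Rightarrow> complex" where
  "acc p L A f 0 = A"
| "acc p L A f (Suc j) = (\<lambda>z. acc p L A f j z + contour_integral (linepath (p j) (p (Suc j))) (\<lambda>\<xi>. L \<xi> z * f j \<xi>))"

text \<open>The continuation to \<open>U j\<close> of A(z) plus the integral of L(\<xi>,z) f(\<xi>)
  from \<open>p 0\<close> to z. The endpoint z occurs in the kernel along the whole polygon, so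
  \<open>acc\<close> has to remain a function of z on the entire plane.\<close>

definition Iop :: "(nat \<Rightarrow> complex) \<Rightarrow> (complex \<Rightarrow> complex \<Rightarrow> complex) \<Rightarrow> (complex \<Rightarrow> complex) \<Rightarrow>
    (nat \<Rightarrow> complex \<Rightarrow> complex) \<Rightarrow> nat \<Rightarrow> complex \<Rightarrow> complex" where
  "Iop p L A f j z = acc p L A f j z + contour_integral (linepath (p j) z) (\<lambda>\<xi>. L \<xi> z * f j \<xi>)"

lemma chainD:
  assumes "chain p U"
  shows "open (U j)" "convex (U j)" "U j \<inter> sing_set = {}" "p j \<in> U j" "p (Suc j) \<in> U j" "U j \<subseteq> - sing_set"
  using assms by (auto simp: chain_def)

lemma acc_holomorphic:
  assumes "chain p U" "jholo L (- sing_set) UNIV" "A holomorphic_on UNIV" "compat U f"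
  shows "acc p L A f j holomorphic_on UNIV"
proof (induction j)
  case (Suc j)
  have L: "jholo L (U j) UNIV" using jholo_subset[OF assms(2) chainD(6)[OF assms(1)]] by simp
  have "(\<lambda>z. contour_integral (linepath (p j) (p (Suc j))) (\<lambda>\<xi>. L \<xi> z * f j \<xi>)) holomorphic_on UNIV"
    by (rule jholo_compose_holo[OF jholo_line[OF L], of _ _ UNIV "\<lambda>_. p (Suc j)" "\<lambda>z. z"])
       (use chainD[OF assms(1)] assms(4) in \<open>auto simp: compat_def\<close>)
  thus ?case using Suc by (auto intro!: holomorphic_intros)
qed (use assms in simp)

text \<open>On an overlap, Cauchy's theorem in the convex set \<open>U j\<close> replaces the
  segment from \<open>p j\<close> to z by two segments through \<open>p (Suc j)\<close>. The second
  lies in the overlap, where both branches of \<open>f\<close> agree.\<close>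

lemma Iop_compat:
  assumes ch: "chain p U" and L: "jholo L (- sing_set) UNIV" and A: "A holomorphic_on UNIV" and f: "compat U f"
  shows "compat U (Iop p L A f)"
  unfolding compat_def
proof (intro allI conjI ballI)
  fix j
  note c = chainD[OF ch]
  have Lj: "jholo L (U i) UNIV" for i using jholo_subset[OF L c(6)] by simp
  have fj: "f i holomorphic_on U i" for i using f by (simp add: compat_def)
  have "(\<lambda>z. contour_integral (linepath (p j) z) (\<lambda>\<xi>. L \<xi> z * f j \<xi>)) holomorphic_on U j"
    by (rule holomorphic_line_diag[OF Lj c(2,1,4) fj])
  thus "Iop p L A f j holomorphic_on U j"
    unfolding Iop_def by (intro holomorphic_intros holomorphic_on_subset[OF acc_holomorphic[OF ch L A f]]) auto
  fix z assume z: "z \<in> U j \<inter> U (Suc j)"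
  let ?q = "p (Suc j)"
  have "closed_segment ?q z \<subseteq> U j \<inter> U (Suc j)"
    using z c by (intro closed_segment_subset convex_Int) auto
  hence "contour_integral (linepath ?q z) (\<lambda>\<xi>. L \<xi> z * f (Suc j) \<xi>) = contour_integral (linepath ?q z) (\<lambda>\<xi>. L \<xi> z * f j \<xi>)"
  proof (intro contour_integral_cong refl)
    fix \<xi> assume "\<xi> \<in> path_image (linepath ?q z)"
    hence "f j \<xi> = f (Suc j) \<xi>" using f \<open>closed_segment ?q z \<subseteq> U j \<inter> U (Suc j)\<close> unfolding compat_def by auto
    thus "L \<xi> z * f (Suc j) \<xi> = L \<xi> z * f j \<xi>" by simp
  qed
  moreover have "contour_integral (linepath (p j) z) (\<lambda>\<xi>. L \<xi> z * f j \<xi>) = 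
     contour_integral (linepath (p j) ?q) (\<lambda>\<xi>. L \<xi> z * f j \<xi>) + contour_integral (linepath ?q z) (\<lambda>\<xi>. L \<xi> z * f j \<xi>)"
    using z c by (intro contour_integral_triangle[of "U j"] holomorphic_intros fj jholo_slice[OF Lj]) auto
  ultimately show "Iop p L A f j z = Iop p L A f (Suc j) z" by (simp add: Iop_def)
qed

definition plen :: "(nat \<Rightarrow> complex) \<Rightarrow> nat \<Rightarrow> real" where
  "plen p j = (\<Sum>i<j. norm (p (Suc i) - p i))"

text \<open>The weight is a function of arc length and \<open>a\<close> is the length already
  covered, so that the bounds of successive segments telescope.\<close>

lemma segment_integral_bound:
  fixes w W :: "real \<Rightarrow> real"
  assumes W: "\<And>x. (W has_real_derivative w x) (at x)"
    and G: "G contour_integrable_on linepath p q" "\<And>\<xi>. \<xi> \<in> closed_segment p q \<Longrightarrow> norm (G \<xi>) \<le> M * w (a + norm (\<xi> - p))"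
  shows "norm (contour_integral (linepath p q) G) \<le> M * (W (a + norm (q - p)) - W a)"
proof -
  let ?d = "norm (q - p)"
  have dist: "norm (linepath p q t - p) = t * ?d" if "t \<in> {0..1}" for t
  proof -
    have "linepath p q t - p = t *\<^sub>R (q - p)" by (simp add: linepath_def algebra_simps)
    thus ?thesis using that by simp
  qed
  have "((\<lambda>t. w (a + t * ?d) * ?d) has_integral (W (a + 1 * ?d) - W (a + 0 * ?d))) {0..1}"
  proof (rule fundamental_theorem_of_calculus)
    fix t :: real
    have "((\<lambda>t. a + t * ?d) has_real_derivative ?d) (at t)" by (rule derivative_eq_intros refl | simp)+
    from DERIV_chain2[OF W this] have "((\<lambda>t. W (a + t * ?d)) has_real_derivative w (a + t * ?d) * ?d) (at t within {0..1})"
      by (rule has_field_derivative_at_within)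
    thus "((\<lambda>t. W (a + t * ?d)) has_vector_derivative w (a + t * ?d) * ?d) (at t within {0..1})"
      by (simp only: has_real_derivative_iff_has_vector_derivative)
  qed simp
  from has_integral_mult_right[OF this, of M]
  have I: "((\<lambda>t. M * (w (a + t * ?d) * ?d)) has_integral M * (W (a + ?d) - W a)) {0..1}" by simp
  have "(\<lambda>t. G (linepath p q t) * (q - p)) integrable_on {0..1}"
    using G(1) by (auto simp: contour_integrable_on_def has_contour_integral_linepath integrable_on_def)
  hence "norm (contour_integral (linepath p q) G) \<le> integral {0..1} (\<lambda>t. M * (w (a + t * ?d) * ?d))"
    unfolding contour_integral_linepath_eq_integral
  proof (rule integral_norm_bound_integral)
    show "(\<lambda>t. M * (w (a + t * ?d) * ?d)) integrable_on {0..1}" using I by blast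
    fix t :: real assume t: "t \<in> {0..1}"
    have "norm (G (linepath p q t)) \<le> M * w (a + t * ?d)" 
      using G(2)[OF linepath_in_path[OF t]] dist[OF t] by simp
    from mult_right_mono[OF this, of ?d] show "norm (G (linepath p q t) * (q - p)) \<le> M * (w (a + t * ?d) * ?d)"
      by (simp add: norm_mult mult_ac)
  qed
  also have "\<dots> = M * (W (a + ?d) - W a)" using I by (rule integral_unique)
  finally show ?thesis .
qed

definition region :: "real \<Rightarrow> real \<Rightarrow> complex set" where
  "region \<epsilon> r = {z. norm z \<le> r \<and> infdist z sing_set \<ge> \<epsilon>}"

lemma compact_region: "compact (region \<epsilon> r)"
proof -
  have "region \<epsilon> r = cball 0 r \<inter> {z. infdist z sing_set \<ge> \<epsilon>}" by (auto simp: region_def)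
  moreover have "closed {z. infdist z sing_set \<ge> \<epsilon>}" by (intro closed_Collect_le continuous_intros)
  ultimately show ?thesis by (simp add: compact_Int_closed)
qed

lemma region_sing: "\<epsilon> > 0 \<Longrightarrow> region \<epsilon> r \<inter> sing_set = {}"
  by (auto simp: region_def)

text \<open>The Volterra estimate: a bound by a weight \<open>w\<close> of the length covered
  becomes one by its primitive \<open>W\<close>. For w(x) = e^(\<mu>x) a primitive is w/\<mu>, the
  source of the contraction; for w = 1 the estimate bounds the logarithm.\<close>

lemma Iop_bound:
  fixes w W :: "real \<Rightarrow> real"
  assumes ch: "chain p U" and L: "jholo L (- sing_set) UNIV" and f: "compat U f"
    and W: "\<And>x. (W has_real_derivative w x) (at x)"
    and M: "M \<ge> 0" "\<And>\<xi>. \<xi> \<in> region \<epsilon> r \<Longrightarrow> norm (L \<xi> z) \<le> M"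
    and fb: "\<And>i \<xi>. i \<le> j \<Longrightarrow> \<xi> \<in> closed_segment (p i) (if i < j then p (Suc i) else z) \<Longrightarrow> norm (f i \<xi>) \<le> w (plen p i + norm (\<xi> - p i))"
    and seg: "\<And>i. i < j \<Longrightarrow> closed_segment (p i) (p (Suc i)) \<subseteq> region \<epsilon> r"
      "closed_segment (p j) z \<subseteq> region \<epsilon> r" "z \<in> U j"
  shows "norm (Iop p L A f j z) \<le> norm (A z) + M * (W (plen p j + norm (z - p j)) - W 0)"
proof -
  note c = chainD[OF ch]
  have Lj: "jholo L (U i) UNIV" for i using jholo_subset[OF L c(6)] by simp
  have fj: "f i holomorphic_on U i" for i using f by (simp add: compat_def)
  have ci: "(\<lambda>\<xi>. L \<xi> z * f i \<xi>) contour_integrable_on linepath (p i) q" if "q \<in> U i" for i q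
    using that c by (intro contour_integrable_linepath_holomorphic[of "U i"] holomorphic_intros fj jholo_slice[OF Lj]) auto
  have acc: "norm (acc p L A f i z) \<le> norm (A z) + M * (W (plen p i) - W 0)" if "i \<le> j" for i
    using that
  proof (induction i)
    case 0 thus ?case by (simp add: plen_def)
  next
    case (Suc i)
    have "norm (contour_integral (linepath (p i) (p (Suc i))) (\<lambda>\<xi>. L \<xi> z * f i \<xi>)) \<le> M * (W (plen p i + norm (p (Suc i) - p i)) - W (plen p i))"
    proof (rule segment_integral_bound[OF W ci[OF c(5)]])
      fix \<xi> assume "\<xi> \<in> closed_segment (p i) (p (Suc i))"
      thus "norm (L \<xi> z * f i \<xi>) \<le> M * w (plen p i + norm (\<xi> - p i))"
        unfolding norm_mult using Suc.prems seg(1)[of i] fb[of i \<xi>] M by (intro mult_mono) auto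
    qed
    moreover have "plen p (Suc i) = plen p i + norm (p (Suc i) - p i)" by (simp add: plen_def)
    ultimately have "norm (acc p L A f (Suc i) z) \<le> (norm (A z) + M * (W (plen p i) - W 0)) + M * (W (plen p (Suc i)) - W (plen p i))"
      unfolding acc.simps using Suc by (intro order_trans[OF norm_triangle_ineq] add_mono) auto
    thus ?case by (simp add: algebra_simps)
  qed
  have "norm (contour_integral (linepath (p j) z) (\<lambda>\<xi>. L \<xi> z * f j \<xi>)) \<le> M * (W (plen p j + norm (z - p j)) - W (plen p j))"
  proof (rule segment_integral_bound[OF W ci[OF seg(3)]])
    fix \<xi> assume "\<xi> \<in> closed_segment (p j) z"
    thus "norm (L \<xi> z * f j \<xi>) \<le> M * w (plen p j + norm (\<xi> - p j))"
      unfolding norm_mult using seg(2) fb[of j \<xi>] M by (intro mult_mono) auto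
  qed
  hence "norm (Iop p L A f j z) \<le> (norm (A z) + M * (W (plen p j) - W 0)) + M * (W (plen p j + norm (z - p j)) - W (plen p j))"
    unfolding Iop_def by (intro order_trans[OF norm_triangle_ineq] add_mono acc) auto
  thus ?thesis by (simp add: algebra_simps)
qed

lemma infdist_sing_set_ge: "(\<And>y. y \<in> sing_set \<Longrightarrow> d \<le> dist x y) \<Longrightarrow> infdist x sing_set \<ge> d"
  using zero_in_sing_set unfolding infdist_def by (auto intro!: cINF_greatest)

lemma compact_subset_region:
  assumes "compact X" "X \<inter> sing_set = {}"
  obtains \<epsilon> r where "\<epsilon> > 0" "X \<subseteq> region \<epsilon> r"
proof -
  obtain d where d: "d > 0" "\<And>x y. x \<in> X \<Longrightarrow> y \<in> sing_set \<Longrightarrow> d \<le> dist x y"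
    using separate_compact_closed[OF assms(1) closed_sing_set assms(2)] by blast
  obtain r where "\<forall>x\<in>X. norm x \<le> r" using assms(1) compact_imp_bounded bounded_iff by metis
  hence "X \<subseteq> region d r" unfolding region_def using d(2) infdist_sing_set_ge by blast
  thus ?thesis using that d(1) by blast
qed

lemma jholo_bounded:
  assumes "jholo L UNIV UNIV"
  obtains M where "M > 0" "\<And>\<xi> z. norm \<xi> \<le> r \<Longrightarrow> norm z \<le> r \<Longrightarrow> norm (L \<xi> z) \<le> M"
proof -
  have "compact ((\<lambda>p. L (fst p) (snd p)) ` (cball 0 r \<times> cball 0 r))"
    using assms unfolding jholo_def by (intro compact_continuous_image compact_Times) (auto intro: continuous_on_subset)
  then obtain M where M: "M > 0" "\<forall>y\<in>(\<lambda>p. L (fst p) (snd p)) ` (cball 0 r \<times> cball 0 r). norm y \<le> M"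
    using compact_imp_bounded bounded_pos by metis
  have "norm (L \<xi> z) \<le> M" if "norm \<xi> \<le> r" "norm z \<le> r" for \<xi> z
  proof -
    have "(\<xi>, z) \<in> cball 0 r \<times> cball 0 r" using that by auto
    thus ?thesis using M by (metis (no_types, lifting) fst_conv image_eqI snd_conv)
  qed
  thus ?thesis using that M by blast
qed

section \<open>The iterates on a chain and their geometric bound\<close>

locale borel_tower =
  fixes L :: "complex \<Rightarrow> complex \<Rightarrow> complex" and \<beta> :: complex and g :: "complex \<Rightarrow> complex"
    and A :: "nat \<Rightarrow> complex \<Rightarrow> complex" and \<Lambda> :: real
  assumes jholo_L: "jholo L UNIV UNIV" and g_hol: "g holomorphic_on UNIV" and A_hol: "\<And>k. A k holomorphic_on UNIV"
    and \<Lambda>: "0 < \<Lambda>" "\<Lambda> < 1" and A_bound: "\<And>r. \<exists>C. \<forall>k z. norm z \<le> r \<longrightarrow> norm (A k z) \<le> C * \<Lambda> ^ k"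
begin

lemma jholo_L': "jholo L (- sing_set) UNIV" using jholo_subset[OF jholo_L] by simp

lemma jholo_inv: "jholo (\<lambda>\<xi> z. 1 / \<xi>) (- sing_set) UNIV"
  by (rule jholo_fst) (use zero_in_sing_set in \<open>auto intro!: holomorphic_intros\<close>)

text \<open>The branch of log \<zeta> on \<open>U j\<close>, as an integral of 1/\<xi> along the
  chain; for chains that start at 1 it continues the principal branch.\<close>

definition lg :: "(nat \<Rightarrow> complex) \<Rightarrow> nat \<Rightarrow> complex \<Rightarrow> complex" where
  "lg p = Iop p (\<lambda>\<xi> z. 1 / \<xi>) (\<lambda>_. 0) (\<lambda>_ _. 1)"

text \<open>\<open>tow p k j\<close> will be the branch on \<open>U j\<close> of the k-th Borel
  transform. In the application \<open>g\<close> is the Borel transform of b_\<alpha> without its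
  factor \<zeta>^\<beta>, and \<open>A k\<close> is the integral from 0 to 1.\<close>

primrec tow :: "(nat \<Rightarrow> complex) \<Rightarrow> nat \<Rightarrow> nat \<Rightarrow> complex \<Rightarrow> complex" where
  "tow p 0 = (\<lambda>j z. exp (\<beta> * lg p j z) * g z / (exp z - 1))"
| "tow p (Suc k) = (\<lambda>j z. Iop p L (A k) (tow p k) j z / (exp z - 1))"

lemma compat_const: "compat U (\<lambda>_ _. 1)" by (simp add: compat_def)

lemma lg_compat: "chain p U \<Longrightarrow> compat U (lg p)"
  unfolding lg_def by (intro Iop_compat jholo_inv compat_const) auto

lemma exp_nz: "chain p U \<Longrightarrow> z \<in> U j \<Longrightarrow> exp z - 1 \<noteq> 0"
  using chainD(3) sing_set_iff by fastforce

lemma tow_compat: "chain p U \<Longrightarrow> compat U (tow p k)"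
proof (induction k)
  case 0
  show ?case unfolding compat_def
    using lg_compat[OF 0] exp_nz[OF 0] 
    by (auto simp: compat_def intro!: holomorphic_intros holomorphic_on_subset[OF g_hol])
next
  case (Suc k)
  have "compat U (Iop p L (A k) (tow p k))" by (intro Iop_compat jholo_L' A_hol Suc)
  thus ?case using exp_nz[OF Suc.prems] unfolding compat_def by (auto intro!: holomorphic_intros)
qed

text \<open>At the start of the chain nothing has been accumulated yet, so the recursion of
  \<open>tow\<close> is that of the germs on \<open>ball 1 1\<close>.\<close>

lemma tow_start:
  assumes ch: "chain p U" and p0: "p 0 = 1" and U0: "U 0 \<subseteq> ball 1 1"
    and \<phi>0: "\<And>z. z \<in> ball 1 1 \<Longrightarrow> (exp z - 1) * \<phi> 0 z = exp (\<beta> * Ln z) * g z"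
    and \<phi>S: "\<And>k z. z \<in> ball 1 1 \<Longrightarrow> (exp z - 1) * \<phi> (Suc k) z = A k z + contour_integral (linepath 1 z) (\<lambda>\<xi>. L \<xi> z * \<phi> k \<xi>)"
    and z: "z \<in> U 0"
  shows "tow p k 0 z = \<phi> k z"
  using z
proof (induction k arbitrary: z)
  case 0
  have seg: "closed_segment 1 z \<subseteq> ball 1 1" using 0 U0 by (intro closed_segment_subset) auto
  have Re: "Re x > 0" if "x \<in> ball 1 1" for x
    using that abs_Re_le_cmod[of "1 - x"] by (auto simp: dist_norm)
  have "((\<lambda>\<xi>. 1 / \<xi>) has_contour_integral (Ln (pathfinish (linepath 1 z)) - Ln (pathstart (linepath 1 z)))) (linepath 1 z)"
  proof (rule contour_integral_primitive[where S="ball 1 1"])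
    fix x :: complex assume "x \<in> ball 1 1"
    thus "(Ln has_field_derivative 1 / x) (at x within ball 1 1)"
      using Re[of x] by (intro DERIV_subset[OF has_field_derivative_Ln[THEN DERIV_cong]]) (auto simp: complex_nonpos_Reals_iff divide_inverse)
  qed (use seg in auto)
  hence "lg p 0 z = Ln z" unfolding lg_def Iop_def using p0 by (simp add: contour_integral_unique)
  thus ?case using \<phi>0[of z] 0 U0 exp_nz[OF ch 0] by (auto simp: field_simps)
next
  case (Suc k)
  have "closed_segment 1 z \<subseteq> U 0" using Suc.prems chainD[OF ch, of 0] p0 by (intro closed_segment_subset) auto
  hence "contour_integral (linepath 1 z) (\<lambda>\<xi>. L \<xi> z * tow p k 0 \<xi>) = contour_integral (linepath 1 z) (\<lambda>\<xi>. L \<xi> z * \<phi> k \<xi>)"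
    by (intro contour_integral_cong) (use Suc.IH in auto)
  thus ?case using \<phi>S[of z k] Suc.prems U0 exp_nz[OF ch Suc.prems] p0 by (auto simp: Iop_def field_simps)
qed

text \<open>\<open>C\<close> and \<open>\<mu>\<close> depend on \<open>\<epsilon>\<close> and
  \<open>r\<close> but neither on the chain nor on k. In the induction, the contributions of
  \<open>A k\<close> and of the integral to level k + 1 are each held to half of \<Lambda> times the
  bound of level k.\<close>

lemma tow_bound:
  assumes "\<epsilon> > 0"
  obtains C \<mu> where "C > 0" "\<mu> > 0" 
    "\<And>p U j z k. chain p U \<Longrightarrow> (\<And>i. i < j \<Longrightarrow> closed_segment (p i) (p (Suc i)) \<subseteq> region \<epsilon> r) \<Longrightarrow>
       closed_segment (p j) z \<subseteq> region \<epsilon> r \<Longrightarrow> z \<in> U j \<Longrightarrow>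
       norm (tow p k j z) \<le> C * \<Lambda> ^ k * exp (\<mu> * (plen p j + norm (z - p j)))"
proof -
  obtain M where M: "M > 0" "\<And>\<xi> z. norm \<xi> \<le> r \<Longrightarrow> norm z \<le> r \<Longrightarrow> norm (L \<xi> z) \<le> M" using jholo_bounded[OF jholo_L] by blast
  obtain CA where CA: "\<And>k z. norm z \<le> r \<Longrightarrow> norm (A k z) \<le> CA * \<Lambda> ^ k" using A_bound by blast
  have "continuous_on (region \<epsilon> r) (\<lambda>z. 1 / (exp z - 1))"
    using region_sing[OF assms] sing_set_iff by (intro continuous_intros) fastforce
  then obtain M1 where M1: "M1 > 0" "\<And>z. z \<in> region \<epsilon> r \<Longrightarrow> norm (1 / (exp z - 1)) \<le> M1"
    using compact_imp_bounded[OF compact_continuous_image[OF _ compact_region], of \<epsilon> r "\<lambda>z. 1 / (exp z - 1)"]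
    unfolding bounded_pos by (metis image_eqI)
  have "continuous_on (cball 0 r) g" using g_hol holomorphic_on_imp_continuous_on continuous_on_subset by blast
  then obtain G where G: "G > 0" "\<And>z. norm z \<le> r \<Longrightarrow> norm (g z) \<le> G"
    using compact_imp_bounded[OF compact_continuous_image[OF _ compact_cball], of 0 r g]
    unfolding bounded_pos by (metis image_eqI mem_cball_0)
  \<comment> \<open>The first summand controls \<zeta>^\<beta>, as 0 is singular and |log \<zeta>|
    is thus at most length/\<epsilon>. The second makes M1 M/\<mu> \<le> \<Lambda>/2.\<close>
  define \<mu> where "\<mu> = norm \<beta> / \<epsilon> + 2 * M1 * M / \<Lambda>"
  \<comment> \<open>The first summand settles k = 0; the second makes M1 |CA| at most \<Lambda>
    C/2.\<close>
  define C where "C = M1 * G + 2 * M1 * \<bar>CA\<bar> / \<Lambda>"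
  have \<mu>: "\<mu> > 0" "norm \<beta> / \<epsilon> \<le> \<mu>" "2 * M1 * M \<le> \<Lambda> * \<mu>" 
    using M1 M \<Lambda> assms by (auto simp: \<mu>_def field_simps intro!: add_nonneg_pos)
  have C: "C > 0" "M1 * G \<le> C" "2 * M1 * \<bar>CA\<bar> \<le> \<Lambda> * C" 
    using M1 G \<Lambda> by (auto simp: C_def field_simps intro!: add_pos_nonneg)
  show ?thesis
  proof (rule that[OF C(1) \<mu>(1)])
    fix p U j z k
    assume ch: "chain p U"
    show "(\<And>i. i < j \<Longrightarrow> closed_segment (p i) (p (Suc i)) \<subseteq> region \<epsilon> r) \<Longrightarrow>
       closed_segment (p j) z \<subseteq> region \<epsilon> r \<Longrightarrow> z \<in> U j \<Longrightarrow> norm (tow p k j z) \<le> C * \<Lambda> ^ k * exp (\<mu> * (plen p j + norm (z - p j)))"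
    proof (induction k arbitrary: j z)
      case 0
      have zr: "z \<in> region \<epsilon> r" using 0(2) by auto
      let ?x = "plen p j + norm (z - p j)"
      have x0: "?x \<ge> 0" by (simp add: plen_def sum_nonneg)
      have "norm (lg p j z) \<le> norm (0::complex) + 1 / \<epsilon> * (?x - 0)"
        unfolding lg_def
      proof (rule Iop_bound[OF ch jholo_inv compat_const, where w="\<lambda>_. 1"])
        show "norm (1 / \<xi>) \<le> 1 / \<epsilon>" if "\<xi> \<in> region \<epsilon> r" for \<xi> :: complex
        proof -
          have "\<epsilon> \<le> norm \<xi>" using that infdist_le[OF zero_in_sing_set, of \<xi>] by (simp add: region_def)
          thus ?thesis using assms by (simp add: norm_divide frac_le)
        qed
      qed (use 0 assms in auto)
      hence "norm \<beta> * norm (lg p j z) \<le> norm \<beta> / \<epsilon> * ?x" 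
        using mult_left_mono[of "norm (lg p j z)" "1 / \<epsilon> * ?x" "norm \<beta>"] by simp
      also have "\<dots> \<le> \<mu> * ?x" using \<mu> x0 by (intro mult_right_mono) auto
      finally have e: "norm (exp (\<beta> * lg p j z)) \<le> exp (\<mu> * ?x)"
        by (intro order_trans[OF norm_exp]) (simp add: norm_mult)
      have "norm (tow p 0 j z) = norm (exp (\<beta> * lg p j z)) * (norm (1 / (exp z - 1)) * norm (g z))"
        by (simp add: norm_mult norm_divide)
      also have "\<dots> \<le> exp (\<mu> * ?x) * (M1 * G)"
        using zr by (intro mult_mono e M1(2) G(2)) (auto simp: region_def M1(1) less_imp_le)
      also have "\<dots> \<le> exp (\<mu> * ?x) * C" using C by (intro mult_left_mono) auto
      finally show ?case by (simp add: mult_ac)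
    next
      case (Suc k)
      have zr: "z \<in> region \<epsilon> r" using Suc.prems(2) by auto
      let ?x = "plen p j + norm (z - p j)"
      define C' where "C' = C * \<Lambda> ^ k"
      have C': "C' > 0" using C \<Lambda> by (simp add: C'_def)
      have "norm (Iop p L (A k) (tow p k) j z) \<le> norm (A k z) + M * (C' * exp (\<mu> * ?x) / \<mu> - C' * exp (\<mu> * 0) / \<mu>)"
      proof (rule Iop_bound[OF ch jholo_L' tow_compat[OF ch], where w="\<lambda>x. C' * exp (\<mu> * x)"])
        show "((\<lambda>x. C' * exp (\<mu> * x) / \<mu>) has_real_derivative C' * exp (\<mu> * x)) (at x)" for x
          using \<mu>(1) by (auto intro!: derivative_eq_intros)
        show "norm (L \<xi> z) \<le> M" if "\<xi> \<in> region \<epsilon> r" for \<xi> using that zr M(2) by (auto simp: region_def)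
        fix i \<xi> assume i: "i \<le> j" and \<xi>: "\<xi> \<in> closed_segment (p i) (if i < j then p (Suc i) else z)"
        let ?q = "if i < j then p (Suc i) else z"
        have q: "?q \<in> U i" "closed_segment (p i) ?q \<subseteq> region \<epsilon> r" 
          using i Suc.prems chainD(5)[OF ch] by auto
        have "closed_segment (p i) \<xi> \<subseteq> closed_segment (p i) ?q" using \<xi> by (simp add: subset_closed_segment)
        moreover have "\<xi> \<in> U i" using \<xi> closed_segment_subset[OF chainD(4)[OF ch] q(1) chainD(2)[OF ch]] by blast
        ultimately show "norm (tow p k i \<xi>) \<le> C' * exp (\<mu> * (plen p i + norm (\<xi> - p i)))"
          unfolding C'_def using Suc.prems(1) i q(2) by (intro Suc.IH) auto
      qed (use Suc.prems M in auto)
      also have "\<dots> \<le> \<bar>CA\<bar> * \<Lambda> ^ k * exp (\<mu> * ?x) + M * (C' * exp (\<mu> * ?x) / \<mu>)"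
      proof (rule add_mono)
        have "norm (A k z) \<le> CA * \<Lambda> ^ k" using CA zr by (auto simp: region_def)
        also have "\<dots> \<le> \<bar>CA\<bar> * \<Lambda> ^ k * 1" using \<Lambda> by (simp add: mult_right_mono)
        also have "\<dots> \<le> \<bar>CA\<bar> * \<Lambda> ^ k * exp (\<mu> * ?x)" using \<mu> \<Lambda> by (intro mult_left_mono) (auto simp: plen_def sum_nonneg)
        finally show "norm (A k z) \<le> \<bar>CA\<bar> * \<Lambda> ^ k * exp (\<mu> * ?x)" .
        show "M * (C' * exp (\<mu> * ?x) / \<mu> - C' * exp (\<mu> * 0) / \<mu>) \<le> M * (C' * exp (\<mu> * ?x) / \<mu>)"
          using M C' \<mu> by (intro mult_left_mono) auto
      qed
      finally have I: "norm (Iop p L (A k) (tow p k) j z) \<le> \<Lambda> ^ k * exp (\<mu> * ?x) * (\<bar>CA\<bar> + M * C / \<mu>)"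
        by (simp add: C'_def algebra_simps)
      have "norm (tow p (Suc k) j z) = norm (1 / (exp z - 1)) * norm (Iop p L (A k) (tow p k) j z)"
        by (simp add: norm_mult norm_divide)
      also have "\<dots> \<le> M1 * (\<Lambda> ^ k * exp (\<mu> * ?x) * (\<bar>CA\<bar> + M * C / \<mu>))"
        using I zr M1 by (intro mult_mono) auto
      also have "\<dots> = \<Lambda> ^ k * exp (\<mu> * ?x) * (M1 * \<bar>CA\<bar> + M1 * M / \<mu> * C)" by (simp add: algebra_simps)
      also have "\<dots> \<le> \<Lambda> ^ k * exp (\<mu> * ?x) * (\<Lambda> * C)"
      proof (intro mult_left_mono)
        have "M1 * M / \<mu> \<le> \<Lambda> / 2" using \<mu> by (simp add: field_simps)
        hence "M1 * M / \<mu> * C \<le> \<Lambda> / 2 * C" using C by (intro mult_right_mono) auto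
        thus "M1 * \<bar>CA\<bar> + M1 * M / \<mu> * C \<le> \<Lambda> * C" using C(3) by linarith
      qed (use \<Lambda> in auto)
      finally show ?case by (simp add: mult_ac)
    qed
  qed
qed

text \<open>The segments to all points of \<open>S\<close>, together with the polygon, form a
  compact set away from the singularities, so one pair \<open>\<epsilon>\<close>, \<open>r\<close>
  serves all of \<open>S\<close>.\<close>

lemma tow_local_bound:
  assumes ch: "chain p U" and S: "compact S" "S \<subseteq> U j"
  obtains C where "C > 0" "\<And>k z. z \<in> S \<Longrightarrow> norm (tow p k j z) \<le> C * \<Lambda> ^ k"
proof -
  note c = chainD[OF ch]
  define X where "X = (\<Union>i<j. closed_segment (p i) (p (Suc i))) \<union> (\<lambda>q. linepath (p j) (fst q) (snd q)) ` (S \<times> {0..1})"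
  have "compact X" unfolding X_def
  proof (intro compact_Un compact_UN compact_continuous_image)
    show "continuous_on (S \<times> {0..1}) (\<lambda>q. linepath (p j) (fst q) (snd q))" unfolding linepath_def by (intro continuous_intros)
  qed (use S in \<open>auto intro!: compact_Times\<close>)
  moreover have "X \<inter> sing_set = {}"
  proof -
    have 1: "closed_segment (p i) (p (Suc i)) \<subseteq> U i" for i using c by (intro closed_segment_subset) auto
    have 2: "linepath (p j) z t \<in> U j" if "z \<in> S" "t \<in> {0..1}" for z t using c S that by (intro linepath_in_convex) auto
    have "X \<subseteq> - sing_set" unfolding X_def
    proof (intro Un_least UN_least image_subsetI)
      show "closed_segment (p i) (p (Suc i)) \<subseteq> - sing_set" for i using 1[of i] c(6)[of i] by (rule order_trans)
      show "linepath (p j) (fst q) (snd q) \<in> - sing_set" if "q \<in> S \<times> {0..1}" for q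
        by (rule subsetD[OF c(6)[of j]], rule 2) (use that in auto)
    qed
    thus ?thesis by blast
  qed
  ultimately obtain \<epsilon> r where er: "\<epsilon> > 0" "X \<subseteq> region \<epsilon> r" by (rule compact_subset_region)
  obtain C \<mu> where C: "C > 0" "\<mu> > 0" 
    "\<And>p U j z k. chain p U \<Longrightarrow> (\<And>i. i < j \<Longrightarrow> closed_segment (p i) (p (Suc i)) \<subseteq> region \<epsilon> r) \<Longrightarrow>
       closed_segment (p j) z \<subseteq> region \<epsilon> r \<Longrightarrow> z \<in> U j \<Longrightarrow>
       norm (tow p k j z) \<le> C * \<Lambda> ^ k * exp (\<mu> * (plen p j + norm (z - p j)))" by (rule tow_bound[OF er(1), of r]) blast
  obtain B where B: "\<forall>z\<in>S. norm z \<le> B" using S(1) compact_imp_bounded bounded_iff by metis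
  define E where "E = exp (\<mu> * (plen p j + (B + norm (p j))))"
  show ?thesis
  proof (rule that)
    show "C * E > 0" using C by (simp add: E_def)
    fix k z assume z: "z \<in> S"
    have "closed_segment (p j) z = linepath (p j) z ` {0..1}" by (simp add: linepath_image_01)
    hence "closed_segment (p j) z \<subseteq> X" using z unfolding X_def by force
    hence "norm (tow p k j z) \<le> C * \<Lambda> ^ k * exp (\<mu> * (plen p j + norm (z - p j)))"
    proof (intro C(3)[OF ch])
      show "closed_segment (p i) (p (Suc i)) \<subseteq> region \<epsilon> r" if "i < j" for i
        using er(2) that unfolding X_def by blast
    qed (use z S er(2) in auto)
    also have "\<dots> \<le> C * \<Lambda> ^ k * E" unfolding E_def
      using C \<Lambda> B z norm_triangle_ineq4[of z "p j"] by (intro mult_left_mono) auto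
    finally show "norm (tow p k j z) \<le> C * E * \<Lambda> ^ k" by (simp add: mult_ac)
  qed
qed

definition towsum :: "(nat \<Rightarrow> complex) \<Rightarrow> nat \<Rightarrow> complex \<Rightarrow> complex" where
  "towsum p j z = (\<Sum>k. tow p k j z)"

lemma tow_sums:
  assumes "chain p U" "z \<in> U j"
  shows "(\<lambda>k. tow p k j z) sums towsum p j z"
proof -
  obtain C where C: "\<And>k. norm (tow p k j z) \<le> C * \<Lambda> ^ k" using tow_local_bound[OF assms(1), of "{z}" j] assms(2) by auto
  have "summable (\<lambda>k. C * \<Lambda> ^ k)" using \<Lambda> by (intro summable_mult summable_geometric) auto
  hence "summable (\<lambda>k. tow p k j z)" by (rule summable_comparison_test') (rule C)
  thus ?thesis unfolding towsum_def by (rule summable_sums)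
qed

lemma towsum_compat:
  assumes ch: "chain p U"
  shows "compat U (towsum p)"
  unfolding compat_def
proof (intro allI conjI ballI)
  fix j
  show "towsum p j holomorphic_on U j"
  proof (rule holomorphic_uniform_sequence[OF chainD(1)[OF ch]])
    show "(\<lambda>z. \<Sum>k<n. tow p k j z) holomorphic_on U j" for n
      using tow_compat[OF ch] by (intro holomorphic_intros) (auto simp: compat_def)
    fix x assume "x \<in> U j"
    then obtain d where d: "d > 0" "cball x d \<subseteq> U j" using chainD(1)[OF ch] open_contains_cball by blast
    obtain C where "C > 0" and C: "\<And>k z. z \<in> cball x d \<Longrightarrow> norm (tow p k j z) \<le> C * \<Lambda> ^ k" by (rule tow_local_bound[OF ch compact_cball d(2)]) (rule that)
    have "uniform_limit (cball x d) (\<lambda>n z. \<Sum>k<n. tow p k j z) (towsum p j) sequentially"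
      unfolding towsum_def[abs_def] by (rule Weierstrass_m_test[OF C]) (use \<Lambda> in \<open>auto intro!: summable_mult summable_geometric\<close>)
    thus "\<exists>d>0. cball x d \<subseteq> U j \<and> uniform_limit (cball x d) (\<lambda>n z. \<Sum>k<n. tow p k j z) (towsum p j) sequentially" using d by blast
  qed
  fix z assume "z \<in> U j \<inter> U (Suc j)"
  thus "towsum p j z = towsum p (Suc j) z" using tow_compat[OF ch] by (simp add: towsum_def compat_def)
qed

end

subsection \<open>Analytic continuation along paths\<close>

lemma eventually_in_open: "open S \<Longrightarrow> x \<in> S \<Longrightarrow> (\<And>z. z \<in> S \<Longrightarrow> P z) \<Longrightarrow> \<forall>\<^sub>F z in nhds x. P z"
  unfolding eventually_nhds by blast

lemma continues_const:
  assumes "g analytic_on path_image \<gamma>"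
  shows "continues_along \<gamma> g g"
  unfolding continues_along_def
proof (intro exI[of _ "\<lambda>_. g"] conjI ballI)
  fix t :: real assume "t \<in> {0..1}"
  thus "g analytic_on {\<gamma> t}" using assms by (auto simp: path_image_def intro: analytic_on_subset)
qed (auto intro: exI[of _ 1])

lemma continues_cong:
  assumes "continues_along \<gamma> f g" "\<forall>\<^sub>F z in nhds (pathstart \<gamma>). f z = f' z" "\<forall>\<^sub>F z in nhds (pathfinish \<gamma>). g z = g' z"
  shows "continues_along \<gamma> f' g'"
proof -
  obtain F where F: "\<forall>t\<in>{0..1}. F t analytic_on {\<gamma> t} \<and>
              (\<exists>\<delta>>0. \<forall>u\<in>{0..1}. \<bar>u - t\<bar> < \<delta> \<longrightarrow> (\<forall>\<^sub>F z in nhds (\<gamma> u). F u z = F t z))"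
          "\<forall>\<^sub>F z in nhds (pathstart \<gamma>). F 0 z = f z" "\<forall>\<^sub>F z in nhds (pathfinish \<gamma>). F 1 z = g z"
    using assms(1) unfolding continues_along_def by blast
  have "\<forall>\<^sub>F z in nhds (pathstart \<gamma>). F 0 z = f' z" using F(2) assms(2) by eventually_elim simp
  moreover have "\<forall>\<^sub>F z in nhds (pathfinish \<gamma>). F 1 z = g' z" using F(3) assms(3) by eventually_elim simp
  ultimately show ?thesis unfolding continues_along_def using F(1) by blast
qed

lemma continues_join:
  assumes p: "path \<gamma>1" "path \<gamma>2" "pathfinish \<gamma>1 = pathstart \<gamma>2"
    and c: "continues_along \<gamma>1 f g" "continues_along \<gamma>2 g h"
  shows "continues_along (\<gamma>1 +++ \<gamma>2) f h"
proof -
  let ?\<gamma> = "\<gamma>1 +++ \<gamma>2"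
  obtain F1 where F1: "\<And>t. t \<in> {0..1} \<Longrightarrow> F1 t analytic_on {\<gamma>1 t}"
     "\<And>t. t \<in> {0..1} \<Longrightarrow> \<exists>\<delta>>0. \<forall>u\<in>{0..1}. \<bar>u - t\<bar> < \<delta> \<longrightarrow> (\<forall>\<^sub>F z in nhds (\<gamma>1 u). F1 u z = F1 t z)"
     "\<forall>\<^sub>F z in nhds (pathstart \<gamma>1). F1 0 z = f z" "\<forall>\<^sub>F z in nhds (pathfinish \<gamma>1). F1 1 z = g z"
    using c(1) unfolding continues_along_def by blast
  obtain F2 where F2: "\<And>t. t \<in> {0..1} \<Longrightarrow> F2 t analytic_on {\<gamma>2 t}"
     "\<And>t. t \<in> {0..1} \<Longrightarrow> \<exists>\<delta>>0. \<forall>u\<in>{0..1}. \<bar>u - t\<bar> < \<delta> \<longrightarrow> (\<forall>\<^sub>F z in nhds (\<gamma>2 u). F2 u z = F2 t z)"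
     "\<forall>\<^sub>F z in nhds (pathstart \<gamma>2). F2 0 z = g z" "\<forall>\<^sub>F z in nhds (pathfinish \<gamma>2). F2 1 z = h z"
    using c(2) unfolding continues_along_def by blast
  define F where "F t = (if t \<le> 1/2 then F1 (2 * t) else F2 (2 * t - 1))" for t :: real
  have \<gamma>: "?\<gamma> t = (if t \<le> 1/2 then \<gamma>1 (2 * t) else \<gamma>2 (2 * t - 1))" for t by (simp add: joinpaths_def)
  have pj: "path ?\<gamma>" using p by simp
  have mid: "\<forall>\<^sub>F z in nhds (pathfinish \<gamma>1). F2 0 z = F1 1 z"
    using F1(4) F2(3) unfolding p(3) by eventually_elim simp
  show ?thesis unfolding continues_along_def
  proof (intro exI[of _ F] conjI ballI)
    fix t :: real assume t: "t \<in> {0..1}"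
    show "F t analytic_on {?\<gamma> t}" using F1(1)[of "2 * t"] F2(1)[of "2 * t - 1"] t by (auto simp: F_def \<gamma>)
    consider "t < 1/2" | "t = 1/2" | "t > 1/2" by linarith
    thus "\<exists>\<delta>>0. \<forall>u\<in>{0..1}. \<bar>u - t\<bar> < \<delta> \<longrightarrow> (\<forall>\<^sub>F z in nhds (?\<gamma> u). F u z = F t z)"
    proof cases
      case 1
      then obtain \<delta> where \<delta>: "\<delta> > 0" "\<And>u. u \<in> {0..1} \<Longrightarrow> \<bar>u - 2 * t\<bar> < \<delta> \<Longrightarrow> (\<forall>\<^sub>F z in nhds (\<gamma>1 u). F1 u z = F1 (2 * t) z)"
        using F1(2)[of "2 * t"] t by auto
      show ?thesis
      proof (intro exI[of _ "min (\<delta> / 2) (1/2 - t)"] conjI ballI impI)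
        fix u :: real assume u: "u \<in> {0..1}" "\<bar>u - t\<bar> < min (\<delta> / 2) (1/2 - t)"
        hence u2: "u \<le> 1/2" "\<bar>2 * u - 2 * t\<bar> < \<delta>" by (auto simp: abs_if split: if_splits)
        thus "\<forall>\<^sub>F z in nhds (?\<gamma> u). F u z = F t z" using \<delta>(2)[of "2 * u"] u 1 by (simp add: F_def \<gamma>)
      qed (use \<delta> 1 in auto)
    next
      case 3
      then obtain \<delta> where \<delta>: "\<delta> > 0" "\<And>u. u \<in> {0..1} \<Longrightarrow> \<bar>u - (2 * t - 1)\<bar> < \<delta> \<Longrightarrow> (\<forall>\<^sub>F z in nhds (\<gamma>2 u). F2 u z = F2 (2 * t - 1) z)"
        using F2(2)[of "2 * t - 1"] t by auto
      show ?thesis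
      proof (intro exI[of _ "min (\<delta> / 2) (t - 1/2)"] conjI ballI impI)
        fix u :: real assume u: "u \<in> {0..1}" "\<bar>u - t\<bar> < min (\<delta> / 2) (t - 1/2)"
        hence u2: "u > 1/2" "\<bar>(2 * u - 1) - (2 * t - 1)\<bar> < \<delta>" by (auto simp: abs_if split: if_splits)
        thus "\<forall>\<^sub>F z in nhds (?\<gamma> u). F u z = F t z" using \<delta>(2)[of "2 * u - 1"] u 3 by (simp add: F_def \<gamma>)
      qed (use \<delta> 3 in auto)
    next
      case 2
      obtain \<delta>1 where \<delta>1: "\<delta>1 > 0" "\<And>u. u \<in> {0..1} \<Longrightarrow> \<bar>u - 1\<bar> < \<delta>1 \<Longrightarrow> (\<forall>\<^sub>F z in nhds (\<gamma>1 u). F1 u z = F1 1 z)"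
        using F1(2)[of 1] by auto
      obtain \<delta>2 where \<delta>2: "\<delta>2 > 0" "\<And>u. u \<in> {0..1} \<Longrightarrow> \<bar>u - 0\<bar> < \<delta>2 \<Longrightarrow> (\<forall>\<^sub>F z in nhds (\<gamma>2 u). F2 u z = F2 0 z)"
        using F2(2)[of 0] by auto
      \<comment> \<open>At the junction the two families agree only as germs. Times beyond 1/2 must
        be so close that \<gamma>2 is still in the set \<open>S\<close> of agreement.\<close>
      obtain S where S: "open S" "pathfinish \<gamma>1 \<in> S" "\<And>z. z \<in> S \<Longrightarrow> F2 0 z = F1 1 z"
        using mid unfolding eventually_nhds by blast
      have "continuous_on {0..1} \<gamma>2" using p(2) by (simp add: path_def)
      then obtain \<delta>3 where \<delta>3: "\<delta>3 > 0" "\<And>u. u \<in> {0..1} \<Longrightarrow> dist u 0 < \<delta>3 \<Longrightarrow> \<gamma>2 u \<in> S"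
      proof -
        assume a: "continuous_on {0..1} \<gamma>2" and th: "\<And>\<delta>3. \<delta>3 > 0 \<Longrightarrow> (\<And>u. u \<in> {0..1} \<Longrightarrow> dist u 0 < \<delta>3 \<Longrightarrow> \<gamma>2 u \<in> S) \<Longrightarrow> thesis"
        have "\<gamma>2 0 \<in> S" using S(2) p(3) by (simp add: pathstart_def)
        then obtain e where e: "e > 0" "ball (\<gamma>2 0) e \<subseteq> S" using S(1) openE by blast
        obtain d where "d > 0" "\<forall>u\<in>{0..1}. dist u 0 < d \<longrightarrow> dist (\<gamma>2 u) (\<gamma>2 0) < e"
          using a e(1) unfolding continuous_on_iff by force
        thus thesis using th[of d] e(2) by (auto simp: dist_commute subset_iff)
      qed
      show ?thesis
      proof (intro exI[of _ "min (\<delta>1 / 2) (min (\<delta>2 / 2) (\<delta>3 / 2))"] conjI ballI impI)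
        fix u :: real assume u: "u \<in> {0..1}" "\<bar>u - t\<bar> < min (\<delta>1 / 2) (min (\<delta>2 / 2) (\<delta>3 / 2))"
        have d: "\<bar>u - 1/2\<bar> < \<delta>1 / 2" "\<bar>u - 1/2\<bar> < \<delta>2 / 2" "\<bar>u - 1/2\<bar> < \<delta>3 / 2" using u 2 by auto
        have "2 * t = 1" using 2 by simp
        hence Ft: "F t = F1 1" unfolding F_def using 2 by (simp only: order_refl if_True)
        show "\<forall>\<^sub>F z in nhds (?\<gamma> u). F u z = F t z"
        proof (cases "u \<le> 1/2")
          case True
          hence "\<forall>\<^sub>F z in nhds (\<gamma>1 (2 * u)). F1 (2 * u) z = F1 1 z" using u d by (intro \<delta>1(2)) auto
          thus ?thesis unfolding Ft using True by (simp add: F_def \<gamma>)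
        next
          case False
          hence "\<forall>\<^sub>F z in nhds (\<gamma>2 (2 * u - 1)). F2 (2 * u - 1) z = F2 0 z"
            using u d by (intro \<delta>2(2)) auto
          moreover have "\<gamma>2 (2 * u - 1) \<in> S" using u d False by (intro \<delta>3(2)) (auto simp: dist_real_def)
          hence "\<forall>\<^sub>F z in nhds (\<gamma>2 (2 * u - 1)). F2 0 z = F1 1 z" by (rule eventually_in_open[OF S(1)]) (rule S(3))
          ultimately have "\<forall>\<^sub>F z in nhds (\<gamma>2 (2 * u - 1)). F2 (2 * u - 1) z = F1 1 z" by eventually_elim simp
          thus ?thesis unfolding Ft using False by (simp add: F_def \<gamma>)
        qed
      qed (use \<delta>1 \<delta>2 \<delta>3 in auto)
    qed
  next
    show "\<forall>\<^sub>F z in nhds (pathstart ?\<gamma>). F 0 z = f z" using F1(3) by (simp add: F_def)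
    show "\<forall>\<^sub>F z in nhds (pathfinish ?\<gamma>). F 1 z = h z" using F2(4) by (simp add: F_def)
  qed
qed

text \<open>Identity theorem on a disc: two analytic functions that agree near one of its points
  agree on all of it, so agreement of germs is locally constant.\<close>

lemma analytic_germs_transfer:
  assumes "F analytic_on {a}" "G analytic_on {a}"
  obtains e where "e > 0" "\<And>b. b \<in> ball a e \<Longrightarrow> (\<forall>\<^sub>F z in nhds b. F z = G z) \<longleftrightarrow> (\<forall>\<^sub>F z in nhds a. F z = G z)"
proof -
  obtain e1 e2 where e: "e1 > 0" "F holomorphic_on ball a e1" "e2 > 0" "G holomorphic_on ball a e2"
    using assms unfolding analytic_on_def by auto
  define e where "e = min e1 e2"
  have hol: "F holomorphic_on ball a e" "G holomorphic_on ball a e" "e > 0"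
    using e by (auto simp: e_def intro: holomorphic_on_subset)
  have eq: "F z = G z" if b: "b \<in> ball a e" and ev: "\<forall>\<^sub>F z in nhds b. F z = G z" and z: "z \<in> ball a e" for b z
  proof -
    obtain S where S: "open S" "b \<in> S" "\<And>z. z \<in> S \<Longrightarrow> F z = G z" using ev unfolding eventually_nhds by blast
    show ?thesis
      by (rule analytic_continuation_open[of "S \<inter> ball a e" "ball a e" F G]) (use S b z hol in auto)
  qed
  show ?thesis
  proof (rule that[OF hol(3)])
    fix b assume b: "b \<in> ball a e"
    show "(\<forall>\<^sub>F z in nhds b. F z = G z) \<longleftrightarrow> (\<forall>\<^sub>F z in nhds a. F z = G z)"
    proof
      assume "\<forall>\<^sub>F z in nhds b. F z = G z"
      thus "\<forall>\<^sub>F z in nhds a. F z = G z"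
        using eq[OF b] hol(3) by (intro eventually_in_open[OF open_ball[of a e]]) auto
    next
      assume "\<forall>\<^sub>F z in nhds a. F z = G z"
      thus "\<forall>\<^sub>F z in nhds b. F z = G z"
        using eq[of a] hol(3) b by (intro eventually_in_open[OF open_ball[of a e]]) auto
    qed
  qed
qed

text \<open>Agreement of the two families at time t is locally constant in t, and the unit interval
  is connected.\<close>

lemma continues_unique:
  assumes p: "path \<gamma>" and c: "continues_along \<gamma> f g1" "continues_along \<gamma> f g2"
  shows "\<forall>\<^sub>F z in nhds (pathfinish \<gamma>). g1 z = g2 z"
proof -
  obtain F where F: "\<And>t. t \<in> {0..1} \<Longrightarrow> F t analytic_on {\<gamma> t}"
     "\<And>t. t \<in> {0..1} \<Longrightarrow> \<exists>\<delta>>0. \<forall>u\<in>{0..1}. \<bar>u - t\<bar> < \<delta> \<longrightarrow> (\<forall>\<^sub>F z in nhds (\<gamma> u). F u z = F t z)"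
     "\<forall>\<^sub>F z in nhds (pathstart \<gamma>). F 0 z = f z" "\<forall>\<^sub>F z in nhds (pathfinish \<gamma>). F 1 z = g1 z"
    using c(1) unfolding continues_along_def by blast
  obtain G where G: "\<And>t. t \<in> {0..1} \<Longrightarrow> G t analytic_on {\<gamma> t}"
     "\<And>t. t \<in> {0..1} \<Longrightarrow> \<exists>\<delta>>0. \<forall>u\<in>{0..1}. \<bar>u - t\<bar> < \<delta> \<longrightarrow> (\<forall>\<^sub>F z in nhds (\<gamma> u). G u z = G t z)"
     "\<forall>\<^sub>F z in nhds (pathstart \<gamma>). G 0 z = f z" "\<forall>\<^sub>F z in nhds (pathfinish \<gamma>). G 1 z = g2 z"
    using c(2) unfolding continues_along_def by blast
  define P where "P t = (\<forall>\<^sub>F z in nhds (\<gamma> t). F t z = G t z)" for t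
  have "P 1 = P 0"
  proof (rule connected_equivalence_relation[of "{0..1::real}" 1 0 "\<lambda>s t. P s = P t"])
    fix t :: real assume t: "t \<in> {0..1}"
    obtain d1 where d1: "d1 > 0" "\<And>u. u \<in> {0..1} \<Longrightarrow> \<bar>u - t\<bar> < d1 \<Longrightarrow> (\<forall>\<^sub>F z in nhds (\<gamma> u). F u z = F t z)" using F(2)[OF t] by blast
    obtain d2 where d2: "d2 > 0" "\<And>u. u \<in> {0..1} \<Longrightarrow> \<bar>u - t\<bar> < d2 \<Longrightarrow> (\<forall>\<^sub>F z in nhds (\<gamma> u). G u z = G t z)" using G(2)[OF t] by blast
    obtain e where e: "e > 0" "\<And>b. b \<in> ball (\<gamma> t) e \<Longrightarrow> (\<forall>\<^sub>F z in nhds b. F t z = G t z) \<longleftrightarrow> (\<forall>\<^sub>F z in nhds (\<gamma> t). F t z = G t z)"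
      using analytic_germs_transfer[OF F(1)[OF t] G(1)[OF t]] by blast
    obtain d3 where d3: "d3 > 0" "\<And>u. u \<in> {0..1} \<Longrightarrow> dist u t < d3 \<Longrightarrow> dist (\<gamma> u) (\<gamma> t) < e"
      using p e(1) t unfolding path_def continuous_on_iff by blast
    define d where "d = min d1 (min d2 d3)"
    have "P t = P u" if u: "u \<in> {0..1} \<inter> ball t d" for u
    proof -
      have u': "u \<in> {0..1}" "\<bar>u - t\<bar> < d1" "\<bar>u - t\<bar> < d2" "dist u t < d3"
        using u by (auto simp: d_def dist_real_def abs_minus_commute)
      have "P u \<longleftrightarrow> (\<forall>\<^sub>F z in nhds (\<gamma> u). F t z = G t z)"
        unfolding P_def
      proof
        assume "\<forall>\<^sub>F z in nhds (\<gamma> u). F u z = G u z"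
        thus "\<forall>\<^sub>F z in nhds (\<gamma> u). F t z = G t z" using d1(2)[OF u'(1,2)] d2(2)[OF u'(1,3)] by eventually_elim simp
      next
        assume "\<forall>\<^sub>F z in nhds (\<gamma> u). F t z = G t z"
        thus "\<forall>\<^sub>F z in nhds (\<gamma> u). F u z = G u z" using d1(2)[OF u'(1,2)] d2(2)[OF u'(1,3)] by eventually_elim simp
      qed
      also have "\<dots> \<longleftrightarrow> P t" unfolding P_def using e(2) d3(2)[OF u'(1,4)] by (simp add: dist_commute)
      finally show ?thesis by simp
    qed
    moreover have "openin (top_of_set {0..1}) ({0..1} \<inter> ball t d)" by (simp add: openin_open_Int)
    moreover have "t \<in> {0..1} \<inter> ball t d" using t d1 d2 d3 by (auto simp: d_def)
    ultimately show "\<exists>T. openin (top_of_set {0..1}) T \<and> t \<in> T \<and> (\<forall>x\<in>T. P t = P x)" by blast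
  qed auto
  moreover have "P 0" unfolding P_def using F(3) G(3) unfolding pathstart_def by eventually_elim simp
  ultimately have "\<forall>\<^sub>F z in nhds (pathfinish \<gamma>). F 1 z = G 1 z" unfolding P_def pathfinish_def by simp
  thus ?thesis using F(4) G(4) by eventually_elim simp
qed

text \<open>\<open>cont\<close> is a choice among continuations that may differ as functions; by
  uniqueness of the germ its value at the endpoint is determined.\<close>

lemma cont_eqI:
  assumes "path \<gamma>" "continues_along \<gamma> f g"
  shows "cont \<gamma> f (pathfinish \<gamma>) = g (pathfinish \<gamma>)"
proof -
  have "continues_along \<gamma> f (cont \<gamma> f)" unfolding cont_def using someI[of "continues_along \<gamma> f", OF assms(2)] .
  from continues_unique[OF assms(1) this assms(2)] show ?thesis by (rule eventually_nhds_x_imp_x)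
qed

text \<open>At time t the branch with index floor(n t) is used. Near t this index changes by at most
  one, and neighbouring branches agree on the overlap of their sets.\<close>

lemma chain_continues:
  assumes path: "path \<gamma>" and n: "n > 0" and ch: "chain p U" and f: "compat U f"
    and p: "\<And>j. j \<le> n \<Longrightarrow> p j = \<gamma> (real j / real n)"
    and seg: "\<And>j s. j < n \<Longrightarrow> real j / n \<le> s \<Longrightarrow> s \<le> (real j + 1) / n \<Longrightarrow> \<gamma> s \<in> U j"
  shows "continues_along \<gamma> (f 0) (f n)"
proof -
  define J where "J t = nat \<lfloor>real n * t\<rfloor>" for t
  note c = chainD[OF ch]
  have J: "real (J t) / n \<le> t" "t < (real (J t) + 1) / n" "J t \<le> n" if "t \<in> {0..1}" for t
  proof -
    have "real (J t) = of_int \<lfloor>real n * t\<rfloor>" using that by (simp add: J_def)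
    hence "real (J t) \<le> real n * t" "real n * t < real (J t) + 1" by linarith+
    thus "real (J t) / n \<le> t" "t < (real (J t) + 1) / n" using n by (auto simp: field_simps)
    have "real n * t \<le> real n * 1" using that by (intro mult_left_mono) auto
    hence "real (J t) \<le> real n" using \<open>real (J t) \<le> real n * t\<close> by linarith
    thus "J t \<le> n" by simp
  qed
  have inU: "\<gamma> t \<in> U (J t)" if t: "t \<in> {0..1}" for t
  proof (cases "J t < n")
    case True thus ?thesis using seg[of "J t" t] J[OF t] by auto
  next
    case False
    hence "J t = n" using J[OF t] by simp
    hence "t = 1" using J(1)[OF t] t n by simp
    thus ?thesis using p[of n] c(4)[of n] \<open>J t = n\<close> n by simp
  qed
  have fh: "f j holomorphic_on U j" for j using f by (simp add: compat_def)
  have main: "f (J t) analytic_on {\<gamma> t}"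
    "\<exists>\<delta>>0. \<forall>u\<in>{0..1}. \<bar>u - t\<bar> < \<delta> \<longrightarrow> (\<forall>\<^sub>F z in nhds (\<gamma> u). f (J u) z = f (J t) z)"
    if t: "t \<in> {0..1}" for t
  proof -
    show "f (J t) analytic_on {\<gamma> t}" 
      using fh[of "J t"] c(1) inU[OF t] by (meson analytic_on_open analytic_on_subset empty_subsetI insert_subset)
    obtain e where e: "e > 0" "ball (\<gamma> t) e \<subseteq> U (J t)" using c(1) inU[OF t] openE by blast
    obtain d where d: "d > 0" "\<And>u. u \<in> {0..1} \<Longrightarrow> dist u t < d \<Longrightarrow> dist (\<gamma> u) (\<gamma> t) < e"
      using path e(1) t unfolding path_def continuous_on_iff by blast
    \<comment> \<open>\<open>d\<close> keeps \<gamma> u in \<open>U (J t)\<close>,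
      \<open>1 / n\<close> keeps the index from dropping by more than one, and the last bound keeps
      it from exceeding \<open>J t\<close>.\<close>
    define \<delta> where "\<delta> = min d (min (1 / n) ((real (J t) + 1) / n - t))"
    have "\<forall>\<^sub>F z in nhds (\<gamma> u). f (J u) z = f (J t) z" if u: "u \<in> {0..1}" "\<bar>u - t\<bar> < \<delta>" for u
    proof -
      have u2: "\<bar>u - t\<bar> < d" "\<bar>u - t\<bar> < 1 / n" "u < (real (J t) + 1) / n" using u(2) by (auto simp: \<delta>_def)
      have gu: "\<gamma> u \<in> U (J t)" using d(2)[OF u(1)] u2(1) e(2) by (auto simp: dist_real_def dist_commute subset_iff)
      have "real (J u) / n < (real (J t) + 1) / n" using J(1)[OF u(1)] u2(3) by linarith
      hence le: "J u \<le> J t" using n by (simp add: field_simps)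
      have "real (J t) / n - 1 / n < (real (J u) + 1) / n" using J(2)[OF u(1)] J(1)[OF t] u2(2) by linarith
      hence "(real (J t) - 1) / n < (real (J u) + 1) / n" by (simp add: diff_divide_distrib)
      hence "real (J t) - 1 < real (J u) + 1" using n by (simp add: divide_less_cancel)
      hence "J t \<le> Suc (J u)" by linarith
      hence "J t = J u \<or> J t = Suc (J u)" using le by linarith
      thus ?thesis
      proof
        assume *: "J t = Suc (J u)"
        have "\<gamma> u \<in> U (J u) \<inter> U (Suc (J u))" using inU[OF u(1)] gu * by auto
        thus ?thesis unfolding * using f c(1)
          by (intro eventually_in_open[of "U (J u) \<inter> U (Suc (J u))"]) (auto simp: compat_def)
      qed simp
    qed
    moreover have "\<delta> > 0" using d n J(2)[OF t] by (auto simp: \<delta>_def)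
    ultimately show "\<exists>\<delta>>0. \<forall>u\<in>{0..1}. \<bar>u - t\<bar> < \<delta> \<longrightarrow> (\<forall>\<^sub>F z in nhds (\<gamma> u). f (J u) z = f (J t) z)" by blast
  qed
  show ?thesis unfolding continues_along_def
  proof (intro exI[of _ "\<lambda>t. f (J t)"] conjI ballI)
    show "\<forall>\<^sub>F z in nhds (pathstart \<gamma>). f (J 0) z = f 0 z" by (simp add: J_def)
    show "\<forall>\<^sub>F z in nhds (pathfinish \<gamma>). f (J 1) z = f n z" by (simp add: J_def)
  qed (use main in auto)
qed

section \<open>Chains subordinate to a given path\<close>

lemma path_mesh:
  assumes "path \<gamma>" "e > 0"
  obtains n where "n > 0" "\<And>s t. s \<in> {0..1} \<Longrightarrow> t \<in> {0..1} \<Longrightarrow> \<bar>s - t\<bar> \<le> 1 / real n \<Longrightarrow> dist (\<gamma> s) (\<gamma> t) < e"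
proof -
  have "uniformly_continuous_on {0..1} \<gamma>" using assms(1) by (intro compact_uniformly_continuous) (auto simp: path_def)
  then obtain d where d: "d > 0" "\<And>s t. s \<in> {0..1} \<Longrightarrow> t \<in> {0..1} \<Longrightarrow> dist s t < d \<Longrightarrow> dist (\<gamma> s) (\<gamma> t) < e"
    using assms(2) unfolding uniformly_continuous_on_def by metis
  obtain m where m: "inverse (real (Suc m)) < d" using reals_Archimedean d(1) by blast
  show ?thesis
    by (rule that[of "Suc m"]) (use m in \<open>auto intro!: d(2) simp: dist_real_def inverse_eq_divide\<close>)
qed

text \<open>Frozen at the endpoint for j > n, since chains are infinite sequences.\<close>

definition path_pts :: "(real \<Rightarrow> complex) \<Rightarrow> nat \<Rightarrow> nat \<Rightarrow> complex" where
  "path_pts \<gamma> n j = \<gamma> (real (min j n) / real n)"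

lemma ball_chain:
  assumes path: "path \<gamma>" and n: "n > 0"
    and mesh: "\<And>s t. s \<in> {0..1} \<Longrightarrow> t \<in> {0..1} \<Longrightarrow> \<bar>s - t\<bar> \<le> 1 / real n \<Longrightarrow> dist (\<gamma> s) (\<gamma> t) < r'"
    and r: "r' \<le> r" and free: "\<And>t. t \<in> {0..1} \<Longrightarrow> ball (\<gamma> t) r \<inter> sing_set = {}"
  shows "chain (path_pts \<gamma> n) (\<lambda>j. ball (path_pts \<gamma> n j) r)"
    and "\<And>j. dist (path_pts \<gamma> n j) (path_pts \<gamma> n (Suc j)) < r'"
    and "\<And>j s. j < n \<Longrightarrow> real j / n \<le> s \<Longrightarrow> s \<le> (real j + 1) / n \<Longrightarrow> \<gamma> s \<in> ball (path_pts \<gamma> n j) r"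
proof -
  have in01: "real (min j n) / real n \<in> {0..1}" for j using n by auto
  show d: "dist (path_pts \<gamma> n j) (path_pts \<gamma> n (Suc j)) < r'" for j
    unfolding path_pts_def
  proof (rule mesh[OF in01 in01])
    have "\<bar>real (min j n) - real (min (Suc j) n)\<bar> \<le> 1" by auto
    thus "\<bar>real (min j n) / real n - real (min (Suc j) n) / real n\<bar> \<le> 1 / real n"
      using n by (simp add: diff_divide_distrib[symmetric] divide_right_mono)
  qed
  have "r' > 0" using mesh[of 0 0] by simp
  thus "chain (path_pts \<gamma> n) (\<lambda>j. ball (path_pts \<gamma> n j) r)"
    unfolding chain_def using d r free[OF in01] by (auto simp: path_pts_def intro: less_le_trans)
  show "\<gamma> s \<in> ball (path_pts \<gamma> n j) r" if "j < n" "real j / n \<le> s" "s \<le> (real j + 1) / n" for j s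
  proof -
    have "(real j + 1) / n \<le> 1" using that n by (simp add: field_simps)
    moreover have "0 \<le> real j / n" by simp
    ultimately have s01: "s \<in> {0..1}" using that by (simp only: atLeastAtMost_iff) linarith
    have "\<bar>real (min j n) / real n - s\<bar> \<le> 1 / n" using that by (simp add: add_divide_distrib)
    from mesh[OF in01 s01 this] show ?thesis using r by (simp add: path_pts_def)
  qed
qed

text \<open>That r \<le> 1 follows from the path starting at 1 while 0 is singular. It puts the
  first ball of the chain inside \<open>ball 1 1\<close>, where the germs are given.\<close>

lemma path_sing_dist:
  assumes "path \<gamma>" "path_image \<gamma> \<inter> sing_set = {}" "pathstart \<gamma> = 1"
  obtains r where "r > 0" "r \<le> 1" "\<And>t. t \<in> {0..1} \<Longrightarrow> ball (\<gamma> t) r \<inter> sing_set = {}"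
proof -
  obtain d where d: "d > 0" "\<And>x y. x \<in> path_image \<gamma> \<Longrightarrow> y \<in> sing_set \<Longrightarrow> d \<le> dist x y"
    using separate_compact_closed[OF compact_path_image[OF assms(1)] closed_sing_set assms(2)] by blast
  have "1 \<in> path_image \<gamma>" using assms(3) pathstart_in_path_image by metis
  hence "d \<le> 1" using d(2)[OF _ zero_in_sing_set] by fastforce
  moreover have "ball (\<gamma> t) d \<inter> sing_set = {}" if "t \<in> {0..1}" for t
    using d(2)[of "\<gamma> t"] that by (force simp: path_image_def)
  ultimately show ?thesis using that d(1) by blast
qed

locale borel_tower_germs = borel_tower +
  fixes \<phi> :: "nat \<Rightarrow> complex \<Rightarrow> complex" and \<Phi> :: "complex \<Rightarrow> complex"
  assumes \<phi>_sums: "\<And>z. z \<in> ball 1 1 \<Longrightarrow> (\<lambda>k. \<phi> k z) sums \<Phi> z"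
    and \<phi>0: "\<And>z. z \<in> ball 1 1 \<Longrightarrow> (exp z - 1) * \<phi> 0 z = exp (\<beta> * Ln z) * g z"
    and \<phi>S: "\<And>k z. z \<in> ball 1 1 \<Longrightarrow> (exp z - 1) * \<phi> (Suc k) z = A k z + contour_integral (linepath 1 z) (\<lambda>\<xi>. L \<xi> z * \<phi> k \<xi>)"
begin

lemma tow_start': "chain p U \<Longrightarrow> p 0 = 1 \<Longrightarrow> U 0 \<subseteq> ball 1 1 \<Longrightarrow> z \<in> U 0 \<Longrightarrow> tow p k 0 z = \<phi> k z"
  by (rule tow_start[where \<phi>=\<phi>]) (use \<phi>0 \<phi>S in auto)

lemma chain_germs:
  assumes "path \<gamma>" "n > 0" and ch: "chain p U" and "U 0 \<subseteq> ball 1 1" "p 0 = 1"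
    and p: "\<And>j. j \<le> n \<Longrightarrow> p j = \<gamma> (real j / real n)"
    and seg: "\<And>j s. j < n \<Longrightarrow> real j / n \<le> s \<Longrightarrow> s \<le> (real j + 1) / n \<Longrightarrow> \<gamma> s \<in> U j"
  shows "continues_along \<gamma> (\<phi> k) (tow p k n)"
    and "continues_along \<gamma> \<Phi> (towsum p n)"
proof -
  have st: "pathstart \<gamma> = p 0" using p[of 0] by (simp add: pathstart_def)
  have U0: "\<forall>\<^sub>F z in nhds (pathstart \<gamma>). z \<in> U 0"
    unfolding st using chainD[OF ch] eventually_nhds_in_open by blast
  show "continues_along \<gamma> (\<phi> k) (tow p k n)"
    by (rule continues_cong[OF chain_continues[OF assms(1,2) ch tow_compat[OF ch] p seg]])
       (use U0 in \<open>auto elim!: eventually_mono simp: tow_start'[OF ch assms(5,4)]\<close>)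
  have eq: "towsum p 0 z = \<Phi> z" if "z \<in> U 0" for z
  proof -
    have "(\<lambda>k. tow p k 0 z) = (\<lambda>k. \<phi> k z)" by (rule ext) (rule tow_start'[OF ch assms(5,4) that])
    hence "(\<lambda>k. \<phi> k z) sums towsum p 0 z" using tow_sums[OF ch that] by simp
    moreover have "(\<lambda>k. \<phi> k z) sums \<Phi> z" using that assms(4) by (intro \<phi>_sums) auto
    ultimately show ?thesis by (rule sums_unique2)
  qed
  show "continues_along \<gamma> \<Phi> (towsum p n)"
    by (rule continues_cong[OF chain_continues[OF assms(1,2) ch towsum_compat[OF ch] p seg]])
       (use U0 in \<open>auto elim!: eventually_mono simp: eq\<close>)
qed

text \<open>The order of quantifiers is the point: one chain serves every k, so the continuations
  can be summed on it.\<close>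

lemma path_chain:
  assumes "\<gamma> \<in> paths_from_1"
  obtains p n where "\<And>k. continues_along \<gamma> (\<phi> k) (tow p k n)"
    "continues_along \<gamma> \<Phi> (towsum p n)"
    "(\<lambda>k. tow p k n (pathfinish \<gamma>)) sums towsum p n (pathfinish \<gamma>)"
proof -
  have \<gamma>: "path \<gamma>" "pathstart \<gamma> = 1" "path_image \<gamma> \<inter> sing_set = {}" using assms by (auto simp: paths_from_1_def)
  obtain r where r: "r > 0" "r \<le> 1" "\<And>t. t \<in> {0..1} \<Longrightarrow> ball (\<gamma> t) r \<inter> sing_set = {}"
    using path_sing_dist[OF \<gamma>(1,3,2)] by blast
  obtain n where n: "n > 0" "\<And>s t. s \<in> {0..1} \<Longrightarrow> t \<in> {0..1} \<Longrightarrow> \<bar>s - t\<bar> \<le> 1 / real n \<Longrightarrow> dist (\<gamma> s) (\<gamma> t) < r"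
    using path_mesh[OF \<gamma>(1) r(1)] by blast
  let ?p = "path_pts \<gamma> n"
  have ch: "chain ?p (\<lambda>j. ball (?p j) r)" by (rule ball_chain[OF \<gamma>(1) n(1) n(2) order_refl r(3)])
  have p0: "?p 0 = 1" using \<gamma>(2) by (simp add: path_pts_def pathstart_def)
  have pn: "?p n = pathfinish \<gamma>" using n(1) by (simp add: path_pts_def pathfinish_def)
  have U0: "ball (?p 0) r \<subseteq> ball 1 1" unfolding p0 using r(2) by (rule subset_ball)
  have pj: "?p j = \<gamma> (real j / real n)" if "j \<le> n" for j using that by (simp add: path_pts_def)
  have seg: "\<gamma> s \<in> ball (?p j) r" if "j < n" "real j / n \<le> s" "s \<le> (real j + 1) / n" for j s
    by (rule ball_chain(3)[OF \<gamma>(1) n(1) n(2) order_refl r(3) that])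
  show ?thesis
  proof (rule that)
    show "continues_along \<gamma> (\<phi> k) (tow ?p k n)" for k by (rule chain_germs(1)[OF \<gamma>(1) n(1) ch U0 p0 pj seg])
    show "continues_along \<gamma> \<Phi> (towsum ?p n)" by (rule chain_germs(2)[OF \<gamma>(1) n(1) ch U0 p0 pj seg])
    show "(\<lambda>k. tow ?p k n (pathfinish \<gamma>)) sums towsum ?p n (pathfinish \<gamma>)"
      by (rule tow_sums[OF ch, of _ n]) (use pn r in auto)
  qed
qed

lemma cont_sums:
  assumes "\<gamma> \<in> paths_from_1"
  shows "(\<lambda>k. cont \<gamma> (\<phi> k) (pathfinish \<gamma>)) sums cont \<gamma> \<Phi> (pathfinish \<gamma>)"
proof -
  obtain p n where pn: "\<And>k. continues_along \<gamma> (\<phi> k) (tow p k n)"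
    "continues_along \<gamma> \<Phi> (towsum p n)"
    "(\<lambda>k. tow p k n (pathfinish \<gamma>)) sums towsum p n (pathfinish \<gamma>)" 
    by (rule path_chain[OF assms(1)]) (rule that)
  have "path \<gamma>" using assms(1) by (simp add: paths_from_1_def)
  thus ?thesis using pn(3) cont_eqI[OF _ pn(1)] cont_eqI[OF _ pn(2)] by simp
qed

lemma plen_le_path_len:
  assumes "n > 0"
  shows "ereal (plen (path_pts \<gamma> n) n) \<le> path_len \<gamma>"
proof -
  define ts where "ts = map (\<lambda>i. real i / real n) [0..<Suc n]"
  have "sorted ts" unfolding ts_def sorted_map
    by (rule sorted_wrt_mono_rel[OF _ sorted_upt]) (auto intro: divide_right_mono)
  moreover have "set ts \<subseteq> {0..1}" using assms by (auto simp: ts_def)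
  ultimately have "ereal (\<Sum>i<length ts - 1. dist (\<gamma> (ts ! i)) (\<gamma> (ts ! Suc i))) \<le> path_len \<gamma>"
    unfolding path_len_def by (intro SUP_upper) auto
  also have "(\<Sum>i<length ts - 1. dist (\<gamma> (ts ! i)) (\<gamma> (ts ! Suc i))) = plen (path_pts \<gamma> n) n"
    unfolding plen_def
  proof (rule sum.cong)
    show "{..<length ts - 1} = {..<n}" by (simp add: ts_def)
    fix i assume "i \<in> {..<n}"
    hence "ts ! i = real i / n" "ts ! Suc i = real (Suc i) / n" "min i n = i" "min (Suc i) n = Suc i"
      by (auto simp: ts_def simp del: upt_Suc)
    thus "dist (\<gamma> (ts ! i)) (\<gamma> (ts ! Suc i)) = norm (path_pts \<gamma> n (Suc i) - path_pts \<gamma> n i)"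
      by (simp add: path_pts_def dist_norm norm_minus_commute)
  qed
  finally show ?thesis .
qed

text \<open>A mesh below \<epsilon>/2 keeps the polygon at distance at least \<epsilon>/2 from the
  singularities, and the bound on the length keeps it in the disc of radius 1 + Len. So the
  constants of \<open>tow_bound\<close> do not depend on the path.\<close>

lemma short_path_bound:
  assumes "\<epsilon> > 0"
  obtains C where "C > 0" "\<And>\<gamma> k. \<gamma> \<in> short_paths \<epsilon> Len \<Longrightarrow> norm (cont \<gamma> (\<phi> k) (pathfinish \<gamma>)) \<le> C * \<Lambda> ^ k"
proof -
  have e2: "\<epsilon> / 2 > 0" using assms by simp
  obtain C \<mu> where C: "C > 0" "\<mu> > 0" 
    "\<And>p U j z k. chain p U \<Longrightarrow> (\<And>i. i < j \<Longrightarrow> closed_segment (p i) (p (Suc i)) \<subseteq> region (\<epsilon> / 2) (1 + Len)) \<Longrightarrow>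
       closed_segment (p j) z \<subseteq> region (\<epsilon> / 2) (1 + Len) \<Longrightarrow> z \<in> U j \<Longrightarrow>
       norm (tow p k j z) \<le> C * \<Lambda> ^ k * exp (\<mu> * (plen p j + norm (z - p j)))"
    by (rule tow_bound[OF e2, of "1 + Len"]) blast
  show ?thesis
  proof (rule that)
    show "C * exp (\<mu> * Len) > 0" using C by simp
    fix \<gamma> k assume sp: "\<gamma> \<in> short_paths \<epsilon> Len"
    hence \<gamma>: "path \<gamma>" "pathstart \<gamma> = 1" "path_len \<gamma> < ereal Len" and inf: "\<And>z. z \<in> path_image \<gamma> \<Longrightarrow> infdist z sing_set > \<epsilon>"
      by (auto simp: short_paths_def)
    have "infdist (1::complex) sing_set \<le> dist (1::complex) 0" by (rule infdist_le[OF zero_in_sing_set])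
    hence e1: "\<epsilon> \<le> 1" using inf[of 1] \<gamma>(2) pathstart_in_path_image[of \<gamma>] by simp
    have free: "ball (\<gamma> t) \<epsilon> \<inter> sing_set = {}" if "t \<in> {0..1}" for t
    proof -
      have "infdist (\<gamma> t) sing_set > \<epsilon>" using inf that by (auto simp: path_image_def)
      thus ?thesis using infdist_le[of _ sing_set "\<gamma> t"] by fastforce
    qed
    obtain n where n: "n > 0" "\<And>s t. s \<in> {0..1} \<Longrightarrow> t \<in> {0..1} \<Longrightarrow> \<bar>s - t\<bar> \<le> 1 / real n \<Longrightarrow> dist (\<gamma> s) (\<gamma> t) < \<epsilon> / 2"
      using path_mesh[OF \<gamma>(1) e2] by blast
    have le: "\<epsilon> / 2 \<le> \<epsilon>" using assms by simp
    let ?p = "path_pts \<gamma> n"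
    have ch: "chain ?p (\<lambda>j. ball (?p j) \<epsilon>)" by (rule ball_chain(1)[OF \<gamma>(1) n(1) n(2) le free])
    have p0: "?p 0 = 1" using \<gamma>(2) by (simp add: path_pts_def pathstart_def)
    have pn: "?p n = pathfinish \<gamma>" using n(1) by (simp add: path_pts_def pathfinish_def)
    have U0: "ball (?p 0) \<epsilon> \<subseteq> ball 1 1" unfolding p0 using e1 by (rule subset_ball)
    have pj: "?p j = \<gamma> (real j / real n)" if "j \<le> n" for j using that by (simp add: path_pts_def)
    have co: "continues_along \<gamma> (\<phi> k) (tow ?p k n)"
      by (rule chain_germs(1)[OF \<gamma>(1) n(1) ch U0 p0 pj ball_chain(3)[OF \<gamma>(1) n(1) n(2) le free]])
    have "ereal (plen ?p n) < ereal Len" using plen_le_path_len[OF n(1)] \<gamma>(3) by (rule le_less_trans)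
    hence len: "plen ?p n < Len" by simp
    have np: "norm (?p i) \<le> 1 + plen ?p i" for i
    proof (induction i)
      case (Suc i)
      have "norm (?p (Suc i)) \<le> norm (?p i) + norm (?p (Suc i) - ?p i)" using norm_triangle_sub by blast
      thus ?case using Suc by (simp add: plen_def)
    qed (simp add: p0 plen_def)
    have pl: "plen ?p i \<le> plen ?p n" if "i \<le> n" for i
      unfolding plen_def using that by (intro sum_mono2) auto
    have pin: "?p i \<in> path_image \<gamma>" for i using n(1) by (auto simp: path_pts_def path_image_def)
    have reg: "closed_segment (?p i) q \<subseteq> region (\<epsilon> / 2) (1 + Len)" if i: "i \<le> n" and q: "dist (?p i) q < \<epsilon> / 2" "norm q \<le> 1 + Len" for i q
    proof
      fix z assume z: "z \<in> closed_segment (?p i) q"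
      have "norm (?p i) \<le> 1 + Len" using np[of i] pl[OF i] len by linarith
      hence "closed_segment (?p i) q \<subseteq> cball 0 (1 + Len)" using q by (intro closed_segment_subset) auto
      moreover have "closed_segment (?p i) q \<subseteq> ball (?p i) (\<epsilon> / 2)" using q e2 by (intro closed_segment_subset) auto
      moreover have "infdist (?p i) sing_set \<le> infdist z sing_set + dist (?p i) z" by (rule infdist_triangle)
      ultimately show "z \<in> region (\<epsilon> / 2) (1 + Len)" using z inf[OF pin[of i]] by (fastforce simp: region_def)
    qed
    have "norm (tow ?p k n (?p n)) \<le> C * \<Lambda> ^ k * exp (\<mu> * (plen ?p n + norm (?p n - ?p n)))"
    proof (rule C(3)[OF ch])
      show "closed_segment (?p i) (?p (Suc i)) \<subseteq> region (\<epsilon> / 2) (1 + Len)" if "i < n" for i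
        using that ball_chain(2)[OF \<gamma>(1) n(1) n(2) le free, of i] np[of "Suc i"] pl[of "Suc i"] len by (intro reg) auto
      show "closed_segment (?p n) (?p n) \<subseteq> region (\<epsilon> / 2) (1 + Len)"
        using np[of n] len e2 by (intro reg) auto
    qed (use assms in auto)
    also have "\<dots> \<le> C * \<Lambda> ^ k * exp (\<mu> * Len)" using C \<Lambda> len by (intro mult_left_mono) auto
    finally show "norm (cont \<gamma> (\<phi> k) (pathfinish \<gamma>)) \<le> C * exp (\<mu> * Len) * \<Lambda> ^ k"
      using cont_eqI[OF \<gamma>(1) co] by (simp add: pn mult_ac)
  qed
qed

end

subsection \<open>The singularity at \<open>\<omega>\<close>\<close>

lemma jholo_add:
  assumes L: "jholo L S T" and M: "jholo M S T"
  shows "jholo (\<lambda>x y. L x y + M x y) S T"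
  unfolding jholo_def
proof (intro conjI allI impI)
  show "continuous_on (S \<times> T) (\<lambda>p. L (fst p) (snd p) + M (fst p) (snd p))"
    using L M unfolding jholo_def by (intro continuous_on_add) simp_all
  fix U g1 g2
  assume *: "open U" "g1 holomorphic_on U" "g2 holomorphic_on U" "g1 ` U \<subseteq> S" "g2 ` U \<subseteq> T"
  show "(\<lambda>z. L (g1 z) (g2 z) + M (g1 z) (g2 z)) holomorphic_on U"
    using *(4,5) by (intro holomorphic_on_add jholo_compose_holo[OF L *(1-3)] jholo_compose_holo[OF M *(1-3)]) auto
qed

lemma jholo_diff:
  assumes L: "jholo L S T" and M: "jholo M S T"
  shows "jholo (\<lambda>x y. L x y - M x y) S T"
proof -
  have "jholo (\<lambda>x y. L x y + (- 1) * M x y) S T"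
    by (intro jholo_add jholo_mult L M jholo_fst holomorphic_on_const)
  thus ?thesis by simp
qed

text \<open>Half-discs turned by \<open>i\<close> quarter turns, with the branches \<open>lgi i\<close> of the logarithm obtained by
  continuation through them; \<open>i\<close> and \<open>i + 4\<close> differ by a full turn.\<close>

definition Hd :: "real \<Rightarrow> nat \<Rightarrow> complex set" where
  "Hd s i = {\<zeta>. Re (\<zeta> / \<i> ^ i) > 0} \<inter> ball 0 s"

definition lgi :: "nat \<Rightarrow> complex \<Rightarrow> complex" where
  "lgi i \<zeta> = Ln (\<zeta> / \<i> ^ i) + of_nat i * (\<i> * of_real pi / 2)"

definition log_expansion :: "nat \<Rightarrow> complex \<Rightarrow> (complex \<Rightarrow> complex) \<Rightarrow> (complex \<Rightarrow> complex) \<Rightarrow> complex \<Rightarrow> complex" where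
  "log_expansion i c \<chi> R \<zeta> = c / (2 * of_real pi * \<i> * \<zeta>) + \<chi> \<zeta> * (lgi i \<zeta> / (2 * of_real pi * \<i>)) + R \<zeta>"

lemma Hd_open: "open (Hd s i)"
  unfolding Hd_def by (intro open_Int open_Collect_less continuous_intros open_ball) auto

lemma Hd_convex: "convex (Hd s i)"
proof -
  have "linear (\<lambda>\<zeta>::complex. \<zeta> / \<i> ^ i)" by (rule bounded_linear.linear[OF bounded_linear_divide])
  hence "convex ((\<lambda>\<zeta>::complex. \<zeta> / \<i> ^ i) -` {z. Re z > 0})" by (rule convex_linear_vimage) (rule convex_halfspace_Re_gt)
  moreover have "(\<lambda>\<zeta>::complex. \<zeta> / \<i> ^ i) -` {z. Re z > 0} = {\<zeta>. Re (\<zeta> / \<i> ^ i) > 0}" by auto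
  ultimately show ?thesis unfolding Hd_def by (intro convex_Int) auto
qed

lemma Hd_nz: "\<zeta> \<in> Hd s i \<Longrightarrow> \<zeta> \<noteq> 0" by (auto simp: Hd_def)

lemma Hd_ball: "Hd s i \<subseteq> ball 0 s" by (auto simp: Hd_def)

lemma Hd_add_4: "Hd s (i + 4) = Hd s i" by (simp add: Hd_def power_add)

lemma lgi_0: "lgi 0 = Ln" by (auto simp: lgi_def)

lemma lgi_add_4: "lgi (i + 4) \<zeta> = lgi i \<zeta> + 2 * of_real pi * \<i>"
  by (simp add: lgi_def power_add algebra_simps)

lemma lgi_holomorphic: "lgi i holomorphic_on Hd s i"
  unfolding lgi_def by (intro holomorphic_intros) (auto simp: Hd_def complex_nonpos_Reals_iff)

lemma lgi_Suc:
  assumes "\<zeta> \<in> Hd s i" "\<zeta> \<in> Hd s (Suc i)"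
  shows "lgi (Suc i) \<zeta> = lgi i \<zeta>"
proof -
  define v where "v = \<zeta> / \<i> ^ Suc i"
  have v: "\<zeta> / \<i> ^ i = \<i> * v" by (simp add: v_def)
  have "Re v > 0" using assms by (simp add: Hd_def v_def)
  hence "Ln (\<i> * v) = Ln v + \<i> * of_real pi / 2" using Ln_times_ii[of v] by fastforce
  thus ?thesis unfolding lgi_def v v_def[symmetric] by (simp add: algebra_simps add_divide_distrib)
qed

lemma log_expansion_holomorphic:
  assumes "\<chi> holomorphic_on ball 0 s" "R holomorphic_on ball 0 s"
  shows "log_expansion i c \<chi> R holomorphic_on Hd s i"
  unfolding log_expansion_def[abs_def]
  using assms Hd_ball Hd_nz by (intro holomorphic_intros lgi_holomorphic) (auto intro: holomorphic_on_subset)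

lemma spiral_point:
  assumes "s > 0"
  shows "\<exists>z. z \<in> Hd s i \<inter> Hd s (Suc i)"
proof -
  define z where "z = \<i> ^ i * (of_real (s / 4) * (1 + \<i>))"
  have 1: "z / \<i> ^ i = of_real (s / 4) * (1 + \<i>)" "z / \<i> ^ Suc i = of_real (s / 4) * (1 - \<i>)" 
    by (simp_all add: z_def field_simps)
  have "norm z \<le> s / 4 * (1 + 1)"
    unfolding z_def norm_mult using norm_triangle_ineq[of 1 \<i>] assms by (simp add: norm_power)
  also have "\<dots> < s" using assms by simp
  finally have "norm z < s" .
  hence "z \<in> Hd s i \<inter> Hd s (Suc i)" using assms unfolding Hd_def Int_iff mem_Collect_eq 1 by simp
  thus ?thesis by blast
qed

text \<open>On the overlap of consecutive half-discs the two logarithms coincide; the identity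
  theorem then carries the expansion to the next half-disc with the same c, \<chi> and R.\<close>

lemma spiral_expansion:
  assumes s: "s > 0" and hol: "\<chi> holomorphic_on ball 0 s" "R holomorphic_on ball 0 s"
    and G: "\<And>i. G i holomorphic_on Hd s i" "\<And>i \<zeta>. \<zeta> \<in> Hd s i \<Longrightarrow> \<zeta> \<in> Hd s (Suc i) \<Longrightarrow> G i \<zeta> = G (Suc i) \<zeta>"
    and G0: "\<And>\<zeta>. \<zeta> \<in> Hd s 0 \<Longrightarrow> G 0 \<zeta> = log_expansion 0 c \<chi> R \<zeta>"
    and \<zeta>: "\<zeta> \<in> Hd s i"
  shows "G i \<zeta> = log_expansion i c \<chi> R \<zeta>"
  using \<zeta>
proof (induction i arbitrary: \<zeta>)
  case (Suc i)
  show ?case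
  proof (rule analytic_continuation_open[of "Hd s i \<inter> Hd s (Suc i)" "Hd s (Suc i)" "G (Suc i)" "log_expansion (Suc i) c \<chi> R"])
    show "Hd s i \<inter> Hd s (Suc i) \<noteq> {}" using spiral_point[OF s, of i] by blast
    show "connected (Hd s (Suc i))" by (rule convex_connected[OF Hd_convex])
    show "log_expansion (Suc i) c \<chi> R holomorphic_on Hd s (Suc i)" by (rule log_expansion_holomorphic[OF hol])
    fix z assume z: "z \<in> Hd s i \<inter> Hd s (Suc i)"
    have "G (Suc i) z = log_expansion i c \<chi> R z" using Suc.IH[of z] G(2)[of z i] z by simp
    also have "\<dots> = log_expansion (Suc i) c \<chi> R z" using lgi_Suc[of z s i] z by (simp add: log_expansion_def)
    finally show "G (Suc i) z = log_expansion (Suc i) c \<chi> R z" .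
  qed (use G Suc.prems Hd_open in auto)
qed (use G0 in simp)

text \<open>exp \<zeta> - 1 has a simple zero at 0 and no other zero in the disc, so the value of
  \<open>Y\<close> at 0 alone is responsible for a pole.\<close>

lemma divide_exp_minus_one:
  assumes Y: "Y holomorphic_on ball 0 (2 * pi)"
  obtains Q where "Q holomorphic_on ball 0 (2 * pi)"
    "\<And>\<zeta>. \<zeta> \<in> ball 0 (2 * pi) \<Longrightarrow> \<zeta> \<noteq> 0 \<Longrightarrow> Y \<zeta> / (exp \<zeta> - 1) = Y 0 / \<zeta> + Q \<zeta>"
proof -
  let ?B = "ball (0::complex) (2 * pi)"
  define E where "E z = (if z = 0 then deriv exp 0 else (exp z - exp 0) / (z - 0))" for z :: complex
  have Eh: "E holomorphic_on ?B" unfolding E_def[abs_def] by (rule pole_lemma_open) (auto intro: holomorphic_intros)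
  have d: "deriv exp (0::complex) = 1" by (rule DERIV_imp_deriv) (auto intro!: derivative_eq_intros)
  have Enz: "E z \<noteq> 0" if "z \<in> ?B" for z using that exp_eq_1_near_0[of z] by (auto simp: E_def d)
  define W where "W z = Y z / E z" for z
  have Wh: "W holomorphic_on ?B" unfolding W_def[abs_def] using Enz by (intro holomorphic_intros Y Eh)
  define Q where "Q z = (if z = 0 then deriv W 0 else (W z - W 0) / (z - 0))" for z
  have Qh: "Q holomorphic_on ?B" unfolding Q_def[abs_def] by (rule pole_lemma_open[OF Wh]) auto
  have "Y \<zeta> / (exp \<zeta> - 1) = Y 0 / \<zeta> + Q \<zeta>" if "\<zeta> \<in> ?B" "\<zeta> \<noteq> 0" for \<zeta>
  proof -
    have "Y \<zeta> / (exp \<zeta> - 1) = W \<zeta> / \<zeta>" using that by (simp add: W_def E_def)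
    also have "\<dots> = W 0 / \<zeta> + Q \<zeta>" using that by (simp add: Q_def diff_divide_distrib)
    also have "W 0 = Y 0" by (simp add: W_def E_def d)
    finally show ?thesis .
  qed
  thus ?thesis using that Qh by blast
qed

lemma line_integral_deriv:
  assumes "convex S" "open S" "p \<in> S" "x \<in> S" "g holomorphic_on S"
  shows "((\<lambda>x. contour_integral (linepath p x) g) has_field_derivative g x) (at x)"
proof -
  obtain G where G: "\<And>x. x \<in> S \<Longrightarrow> (G has_field_derivative g x) (at x within S)"
    using holomorphic_convex_primitive'[OF assms(1,2,5)] by blast
  have eq: "contour_integral (linepath p y) g = G y - G p" if "y \<in> S" for y
    using contour_integral_primitive[of S G g "linepath p y"] G that closed_segment_subset[OF assms(3) that assms(1)]
    by (intro contour_integral_unique) simp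
  have "(G has_field_derivative g x) (at x)" using G[OF assms(4)] assms(2,4) at_within_open by metis
  hence "((\<lambda>y. G y - G p) has_field_derivative g x) (at x)" by (auto intro!: derivative_eq_intros)
  thus ?thesis
    by (rule has_field_derivative_transform_within_open[OF _ assms(2,4)]) (simp add: eq)
qed

text \<open>Integrating by parts against the logarithm: if \<open>V' = M \<chi>\<close> and \<open>V(0) = 0\<close>, then
  \<open>M \<chi> log = (V log)' - V/\<xi>\<close>, and \<open>V/\<xi>\<close> is regular at the origin.\<close>

lemma singular_step:
  assumes M: "jholo M UNIV UNIV" and M0: "M 0 0 = 0"
    and hol: "\<chi> holomorphic_on ball 0 (2 * pi)" "R holomorphic_on ball 0 (2 * pi)" "A' holomorphic_on ball 0 (2 * pi)"
    and G: "\<And>\<zeta>. \<zeta> \<in> Hd (2 * pi) 0 \<Longrightarrow>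
       (exp \<zeta> - 1) * G \<zeta> = A' \<zeta> + contour_integral (linepath 1 \<zeta>) (\<lambda>\<xi>. M \<xi> \<zeta> * log_expansion 0 c \<chi> R \<xi>)"
  obtains c' \<chi>' R' where "\<chi>' holomorphic_on ball 0 (2 * pi)" "R' holomorphic_on ball 0 (2 * pi)"
    "\<And>\<zeta>. \<zeta> \<in> Hd (2 * pi) 0 \<Longrightarrow> G \<zeta> = log_expansion 0 c' \<chi>' R' \<zeta>"
    "\<And>\<zeta>. \<zeta> \<in> ball 0 (2 * pi) \<Longrightarrow> (exp \<zeta> - 1) * \<chi>' \<zeta> = c * M 0 \<zeta> + contour_integral (linepath 0 \<zeta>) (\<lambda>\<xi>. M \<xi> \<zeta> * \<chi> \<xi>)"
proof -
  let ?B = "ball (0::complex) (2 * pi)" and ?H = "Hd (2 * pi) 0" and ?k = "2 * of_real pi * \<i> :: complex"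
  have k: "?k \<noteq> 0" by simp
  have pi1: "1 < 2 * pi" using pi_gt3 by simp
  have B: "convex ?B" "open ?B" "0 \<in> ?B" "1 \<in> ?B" using pi1 by auto
  have H1: "1 \<in> ?H" using pi1 by (simp add: Hd_def)
  obtain q where q: "jholo q ?B UNIV" "\<And>x y. x \<in> ?B \<Longrightarrow> x * q x y = M x y - M 0 y"
    using jholo_diffquot[OF M, of "2 * pi"] by (metis pi_gt_zero mult_pos_pos zero_less_numeral)
  have MB: "jholo M ?B UNIV" by (rule jholo_subset[OF M]) auto
  define v where "v x y = integral {0..1} (\<lambda>t. M (linepath 0 x t) y * \<chi> (linepath 0 x t))" for x y
  have vj: "jholo v ?B UNIV" unfolding v_def by (rule jholo_line_average[OF MB B(1,3) hol(1)])
  define V where "V x y = contour_integral (linepath 0 x) (\<lambda>\<xi>. M \<xi> y * \<chi> \<xi>)" for x y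
  have Vv: "V x y = x * v x y" for x y
    unfolding V_def v_def contour_integral_linepath_eq_integral by simp
  \<comment> \<open>The regular part of the integrand: M(\<xi>,\<zeta>) c/\<xi> is split through
    M(\<xi>,\<zeta>) = M(0,\<zeta>) + \<xi> q(\<xi>,\<zeta>), and -v is the -V/\<xi> left by the
    integration by parts.\<close>
  define s where "s x y = (1 / ?k * (c * q x y - v x y)) + M x y * R x" for x y
  have sj: "jholo s ?B UNIV"
    unfolding s_def by (intro jholo_add jholo_mult jholo_diff jholo_fst holomorphic_on_const q(1) vj MB hol)
  define Rt where "Rt \<zeta> = A' \<zeta> + contour_integral (linepath 1 \<zeta>) (\<lambda>\<xi>. s \<xi> \<zeta> * 1)" for \<zeta>
  have Rth: "Rt holomorphic_on ?B" unfolding Rt_def[abs_def]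
    by (intro holomorphic_on_add hol holomorphic_line_diag[OF sj B(1,2,4)] holomorphic_on_const)
  define Y where "Y \<zeta> = c * M 0 \<zeta> + V \<zeta> \<zeta>" for \<zeta>
  have Yh: "Y holomorphic_on ?B" unfolding Y_def[abs_def] V_def
    by (intro holomorphic_on_add holomorphic_on_mult holomorphic_on_const holomorphic_line_diag[OF MB B(1,2,3) hol(1)]
         holomorphic_on_subset[OF jholo_slice2[OF M]]) auto
  \<comment> \<open>The decisive use of M(0,0) = 0: the factor of the logarithm vanishes at 0, so
    dividing it by exp \<zeta> - 1 creates no pole.\<close>
  have Y0: "Y 0 = 0" by (simp add: Y_def Vv M0)
  have key: "(exp \<zeta> - 1) * G \<zeta> = Rt \<zeta> + Y \<zeta> * (Ln \<zeta> / ?k)" if \<zeta>: "\<zeta> \<in> ?H" for \<zeta>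
  proof -
    \<comment> \<open>A primitive of the singular part of the integrand. It is 0 at \<xi> = 1, where
      the logarithm vanishes, and at \<xi> = \<zeta> it is the term with \<open>Y\<close>.\<close>
    define F where "F \<xi> = 1 / ?k * ((c * M 0 \<zeta> + V \<xi> \<zeta>) * Ln \<xi>)" for \<xi>
    define F' where "F' \<xi> = 1 / ?k * (M \<xi> \<zeta> * \<chi> \<xi> * Ln \<xi> + (c * M 0 \<zeta> + V \<xi> \<zeta>) * inverse \<xi>)" for \<xi>
    have seg: "closed_segment 1 \<zeta> \<subseteq> ?H" by (rule closed_segment_subset[OF H1 \<zeta> Hd_convex])
    have hMchi: "(\<lambda>\<xi>. M \<xi> \<zeta> * \<chi> \<xi>) holomorphic_on ?B"
      by (intro holomorphic_on_mult hol jholo_slice[OF MB]) auto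
    have dF: "(F has_field_derivative F' \<xi>) (at \<xi> within ?H)" if \<xi>: "\<xi> \<in> ?H" for \<xi>
    proof -
      have \<xi>B: "\<xi> \<in> ?B" using \<xi> Hd_ball by blast
      have \<xi>n: "\<xi> \<notin> \<real>\<^sub>\<le>\<^sub>0" using \<xi> by (auto simp: Hd_def complex_nonpos_Reals_iff)
      have dV: "((\<lambda>x. V x \<zeta>) has_field_derivative M \<xi> \<zeta> * \<chi> \<xi>) (at \<xi>)"
        unfolding V_def by (rule line_integral_deriv[OF B(1,2,3) \<xi>B hMchi])
      have "((\<lambda>x. c * M 0 \<zeta> + V x \<zeta>) has_field_derivative 0 + M \<xi> \<zeta> * \<chi> \<xi>) (at \<xi>)"
        by (intro DERIV_add DERIV_const dV)
      from DERIV_cmult[OF DERIV_mult[OF this has_field_derivative_Ln[OF \<xi>n]], of "1 / ?k"]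
      have "(F has_field_derivative F' \<xi>) (at \<xi>)" unfolding F_def[abs_def] F'_def by (simp add: mult_ac add.commute)
      thus ?thesis by (rule has_field_derivative_at_within)
    qed
    have I1: "(F' has_contour_integral (F \<zeta> - F 1)) (linepath 1 \<zeta>)"
      using contour_integral_primitive[of ?H F F' "linepath 1 \<zeta>"] dF seg by simp
    have \<zeta>B: "\<zeta> \<in> ?B" using \<zeta> Hd_ball by blast
    have I2: "((\<lambda>\<xi>. s \<xi> \<zeta> * 1) has_contour_integral contour_integral (linepath 1 \<zeta>) (\<lambda>\<xi>. s \<xi> \<zeta> * 1)) (linepath 1 \<zeta>)"
      by (intro has_contour_integral_integral contour_integrable_linepath_holomorphic[OF B(1) _ B(4) \<zeta>B] 
           holomorphic_on_mult jholo_slice[OF sj] holomorphic_on_const) auto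
    have eq: "F' \<xi> + s \<xi> \<zeta> * 1 = M \<xi> \<zeta> * log_expansion 0 c \<chi> R \<xi>" if "\<xi> \<in> ?H" for \<xi>
    proof -
      have \<xi>: "\<xi> \<noteq> 0" "\<xi> \<in> ?B" using Hd_nz[OF that] subsetD[OF Hd_ball that] by auto
      have qq: "q \<xi> \<zeta> = (M \<xi> \<zeta> - M 0 \<zeta>) / \<xi>" using q(2)[OF \<xi>(2), of \<zeta>] \<xi>(1) by (simp add: field_simps)
      show ?thesis unfolding F'_def s_def log_expansion_def lgi_0 Vv qq using \<xi>(1) k by (simp add: field_simps)
    qed
    have "((\<lambda>\<xi>. M \<xi> \<zeta> * log_expansion 0 c \<chi> R \<xi>) has_contour_integral (F \<zeta> - F 1 + contour_integral (linepath 1 \<zeta>) (\<lambda>\<xi>. s \<xi> \<zeta> * 1))) (linepath 1 \<zeta>)"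
      by (rule has_contour_integral_eq[OF has_contour_integral_add[OF I1 I2]]) (use seg eq in auto)
    from contour_integral_unique[OF this] G[OF \<zeta>]
    show ?thesis by (simp add: Rt_def Y_def F_def field_simps)
  qed
  obtain QR where QR: "QR holomorphic_on ?B" "\<And>\<zeta>. \<zeta> \<in> ?B \<Longrightarrow> \<zeta> \<noteq> 0 \<Longrightarrow> Rt \<zeta> / (exp \<zeta> - 1) = Rt 0 / \<zeta> + QR \<zeta>"
    using divide_exp_minus_one[OF Rth] by blast
  obtain QY where QY: "QY holomorphic_on ?B" "\<And>\<zeta>. \<zeta> \<in> ?B \<Longrightarrow> \<zeta> \<noteq> 0 \<Longrightarrow> Y \<zeta> / (exp \<zeta> - 1) = Y 0 / \<zeta> + QY \<zeta>"
    using divide_exp_minus_one[OF Yh] by blast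
  show ?thesis
  proof (rule that[of QY QR "?k * Rt 0"])
    fix \<zeta> assume \<zeta>: "\<zeta> \<in> ?H"
    have \<zeta>': "\<zeta> \<in> ?B" "\<zeta> \<noteq> 0" using Hd_nz[OF \<zeta>] subsetD[OF Hd_ball \<zeta>] by auto
    have e: "exp \<zeta> - 1 \<noteq> 0" using exp_eq_1_near_0[of \<zeta>] \<zeta>' by auto
    have "G \<zeta> = (exp \<zeta> - 1) * G \<zeta> / (exp \<zeta> - 1)" using e by simp
    also have "\<dots> = Rt \<zeta> / (exp \<zeta> - 1) + Y \<zeta> / (exp \<zeta> - 1) * (Ln \<zeta> / ?k)"
      unfolding key[OF \<zeta>] by (simp only: add_divide_distrib times_divide_eq_left)
    also have "\<dots> = Rt 0 / \<zeta> + QR \<zeta> + QY \<zeta> * (Ln \<zeta> / ?k)" using QR(2)[OF \<zeta>'] QY(2)[OF \<zeta>'] Y0 by simp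
    finally show "G \<zeta> = log_expansion 0 (?k * Rt 0) QY QR \<zeta>" using k by (simp add: log_expansion_def lgi_0)
  next
    fix \<zeta> assume \<zeta>: "\<zeta> \<in> ?B"
    have "(exp \<zeta> - 1) * QY \<zeta> = Y \<zeta>"
    proof (cases "\<zeta> = 0")
      case False
      have "exp \<zeta> - 1 \<noteq> 0" using exp_eq_1_near_0[of \<zeta>] \<zeta> False by auto
      thus ?thesis using QY(2)[OF \<zeta> False] Y0 by (simp add: field_simps)
    qed (simp add: Y0)
    thus "(exp \<zeta> - 1) * QY \<zeta> = c * M 0 \<zeta> + contour_integral (linepath 0 \<zeta>) (\<lambda>\<xi>. M \<xi> \<zeta> * \<chi> \<xi>)" by (simp add: Y_def V_def)
  qed (use QR QY in auto)
qed

section \<open>The chain around \<omega>, the expansions on it and their bounds\<close>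

locale singular_point = borel_tower_germs +
  fixes \<omega> :: complex and \<Gamma> :: "real \<Rightarrow> complex"
  assumes \<omega>: "\<omega> \<in> sing_set" "\<omega> \<noteq> 0" and \<Gamma>: "\<Gamma> \<in> paths_from_1" "pathfinish \<Gamma> = \<omega> + 1"
    and L\<omega>: "L \<omega> \<omega> = 0"
begin

text \<open>Past the end of \<Gamma> the chain turns around \<omega>. For m \<ge> 1 the point \<i>^m
  (1 - \<i>) = \<i>^(m-1) (1 + \<i>) lies on the bisector of the overlap of the half-discs m - 1 and
  m, so consecutive sets share it.\<close>

definition spiral_pts :: "nat \<Rightarrow> nat \<Rightarrow> complex" where
  "spiral_pts n j = (if j < n then path_pts \<Gamma> n j else \<omega> + (if j = n then 1 else \<i> ^ (j - n) * (1 - \<i>)))"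

definition spiral_sets :: "nat \<Rightarrow> real \<Rightarrow> nat \<Rightarrow> complex set" where
  "spiral_sets n r j = (if j < n then ball (path_pts \<Gamma> n j) r else (+) \<omega> ` Hd (2 * pi) (j - n))"

lemma exp_\<omega>: "exp (\<omega> + z) = exp z"
  using \<omega>(1) by (simp add: exp_add sing_set_iff)

lemma spiral_chain:
  obtains n r where "n > 0" "chain (spiral_pts n) (spiral_sets n r)" "spiral_sets n r 0 \<subseteq> ball 1 1" "spiral_pts n 0 = 1"
    "\<And>k. continues_along \<Gamma> (\<phi> k) (tow (spiral_pts n) k n)" "continues_along \<Gamma> \<Phi> (towsum (spiral_pts n) n)"
proof -
  have \<gamma>: "path \<Gamma>" "pathstart \<Gamma> = 1" "path_image \<Gamma> \<inter> sing_set = {}" using \<Gamma> by (auto simp: paths_from_1_def)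
  obtain r where r: "r > 0" "r \<le> 1" "\<And>t. t \<in> {0..1} \<Longrightarrow> ball (\<Gamma> t) r \<inter> sing_set = {}"
    using path_sing_dist[OF \<gamma>(1,3,2)] by blast
  obtain n where n: "n > 0" "\<And>s t. s \<in> {0..1} \<Longrightarrow> t \<in> {0..1} \<Longrightarrow> \<bar>s - t\<bar> \<le> 1 / real n \<Longrightarrow> dist (\<Gamma> s) (\<Gamma> t) < r"
    using path_mesh[OF \<gamma>(1) r(1)] by blast
  let ?p = "spiral_pts n" and ?U = "spiral_sets n r"
  have bch: "chain (path_pts \<Gamma> n) (\<lambda>j. ball (path_pts \<Gamma> n j) r)" by (rule ball_chain(1)[OF \<gamma>(1) n(1) n(2) order_refl r(3)])
  have seg: "\<Gamma> s \<in> ball (path_pts \<Gamma> n j) r" if "j < n" "real j / n \<le> s" "s \<le> (real j + 1) / n" for j s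
    by (rule ball_chain(3)[OF \<gamma>(1) n(1) n(2) order_refl r(3) that])
  have pend: "path_pts \<Gamma> n n = \<omega> + 1" using n(1) \<Gamma>(2) by (simp add: path_pts_def pathfinish_def)
  have pi6: "2 * pi > 6" using pi_gt3 by simp
  have n2: "norm (1 - \<i>) \<le> 2" "norm (1 + \<i>) \<le> 2" using norm_triangle_ineq4[of 1 \<i>] norm_triangle_ineq[of 1 \<i>] by auto
  have ch: "chain ?p ?U"
    unfolding chain_def
  proof (intro allI conjI)
    fix j
    note bc = chainD[OF bch, of j]
    show "open (?U j)" by (auto simp: spiral_sets_def intro!: open_translation Hd_open)
    show "convex (?U j)" by (auto simp: spiral_sets_def intro!: convex_translation Hd_convex)
    show "?U j \<inter> sing_set = {}"
    proof (cases "j < n")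
      case True thus ?thesis using bc(3) by (simp add: spiral_sets_def)
    next
      case False
      have "\<omega> + \<zeta> \<notin> sing_set" if "\<zeta> \<in> Hd (2 * pi) (j - n)" for \<zeta>
        using that Hd_nz[OF that] exp_eq_1_near_0[of \<zeta>] by (auto simp: sing_set_iff exp_\<omega> Hd_def)
      thus ?thesis using False by (auto simp: spiral_sets_def)
    qed
    show "?p j \<in> ?U j"
    proof (cases "j < n")
      case True thus ?thesis using bc(4) by (simp add: spiral_pts_def spiral_sets_def)
    next
      case False
      have "(if j = n then 1 else \<i> ^ (j - n) * (1 - \<i>)) \<in> Hd (2 * pi) (j - n)"
        using pi6 n2 by (auto simp: Hd_def norm_mult norm_power)
      thus ?thesis using False by (simp add: spiral_pts_def spiral_sets_def)
    qed
    show "?p (Suc j) \<in> ?U j"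
    proof (cases "j < n")
      case True
      have "?p (Suc j) = path_pts \<Gamma> n (Suc j)"
      proof (cases "Suc j < n")
        case False
        hence "Suc j = n" using True by simp
        thus ?thesis using pend by (simp add: spiral_pts_def)
      qed (simp add: spiral_pts_def)
      thus ?thesis using bc(5) True by (simp add: spiral_sets_def)
    next
      case False
      define i where "i = j - n"
      have e: "\<i> ^ Suc i * (1 - \<i>) = \<i> ^ i * (1 + \<i>)" by (simp add: algebra_simps)
      have pj: "?p (Suc j) = \<omega> + \<i> ^ Suc i * (1 - \<i>)" 
        using False by (simp add: spiral_pts_def i_def Suc_diff_le del: power_Suc)
      have m: "\<i> ^ i * (1 + \<i>) \<in> Hd (2 * pi) i" using pi6 n2 by (auto simp: Hd_def norm_mult norm_power)
      have "?U j = (+) \<omega> ` Hd (2 * pi) i" using False by (simp add: spiral_sets_def i_def)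
      thus ?thesis unfolding pj e using m by simp
    qed
  qed
  have p0: "?p 0 = 1" using n(1) \<gamma>(2) by (simp add: spiral_pts_def path_pts_def pathstart_def)
  have U0: "?U 0 \<subseteq> ball 1 1"
  proof -
    have "path_pts \<Gamma> n 0 = 1" using \<gamma>(2) by (simp add: path_pts_def pathstart_def)
    thus ?thesis using n(1) subset_ball[OF r(2), of "1::complex"] by (simp add: spiral_sets_def)
  qed
  have pj: "?p j = \<Gamma> (real j / real n)" if "j \<le> n" for j
  proof (cases "j < n")
    case False
    hence "j = n" using that by simp
    thus ?thesis using n(1) \<Gamma>(2) by (simp add: spiral_pts_def pathfinish_def)
  qed (simp add: spiral_pts_def path_pts_def)
  have seg': "\<Gamma> s \<in> ?U j" if "j < n" "real j / n \<le> s" "s \<le> (real j + 1) / n" for j s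
    using seg[OF that] that by (simp add: spiral_sets_def)
  show ?thesis
    by (rule that[OF n(1) ch U0 p0 chain_germs(1)[OF \<gamma>(1) n(1) ch U0 p0 pj seg'] chain_germs(2)[OF \<gamma>(1) n(1) ch U0 p0 pj seg']])
qed

lemma linepath_shift: "linepath (\<omega> + a) (\<omega> + b) t = \<omega> + linepath a b t"
  by (simp add: linepath_def algebra_simps scaleR_conv_of_real)

lemma contour_integral_shift:
  "contour_integral (linepath (\<omega> + a) (\<omega> + b)) q = contour_integral (linepath a b) (\<lambda>\<xi>. q (\<omega> + \<xi>))"
  unfolding contour_integral_linepath_eq_integral linepath_shift by simp

lemma ball_avoids_0: "\<zeta> \<in> ball 0 (2 * pi) \<Longrightarrow> \<omega> + \<zeta> \<noteq> 0"
proof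
  assume "\<zeta> \<in> ball 0 (2 * pi)" "\<omega> + \<zeta> = 0"
  moreover have "exp \<zeta> = 1" using exp_\<omega>[of \<zeta>] calculation(2) by simp
  ultimately have "\<zeta> = 0" using exp_eq_1_near_0[of \<zeta>] by simp
  thus False using \<open>\<omega> + \<zeta> = 0\<close> \<omega>(2) by simp
qed

lemma holomorphic_shift: "f holomorphic_on (+) \<omega> ` S \<Longrightarrow> (\<lambda>\<zeta>. f (\<omega> + \<zeta>)) holomorphic_on S"
proof -
  assume f: "f holomorphic_on (+) \<omega> ` S"
  have "(\<lambda>\<zeta>. \<omega> + \<zeta>) holomorphic_on S" by (intro holomorphic_intros)
  from holomorphic_on_compose_gen[OF this f] show ?thesis by (simp add: o_def)
qed

definition M\<omega> :: "complex \<Rightarrow> complex \<Rightarrow> complex" where "M\<omega> \<xi> z = L (\<omega> + \<xi>) (\<omega> + z)"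

lemma jholo_M\<omega>: "jholo M\<omega> UNIV UNIV"
proof -
  have "jholo (\<lambda>x y. \<omega> + x) UNIV UNIV" "jholo (\<lambda>x y. \<omega> + y) UNIV UNIV"
    unfolding jholo_def by (auto intro!: continuous_intros holomorphic_intros)
  thus ?thesis unfolding M\<omega>_def by (rule jholo_compose2[OF jholo_L]) auto
qed

text \<open>At k = 0 there is no logarithm: the disc of radius 2\<pi> around \<omega> does not
  contain 0, so \<zeta>^\<beta> is holomorphic in it and only the pole of 1/(exp \<zeta> - 1)
  remains. Later levels come from \<open>singular_step\<close>; dependent choice gathers the data,
  each obtained from the previous one, into sequences.\<close>

lemma singular_expansions:
  assumes n: "n > 0" and ch: "chain (spiral_pts n) (spiral_sets n r)"
  obtains c :: "nat \<Rightarrow> complex" and \<chi> R :: "nat \<Rightarrow> complex \<Rightarrow> complex"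
  where "\<And>k. \<chi> k holomorphic_on ball 0 (2 * pi)" "\<And>k. R k holomorphic_on ball 0 (2 * pi)" "\<And>\<zeta>. \<chi> 0 \<zeta> = 0"
    "\<And>k i \<zeta>. \<zeta> \<in> Hd (2 * pi) i \<Longrightarrow> tow (spiral_pts n) k (n + i) (\<omega> + \<zeta>) = log_expansion i (c k) (\<chi> k) (R k) \<zeta>"
    "\<And>k \<zeta>. \<zeta> \<in> ball 0 (2 * pi) \<Longrightarrow> (exp \<zeta> - 1) * \<chi> (Suc k) \<zeta> = 
        c k * M\<omega> 0 \<zeta> + contour_integral (linepath 0 \<zeta>) (\<lambda>\<xi>. M\<omega> \<xi> \<zeta> * \<chi> k \<xi>)"
proof -
  let ?p = "spiral_pts n" and ?U = "spiral_sets n r" and ?B = "ball (0::complex) (2 * pi)"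
  have pn: "?p n = \<omega> + 1" by (simp add: spiral_pts_def)
  have Un: "?U (n + i) = (+) \<omega> ` Hd (2 * pi) i" for i by (simp add: spiral_sets_def)
  have pi1: "1 < 2 * pi" using pi_gt3 by simp
  have H1: "1 \<in> Hd (2 * pi) 0" using pi1 by (simp add: Hd_def)
  define G where "G k i \<zeta> = tow ?p k (n + i) (\<omega> + \<zeta>)" for k i \<zeta>
  have Gh: "G k i holomorphic_on Hd (2 * pi) i" for k i
  proof -
    have "tow ?p k (n + i) holomorphic_on ?U (n + i)" using tow_compat[OF ch, of k] by (simp add: compat_def)
    thus ?thesis unfolding G_def[abs_def] Un by (rule holomorphic_shift)
  qed
  have Gc: "G k i \<zeta> = G k (Suc i) \<zeta>" if "\<zeta> \<in> Hd (2 * pi) i" "\<zeta> \<in> Hd (2 * pi) (Suc i)" for k i \<zeta>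
  proof -
    have "\<omega> + \<zeta> \<in> ?U (n + i) \<inter> ?U (Suc (n + i))" using that Un[of i] Un[of "Suc i"] by auto
    thus ?thesis using tow_compat[OF ch, of k] by (auto simp: G_def compat_def)
  qed
  define P where "P k x = (case x of (c, \<chi>, R) \<Rightarrow> \<chi> holomorphic_on ?B \<and> R holomorphic_on ?B \<and> (k = 0 \<longrightarrow> \<chi> = (\<lambda>_. 0)) \<and>
      (\<forall>\<zeta>\<in>Hd (2 * pi) 0. G k 0 \<zeta> = log_expansion 0 c \<chi> R \<zeta>))" for k x
  define Q where "Q x y = (case x of (c, \<chi>, R :: complex \<Rightarrow> complex) \<Rightarrow> case y of (c' :: complex, \<chi>', R' :: complex \<Rightarrow> complex) \<Rightarrow>
      (\<forall>\<zeta>\<in>?B. (exp \<zeta> - 1) * \<chi>' \<zeta> = c * M\<omega> 0 \<zeta> + contour_integral (linepath 0 \<zeta>) (\<lambda>\<xi>. M\<omega> \<xi> \<zeta> * \<chi> \<xi>)))" for x y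
  have "\<exists>f. \<forall>k. P k (f k) \<and> Q (f k) (f (Suc k))"
  proof (rule dependent_nat_choice)
    have lgh: "(\<lambda>z. lg ?p n z) holomorphic_on (+) \<omega> ` ?B"
    proof -
      have 0: "0 \<notin> (+) \<omega> ` ?B" using ball_avoids_0 by force
      have S: "convex ((+) \<omega> ` ?B)" "open ((+) \<omega> ` ?B)"
        by (intro convex_translation open_translation convex_ball open_ball)+
      have S': "?p n \<in> (+) \<omega> ` ?B" unfolding pn using pi1 by (intro image_eqI[of _ _ 1]) auto
      have "jholo (\<lambda>\<xi> z. 1 / \<xi>) ((+) \<omega> ` ?B) UNIV" using 0 by (intro jholo_fst holomorphic_intros) auto
      hence "(\<lambda>z. contour_integral (linepath (?p n) z) (\<lambda>\<xi>. 1 / \<xi> * 1)) holomorphic_on (+) \<omega> ` ?B"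
        by (rule holomorphic_line_diag[OF _ S S']) auto
      moreover have "acc ?p (\<lambda>\<xi> z. 1 / \<xi>) (\<lambda>_. 0) (\<lambda>_ _. 1) n holomorphic_on (+) \<omega> ` ?B"
        by (rule holomorphic_on_subset[OF acc_holomorphic[OF ch jholo_inv _ compat_const]]) auto
      ultimately show ?thesis unfolding lg_def Iop_def by (intro holomorphic_on_add)
    qed
    define a0 where "a0 \<zeta> = exp (\<beta> * lg ?p n (\<omega> + \<zeta>)) * g (\<omega> + \<zeta>)" for \<zeta>
    have a0h: "a0 holomorphic_on ?B" unfolding a0_def[abs_def]
      using holomorphic_shift[OF lgh] holomorphic_shift[of g ?B] g_hol
      by (intro holomorphic_intros) (auto intro: holomorphic_on_subset)
    obtain Q0 where Q0: "Q0 holomorphic_on ?B" "\<And>\<zeta>. \<zeta> \<in> ?B \<Longrightarrow> \<zeta> \<noteq> 0 \<Longrightarrow> a0 \<zeta> / (exp \<zeta> - 1) = a0 0 / \<zeta> + Q0 \<zeta>"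
      using divide_exp_minus_one[OF a0h] by blast
    have "G 0 0 \<zeta> = log_expansion 0 (2 * of_real pi * \<i> * a0 0) (\<lambda>_. 0) Q0 \<zeta>" if "\<zeta> \<in> Hd (2 * pi) 0" for \<zeta>
      using Q0(2)[of \<zeta>] Hd_nz[OF that] subsetD[OF Hd_ball that] by (auto simp: G_def log_expansion_def a0_def exp_\<omega>)
    hence "P 0 (2 * of_real pi * \<i> * a0 0, (\<lambda>_. 0), Q0)" using Q0(1) by (auto simp: P_def)
    thus "\<exists>x. P 0 x" by blast
  next
    fix x k assume Px: "P k x"
    obtain c \<chi> R where x: "x = (c, \<chi>, R)" by (cases x)
    have h: "\<chi> holomorphic_on ?B" "R holomorphic_on ?B" "\<And>\<zeta>. \<zeta> \<in> Hd (2 * pi) 0 \<Longrightarrow> G k 0 \<zeta> = log_expansion 0 c \<chi> R \<zeta>"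
      using Px by (auto simp: x P_def)
    define A' where "A' \<zeta> = acc ?p L (A k) (tow ?p k) n (\<omega> + \<zeta>)" for \<zeta>
    have A'h: "A' holomorphic_on ?B" unfolding A'_def
      by (rule holomorphic_shift[OF holomorphic_on_subset[OF acc_holomorphic[OF ch jholo_L' A_hol tow_compat[OF ch]]]]) auto
    have rec: "(exp \<zeta> - 1) * G (Suc k) 0 \<zeta> = A' \<zeta> + contour_integral (linepath 1 \<zeta>) (\<lambda>\<xi>. M\<omega> \<xi> \<zeta> * log_expansion 0 c \<chi> R \<xi>)"
      if \<zeta>: "\<zeta> \<in> Hd (2 * pi) 0" for \<zeta>
    proof -
      have "exp \<zeta> - 1 \<noteq> 0" using exp_eq_1_near_0[of \<zeta>] Hd_nz[OF \<zeta>] subsetD[OF Hd_ball \<zeta>] by auto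
      hence "(exp \<zeta> - 1) * G (Suc k) 0 \<zeta> = A' \<zeta> + contour_integral (linepath (\<omega> + 1) (\<omega> + \<zeta>)) (\<lambda>\<xi>. L \<xi> (\<omega> + \<zeta>) * tow ?p k n \<xi>)"
        by (simp add: G_def Iop_def A'_def exp_\<omega> pn)
      also have "contour_integral (linepath (\<omega> + 1) (\<omega> + \<zeta>)) (\<lambda>\<xi>. L \<xi> (\<omega> + \<zeta>) * tow ?p k n \<xi>) =
         contour_integral (linepath 1 \<zeta>) (\<lambda>\<xi>. M\<omega> \<xi> \<zeta> * G k 0 \<xi>)"
        unfolding contour_integral_shift by (simp add: M\<omega>_def G_def)
      also have "\<dots> = contour_integral (linepath 1 \<zeta>) (\<lambda>\<xi>. M\<omega> \<xi> \<zeta> * log_expansion 0 c \<chi> R \<xi>)"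
        using closed_segment_subset[OF H1 \<zeta> Hd_convex] h(3) by (intro contour_integral_cong refl) auto
      finally show ?thesis .
    qed
    have M0: "M\<omega> 0 0 = 0" using L\<omega> by (simp add: M\<omega>_def)
    obtain c' \<chi>' R' where n': "\<chi>' holomorphic_on ?B" "R' holomorphic_on ?B"
      "\<And>\<zeta>. \<zeta> \<in> Hd (2 * pi) 0 \<Longrightarrow> G (Suc k) 0 \<zeta> = log_expansion 0 c' \<chi>' R' \<zeta>"
      "\<And>\<zeta>. \<zeta> \<in> ?B \<Longrightarrow> (exp \<zeta> - 1) * \<chi>' \<zeta> = c * M\<omega> 0 \<zeta> + contour_integral (linepath 0 \<zeta>) (\<lambda>\<xi>. M\<omega> \<xi> \<zeta> * \<chi> \<xi>)"
      by (rule singular_step[OF jholo_M\<omega> M0 h(1,2) A'h rec]) (assumption, rule that)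
    hence "P (Suc k) (c', \<chi>', R') \<and> Q x (c', \<chi>', R')" by (simp add: P_def Q_def x)
    thus "\<exists>y. P (Suc k) y \<and> Q x y" by blast
  qed
  then obtain F where F: "\<And>k. P k (F k)" "\<And>k. Q (F k) (F (Suc k))" by blast
  define c where "c k = fst (F k)" for k
  define \<chi> where "\<chi> k = fst (snd (F k))" for k
  define R where "R k = snd (snd (F k))" for k
  have Fk: "F k = (c k, \<chi> k, R k)" for k by (simp add: c_def \<chi>_def R_def)
  have Pk: "\<chi> k holomorphic_on ?B" "R k holomorphic_on ?B" "k = 0 \<Longrightarrow> \<chi> k = (\<lambda>_. 0)"
     "\<And>\<zeta>. \<zeta> \<in> Hd (2 * pi) 0 \<Longrightarrow> G k 0 \<zeta> = log_expansion 0 (c k) (\<chi> k) (R k) \<zeta>" for k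
    using F(1)[of k] unfolding Fk P_def by auto
  show ?thesis
  proof (rule that[of \<chi> R c])
    show "\<chi> 0 \<zeta> = 0" for \<zeta> using Pk(3)[of 0] by simp
    show "tow ?p k (n + i) (\<omega> + \<zeta>) = log_expansion i (c k) (\<chi> k) (R k) \<zeta>" if "\<zeta> \<in> Hd (2 * pi) i" for k i \<zeta>
      using spiral_expansion[OF _ Pk(1)[of k] Pk(2)[of k] Gh Gc Pk(4) that] by (simp add: G_def)
    show "(exp \<zeta> - 1) * \<chi> (Suc k) \<zeta> = c k * M\<omega> 0 \<zeta> + contour_integral (linepath 0 \<zeta>) (\<lambda>\<xi>. M\<omega> \<xi> \<zeta> * \<chi> k \<xi>)"
      if "\<zeta> \<in> ?B" for k \<zeta>
      using F(2)[of k] that unfolding Fk Q_def by simp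
  qed (use Pk in auto)
qed

text \<open>The bound 1/2, and not merely positivity, keeps the point away from the edge of its
  half-disc, so that compact pieces of four half-discs cover the circle.\<close>

lemma unit_circle_quadrant:
  assumes "norm (\<zeta>::complex) = 1"
  obtains i where "i < 4" "Re (\<zeta> / \<i> ^ i) \<ge> 1/2"
proof -
  have "(Re \<zeta>)\<^sup>2 + (Im \<zeta>)\<^sup>2 = 1" using assms cmod_power2[of \<zeta>] by simp
  moreover have "\<not> (\<bar>Re \<zeta>\<bar> < 1/2 \<and> \<bar>Im \<zeta>\<bar> < 1/2)"
  proof
    assume "\<bar>Re \<zeta>\<bar> < 1/2 \<and> \<bar>Im \<zeta>\<bar> < 1/2"
    hence "\<bar>Re \<zeta>\<bar>\<^sup>2 \<le> (1/2)\<^sup>2" "\<bar>Im \<zeta>\<bar>\<^sup>2 \<le> (1/2)\<^sup>2" by (intro power_mono; simp)+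
    thus False using calculation by (simp add: power2_eq_square)
  qed
  ultimately consider "Re \<zeta> \<ge> 1/2" | "Im \<zeta> \<ge> 1/2" | "Re \<zeta> \<le> - 1/2" | "Im \<zeta> \<le> - 1/2" by linarith
  thus ?thesis
  proof cases
    case 1 thus ?thesis using that[of 0] by simp
  next
    case 2 thus ?thesis using that[of 1] by (simp add: Re_divide)
  next
    case 3 thus ?thesis using that[of 2] by (simp add: power2_eq_square)
  next
    case 4 thus ?thesis using that[of 3] by (simp add: power3_eq_cube Re_divide)
  qed
qed

lemma unit_circle_bound:
  assumes f: "f holomorphic_on ball 0 (2 * pi)" and B: "\<And>z. norm z = 1 \<Longrightarrow> norm (f z) \<le> B" and z: "norm z \<le> 1"
  shows "norm (f z) \<le> B"
proof (rule maximum_modulus_frontier[of f "cball 0 1"])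
  have sub: "cball (0::complex) 1 \<subseteq> ball 0 (2 * pi)" using pi_gt3 by (auto simp: dist_norm)
  show "f holomorphic_on interior (cball 0 1)" using f sub holomorphic_on_subset interior_subset by (metis subset_trans)
  show "continuous_on (closure (cball 0 1)) f" using f sub holomorphic_on_imp_continuous_on continuous_on_subset by (metis closed_cball closure_closed)
qed (use B z in auto)

text \<open>\<chi>_k is the difference of the branches i + 4 and i, a full turn apart, so it
  inherits the bound of \<open>tow\<close> on the unit circle, and the maximum principle fills the
  disc. The function c_k/(2\<pi>\<i>) + \<zeta> R_k is holomorphic and bounded in the same way; its
  value at 0 gives c_k.\<close>

lemma singular_bounds:
  assumes ch: "chain (spiral_pts n) (spiral_sets n r)"
    and hol: "\<And>k. \<chi> k holomorphic_on ball 0 (2 * pi)" "\<And>k. R k holomorphic_on ball 0 (2 * pi)"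
    and ex: "\<And>k i \<zeta>. \<zeta> \<in> Hd (2 * pi) i \<Longrightarrow> tow (spiral_pts n) k (n + i) (\<omega> + \<zeta>) = log_expansion i (c k) (\<chi> k) (R k) \<zeta>"
  obtains C where "C > 0" "\<And>k. norm (c k) \<le> C * \<Lambda> ^ k" "\<And>k \<zeta>. norm \<zeta> \<le> 1 \<Longrightarrow> norm (\<chi> k \<zeta>) \<le> C * \<Lambda> ^ k"
    "\<And>k \<zeta>. norm \<zeta> \<le> 1 \<Longrightarrow> norm (R k \<zeta>) \<le> C * \<Lambda> ^ k"
proof -
  let ?p = "spiral_pts n" and ?k = "2 * of_real pi * \<i> :: complex"
  have pi1: "1 < 2 * pi" using pi_gt3 by simp
  have nk: "norm ?k = 2 * pi" by (simp add: norm_mult)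
  define S where "S i = {\<zeta>. norm \<zeta> = 1 \<and> Re (\<zeta> / \<i> ^ i) \<ge> 1/2}" for i :: nat
  have SH: "S i \<subseteq> Hd (2 * pi) i" for i using pi1 by (auto simp: S_def Hd_def)
  have "\<exists>C. \<forall>k. \<forall>\<zeta>\<in>S i. norm (tow ?p k (n + i) (\<omega> + \<zeta>)) \<le> C * \<Lambda> ^ k" for i
  proof -
    have "S i = sphere 0 1 \<inter> {\<zeta>. Re (\<zeta> / \<i> ^ i) \<ge> 1/2}" by (auto simp: S_def)
    moreover have "closed {\<zeta>::complex. Re (\<zeta> / \<i> ^ i) \<ge> 1/2}" by (intro closed_Collect_le continuous_intros) auto
    ultimately have "compact (S i)" by (simp add: compact_Int_closed)
    hence 1: "compact ((+) \<omega> ` S i)" by (rule compact_translation)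
    have 2: "(+) \<omega> ` S i \<subseteq> spiral_sets n r (n + i)" using SH[of i] by (auto simp: spiral_sets_def)
    obtain C where "C > 0" and "\<And>k z. z \<in> (+) \<omega> ` S i \<Longrightarrow> norm (tow ?p k (n + i) z) \<le> C * \<Lambda> ^ k"
      by (rule tow_local_bound[OF ch 1 2]) (rule that)
    thus ?thesis by (intro exI[of _ C]) auto
  qed
  then obtain C1 where C1: "\<And>i k \<zeta>. \<zeta> \<in> S i \<Longrightarrow> norm (tow ?p k (n + i) (\<omega> + \<zeta>)) \<le> C1 i * \<Lambda> ^ k" by metis
  \<comment> \<open>Eight half-discs: four to reach every point of the circle, and four more for the
    branches one turn later.\<close>
  define C0 where "C0 = (\<Sum>i<8. \<bar>C1 i\<bar>) + 1"
  have C0: "C0 > 0" unfolding C0_def by (intro add_nonneg_pos sum_nonneg) auto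
  have C1': "norm (tow ?p k (n + i) (\<omega> + \<zeta>)) \<le> C0 * \<Lambda> ^ k" if "\<zeta> \<in> S i" "i < 8" for i k \<zeta>
  proof -
    have "\<bar>C1 i\<bar> \<le> (\<Sum>i<8. \<bar>C1 i\<bar>)" using that by (intro member_le_sum) auto
    hence "C1 i \<le> C0" by (simp add: C0_def)
    thus ?thesis using C1[OF that(1), of k] \<Lambda> by (meson mult_right_mono order_trans zero_le_power less_imp_le)
  qed
  have circ: "norm (\<chi> k \<zeta>) \<le> 2 * C0 * \<Lambda> ^ k \<and> norm (c k / ?k + \<zeta> * R k \<zeta>) \<le> 5 * C0 * \<Lambda> ^ k" if \<zeta>: "norm \<zeta> = 1" for k \<zeta>
  proof -
    obtain i where i: "i < 4" "Re (\<zeta> / \<i> ^ i) \<ge> 1/2" using unit_circle_quadrant[OF \<zeta>] by blast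
    have Si: "\<zeta> \<in> S i" using i \<zeta> by (simp add: S_def)
    have Si4: "\<zeta> \<in> S (i + 4)" using i \<zeta> by (simp add: S_def power_add)
    have H: "\<zeta> \<in> Hd (2 * pi) i" "\<zeta> \<in> Hd (2 * pi) (i + 4)" using SH Si Si4 by blast+
    define G where "G = tow ?p k (n + i) (\<omega> + \<zeta>)"
    define G4 where "G4 = tow ?p k (n + (i + 4)) (\<omega> + \<zeta>)"
    have G: "norm G \<le> C0 * \<Lambda> ^ k" "norm G4 \<le> C0 * \<Lambda> ^ k"
      unfolding G_def G4_def using i by (intro C1' Si Si4; simp)+
    have e: "G = log_expansion i (c k) (\<chi> k) (R k) \<zeta>" "G4 = log_expansion (i + 4) (c k) (\<chi> k) (R k) \<zeta>"
      unfolding G_def G4_def by (intro ex H)+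
    have "G4 - G = \<chi> k \<zeta> * ((lgi (i + 4) \<zeta> - lgi i \<zeta>) / ?k)" unfolding e log_expansion_def by (simp add: field_simps)
    also have "\<dots> = \<chi> k \<zeta>" unfolding lgi_add_4 by simp
    finally have chi: "\<chi> k \<zeta> = G4 - G" by simp
    have b1: "norm (\<chi> k \<zeta>) \<le> 2 * C0 * \<Lambda> ^ k" unfolding chi using norm_triangle_ineq4[of G4 G] G by linarith
    have u: "c k / ?k + \<zeta> * R k \<zeta> = \<zeta> * (G - \<chi> k \<zeta> * (lgi i \<zeta> / ?k))"
      using Hd_nz[OF H(1)] unfolding e log_expansion_def by (simp add: field_simps)
    have "norm (lgi i \<zeta>) \<le> 4 * pi"
    proof -
      let ?u = "\<zeta> / \<i> ^ i"
      have un: "norm ?u = 1" using \<zeta> by (simp add: norm_divide norm_power)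
      have "?u \<noteq> 0" using un by auto
      hence "\<bar>Re (Ln ?u)\<bar> = 0" "\<bar>Im (Ln ?u)\<bar> \<le> pi" using un Re_Ln[of ?u] Im_Ln_le_pi[of ?u] mpi_less_Im_Ln[of ?u] by auto
      hence "norm (Ln ?u) \<le> pi" using cmod_le[of "Ln ?u"] by linarith
      moreover have "norm (of_nat i * (\<i> * of_real pi / 2)) \<le> 3 * (pi / 2)"
        using i(1) by (simp add: norm_mult norm_divide)
      ultimately show ?thesis unfolding lgi_def using norm_triangle_ineq[of "Ln ?u" "of_nat i * (\<i> * of_real pi / 2)"] pi_gt_zero by linarith
    qed
    hence lg2: "norm (lgi i \<zeta> / ?k) \<le> 2" unfolding norm_divide nk by (simp add: field_simps)
    have "norm (\<zeta> * (G - \<chi> k \<zeta> * (lgi i \<zeta> / ?k))) \<le> norm G + norm (\<chi> k \<zeta>) * norm (lgi i \<zeta> / ?k)"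
      unfolding norm_mult[of \<zeta>] \<zeta> using norm_triangle_ineq4[of G "\<chi> k \<zeta> * (lgi i \<zeta> / ?k)"] by (simp only: norm_mult mult_1)
    also have "\<dots> \<le> C0 * \<Lambda> ^ k + 2 * C0 * \<Lambda> ^ k * 2"
      using G b1 lg2 C0 \<Lambda> by (intro add_mono mult_mono) auto
    finally show ?thesis using b1 unfolding u by simp
  qed
  have uh: "(\<lambda>\<zeta>. c k / ?k + \<zeta> * R k \<zeta>) holomorphic_on ball 0 (2 * pi)" for k by (intro holomorphic_intros hol)
  have c0: "norm (c k / ?k) \<le> 5 * C0 * \<Lambda> ^ k" for k
    using unit_circle_bound[OF uh, of k "5 * C0 * \<Lambda> ^ k" 0] circ by simp
  show ?thesis
  \<comment> \<open>The 5 above is 1 + 2 * 2, from the branch itself and from \<chi>_k times at most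
    2; 40 is 5 * 8, with 8 > 2\<pi>.\<close>
  proof (rule that[of "40 * C0"])
    fix k
    have pos: "C0 * \<Lambda> ^ k > 0" using C0 \<Lambda> by simp
    have "norm (c k) = norm (c k / ?k) * (2 * pi)" by (simp add: norm_divide nk)
    also have "\<dots> \<le> 5 * C0 * \<Lambda> ^ k * 8" using c0[of k] pi_less_4 pos by (intro mult_mono) (auto simp: mult.assoc)
    finally show "norm (c k) \<le> 40 * C0 * \<Lambda> ^ k" by simp
    fix \<zeta> :: complex assume \<zeta>: "norm \<zeta> \<le> 1"
    have "norm (\<chi> k \<zeta>) \<le> 2 * C0 * \<Lambda> ^ k" by (rule unit_circle_bound[OF hol(1) _ \<zeta>]) (use circ in blast)
    thus "norm (\<chi> k \<zeta>) \<le> 40 * C0 * \<Lambda> ^ k" using pos by linarith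
    have "norm (R k \<zeta>) \<le> 10 * C0 * \<Lambda> ^ k"
    proof (rule unit_circle_bound[OF hol(2) _ \<zeta>])
      fix z :: complex assume z: "norm z = 1"
      have "norm (R k z) = norm ((c k / ?k + z * R k z) - c k / ?k)" using z by (simp add: norm_mult)
      also have "\<dots> \<le> norm (c k / ?k + z * R k z) + norm (c k / ?k)" by (rule norm_triangle_ineq4)
      also have "\<dots> \<le> 10 * C0 * \<Lambda> ^ k" using circ[OF z, of k] c0[of k] by linarith
      finally show "norm (R k z) \<le> 10 * C0 * \<Lambda> ^ k" .
    qed
    thus "norm (R k \<zeta>) \<le> 40 * C0 * \<Lambda> ^ k" using pos by linarith
  qed (use C0 in simp)
qed

text \<open>The condition of \<open>simple_expansion\<close> for an arbitrary germ, since the germs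
  of this locale are not tied to a formal series.\<close>

definition germ_expansion :: "(complex \<Rightarrow> complex) \<Rightarrow> complex \<Rightarrow> complex fps \<Rightarrow> complex fps \<Rightarrow> bool" where
  "germ_expansion f c chi R \<longleftrightarrow> fps_conv_radius chi > 0 \<and> fps_conv_radius R > 0 \<and>
     (\<forall>\<^sub>F t in at_right (0::real).
        cont (\<Gamma> +++ linepath (\<omega> + 1) (\<omega> + of_real t)) f (\<omega> + of_real t) =
          c / (2 * of_real pi * \<i> * of_real t)
          + eval_fps chi (of_real t) * (of_real (ln t) / (2 * of_real pi * \<i>))
          + eval_fps R (of_real t))"

text \<open>The segment from \<omega> + 1 towards \<omega> stays in the half-disc where
  \<open>F\<close> is holomorphic, so continuing along it does not change \<open>F\<close>.\<close>

lemma germ_expansionI: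
  assumes co: "continues_along \<Gamma> f F" and hol: "F holomorphic_on (+) \<omega> ` Hd (2 * pi) 0"
    and rad: "fps_conv_radius chi > 0" "fps_conv_radius R > 0"
    and ex: "\<And>t. 0 < t \<Longrightarrow> t < 1 \<Longrightarrow> F (\<omega> + of_real t) = c / (2 * of_real pi * \<i> * of_real t)
          + eval_fps chi (of_real t) * (of_real (ln t) / (2 * of_real pi * \<i>)) + eval_fps R (of_real t)"
  shows "germ_expansion f c chi R"
  unfolding germ_expansion_def
proof (intro conjI rad)
  have pG: "path \<Gamma>" using \<Gamma>(1) by (simp add: paths_from_1_def)
  have c: "cont (\<Gamma> +++ linepath (\<omega> + 1) (\<omega> + of_real t)) f (\<omega> + of_real t) = F (\<omega> + of_real t)" if t: "0 < t" "t < 1" for t :: real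
  proof -
    let ?l = "linepath (\<omega> + 1) (\<omega> + of_real t)"
    have inH: "of_real x \<in> Hd (2 * pi) 0" if "0 < x" "x \<le> 1" for x :: real using that pi_gt3 by (auto simp: Hd_def)
    have op: "open ((+) \<omega> ` Hd (2 * pi) 0)" "convex ((+) \<omega> ` Hd (2 * pi) 0)"
      by (auto intro!: open_translation Hd_open convex_translation Hd_convex)
    have ends: "\<omega> + 1 \<in> (+) \<omega> ` Hd (2 * pi) 0" "\<omega> + of_real t \<in> (+) \<omega> ` Hd (2 * pi) 0"
      using inH[of 1] inH[of t] t by auto
    have "path_image ?l \<subseteq> (+) \<omega> ` Hd (2 * pi) 0" 
      unfolding path_image_linepath by (rule closed_segment_subset[OF ends op(2)])
    moreover have "F analytic_on (+) \<omega> ` Hd (2 * pi) 0" using hol op(1) by (simp add: analytic_on_open)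
    ultimately have "continues_along ?l F F" by (intro continues_const) (rule analytic_on_subset)
    hence "continues_along (\<Gamma> +++ ?l) f F" using pG \<Gamma>(2) by (intro continues_join[OF _ _ _ co]) auto
    moreover have "path (\<Gamma> +++ ?l)" using pG \<Gamma>(2) by simp
    ultimately have "cont (\<Gamma> +++ ?l) f (pathfinish (\<Gamma> +++ ?l)) = F (pathfinish (\<Gamma> +++ ?l))" by (rule cont_eqI[rotated])
    thus ?thesis by simp
  qed
  have "\<forall>\<^sub>F t in at_right (0::real). t \<in> {0<..<1}" by (rule eventually_at_right_real) simp
  thus "\<forall>\<^sub>F t in at_right (0::real). cont (\<Gamma> +++ linepath (\<omega> + 1) (\<omega> + of_real t)) f (\<omega> + of_real t) =
          c / (2 * of_real pi * \<i> * of_real t)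
          + eval_fps chi (of_real t) * (of_real (ln t) / (2 * of_real pi * \<i>)) + eval_fps R (of_real t)"
    by eventually_elim (simp add: c ex)
qed

text \<open>The bounds on the unit disc become coefficient bounds C \<Lambda>^k, so for 0 < t < 1
  the expansions are summed over k term by term. The residue and the logarithmic part of the sum are
  the sums of theirs.\<close>

theorem singularity_at_\<omega>:
  obtains c :: "nat \<Rightarrow> complex" and chi R :: "nat \<Rightarrow> complex fps" and C :: real and RR :: "complex fps" where
    "C > 0" "\<And>k. norm (c k) \<le> C * \<Lambda> ^ k" "chi 0 = 0" "\<And>k. fps_conv_radius (chi k) \<ge> ereal (2 * pi)"
    "\<And>k. germ_expansion (\<phi> k) (c k) (chi k) (R k)"
    "\<And>k \<zeta>. norm \<zeta> < 2 * pi \<Longrightarrow> (exp \<zeta> - 1) * eval_fps (chi (Suc k)) \<zeta> = 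
        c k * M\<omega> 0 \<zeta> + contour_integral (linepath 0 \<zeta>) (\<lambda>\<xi>. M\<omega> \<xi> \<zeta> * eval_fps (chi k) \<xi>)"
    "\<And>m. (\<lambda>k. chi k $ m) sums (\<Sum>k. chi k $ m)"
    "germ_expansion \<Phi> (\<Sum>k. c k) (Abs_fps (\<lambda>m. \<Sum>k. chi k $ m)) RR"
proof -
  obtain n r where n: "n > 0" and ch: "chain (spiral_pts n) (spiral_sets n r)" and "spiral_sets n r 0 \<subseteq> ball 1 1" and "spiral_pts n 0 = 1"
    and co: "\<And>k. continues_along \<Gamma> (\<phi> k) (tow (spiral_pts n) k n)" and coS: "continues_along \<Gamma> \<Phi> (towsum (spiral_pts n) n)"
    by (rule spiral_chain) (rule that)
  let ?p = "spiral_pts n" and ?B = "ball (0::complex) (2 * pi)"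
  obtain c \<chi> R where s: "\<And>k. \<chi> k holomorphic_on ?B" "\<And>k. R k holomorphic_on ?B" "\<And>\<zeta>. \<chi> 0 \<zeta> = 0"
    "\<And>k i \<zeta>. \<zeta> \<in> Hd (2 * pi) i \<Longrightarrow> tow (spiral_pts n) k (n + i) (\<omega> + \<zeta>) = log_expansion i (c k) (\<chi> k) (R k) \<zeta>"
    "\<And>k \<zeta>. \<zeta> \<in> ?B \<Longrightarrow> (exp \<zeta> - 1) * \<chi> (Suc k) \<zeta> = 
        c k * M\<omega> 0 \<zeta> + contour_integral (linepath 0 \<zeta>) (\<lambda>\<xi>. M\<omega> \<xi> \<zeta> * \<chi> k \<xi>)"
    by (rule singular_expansions[OF n ch]) (rule that)
  obtain C where C: "C > 0" "\<And>k. norm (c k) \<le> C * \<Lambda> ^ k" "\<And>k \<zeta>. norm \<zeta> \<le> 1 \<Longrightarrow> norm (\<chi> k \<zeta>) \<le> C * \<Lambda> ^ k"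
    "\<And>k \<zeta>. norm \<zeta> \<le> 1 \<Longrightarrow> norm (R k \<zeta>) \<le> C * \<Lambda> ^ k" by (rule singular_bounds[OF ch s(1,2,4)]) (assumption, rule that)
  define chi where "chi k = fps_expansion (\<chi> k) 0" for k
  define Rf where "Rf k = fps_expansion (R k) 0" for k
  have chi: "fps_conv_radius (chi k) \<ge> ereal (2 * pi)" "\<And>z. norm z < 2 * pi \<Longrightarrow> eval_fps (chi k) z = \<chi> k z" for k
    unfolding chi_def using conv_radius_fps_expansion[of "\<chi> k" 0 "ereal (2 * pi)"] eval_fps_expansion'[of "\<chi> k" 0 "ereal (2 * pi)"] s(1) by auto
  have Rf: "fps_conv_radius (Rf k) \<ge> ereal (2 * pi)" "\<And>z. norm z < 2 * pi \<Longrightarrow> eval_fps (Rf k) z = R k z" for k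
    unfolding Rf_def using conv_radius_fps_expansion[of "R k" 0 "ereal (2 * pi)"] eval_fps_expansion'[of "R k" 0 "ereal (2 * pi)"] s(2) by auto
  have pi1: "1 < 2 * pi" using pi_gt3 by simp
  have pe: "ereal 1 < ereal (2 * pi)" "ereal 0 < ereal (2 * pi)" using pi1 by auto
  have bc: "norm (chi k $ m) \<le> C * \<Lambda> ^ k / 1 ^ m" for k m
    by (rule fps_coeff_bound[OF _ less_le_trans[OF pe(1) chi(1)]]) (use C(3) chi(2) pi1 in auto)
  have bR: "norm (Rf k $ m) \<le> C * \<Lambda> ^ k / 1 ^ m" for k m
    by (rule fps_coeff_bound[OF _ less_le_trans[OF pe(1) Rf(1)]]) (use C(4) Rf(2) pi1 in auto)
  note sc = fps_suminf_of_geometric[of chi C \<Lambda> 1, OF bc \<Lambda> zero_less_one]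
  note sR = fps_suminf_of_geometric[of Rf C \<Lambda> 1, OF bR \<Lambda> zero_less_one]
  have csum: "c sums (\<Sum>k. c k)"
  proof (rule summable_sums, rule summable_comparison_test')
    show "summable (\<lambda>k. C * \<Lambda> ^ k)" using \<Lambda> by (intro summable_mult summable_geometric) auto
    show "\<And>k. 0 \<le> k \<Longrightarrow> norm (c k) \<le> C * \<Lambda> ^ k" using C(2) by simp
  qed
  have inH: "of_real t \<in> Hd (2 * pi) 0" if "0 < t" "t < 1" for t :: real using that pi1 by (auto simp: Hd_def)
  have tw: "tow ?p k n (\<omega> + of_real t) = c k / (2 * of_real pi * \<i> * of_real t)
          + eval_fps (chi k) (of_real t) * (of_real (ln t) / (2 * of_real pi * \<i>)) + eval_fps (Rf k) (of_real t)" if t: "0 < t" "t < 1" for k and t :: real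
  proof -
    have "norm (of_real t :: complex) < 2 * pi" using t pi1 by simp
    thus ?thesis using s(4)[OF inH[OF t], of k] t by (simp add: log_expansion_def lgi_0 chi(2) Rf(2) Ln_of_real)
  qed
  have Un: "(+) \<omega> ` Hd (2 * pi) 0 = spiral_sets n r n" by (simp add: spiral_sets_def)
  show ?thesis
  proof (rule that[of C c chi Rf "Abs_fps (\<lambda>m. \<Sum>k. Rf k $ m)"])
    show "chi 0 = 0"
    proof (rule eval_fps_eqD)
      show "fps_conv_radius (chi 0) > 0" using less_le_trans[OF pe(2) chi(1)[of 0]] by (simp add: zero_ereal_def)
      show "\<forall>\<^sub>F z in nhds 0. eval_fps (chi 0) z = eval_fps 0 z"
        by (rule eventually_in_open[of ?B]) (auto simp: chi(2) s(3))
    qed simp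
    show "germ_expansion (\<phi> k) (c k) (chi k) (Rf k)" for k
    proof (rule germ_expansionI[OF co])
      show "tow ?p k n holomorphic_on (+) \<omega> ` Hd (2 * pi) 0" unfolding Un using tow_compat[OF ch] by (simp add: compat_def)
      show "fps_conv_radius (chi k) > 0" "fps_conv_radius (Rf k) > 0"
        using less_le_trans[OF pe(2) chi(1)[of k]] less_le_trans[OF pe(2) Rf(1)[of k]] by (simp_all add: zero_ereal_def)
    qed (rule tw)
    show "(exp \<zeta> - 1) * eval_fps (chi (Suc k)) \<zeta> = 
        c k * M\<omega> 0 \<zeta> + contour_integral (linepath 0 \<zeta>) (\<lambda>\<xi>. M\<omega> \<xi> \<zeta> * eval_fps (chi k) \<xi>)" if \<zeta>: "norm \<zeta> < 2 * pi" for k \<zeta>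
    proof -
      have "closed_segment 0 \<zeta> \<subseteq> ?B" using \<zeta> by (intro closed_segment_subset) auto
      hence "contour_integral (linepath 0 \<zeta>) (\<lambda>\<xi>. M\<omega> \<xi> \<zeta> * eval_fps (chi k) \<xi>) = contour_integral (linepath 0 \<zeta>) (\<lambda>\<xi>. M\<omega> \<xi> \<zeta> * \<chi> k \<xi>)"
        by (intro contour_integral_cong refl) (auto simp: chi(2))
      thus ?thesis using s(5)[of \<zeta> k] \<zeta> by (simp add: chi(2))
    qed
    show "(\<lambda>k. chi k $ m) sums (\<Sum>k. chi k $ m)" for m using sc(3)[of m] by simp
    show "germ_expansion \<Phi> (\<Sum>k. c k) (Abs_fps (\<lambda>m. \<Sum>k. chi k $ m)) (Abs_fps (\<lambda>m. \<Sum>k. Rf k $ m))"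
    proof (rule germ_expansionI[OF coS])
      show "towsum ?p n holomorphic_on (+) \<omega> ` Hd (2 * pi) 0" unfolding Un using towsum_compat[OF ch] by (simp add: compat_def)
      show "fps_conv_radius (Abs_fps (\<lambda>m. \<Sum>k. chi k $ m)) > 0" "fps_conv_radius (Abs_fps (\<lambda>m. \<Sum>k. Rf k $ m)) > 0"
        using sc(1) sR(1) by (auto elim!: less_le_trans[rotated])
      fix t :: real assume t: "0 < t" "t < 1"
      have t1: "norm (of_real t :: complex) < 1" using t by simp
      have "\<omega> + of_real t \<in> spiral_sets n r n" unfolding Un[symmetric] using inH[OF t] by simp
      hence "(\<lambda>k. tow ?p k n (\<omega> + of_real t)) sums towsum ?p n (\<omega> + of_real t)" by (rule tow_sums[OF ch])
      moreover have "(\<lambda>k. tow ?p k n (\<omega> + of_real t)) sums ((\<Sum>k. c k) / (2 * of_real pi * \<i> * of_real t)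
          + eval_fps (Abs_fps (\<lambda>m. \<Sum>k. chi k $ m)) (of_real t) * (of_real (ln t) / (2 * of_real pi * \<i>)) + eval_fps (Abs_fps (\<lambda>m. \<Sum>k. Rf k $ m)) (of_real t))"
        unfolding tw[OF t] by (intro sums_add sums_divide sums_mult2 csum sc(2)[OF t1] sR(2)[OF t1])
      ultimately show "towsum ?p n (\<omega> + of_real t) = (\<Sum>k. c k) / (2 * of_real pi * \<i> * of_real t)
          + eval_fps (Abs_fps (\<lambda>m. \<Sum>k. chi k $ m)) (of_real t) * (of_real (ln t) / (2 * of_real pi * \<i>)) + eval_fps (Abs_fps (\<lambda>m. \<Sum>k. Rf k $ m)) (of_real t)"
        by (rule sums_unique2)
    qed
  qed (use C chi in auto)
qed

end

subsection \<open>Uniqueness of the alien operator and conclusion\<close>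

lemma fps_conv_radius_pos_add: "fps_conv_radius P > 0 \<Longrightarrow> fps_conv_radius Q > 0 \<Longrightarrow> fps_conv_radius (P + Q :: complex fps) > 0"
  by (rule less_le_trans[OF _ fps_conv_radius_add]) simp

lemma fps_conv_radius_pos_diff: "fps_conv_radius P > 0 \<Longrightarrow> fps_conv_radius Q > 0 \<Longrightarrow> fps_conv_radius (P - Q :: complex fps) > 0"
  by (rule less_le_trans[OF _ fps_conv_radius_diff]) simp

lemma fps_conv_radius_pos_mult: "fps_conv_radius P > 0 \<Longrightarrow> fps_conv_radius Q > 0 \<Longrightarrow> fps_conv_radius (P * Q :: complex fps) > 0"
  by (rule less_le_trans[OF _ fps_conv_radius_mult]) simp

lemma fps_conv_radius_pos_compose:
  fixes F G :: "complex fps"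
  assumes "fps_conv_radius F > 0" "fps_conv_radius G > 0" "G $ 0 = 0"
  shows "fps_conv_radius (F oo G) > 0"
proof -
  have "(eval_fps F \<circ> eval_fps G) has_fps_expansion (F oo G)"
    using assms by (intro has_fps_expansion_compose eval_fps_has_fps_expansion)
  thus ?thesis by (simp add: has_fps_expansion_def)
qed

lemma fps_cutoff_conv_radius: "fps_conv_radius (fps_cutoff n (P :: complex fps)) = \<infinity>"
proof -
  have "fps_conv_radius (fps_cutoff n P) \<ge> \<infinity>"
    unfolding fps_conv_radius_def
    by (rule conv_radius_geI_ex', rule summable_finite[of "{..<n}"]) auto
  thus ?thesis by simp
qed

lemma fps_cpow_conv_radius_pos: "fps_conv_radius G > 0 \<Longrightarrow> G $ 0 = 1 \<Longrightarrow> fps_conv_radius (fps_cpow G a) > 0"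
  unfolding fps_cpow_def
  by (intro fps_conv_radius_pos_compose fps_conv_radius_pos_diff) (auto simp: fps_conv_radius_binomial)

lemma comp_id_plus_conv_radius_pos:
  assumes "fps_conv_radius c > 0" "fps_conv_radius P > 0"
  shows "fps_conv_radius (comp_id_plus c P) > 0"
proof -
  have "fps_conv_radius (1 + fps_X * c) > 0"
    using assms by (intro fps_conv_radius_pos_add fps_conv_radius_pos_mult) auto
  hence "fps_conv_radius (fps_X * inverse (1 + fps_X * c)) > 0"
    by (intro fps_conv_radius_pos_mult fps_conv_radius_inverse_pos) auto
  thus ?thesis unfolding comp_id_plus_def
    using assms by (intro fps_conv_radius_pos_compose) (auto simp: fps_divide_unit)
qed

text \<open>For n \<ge> 1, |Gamma(n + \<beta> + 1)| is at least a constant times (n - 1)!, which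
  outweighs the geometric growth of the coefficients.\<close>

lemma borel_fps_entire:
  assumes \<beta>: "Re \<beta> \<ge> 0" and P: "fps_conv_radius P > 0"
  shows "fps_conv_radius (borel_fps \<beta> P) = \<infinity>"
proof -
  obtain s where s: "s > 0" "ereal s < fps_conv_radius P"
    using P ereal_dense2[of 0 "fps_conv_radius P"] by (auto simp: zero_ereal_def)
  obtain C where C: "C > 0" "\<And>n. norm (P $ n) \<le> C / s ^ n" by (rule fps_coeff_bound_ex[OF s]) (rule that)
  define G where "G = norm (Gamma (\<beta> + 1))"
  have \<beta>1: "\<beta> + 1 \<notin> \<int>\<^sub>\<le>\<^sub>0" "G > 0" using Gamma_shift_nonzero(1,2)[OF \<beta>, of 0] by (auto simp: G_def)
  have Gam: "norm (Gamma (of_nat (Suc m) + \<beta> + 1)) \<ge> G * fact m" for m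
  proof -
    have "pochhammer (\<beta> + 1) (Suc m) = Gamma (\<beta> + 1 + of_nat (Suc m)) / Gamma (\<beta> + 1)"
      by (rule pochhammer_Gamma[OF \<beta>1(1)])
    hence "norm (Gamma (of_nat (Suc m) + \<beta> + 1)) = G * norm (pochhammer (\<beta> + 1) (Suc m))"
      using \<beta>1(2) by (simp add: G_def norm_divide add_ac del: of_nat_Suc)
    moreover have "fact m \<le> norm (pochhammer (\<beta> + 1) (Suc m))" using norm_pochhammer_ge[OF \<beta>, of 0 m] by simp
    ultimately show ?thesis using \<beta>1(2) by (simp add: mult_left_mono)
  qed
  have "fps_conv_radius (borel_fps \<beta> P) \<ge> \<infinity>"
  proof (rule fps_conv_radius_geI)
    fix r :: real assume r: "0 < r"
    define M where "M = norm (borel_fps \<beta> P $ 0) + C / G * ((r / s) * exp (r / s))"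
    have "norm (borel_fps \<beta> P $ n) \<le> M / r ^ n" for n
    proof (cases n)
      case 0 thus ?thesis using C \<beta>1 r s by (simp add: M_def)
    next
      case (Suc m)
      have "norm (borel_fps \<beta> P $ n) \<le> (C / s ^ n) / (G * fact m)"
        unfolding borel_fps_def fps_nth_Abs_fps norm_divide Suc
        using C(1) C(2)[of "Suc m"] \<beta>1 s Gam[of m] by (intro frac_le) auto
      also have "\<dots> = C / G * ((r / s) * ((r / s) ^ m / fact m)) / r ^ n"
        using r s \<beta>1 by (simp add: Suc field_simps)
      also have "\<dots> \<le> C / G * ((r / s) * exp (r / s)) / r ^ n"
        using r s C \<beta>1 by (intro divide_right_mono mult_left_mono power_div_fact_le_exp) auto
      also have "\<dots> \<le> M / r ^ n" using r by (intro divide_right_mono) (auto simp: M_def)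
      finally show ?thesis .
    qed
    thus "\<exists>C. \<forall>n. norm (borel_fps \<beta> P $ n) \<le> C / r ^ n" by blast
  qed
  thus ?thesis by simp
qed

lemma eval_fps_exp_minus_one_mult:
  fixes z :: complex
  assumes "ereal (norm z) < fps_conv_radius p"
  shows "eval_fps ((fps_exp 1 - 1) * p) z = (exp z - 1) * eval_fps p z"
proof -
  have "fps_conv_radius (fps_exp 1 - 1 :: complex fps) \<ge> min \<infinity> \<infinity>"
    by (rule order_trans[OF _ fps_conv_radius_diff]) simp
  hence "fps_conv_radius (fps_exp 1 - 1 :: complex fps) = \<infinity>" by simp
  moreover have "eval_fps (fps_exp 1 - 1) z = exp z - 1" by (subst eval_fps_diff) auto
  ultimately show ?thesis using assms by (subst eval_fps_mult) auto
qed

text \<open>The zero function is continued once around 0: the half-discs 0 and 4 coincide while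
  their logarithms differ by 2\<pi>\<i>, which forces \<chi> = 0. Then c/(2\<pi>\<i>) + \<zeta> R
  vanishes identically, in particular at 0.\<close>

lemma log_expansion_zero:
  assumes s: "s > 0" and hol: "\<chi> holomorphic_on ball 0 s" "R holomorphic_on ball 0 s"
    and z: "\<And>t. 0 < t \<Longrightarrow> t < s \<Longrightarrow> log_expansion 0 c \<chi> R (of_real t) = 0"
  shows "c = 0" and "\<And>\<zeta>. \<zeta> \<in> ball 0 s \<Longrightarrow> \<chi> \<zeta> = 0"
proof -
  have half: "of_real (s / 2) \<in> Hd s 0" using s by (simp add: Hd_def)
  have L0: "0 = log_expansion 0 c \<chi> R \<zeta>" if "\<zeta> \<in> Hd s 0" for \<zeta>
  proof (rule analytic_continuation[of "log_expansion 0 c \<chi> R" "Hd s 0" "of_real ` {0<..<s}" "of_real (s / 2)", symmetric])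
    show "log_expansion 0 c \<chi> R holomorphic_on Hd s 0" by (rule log_expansion_holomorphic[OF hol])
    show "connected (Hd s 0)" by (rule convex_connected[OF Hd_convex])
    show "open (Hd s 0)" by (rule Hd_open)
    show "complex_of_real (s / 2) islimpt of_real ` {0<..<s}"
      unfolding islimpt_approachable
    proof (intro allI impI)
      fix e :: real assume e: "e > 0"
      define x where "x = min (e / 2) (s / 4)"
      have x: "x > 0" "x < e" "s / 2 + x < s" using e s by (auto simp: x_def min_def)
      have "dist (complex_of_real (s / 2 + x)) (of_real (s / 2)) = x" using x by (simp add: dist_norm)
      thus "\<exists>x'\<in>complex_of_real ` {0<..<s}. x' \<noteq> of_real (s / 2) \<and> dist x' (of_real (s / 2)) < e" 
        using x s by (intro bexI[of _ "of_real (s / 2 + x)"]) (auto simp del: of_real_add of_real_divide)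
    qed
  qed (use z half that in \<open>auto simp: Hd_def\<close>)
  have L: "0 = log_expansion i c \<chi> R \<zeta>" if "\<zeta> \<in> Hd s i" for i \<zeta>
    by (rule spiral_expansion[OF s hol _ refl L0 that]) auto
  have \<chi>H: "\<chi> \<zeta> = 0" if "\<zeta> \<in> Hd s 0" for \<zeta>
  proof -
    have "\<zeta> \<in> Hd s (0 + 4)" unfolding Hd_add_4 by (rule that)
    hence "0 = log_expansion (0 + 4) c \<chi> R \<zeta> - log_expansion 0 c \<chi> R \<zeta>" using L[of \<zeta> "0 + 4"] L0[OF that] by simp
    also have "\<dots> = \<chi> \<zeta>" unfolding log_expansion_def lgi_add_4 by (simp add: field_simps)
    finally show ?thesis by simp
  qed
  show \<chi>0: "\<chi> \<zeta> = 0" if "\<zeta> \<in> ball 0 s" for \<zeta>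
    by (rule analytic_continuation_open[of "Hd s 0" "ball 0 s" \<chi> "\<lambda>_. 0"]) (use \<chi>H half that hol Hd_open Hd_ball in auto)
  have "c / (2 * of_real pi * \<i>) + \<zeta> * R \<zeta> = 0" if "\<zeta> \<in> Hd s 0" for \<zeta>
    using L0[OF that] Hd_nz[OF that] \<chi>H[OF that] by (simp add: log_expansion_def field_simps)
  hence "c / (2 * of_real pi * \<i>) + 0 * R 0 = 0"
    by (intro analytic_continuation_open[of "Hd s 0" "ball 0 s" "\<lambda>\<zeta>. c / (2 * of_real pi * \<i>) + \<zeta> * R \<zeta>" "\<lambda>_. 0" 0])
       (use half s hol Hd_open Hd_ball in \<open>auto intro!: holomorphic_intros\<close>)
  thus "c = 0" by simp
qed

text \<open>Makes the definite description in \<open>alien\<close> meaningful: the difference of two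
  expansions of one germ is an expansion of zero.\<close>

lemma simple_expansion_unique:
  assumes "simple_expansion \<omega> \<Gamma> \<beta> P c chi R" "simple_expansion \<omega> \<Gamma> \<beta> P c' chi' R'"
  shows "c = c'" "chi = chi'"
proof -
  define G where "G t = cont (\<Gamma> +++ linepath (\<omega> + 1) (\<omega> + of_real t)) (borel_germ \<beta> P) (\<omega> + of_real t)" for t :: real
  let ?e = "\<lambda>c chi R (t :: real). G t = c / (2 * of_real pi * \<i> * of_real t) + eval_fps chi (of_real t) * (of_real (ln t) / (2 * of_real pi * \<i>)) + eval_fps R (of_real t)"
  have r: "fps_conv_radius chi > 0" "fps_conv_radius R > 0" "fps_conv_radius chi' > 0" "fps_conv_radius R' > 0"
    and ev: "\<forall>\<^sub>F t in at_right 0. ?e c chi R t" "\<forall>\<^sub>F t in at_right 0. ?e c' chi' R' t"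
    using assms unfolding simple_expansion_def G_def by auto
  from eventually_conj[OF ev] obtain s1 :: real where s1: "s1 > 0" "\<And>t. 0 < t \<Longrightarrow> t < s1 \<Longrightarrow> ?e c chi R t \<and> ?e c' chi' R' t"
    unfolding eventually_at_right_field by blast
  define \<rho> where "\<rho> = min (min (fps_conv_radius chi) (fps_conv_radius R)) (min (fps_conv_radius chi') (fps_conv_radius R'))"
  have "0 < min (ereal s1) \<rho>" using r s1 by (simp add: \<rho>_def)
  then obtain s where s: "0 < s" "ereal s < min (ereal s1) \<rho>"
    using ereal_dense2[of 0 "min (ereal s1) \<rho>"] by (auto simp: zero_ereal_def)
  have sub: "ball 0 s \<subseteq> eball (0::complex) (fps_conv_radius F)" if "F \<in> {chi, chi', R, R'}" for F
  proof -
    have "ereal s < fps_conv_radius F" using that s(2) by (auto simp: \<rho>_def)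
    from eball_cball_subset[OF this] show ?thesis using ball_subset_cball by blast
  qed
  have "log_expansion 0 (c - c') (\<lambda>\<zeta>. eval_fps chi \<zeta> - eval_fps chi' \<zeta>) (\<lambda>\<zeta>. eval_fps R \<zeta> - eval_fps R' \<zeta>) (of_real t) = 0"
    if t: "0 < t" "t < s" for t :: real
  proof -
    have "t < s1" using t s(2) by simp
    from s1(2)[OF t(1) this] have e: "?e c chi R t" "?e c' chi' R' t" by blast+
    have "log_expansion 0 (c - c') (\<lambda>\<zeta>. eval_fps chi \<zeta> - eval_fps chi' \<zeta>) (\<lambda>\<zeta>. eval_fps R \<zeta> - eval_fps R' \<zeta>) (of_real t) =
       (c / (2 * of_real pi * \<i> * of_real t) + eval_fps chi (of_real t) * (of_real (ln t) / (2 * of_real pi * \<i>)) + eval_fps R (of_real t)) -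
       (c' / (2 * of_real pi * \<i> * of_real t) + eval_fps chi' (of_real t) * (of_real (ln t) / (2 * of_real pi * \<i>)) + eval_fps R' (of_real t))"
      using t unfolding log_expansion_def lgi_0 by (simp add: Ln_of_real diff_divide_distrib left_diff_distrib)
    also have "\<dots> = G t - G t" unfolding e(1)[symmetric] e(2)[symmetric] ..
    finally show ?thesis by simp
  qed
  from log_expansion_zero[OF s(1) _ _ this] sub 
  have *: "c - c' = 0" "\<And>\<zeta>. \<zeta> \<in> ball 0 s \<Longrightarrow> eval_fps chi \<zeta> - eval_fps chi' \<zeta> = 0"
    by (auto intro!: holomorphic_intros)
  from *(1) show "c = c'" by simp
  have "\<forall>\<^sub>F \<zeta> in nhds 0. eval_fps chi \<zeta> = eval_fps chi' \<zeta>"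
    by (rule eventually_mono[OF eventually_nhds_in_open[of "ball 0 s"]]) (use s *(2) in auto)
  thus "chi = chi'" using r by (intro eval_fps_eqD)
qed

lemma alien_eqI:
  assumes "simple_expansion \<omega> \<Gamma> \<beta> P c chi R"
  shows "alien \<omega> \<Gamma> \<beta> P = fps_const c + inv_borel chi"
  unfolding alien_def
proof (rule the_equality)
  fix A assume "\<exists>c chi R. simple_expansion \<omega> \<Gamma> \<beta> P c chi R \<and> A = fps_const c + inv_borel chi"
  then obtain c' chi' R' where *: "simple_expansion \<omega> \<Gamma> \<beta> P c' chi' R'" "A = fps_const c' + inv_borel chi'" by blast
  show "A = fps_const c + inv_borel chi" using simple_expansion_unique[OF assms *(1)] *(2) by simp
qed (use assms in blast)

section \<open>The alien values as formal series\<close>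

context parabolic_germ
begin

lemma
  shows quot_conv_radius_pos: "fps_conv_radius (quot_b f) > 0"
    and b_star_conv_radius_pos: "fps_conv_radius bs > 0"
    and h\<^sub>\<omega>_conv_radius_pos: "fps_conv_radius (h\<^sub>\<omega> \<omega>) > 0"
    and b_alpha_conv_radius_pos: "fps_conv_radius (b_alpha f \<rho> \<alpha> N) > 0"
proof -
  have 1: "fps_conv_radius (1 - fps_X :: complex fps) > 0" by (intro fps_conv_radius_pos_diff) auto
  show q: "fps_conv_radius (quot_b f) > 0" 
    unfolding quot_facts(3) using b_facts(1) 1
    by (intro fps_conv_radius_pos_mult fps_conv_radius_pos_add fps_conv_radius_inverse_pos) auto
  show bs: "fps_conv_radius bs > 0"
    unfolding b_star_def fps_log1_def using b_facts(1) q quot_facts(1)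
    by (intro fps_conv_radius_pos_add fps_conv_radius_pos_mult fps_conv_radius_pos_compose fps_conv_radius_pos_diff) auto
  show "fps_conv_radius (h\<^sub>\<omega> \<omega>) > 0" using bs bs_facts by (intro fps_conv_radius_pos_compose) auto
  have m1: "fps_conv_radius (- 1 :: complex fps) > 0" by simp
  have T: "fps_conv_radius (fps_cutoff (N + 1) (phi_ser f \<rho>)) > 0" by (simp add: fps_cutoff_conv_radius)
  have "fps_conv_radius (b_trunc f \<rho> N) > 0"
    unfolding b_trunc_def Let_def
    by (intro fps_conv_radius_pos_add fps_conv_radius_pos_diff comp_id_plus_conv_radius_pos bs b_facts(1) m1 T)
  moreover have "fps_conv_radius (fps_cpow (1 - fps_X) (- \<alpha>)) > 0" using 1 by (intro fps_cpow_conv_radius_pos) auto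
  ultimately show "fps_conv_radius (b_alpha f \<rho> \<alpha> N) > 0"
    unfolding b_alpha_def by (intro fps_conv_radius_pos_mult) auto
qed

lemma inv_borel_eq: "inv_borel chi = fps_X * unborel_fps 0 chi"
proof -
  have "Abs_fps (\<lambda>n. fact n * chi $ n) = unborel_fps 0 chi"
    by (rule fps_ext) (simp add: unborel_fps_def Gamma_fact[symmetric] add.commute)
  thus ?thesis by (simp add: inv_borel_def)
qed

text \<open>The recursion for \<chi> read on the formal side: multiplication by exp \<zeta> - 1 is
  the difference operator, and the right-hand side is the Borel transform of B^\<omega> applied to
  the residue plus the inverse transform of \<chi>.\<close>

lemma EB_inv_borel:
  assumes rad: "fps_conv_radius chi > 0" "fps_conv_radius chi' > 0"
    and eq: "\<forall>\<^sub>F \<zeta> in nhds 0. (exp \<zeta> - 1) * eval_fps chi' \<zeta> =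
      c * eval_fps (borel_fps 0 (fps_shift 1 (h\<^sub>\<omega> \<omega> - 1))) \<zeta> + eval_fps (borel_fps 0 (tw_op (h\<^sub>\<omega> \<omega>) b 0 (unborel_fps 0 chi))) \<zeta>"
    and rT: "fps_conv_radius (borel_fps 0 (tw_op (h\<^sub>\<omega> \<omega>) b 0 (unborel_fps 0 chi))) > 0"
  shows "EB \<omega> (fps_const c + inv_borel chi) = inv_borel chi'"
proof -
  let ?s = "fps_shift 1 (h\<^sub>\<omega> \<omega> - 1)" and ?t = "tw_op (h\<^sub>\<omega> \<omega>) b 0 (unborel_fps 0 chi)"
  define W where "W = fps_const c * ?s + ?t"
  have rs: "fps_conv_radius (borel_fps 0 ?s) = \<infinity>"
    by (rule borel_fps_entire) (auto intro!: fps_conv_radius_pos_diff h\<^sub>\<omega>_conv_radius_pos)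
  have rc: "fps_conv_radius (fps_const c * borel_fps 0 ?s) = \<infinity>"
    using fps_conv_radius_mult[of "fps_const c" "borel_fps 0 ?s"] rs by simp
  have "(fps_exp 1 - 1) * chi' = borel_fps 0 W"
  proof (rule eval_fps_eqD)
    show "fps_conv_radius ((fps_exp 1 - 1) * chi') > 0"
      using rad by (intro fps_conv_radius_pos_mult fps_conv_radius_pos_diff) auto
    show "fps_conv_radius (borel_fps 0 W) > 0"
      unfolding W_def borel_fps_add borel_fps_const_mult using rT rc by (intro fps_conv_radius_pos_add) auto
    have "\<forall>\<^sub>F \<zeta> in nhds 0. \<zeta> \<in> eball 0 (min (fps_conv_radius chi') (fps_conv_radius (borel_fps 0 ?t)))"
      using rad rT by (intro eventually_nhds_in_open) (auto simp: zero_ereal_def)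
    with eq show "\<forall>\<^sub>F \<zeta> in nhds 0. eval_fps ((fps_exp 1 - 1) * chi') \<zeta> = eval_fps (borel_fps 0 W) \<zeta>"
    proof eventually_elim
      case (elim \<zeta>)
      hence r: "ereal (norm \<zeta>) < fps_conv_radius chi'" "ereal (norm \<zeta>) < fps_conv_radius (borel_fps 0 ?t)" by auto
      have "eval_fps (borel_fps 0 W) \<zeta> = c * eval_fps (borel_fps 0 ?s) \<zeta> + eval_fps (borel_fps 0 ?t) \<zeta>"
        unfolding W_def borel_fps_add borel_fps_const_mult using r(2) rs rc
        by (subst eval_fps_add; (subst eval_fps_mult)?; simp)
      thus ?case using elim(1) r(1) by (simp add: eval_fps_exp_minus_one_mult)
    qed
  qed
  hence E: "E_tw 0 W = unborel_fps 0 chi'" by (intro E_tw_eqI) auto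
  have W0: "W $ 0 = 0" using h\<^sub>\<omega>_facts[of \<omega>] by (simp add: W_def tw_op_nth_0)
  have "EB \<omega> (fps_const c + inv_borel chi) = E_op (fps_X * W)"
    unfolding EB_def inv_borel_eq B_omega_const_plus W_def ..
  also have "\<dots> = inv_borel chi'" unfolding E_op_X_mult[OF W0] E inv_borel_eq ..
  finally show ?thesis .
qed

lemma alien_series_eq_sum_Psi:
  assumes chi0: "chi 0 = 0" and step: "\<And>k. EB \<omega> (fps_const (c k) + inv_borel (chi k)) = inv_borel (chi (Suc k))"
  shows "fps_const (c k) + inv_borel (chi k) = (\<Sum>j\<le>k. fps_const (c j) * Psi f \<rho> \<omega> (k - j))"
proof (induction k)
  case 0
  show ?case by (simp add: chi0 inv_borel_def Psi_0 fps_eq_iff fps_X_mult_nth)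
next
  case (Suc k)
  have "inv_borel (chi (Suc k)) = (\<Sum>j\<le>k. fps_const (c j) * Psi f \<rho> \<omega> (Suc k - j))"
    unfolding step[symmetric] Suc EB_sum EB_const_mult by (intro sum.cong refl) (simp add: Psi_Suc[symmetric] Suc_diff_le)
  thus ?case by (simp add: Psi_0 add.commute)
qed

text \<open>For each coefficient a Cauchy product: the residues are absolutely summable, and only
  finitely many \<Psi>_k contribute, because their orders tend to infinity.\<close>

lemma alien_series_sum:
  assumes a: "\<And>k. fps_const (c k) + inv_borel (chi k) = (\<Sum>j\<le>k. fps_const (c j) * Psi f \<rho> \<omega> (k - j))"
    and c: "summable (\<lambda>k. norm (c k))" and chi: "\<And>m. (\<lambda>k. chi k $ m) sums X m"
  shows "fps_const (\<Sum>k. c k) + inv_borel (Abs_fps X) = fps_const (\<Sum>k. c k) * (fps_exp (- \<omega>) oo phi_ser f \<rho>)"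
proof (rule fps_ext)
  fix m
  have cs: "c sums (\<Sum>k. c k)" by (rule summable_sums[OF summable_norm_cancel[OF c]])
  have "(\<lambda>k. (fps_const (c k) + inv_borel (chi k)) $ m) sums ((fps_const (\<Sum>k. c k) + inv_borel (Abs_fps X)) $ m)"
  proof (cases m)
    case 0 thus ?thesis using cs by (simp add: inv_borel_def)
  next
    case (Suc i) thus ?thesis using sums_mult[OF chi[of i], of "fact i"] by (simp add: inv_borel_def fps_X_mult_nth)
  qed
  moreover have "(\<lambda>k. (fps_const (c k) + inv_borel (chi k)) $ m) sums ((\<Sum>k. c k) * (\<Sum>k. Psi f \<rho> \<omega> k $ m))"
  proof -
    have "summable (\<lambda>k. norm (Psi f \<rho> \<omega> k $ m))"
      by (rule summable_finite[of "{..m}"]) (auto simp: Psi_low_order)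
    from Cauchy_product_sums[OF c this] show ?thesis unfolding a by (simp add: fps_sum_nth)
  qed
  moreover have "(\<Sum>k. Psi f \<rho> \<omega> k $ m) = (fps_exp (- \<omega>) oo phi_ser f \<rho>) $ m"
    unfolding exp_phi_eq_sum_Psi[OF lessI] by (rule suminf_finite) (auto simp: Psi_low_order)
  ultimately show "(fps_const (\<Sum>k. c k) + inv_borel (Abs_fps X)) $ m = (fps_const (\<Sum>k. c k) * (fps_exp (- \<omega>) oo phi_ser f \<rho>)) $ m"
    using sums_unique2 by fastforce
qed

end

section \<open>Borel transforms of the iterates and of the remainder at the origin\<close>

locale resurgent_germ = parabolic_germ +
  fixes \<alpha> \<beta> :: complex and N :: nat
  assumes Re_\<beta>: "Re \<beta> \<ge> 0" and \<beta>_eq: "\<beta> = \<alpha> + of_nat N" and \<alpha>\<beta>: "norm \<alpha> < norm (\<beta> + 1)"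
begin

abbreviation "h \<equiv> fps_cpow (quot_b f) \<alpha>"
abbreviation "ba \<equiv> b_alpha f \<rho> \<alpha> N"
abbreviation "p k \<equiv> borel_fps \<beta> (Phi f \<rho> \<alpha> N k)"
abbreviation "r \<equiv> borel_fps \<beta> (phi_rem f \<rho> N)"

lemma h_facts: "h $ 0 = 1" "h $ 1 = \<alpha>" "fps_conv_radius h > 0"
  using cpow_quot_facts[of \<alpha>] quot_facts(1) quot_conv_radius_pos by (auto intro!: fps_cpow_conv_radius_pos)

lemma Phi_0: "Phi f \<rho> \<alpha> N 0 = E_tw \<beta> ba"
  and Phi_Suc: "Phi f \<rho> \<alpha> N (Suc k) = E_tw \<beta> (tw_op h b \<beta> (Phi f \<rho> \<alpha> N k))"
  by (simp_all add: Phi_def \<beta>_eq Let_def B_tw_def tw_op_def)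

lemma exp_p_0: "(fps_exp 1 - 1) * p 0 = borel_fps \<beta> ba"
  and exp_p_Suc: "(fps_exp 1 - 1) * p (Suc k) = borel_fps \<beta> (tw_op h b \<beta> (Phi f \<rho> \<alpha> N k))"
  unfolding Phi_0 Phi_Suc
  by (rule E_tw_borel(1)[OF Re_\<beta>], simp add: phi_rem_eq(2)[OF \<beta>_eq] tw_op_nth_0 h_facts)+

lemma p_Suc_nth: "p (Suc k) $ n = (\<Sum>m\<le>n. EBmat h b \<beta> n m * p k $ m)"
  unfolding Phi_Suc by (rule EBmat_apply[OF Re_\<beta> h_facts(1) b_facts(2)])

lemma borel_ba_radius: "fps_conv_radius (borel_fps \<beta> ba) = \<infinity>"
  by (rule borel_fps_entire[OF Re_\<beta> b_alpha_conv_radius_pos])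

lemma p_0_radius: "fps_conv_radius (p 0) \<ge> ereal (2 * pi)"
proof -
  have "p 0 = bern * fps_shift 1 (borel_fps \<beta> ba)"
    unfolding Phi_0 by (rule E_tw_borel(2)[OF Re_\<beta> phi_rem_eq(2)[OF \<beta>_eq]])
  thus ?thesis using fps_conv_radius_mult[of bern "fps_shift 1 (borel_fps \<beta> ba)"] bern_conv_radius
    by (auto simp: borel_ba_radius intro: order_trans)
qed

text \<open>Re \<beta> \<ge> 0 makes |n + \<beta> + 1| smallest at n = 0, so |\<alpha>|/|\<beta>+1|
  bounds the whole diagonal.\<close>

lemma EBmat_diag_bound: "norm (EBmat h b \<beta> n n) \<le> norm \<alpha> / norm (\<beta> + 1)" "norm \<alpha> / norm (\<beta> + 1) < 1"
proof -
  have p: "norm (\<beta> + 1) > 0" using \<alpha>\<beta> le_less_trans[OF norm_ge_zero] by blast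
  have "(norm (\<beta> + 1))\<^sup>2 \<le> (norm (of_nat n + \<beta> + 1))\<^sup>2"
    unfolding cmod_power2 using Re_\<beta> by (auto intro!: power_mono)
  hence le: "norm (\<beta> + 1) \<le> norm (of_nat n + \<beta> + 1)" by (rule power2_le_imp_le) simp
  show "norm (EBmat h b \<beta> n n) \<le> norm \<alpha> / norm (\<beta> + 1)"
    unfolding EBmat_diag[of h b, OF h_facts(1) b_facts(2)] h_facts(2) norm_divide 
    using le p less_le_trans[OF p le] by (intro divide_left_mono mult_pos_pos) auto
  show "norm \<alpha> / norm (\<beta> + 1) < 1" using p \<alpha>\<beta> by simp
qed

lemma p_bound:
  assumes s: "0 < s" "s < 2 * pi"
  obtains C \<Lambda> where "C > 0" "0 < \<Lambda>" "\<Lambda> < 1" "\<And>k n. norm (p k $ n) \<le> C * \<Lambda> ^ k / s ^ n"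
proof -
  obtain s' where s': "s < s'" "s' < 2 * pi" using s dense by blast
  have "0 < s'" using s s' by simp
  obtain D where D: "D > 0" "\<And>N n. n \<le> N \<Longrightarrow> norm (EBmat h b \<beta> N n) \<le> D / s' ^ (N - n) / (real n + 1)"
    by (rule EBmat_bound[OF Re_\<beta> h_facts(3) b_facts(1,2) \<open>0 < s'\<close> s'(2)]) (rule that)
  have "ereal s < fps_conv_radius (p 0)" using p_0_radius s(2) by (auto elim!: less_le_trans[rotated])
  then obtain C0 where C0: "C0 > 0" "\<And>n. norm (p 0 $ n) \<le> C0 / s ^ n" by (rule fps_coeff_bound_ex[OF s(1)]) (rule that)
  show ?thesis
    by (rule triangular_iterates_geometric[where M = "EBmat h b \<beta>" and p = "\<lambda>k. ($) (p k)", 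
          OF D(2) EBmat_diag_bound s(1) s'(1) D(1) C0(2) p_Suc_nth]) (assumption, rule that)
qed

lemma p_radius: "fps_conv_radius (p k) \<ge> ereal (2 * pi)"
proof (rule fps_conv_radius_geI)
  fix s :: real assume "0 < s" "ereal s < ereal (2 * pi)"
  hence s: "0 < s" "s < 2 * pi" by auto
  obtain C \<Lambda> where "C > 0" "0 < \<Lambda>" "\<Lambda> < 1" "\<And>k n. norm (p k $ n) \<le> C * \<Lambda> ^ k / s ^ n"
    by (rule p_bound[OF s]) (rule that)
  thus "\<exists>C. \<forall>n. norm (p k $ n) \<le> C / s ^ n" by blast
qed

lemma r_nth: "r $ n = p 0 $ n + (\<Sum>m\<le>n. EBmat h b \<beta> n m * r $ m)"
proof -
  let ?t = "tw_op h b \<beta> (phi_rem f \<rho> N)"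
  have "(fps_exp 1 - 1) * r = borel_fps \<beta> (?t + ba)"
    using phi_rem_eq(1)[OF \<beta>_eq] unfolding diff_op_eq_iff[OF Re_\<beta>] .
  hence "r = bern * fps_shift 1 (borel_fps \<beta> ?t) + bern * fps_shift 1 (borel_fps \<beta> ba)"
    unfolding exp_minus_one_mult_eq_iff by (simp add: fps_shift_add distrib_left)
  moreover have "bern * fps_shift 1 (borel_fps \<beta> ba) = p 0" 
    unfolding Phi_0 by (rule E_tw_borel(2)[OF Re_\<beta> phi_rem_eq(2)[OF \<beta>_eq], symmetric])
  moreover have "(bern * fps_shift 1 (borel_fps \<beta> ?t)) $ n = (\<Sum>m\<le>n. EBmat h b \<beta> n m * r $ m)"
    by (rule bern_shift_Bmat) (rule borel_fps_tw_op[OF Re_\<beta> h_facts(1) b_facts(2)])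
  ultimately show ?thesis by (metis fps_add_nth add.commute)
qed

text \<open>The sum over k satisfies the same triangular equation as \<open>r\<close>. Its diagonal
  entries differ from 1, so each coefficient is determined by the earlier ones.\<close>

lemma p_nth_sums: "(\<lambda>k. p k $ n) sums (r $ n)"
proof -
  obtain C \<Lambda> where C: "C > 0" "0 < \<Lambda>" "\<Lambda> < 1" "\<And>k n. norm (p k $ n) \<le> C * \<Lambda> ^ k / 1 ^ n"
    by (rule p_bound[of 1]) (use pi_gt3 in auto)
  define S where "S n = (\<Sum>k. p k $ n)" for n
  have S: "(\<lambda>k. p k $ n) sums S n" for n
    using fps_suminf_of_geometric(3)[of p C \<Lambda> 1, OF C(4,2,3) zero_less_one, of n] by (simp add: S_def)
  have Seq: "S n = p 0 $ n + (\<Sum>m\<le>n. EBmat h b \<beta> n m * S m)" for n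
  proof -
    have "(\<lambda>k. p (Suc k) $ n) sums (S n - p 0 $ n)" using S[of n] sums_Suc_iff[of "\<lambda>k. p k $ n"] by simp
    moreover have "(\<lambda>k. p (Suc k) $ n) sums (\<Sum>m\<le>n. EBmat h b \<beta> n m * S m)"
      unfolding p_Suc_nth by (intro sums_sum sums_mult S)
    ultimately have "S n - p 0 $ n = (\<Sum>m\<le>n. EBmat h b \<beta> n m * S m)" by (rule sums_unique2)
    thus ?thesis by (simp add: algebra_simps)
  qed
  have "r $ n = S n" for n
  proof (induction n rule: less_induct)
    case (less n)
    have "r $ n - S n = (\<Sum>m\<le>n. EBmat h b \<beta> n m * (r $ m - S m))"
      by (subst r_nth, subst Seq) (simp add: sum_subtractf right_diff_distrib)
    also have "\<dots> = (\<Sum>m\<in>{n}. EBmat h b \<beta> n m * (r $ m - S m))"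
      by (rule sum.mono_neutral_right) (use less in auto)
    finally have "(r $ n - S n) * (1 - EBmat h b \<beta> n n) = 0" by (simp add: algebra_simps)
    moreover have "EBmat h b \<beta> n n \<noteq> 1"
    proof
      assume "EBmat h b \<beta> n n = 1"
      thus False using le_less_trans[OF EBmat_diag_bound(1)[of n] EBmat_diag_bound(2)] by simp
    qed
    ultimately show ?case by simp
  qed
  thus ?thesis using S by simp
qed

lemma r_eq: "r = Abs_fps (\<lambda>n. \<Sum>k. p k $ n)"
  by (rule fps_ext) (simp add: sums_unique[OF p_nth_sums])

lemma r_radius: "fps_conv_radius r \<ge> ereal (2 * pi)"
proof (rule fps_conv_radius_geI)
  fix s :: real assume s: "0 < s" "ereal s < ereal (2 * pi)"
  obtain s' where s': "s < s'" "s' < 2 * pi" using s dense[of s "2 * pi"] by auto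
  have "0 < s'" using s s' by simp
  obtain C \<Lambda> where C: "C > 0" "0 < \<Lambda>" "\<Lambda> < 1" "\<And>k n. norm (p k $ n) \<le> C * \<Lambda> ^ k / s' ^ n"
    by (rule p_bound[OF \<open>0 < s'\<close> s'(2)]) (rule that)
  have "ereal s' \<le> fps_conv_radius r"
    unfolding r_eq by (rule fps_suminf_of_geometric(1)[of p C \<Lambda> s', OF C(4,2,3) \<open>0 < s'\<close>])
  hence "ereal s < fps_conv_radius r" using s'(1) by (auto elim: less_le_trans[rotated])
  thus "\<exists>C. \<forall>n. norm (r $ n) \<le> C / s ^ n" using fps_coeff_bound_ex[OF s(1)] by metis
qed

lemma eval_p_sums:
  assumes z: "norm z < 2 * pi"
  shows "(\<lambda>k. eval_fps (p k) z) sums eval_fps r z"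
proof -
  define s where "s = (norm z + 2 * pi) / 2"
  have s: "0 < s" "s < 2 * pi" "norm z < s" using z pi_gt3 norm_ge_zero[of z] by (auto simp: s_def intro: add_nonneg_pos)
  obtain C \<Lambda> where C: "C > 0" "0 < \<Lambda>" "\<Lambda> < 1" "\<And>k n. norm (p k $ n) \<le> C * \<Lambda> ^ k / s ^ n"
    by (rule p_bound[OF s(1,2)]) (rule that)
  show ?thesis unfolding r_eq by (rule fps_suminf_of_geometric(2)[of p C \<Lambda> s, OF C(4,2,3) s(1,3)])
qed

lemma borel_fun_sums:
  assumes "Re w < ln (2 * pi)"
  shows "(\<lambda>k. borel_fun \<beta> (Phi f \<rho> \<alpha> N k) w) sums borel_fun \<beta> (phi_rem f \<rho> N) w"
proof -
  have "exp (Re w) < exp (ln (2 * pi))" using assms by (simp only: exp_less_cancel_iff)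
  hence "norm (exp w) < 2 * pi" by simp
  thus ?thesis unfolding borel_fun_def by (intro sums_mult eval_p_sums)
qed

lemma pow_p_bound:
  obtains C \<Lambda> where "C > 0" "0 < \<Lambda>" "\<Lambda> < 1" "\<And>k t. 0 < t \<Longrightarrow> t \<le> 1 \<Longrightarrow> norm (pow_fps \<beta> (p k) (of_real t)) \<le> C * \<Lambda> ^ k"
proof -
  \<comment> \<open>Any radius strictly between 1 and 2\<pi> gives a convergent geometric sum on the
    unit segment; with 3 the sum is 3/2.\<close>
  obtain C \<Lambda> where C: "C > 0" "0 < \<Lambda>" "\<Lambda> < 1" "\<And>k n. norm (p k $ n) \<le> C * \<Lambda> ^ k / 3 ^ n"
    by (rule p_bound[of 3]) (use pi_gt3 in auto)
  have "norm (pow_fps \<beta> (p k) (of_real t)) \<le> (2 * C) * \<Lambda> ^ k" if t: "0 < t" "t \<le> 1" for k and t :: real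
  proof -
    have b: "norm (p k $ n * of_real t ^ n) \<le> C * \<Lambda> ^ k * (1 / 3) ^ n" for n
    proof -
      have "norm (p k $ n * of_real t ^ n) \<le> (C * \<Lambda> ^ k / 3 ^ n) * 1"
        unfolding norm_mult norm_power using t C(1,2) by (intro mult_mono C(4)) (auto intro: power_le_one)
      thus ?thesis by (simp add: power_divide)
    qed
    have "norm (eval_fps (p k) (of_real t)) \<le> (\<Sum>n. C * \<Lambda> ^ k * (1 / 3) ^ n)"
      unfolding eval_fps_def by (rule norm_suminf_le[OF b]) (intro summable_mult summable_geometric, simp)
    also have "\<dots> = C * \<Lambda> ^ k * (3 / 2)" by (subst suminf_mult) (simp_all add: suminf_geometric)
    also have "\<dots> \<le> (2 * C) * \<Lambda> ^ k" using C by simp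
    finally have "norm (eval_fps (p k) (of_real t)) \<le> (2 * C) * \<Lambda> ^ k" .
    moreover have "norm (exp (\<beta> * Ln (of_real t))) \<le> 1" using norm_pow_Ln_le[OF Re_\<beta> t] by simp
    ultimately show ?thesis unfolding pow_fps_def norm_mult using mult_mono[of _ 1 _ "2 * C * \<Lambda> ^ k"] by fastforce
  qed
  thus ?thesis using that[of "2 * C" \<Lambda>] C by simp
qed

end

text \<open>At \<xi> = 0 the symbol is h alone, so \<open>kerK h b 0\<close> is the Borel transform
  of h - 1. For h = e^(-\<omega> b_star) this is B^\<omega> applied to 1, and it is how a residue
  enters the next \<chi>.\<close>

lemma kerK_0_eq_eval_fps: "kerK h b 0 \<zeta> = eval_fps (borel_fps 0 (fps_shift 1 (h - 1))) \<zeta>"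
proof -
  have "Gamma (of_nat m + 1) = (fact m :: complex)" for m using Gamma_fact[of m] by (simp add: add.commute)
  thus ?thesis by (simp add: kerK_def kap_def eval_fps_def borel_fps_def)
qed

lemma (in parabolic_germ) EB_inv_borel_integral:
  assumes rad: "fps_conv_radius chi \<ge> ereal (2 * pi)" "fps_conv_radius chi' \<ge> ereal (2 * pi)"
    and eq: "\<And>\<zeta>. norm \<zeta> < 2 * pi \<Longrightarrow> (exp \<zeta> - 1) * eval_fps chi' \<zeta> =
      c * kerK (h\<^sub>\<omega> \<omega>) b 0 \<zeta> + contour_integral (linepath 0 \<zeta>) (\<lambda>\<xi>. kerK (h\<^sub>\<omega> \<omega>) b \<xi> (\<zeta> - \<xi>) * eval_fps chi \<xi>)"
  shows "EB \<omega> (fps_const c + inv_borel chi) = inv_borel chi'"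
proof -
  obtain R C where RC: "R \<ge> 1" "C > 0" "\<And>l m. norm ((h\<^sub>\<omega> \<omega> * b ^ l) $ m) \<le> C * R ^ m"
    by (rule mult_power_coeff_bound[OF h\<^sub>\<omega>_conv_radius_pos b_facts(1,2)]) (rule that)
  interpret K: kernel_data "h\<^sub>\<omega> \<omega>" b R C by unfold_locales (use h\<^sub>\<omega>_facts b_facts RC in auto)
  have p0: "ereal 0 < ereal (2 * pi)" by simp
  have pos: "fps_conv_radius chi > 0" "fps_conv_radius chi' > 0"
    using less_le_trans[OF p0 rad(1)] less_le_trans[OF p0 rad(2)] by (simp_all add: zero_ereal_def)
  show ?thesis
  proof (rule EB_inv_borel[OF pos])
    show "fps_conv_radius (borel_fps 0 (tw_op (h\<^sub>\<omega> \<omega>) b 0 (unborel_fps 0 chi))) > 0"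
      using K.tw_op_radius[of 0 "unborel_fps 0 chi"] pos(1) by auto
    have "\<forall>\<^sub>F \<zeta>::complex in nhds 0. \<zeta> \<in> ball 0 (2 * pi)" by (intro eventually_nhds_in_open) auto
    thus "\<forall>\<^sub>F \<zeta> in nhds 0. (exp \<zeta> - 1) * eval_fps chi' \<zeta> =
      c * eval_fps (borel_fps 0 (fps_shift 1 (h\<^sub>\<omega> \<omega> - 1))) \<zeta> + eval_fps (borel_fps 0 (tw_op (h\<^sub>\<omega> \<omega>) b 0 (unborel_fps 0 chi))) \<zeta>"
    proof eventually_elim
      case (elim \<zeta>)
      have "ereal (norm \<zeta>) < ereal (2 * pi)" using elim by simp
      also have "\<dots> \<le> fps_conv_radius (borel_fps 0 (unborel_fps 0 chi))" using rad(1) by simp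
      finally show ?case using elim eq[of \<zeta>] K.tw_op_line_integral_0[of \<zeta> "unborel_fps 0 chi"]
        by (simp add: kerK_0_eq_eval_fps K.Lk_def)
    qed
  qed
qed

context resurgent_germ
begin

text \<open>The bound on \<open>A k\<close> is linear in a bound of the k-th Borel transform on (0,
  1], so \<open>D\<close> and \<open>\<Lambda>\<close> can be fixed before the \<open>A k\<close>
  are chosen, and one \<Lambda> serves every level.\<close>

lemma singular_point_exists:
  assumes \<omega>: "\<omega> \<in> sing_set" "\<omega> \<noteq> 0" and \<Gamma>: "\<Gamma> \<in> paths_from_1" "pathfinish \<Gamma> = \<omega> + 1" and \<alpha>: "\<alpha> = - \<rho> * \<omega>"
  obtains A \<Lambda> where "singular_point (\<lambda>\<xi> z. kerK h b \<xi> (z - \<xi>)) \<beta> (eval_fps (borel_fps \<beta> ba)) A \<Lambda>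
     (\<lambda>k. borel_germ \<beta> (Phi f \<rho> \<alpha> N k)) (borel_germ \<beta> (phi_rem f \<rho> N)) \<omega> \<Gamma>"
proof -
  obtain R C where RC: "R \<ge> 1" "C > 0" "\<And>l m. norm ((h * b ^ l) $ m) \<le> C * R ^ m"
    by (rule mult_power_coeff_bound[OF h_facts(3) b_facts(1,2)]) (rule that)
  interpret K: kernel_data h b R C by unfold_locales (use h_facts b_facts RC in auto)
  let ?T = "\<lambda>k. borel_fps \<beta> (tw_op h b \<beta> (Phi f \<rho> \<alpha> N k))"
  obtain D \<Lambda> where D: "D > 0" "0 < \<Lambda>" "\<Lambda> < 1" "\<And>k t. 0 < t \<Longrightarrow> t \<le> 1 \<Longrightarrow> norm (pow_fps \<beta> (p k) (of_real t)) \<le> D * \<Lambda> ^ k"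
    by (rule pow_p_bound) (rule that)
  define good where "good k A \<longleftrightarrow> A holomorphic_on UNIV \<and>
    (\<forall>z\<in>ball 1 1. pow_fps \<beta> (?T k) z = A z + contour_integral (linepath 1 z) (\<lambda>\<xi>. K.Lk \<xi> z * pow_fps \<beta> (p k) \<xi>)) \<and>
    (\<forall>r M z. (\<forall>\<xi> z. norm \<xi> \<le> 1 \<longrightarrow> norm z \<le> r \<longrightarrow> norm (K.Lk \<xi> z) \<le> M) \<longrightarrow> norm z \<le> r \<longrightarrow> norm (A z) \<le> M * (D * \<Lambda> ^ k))" for k A
  have "\<exists>A. good k A" for k
  proof (rule K.tw_op_line_integral_1[OF Re_\<beta> p_radius[of k]])
    fix A assume A: "A holomorphic_on UNIV"
      "\<And>z. z \<in> ball 1 1 \<Longrightarrow> pow_fps \<beta> (?T k) z = A z + contour_integral (linepath 1 z) (\<lambda>\<xi>. K.Lk \<xi> z * pow_fps \<beta> (p k) \<xi>)"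
      "\<And>r M B z. (\<And>\<xi> z. norm \<xi> \<le> 1 \<Longrightarrow> norm z \<le> r \<Longrightarrow> norm (K.Lk \<xi> z) \<le> M) \<Longrightarrow>
        (\<And>t. 0 < t \<Longrightarrow> t \<le> 1 \<Longrightarrow> norm (pow_fps \<beta> (p k) (of_real t)) \<le> B) \<Longrightarrow> norm z \<le> r \<Longrightarrow> norm (A z) \<le> M * B"
    have "norm (A z) \<le> M * (D * \<Lambda> ^ k)"
      if "\<forall>\<xi> z. norm \<xi> \<le> 1 \<longrightarrow> norm z \<le> r \<longrightarrow> norm (K.Lk \<xi> z) \<le> M" "norm z \<le> r" for r M z
      by (rule A(3)[OF _ D(4) that(2)]) (use that(1) in auto)
    hence "good k A" using A(1,2) by (simp add: good_def)
    thus "\<exists>A. good k A" by blast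
  qed
  then obtain A where gA: "\<And>k. good k (A k)" by metis
  have A: "A k holomorphic_on UNIV"
      "z \<in> ball 1 1 \<Longrightarrow> pow_fps \<beta> (?T k) z = A k z + contour_integral (linepath 1 z) (\<lambda>\<xi>. K.Lk \<xi> z * pow_fps \<beta> (p k) \<xi>)"
      "\<lbrakk>\<forall>\<xi> z. norm \<xi> \<le> 1 \<longrightarrow> norm z \<le> r \<longrightarrow> norm (K.Lk \<xi> z) \<le> M; norm z \<le> r\<rbrakk> \<Longrightarrow> norm (A k z) \<le> M * (D * \<Lambda> ^ k)" for k z r M
    using gA[of k] unfolding good_def by blast+
  have ball: "z \<noteq> 0" "norm z < 2 * pi" if "z \<in> ball 1 1" for z :: complex
  proof -
    have "norm z \<le> norm (1 - z) + 1" using norm_triangle_sub[of z 1] by (simp add: norm_minus_commute)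
    thus "norm z < 2 * pi" using that pi_gt3 by (simp add: dist_norm)
    show "z \<noteq> 0" using that by auto
  qed
  have germ: "borel_germ \<beta> P z = pow_fps \<beta> (borel_fps \<beta> P) z" if "z \<in> ball 1 1" for z P
    using borel_germ_eq[OF ball(1)[OF that]] .
  have mult: "(exp z - 1) * pow_fps \<beta> (p k) z = pow_fps \<beta> ((fps_exp 1 - 1) * p k) z" if "z \<in> ball 1 1" for z k
  proof -
    have "ereal (norm z) < ereal (2 * pi)" using ball(2)[OF that] by simp
    also have "\<dots> \<le> fps_conv_radius (p k)" by (rule p_radius)
    finally show ?thesis by (simp add: pow_fps_def eval_fps_exp_minus_one_mult)
  qed
  have L: "(\<lambda>\<xi> z. kerK h b \<xi> (z - \<xi>)) = K.Lk" by (intro ext) (simp add: K.Lk_def)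
  have "singular_point K.Lk \<beta> (eval_fps (borel_fps \<beta> ba)) A \<Lambda>
     (\<lambda>k. borel_germ \<beta> (Phi f \<rho> \<alpha> N k)) (borel_germ \<beta> (phi_rem f \<rho> N)) \<omega> \<Gamma>"
  proof unfold_locales
    show "jholo K.Lk UNIV UNIV" by (rule K.jholo_Lk)
    show "eval_fps (borel_fps \<beta> ba) holomorphic_on UNIV"
      by (rule holomorphic_on_eval_fps) (simp add: borel_ba_radius)
    show "A k holomorphic_on UNIV" for k by (rule A(1))
    show "0 < \<Lambda>" "\<Lambda> < 1" by (rule D)+
    show "\<exists>C. \<forall>k z. norm z \<le> r \<longrightarrow> norm (A k z) \<le> C * \<Lambda> ^ k" for r
    proof -
      obtain M where M: "M > 0" "\<And>\<xi> z. norm \<xi> \<le> max r 1 \<Longrightarrow> norm z \<le> max r 1 \<Longrightarrow> norm (K.Lk \<xi> z) \<le> M"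
        by (rule jholo_bounded[OF K.jholo_Lk]) (rule that)
      have "norm (A k z) \<le> M * (D * \<Lambda> ^ k)" if "norm z \<le> r" for k z
        by (rule A(3)[OF _ that]) (use M(2) in auto)
      thus ?thesis by (intro exI[of _ "M * D"]) (simp add: mult.assoc)
    qed
    show "(\<lambda>k. borel_germ \<beta> (Phi f \<rho> \<alpha> N k) z) sums borel_germ \<beta> (phi_rem f \<rho> N) z" if "z \<in> ball 1 1" for z
      unfolding borel_germ_def
      by (rule borel_fun_sums) (use ball[OF that] in \<open>simp\<close>)
    show "(exp z - 1) * borel_germ \<beta> (Phi f \<rho> \<alpha> N 0) z = exp (\<beta> * Ln z) * eval_fps (borel_fps \<beta> ba) z" if "z \<in> ball 1 1" for z
      unfolding germ[OF that] mult[OF that] exp_p_0 by (simp add: pow_fps_def)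
    show "(exp z - 1) * borel_germ \<beta> (Phi f \<rho> \<alpha> N (Suc k)) z =
        A k z + contour_integral (linepath 1 z) (\<lambda>\<xi>. K.Lk \<xi> z * borel_germ \<beta> (Phi f \<rho> \<alpha> N k) \<xi>)" if z: "z \<in> ball 1 1" for k z
    proof -
      have "closed_segment 1 z \<subseteq> ball 1 1" using z by (intro closed_segment_subset) auto
      hence "contour_integral (linepath 1 z) (\<lambda>\<xi>. K.Lk \<xi> z * borel_germ \<beta> (Phi f \<rho> \<alpha> N k) \<xi>) =
         contour_integral (linepath 1 z) (\<lambda>\<xi>. K.Lk \<xi> z * pow_fps \<beta> (p k) \<xi>)"
        by (intro contour_integral_cong refl) (use germ in auto)
      thus ?thesis unfolding germ[OF z] mult[OF z] exp_p_Suc using A(2)[OF z] by simp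
    qed
    \<comment> \<open>\<alpha> = -\<rho>\<omega> makes h e^(-\<omega> b) equal to e^(-\<omega>
      b_star), whose z^-1 coefficient is the value of the translated kernel at the origin.\<close>
    show "K.Lk \<omega> \<omega> = 0"
      unfolding K.Lk_def using kerK_shift[OF b_facts(2), of h \<omega> 0 0] kerK_00[OF b_facts(2), of "h * (fps_exp (- \<omega>) oo b)"] h\<^sub>\<omega>_facts(2)[of \<omega>]
      by (simp add: h\<^sub>\<omega>_eq \<alpha>)
  qed (use \<omega> \<Gamma> in auto)
  thus ?thesis using that unfolding L by blast
qed

end

theorem theorem1:
  fixes f :: "complex \<Rightarrow> complex" and \<rho> \<omega> \<alpha> \<beta> :: complex
    and \<Gamma> :: "real \<Rightarrow> complex" and N :: nat
  assumes "simple_parabolic f \<rho>"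
    and "\<omega> \<in> sing_set" and "\<omega> \<noteq> 0"
    and "path \<Gamma>" and "path_image \<Gamma> \<inter> sing_set = {}"
    and "pathstart \<Gamma> = 1" and "pathfinish \<Gamma> = \<omega> + 1"
    and "\<alpha> = - \<rho> * \<omega>"
    and "real N \<ge> max 0 (- 2 * Re \<alpha>)"
    and "\<beta> = \<alpha> + of_nat N"
  shows
    "((\<forall>k. simple_at \<omega> \<Gamma> \<beta> (Phi f \<rho> \<alpha> N k)) \<and> simple_at \<omega> \<Gamma> \<beta> (phi_rem f \<rho> N))
     \<and>
     ((\<forall>\<epsilon>>0. \<forall>L>0. \<exists>C\<^sub>0 \<Lambda>. C\<^sub>0 > 0 \<and> 0 < \<Lambda> \<and> \<Lambda> < 1 \<and>
         (\<forall>\<gamma>\<in>short_paths \<epsilon> L. \<forall>k.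
            norm (cont \<gamma> (borel_germ \<beta> (Phi f \<rho> \<alpha> N k)) (pathfinish \<gamma>)) \<le> C\<^sub>0 * \<Lambda> ^ k)) \<and>
      (\<forall>w. Re w < ln (2 * pi) \<longrightarrow>
         (\<lambda>k. borel_fun \<beta> (Phi f \<rho> \<alpha> N k) w) sums borel_fun \<beta> (phi_rem f \<rho> N) w) \<and>
      (\<forall>\<gamma>\<in>paths_from_1.
         (\<lambda>k. cont \<gamma> (borel_germ \<beta> (Phi f \<rho> \<alpha> N k)) (pathfinish \<gamma>)) sums
           cont \<gamma> (borel_germ \<beta> (phi_rem f \<rho> N)) (pathfinish \<gamma>)))
     \<and>
     (\<exists>S. (\<exists>\<Lambda>::real. 0 < \<Lambda> \<and> \<Lambda> < 1 \<and> S \<in> O(\<lambda>k. complex_of_real (\<Lambda> ^ k))) \<and>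
        (\<forall>k. alien \<omega> \<Gamma> \<beta> (Phi f \<rho> \<alpha> N k) = (\<Sum>j\<le>k. fps_const (S j) * Psi f \<rho> \<omega> (k - j))) \<and>
        alien \<omega> \<Gamma> \<beta> (phi_rem f \<rho> N) =
          fps_const (\<Sum>k. S k) * (fps_exp (- \<omega>) oo phi_ser f \<rho>))"
proof -
  interpret resurgent_germ f \<rho> \<alpha> \<beta> N
  proof unfold_locales
    show "simple_parabolic f \<rho>" "\<beta> = \<alpha> + of_nat N" by (rule assms)+
    show "Re \<beta> \<ge> 0" using assms(9) by (simp add: assms(10))
    \<comment> \<open>\<beta> + 1 and \<alpha> have the same imaginary part, so the difference of
      their squared norms factors in this way; N \<ge> -2 Re \<alpha> makes the second factor at
      least 1.\<close>
    have "0 < (real N + 1) * (real N + 1 + 2 * Re \<alpha>)" using assms(9) by (intro mult_pos_pos) auto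
    also have "\<dots> = (norm (\<beta> + 1))\<^sup>2 - (norm \<alpha>)\<^sup>2"
      unfolding cmod_power2 by (simp add: assms(10) power2_eq_square algebra_simps)
    finally show "norm \<alpha> < norm (\<beta> + 1)" by (intro power2_less_imp_less[of "norm \<alpha>"]) auto
  qed
  have \<Gamma>: "\<Gamma> \<in> paths_from_1" using assms(4-6) by (simp add: paths_from_1_def)
  obtain A \<Lambda> where sp: "singular_point (\<lambda>\<xi> z. kerK h b \<xi> (z - \<xi>)) \<beta> (eval_fps (borel_fps \<beta> ba)) A \<Lambda>
     (\<lambda>k. borel_germ \<beta> (Phi f \<rho> \<alpha> N k)) (borel_germ \<beta> (phi_rem f \<rho> N)) \<omega> \<Gamma>"
    by (rule singular_point_exists[OF assms(2,3) \<Gamma> assms(7,8)]) (rule that)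
  interpret S: singular_point "\<lambda>\<xi> z. kerK h b \<xi> (z - \<xi>)" \<beta> "eval_fps (borel_fps \<beta> ba)" A \<Lambda>
     "\<lambda>k. borel_germ \<beta> (Phi f \<rho> \<alpha> N k)" "borel_germ \<beta> (phi_rem f \<rho> N)" \<omega> \<Gamma> by (rule sp)
  obtain c chi R C RR where s: "C > 0" "\<And>k. norm (c k) \<le> C * \<Lambda> ^ k" "chi 0 = 0" "\<And>k. fps_conv_radius (chi k) \<ge> ereal (2 * pi)"
    "\<And>k. S.germ_expansion (borel_germ \<beta> (Phi f \<rho> \<alpha> N k)) (c k) (chi k) (R k)"
    "\<And>k \<zeta>. norm \<zeta> < 2 * pi \<Longrightarrow> (exp \<zeta> - 1) * eval_fps (chi (Suc k)) \<zeta> = 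
        c k * S.M\<omega> 0 \<zeta> + contour_integral (linepath 0 \<zeta>) (\<lambda>\<xi>. S.M\<omega> \<xi> \<zeta> * eval_fps (chi k) \<xi>)"
    "\<And>m. (\<lambda>k. chi k $ m) sums (\<Sum>k. chi k $ m)"
    "S.germ_expansion (borel_germ \<beta> (phi_rem f \<rho> N)) (\<Sum>k. c k) (Abs_fps (\<lambda>m. \<Sum>k. chi k $ m)) RR"
    by (rule S.singularity_at_\<omega>) (rule that)
  have se: "simple_expansion \<omega> \<Gamma> \<beta> (Phi f \<rho> \<alpha> N k) (c k) (chi k) (R k)"
    "simple_expansion \<omega> \<Gamma> \<beta> (phi_rem f \<rho> N) (\<Sum>k. c k) (Abs_fps (\<lambda>m. \<Sum>k. chi k $ m)) RR" for k
    using s(5)[of k] s(8) unfolding S.germ_expansion_def simple_expansion_def .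
  have res: "resurgent \<beta> (Phi f \<rho> \<alpha> N k)" "resurgent \<beta> (phi_rem f \<rho> N)" for k
  proof -
    have "\<exists>g. continues_along \<gamma> (borel_germ \<beta> (Phi f \<rho> \<alpha> N k)) g" "\<exists>g. continues_along \<gamma> (borel_germ \<beta> (phi_rem f \<rho> N)) g"
      if "\<gamma> \<in> paths_from_1" for \<gamma>
      by (rule S.path_chain[OF that], blast)+
    thus "resurgent \<beta> (Phi f \<rho> \<alpha> N k)" "resurgent \<beta> (phi_rem f \<rho> N)" 
      unfolding resurgent_def using p_radius[of k] r_radius by simp_all
  qed
  have M: "S.M\<omega> \<xi> \<zeta> = kerK (h\<^sub>\<omega> \<omega>) b \<xi> (\<zeta> - \<xi>)" for \<xi> \<zeta>
    unfolding S.M\<omega>_def using kerK_shift[OF b_facts(2), of h \<omega> \<xi> "\<zeta> - \<xi>"] by (simp add: h\<^sub>\<omega>_eq assms(8))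
  have EB: "EB \<omega> (fps_const (c k) + inv_borel (chi k)) = inv_borel (chi (Suc k))" for k
    by (rule EB_inv_borel_integral[OF s(4) s(4)]) (use s(6) in \<open>simp add: M\<close>)
  note al = alien_series_eq_sum_Psi[of chi, OF s(3) EB]
  have sc: "summable (\<lambda>k. norm (c k))"
  proof (rule summable_comparison_test')
    show "summable (\<lambda>k. C * \<Lambda> ^ k)" using S.\<Lambda> by (intro summable_mult summable_geometric) auto
    show "\<And>k. 0 \<le> k \<Longrightarrow> norm (norm (c k)) \<le> C * \<Lambda> ^ k" using s(2) by simp
  qed
  note alsum = alien_series_sum[OF al sc s(7)]
  show ?thesis
  proof (intro conjI allI impI ballI)
    show "simple_at \<omega> \<Gamma> \<beta> (Phi f \<rho> \<alpha> N k)" for k unfolding simple_at_def using res se(1) by blast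
    show "simple_at \<omega> \<Gamma> \<beta> (phi_rem f \<rho> N)" unfolding simple_at_def using res se(2) by blast
    show "(\<lambda>k. borel_fun \<beta> (Phi f \<rho> \<alpha> N k) w) sums borel_fun \<beta> (phi_rem f \<rho> N) w" if "Re w < ln (2 * pi)" for w
      by (rule borel_fun_sums[OF that])
    show "(\<lambda>k. cont \<gamma> (borel_germ \<beta> (Phi f \<rho> \<alpha> N k)) (pathfinish \<gamma>)) sums
           cont \<gamma> (borel_germ \<beta> (phi_rem f \<rho> N)) (pathfinish \<gamma>)" if "\<gamma> \<in> paths_from_1" for \<gamma>
      by (rule S.cont_sums[OF that])
    show "\<exists>C\<^sub>0 \<Lambda>. C\<^sub>0 > 0 \<and> 0 < \<Lambda> \<and> \<Lambda> < 1 \<and>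
         (\<forall>\<gamma>\<in>short_paths \<epsilon> L. \<forall>k.
            norm (cont \<gamma> (borel_germ \<beta> (Phi f \<rho> \<alpha> N k)) (pathfinish \<gamma>)) \<le> C\<^sub>0 * \<Lambda> ^ k)" if "\<epsilon> > 0" "L > 0" for \<epsilon> L
    proof -
      obtain C0 where "C0 > 0" "\<And>\<gamma> k. \<gamma> \<in> short_paths \<epsilon> L \<Longrightarrow> norm (cont \<gamma> (borel_germ \<beta> (Phi f \<rho> \<alpha> N k)) (pathfinish \<gamma>)) \<le> C0 * \<Lambda> ^ k"
        by (rule S.short_path_bound[OF \<open>\<epsilon> > 0\<close>]) (rule that)
      thus ?thesis using S.\<Lambda> by (intro exI[of _ C0] exI[of _ \<Lambda>]) auto
    qed
    have "c \<in> O(\<lambda>k. complex_of_real (\<Lambda> ^ k))"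
      by (rule bigoI[of _ C]) (use s(2) S.\<Lambda> in \<open>auto simp: norm_power\<close>)
    moreover have "alien \<omega> \<Gamma> \<beta> (Phi f \<rho> \<alpha> N k) = (\<Sum>j\<le>k. fps_const (c j) * Psi f \<rho> \<omega> (k - j))" for k
      unfolding alien_eqI[OF se(1)] by (rule al)
    moreover have "alien \<omega> \<Gamma> \<beta> (phi_rem f \<rho> N) = fps_const (\<Sum>k. c k) * (fps_exp (- \<omega>) oo phi_ser f \<rho>)"
      unfolding alien_eqI[OF se(2)] by (rule alsum)
    ultimately show "\<exists>S. (\<exists>\<Lambda>::real. 0 < \<Lambda> \<and> \<Lambda> < 1 \<and> S \<in> O(\<lambda>k. complex_of_real (\<Lambda> ^ k))) \<and>
        (\<forall>k. alien \<omega> \<Gamma> \<beta> (Phi f \<rho> \<alpha> N k) = (\<Sum>j\<le>k. fps_const (S j) * Psi f \<rho> \<omega> (k - j))) \<and>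
        alien \<omega> \<Gamma> \<beta> (phi_rem f \<rho> N) =
          fps_const (\<Sum>k. S k) * (fps_exp (- \<omega>) oo phi_ser f \<rho>)"
      using S.\<Lambda> by (intro exI[of _ c] conjI exI[of _ \<Lambda>] allI)
  qed
qed

end
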